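(* Let $\gamma>0$, $N\ge1$, $0<b<\min\{2,N\}$, $1<p<2^\circ$ and $\omega>-\gamma N$. Let $$d_\omega=\inf\{S_\omega(u): u\in\Sigma(\mathbb{R}^N)\setminus\{0\},\ K_\omega(u)=0\}.$$ Then $d_\omega>0$ and $d_\omega$ is attained by a function which is a solution of the elliptic equation $$-\Delta\varphi+\omega\varphi+\gamma^2|x|^2\varphi-|x|^{-b}|\varphi|^{p-1}\varphi=0,\qquad \varphi\in\Sigma(\mathbb{R}^N)\setminus\{0\}.$$ Moreover, every minimizer is of the form $e^{i\theta}\varphi(x)$ with $\theta\in\mathbb{R}$, where $\varphi$ is a real-valued, positive and spherically symmetric function.
   Context: $2^\circ=1+\frac{4-2b}{N-2}$ if $N\ge3$ and $2^\circ=\infty$ if $N=1,2$. $\Sigma(\mathbb{R}^N)=\{u\in H^1(\mathbb{R}^N;\mathbb{C}): |x|u\in L^2(\mathbb{R}^N)\}$ with norm $\|u\|_\Sigma^2=\int_{\mathbb{R}^N}(|\nabla u|^2+|x|^2|u|^2)\,dx$. $\|u\|_{H_\omega}^2=\|\nabla u\|_{L^2}^2+\gamma^2\|xu\|_{L^2}^2+\omega\|u\|_{L^2}^2$ and $P(u)=\int_{\mathbb{R}^N}|x|^{-b}|u|^{p+1}dx$. $S_\omega(u)=\frac12\|u\|_{H_\omega}^2-\frac{1}{p+1}P(u)$ and $K_\omega(u)=\|u\|_{H_\omega}^2-P(u)$. A minimizer for $d_\omega$ is a $u\in\Sigma(\mathbb{R}^N)\setminus\{0\}$ with $K_\omega(u)=0$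 and $S_\omega(u)=d_\omega$. *)

theory Defs
  imports "HOL-Analysis.Analysis"
begin

definition partial_deriv :: "'n::finite \<Rightarrow> (real^'n \<Rightarrow> real) \<Rightarrow> real^'n \<Rightarrow> real" where
  "partial_deriv i f x = frechet_derivative f (at x) (axis i 1)"

primrec Ck :: "nat \<Rightarrow> (real^'n::finite \<Rightarrow> real) \<Rightarrow> bool" where
  "Ck 0 f \<longleftrightarrow> continuous_on UNIV f"
| "Ck (Suc k) f \<longleftrightarrow> f differentiable_on UNIV \<and> (\<forall>i. Ck k (partial_deriv i f))"

definition test_function :: "(real^'n::finite \<Rightarrow> real) \<Rightarrow> bool" where
  "test_function \<psi> \<longleftrightarrow> (\<forall>k. Ck k \<psi>) \<and> compact (closure {x. \<psi> x \<noteq> 0})"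

definition laplacian :: "(real^'n::finite \<Rightarrow> real) \<Rightarrow> real^'n \<Rightarrow> real" where
  "laplacian \<psi> x = (\<Sum>i\<in>UNIV. partial_deriv i (partial_deriv i \<psi>) x)"

definition locally_integrable ::
    "(real^'n::finite \<Rightarrow> 'b::{banach, second_countable_topology}) \<Rightarrow> bool" where
  "locally_integrable f \<longleftrightarrow> (\<forall>K. compact K \<longrightarrow> set_integrable lebesgue K f)"

text \<open>Elements of the function spaces below are functions, not classes modulo null sets.  Hence
  being nonzero, and equality of two elements, are always expressed almost everywhere.\<close>

definition L2 :: "(real^'n::finite \<Rightarrow> 'b::{banach, second_countable_topology}) set" where
  "L2 = {f. f \<in> borel_measurable lebesgue \<and> integrable lebesgue (\<lambda>x. (norm (f x))\<^sup>2)}"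

definition has_weak_gradient ::
    "(real^'n::finite \<Rightarrow> complex) \<Rightarrow> (real^'n \<Rightarrow> complex^'n) \<Rightarrow> bool" where
  "has_weak_gradient u G \<longleftrightarrow>
     locally_integrable u \<and> locally_integrable G \<and>
     (\<forall>\<psi> i. test_function \<psi> \<longrightarrow>
        (\<integral>x. partial_deriv i \<psi> x *\<^sub>R u x \<partial>lebesgue) = - (\<integral>x. \<psi> x *\<^sub>R (G x $ i) \<partial>lebesgue))"

text \<open>Weak gradients are unique up to null sets, so integrals involving \<^term>\<open>weak_gradient u\<close>
  do not depend on the choice made here.\<close>

definition weak_gradient :: "(real^'n::finite \<Rightarrow> complex) \<Rightarrow> real^'n \<Rightarrow> complex^'n" where
  "weak_gradient u = (SOME G. has_weak_gradient u G)"

definition H1 :: "(real^'n::finite \<Rightarrow> complex) set" where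
  "H1 = {u \<in> L2. \<exists>G \<in> L2. has_weak_gradient u G}"

definition Sigma_space :: "(real^'n::finite \<Rightarrow> complex) set" where
  "Sigma_space = {u \<in> H1. (\<lambda>x. norm x *\<^sub>R u x) \<in> L2}"

definition Sigma_nonzero :: "(real^'n::finite \<Rightarrow> complex) set" where
  "Sigma_nonzero = {u \<in> Sigma_space. \<not> (AE x in lebesgue. u x = 0)}"

definition H_norm_sq :: "real \<Rightarrow> real \<Rightarrow> (real^'n::finite \<Rightarrow> complex) \<Rightarrow> real" where
  "H_norm_sq \<gamma> \<omega> u =
     (\<integral>x. (norm (weak_gradient u x))\<^sup>2 \<partial>lebesgue)
     + \<gamma>\<^sup>2 * (\<integral>x. (norm x)\<^sup>2 * (norm (u x))\<^sup>2 \<partial>lebesgue)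
     + \<omega> * (\<integral>x. (norm (u x))\<^sup>2 \<partial>lebesgue)"

definition P_fun :: "real \<Rightarrow> real \<Rightarrow> (real^'n::finite \<Rightarrow> complex) \<Rightarrow> real" where
  "P_fun b p u = (\<integral>x. norm x powr (-b) * norm (u x) powr (p + 1) \<partial>lebesgue)"

definition S_fun :: "real \<Rightarrow> real \<Rightarrow> real \<Rightarrow> real \<Rightarrow> (real^'n::finite \<Rightarrow> complex) \<Rightarrow> real" where
  "S_fun \<gamma> b p \<omega> u = 1/2 * H_norm_sq \<gamma> \<omega> u - 1/(p + 1) * P_fun b p u"

definition K_fun :: "real \<Rightarrow> real \<Rightarrow> real \<Rightarrow> real \<Rightarrow> (real^'n::finite \<Rightarrow> complex) \<Rightarrow> real" where
  "K_fun \<gamma> b p \<omega> u = H_norm_sq \<gamma> \<omega> u - P_fun b p u"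

text \<open>The first argument only carries the dimension.  On the constraint set
  \<open>S = (1/2 - 1/(p+1)) P \<ge> 0\<close> for \<open>p > 1\<close>, so the set of values is bounded below and the real-valued
  \<open>Inf\<close> is the true infimum whenever the constraint set is nonempty.\<close>

definition d_level :: "'n::finite itself \<Rightarrow> real \<Rightarrow> real \<Rightarrow> real \<Rightarrow> real \<Rightarrow> real" where
  "d_level N \<gamma> b p \<omega> =
     Inf {S_fun \<gamma> b p \<omega> u | u :: real^'n \<Rightarrow> complex. u \<in> Sigma_nonzero \<and> K_fun \<gamma> b p \<omega> u = 0}"

definition is_minimizer ::
    "real \<Rightarrow> real \<Rightarrow> real \<Rightarrow> real \<Rightarrow> (real^'n::finite \<Rightarrow> complex) \<Rightarrow> bool" where
  "is_minimizer \<gamma> b p \<omega> u \<longleftrightarrow>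
     u \<in> Sigma_nonzero \<and> K_fun \<gamma> b p \<omega> u = 0 \<and> S_fun \<gamma> b p \<omega> u = d_level TYPE('n) \<gamma> b p \<omega>"

text \<open>The elliptic equation is understood in the sense of distributions.  Real test functions
  suffice by linearity.  The nonlinear term is required to be locally integrable; the other terms
  are so for every element of \<^const>\<open>Sigma_space\<close>.\<close>

definition is_solution ::
    "real \<Rightarrow> real \<Rightarrow> real \<Rightarrow> real \<Rightarrow> (real^'n::finite \<Rightarrow> complex) \<Rightarrow> bool" where
  "is_solution \<gamma> b p \<omega> \<phi> \<longleftrightarrow>
     \<phi> \<in> Sigma_nonzero \<and>
     locally_integrable (\<lambda>x. (norm x powr (-b) * norm (\<phi> x) powr (p - 1)) *\<^sub>R \<phi> x) \<and>
     (\<forall>\<psi>. test_function \<psi> \<longrightarrow>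
        (\<integral>x. (- laplacian \<psi> x) *\<^sub>R \<phi> x
             + \<psi> x *\<^sub>R (\<omega> *\<^sub>R \<phi> x + (\<gamma>\<^sup>2 * (norm x)\<^sup>2) *\<^sub>R \<phi> x
                       - (norm x powr (-b) * norm (\<phi> x) powr (p - 1)) *\<^sub>R \<phi> x) \<partial>lebesgue) = 0)"

definition spherically_symmetric :: "(real^'n::finite \<Rightarrow> real) \<Rightarrow> bool" where
  "spherically_symmetric f \<longleftrightarrow> (\<forall>x y. norm x = norm y \<longrightarrow> f x = f y)"

definition two_circ :: "nat \<Rightarrow> real \<Rightarrow> ereal" where
  "two_circ N b = (if N \<ge> 3 then ereal (1 + (4 - 2 * b) / (real N - 2)) else \<infinity>)"

end

theory Submission
  imports Defs "HOL-Complex_Analysis.Great_Picard" "HOL-Computational_Algebra.Polynomial"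
begin

text \<open>With \<open>q = p + 1\<close> and \<open>E\<close> the squared \<open>H\<^sub>\<omega>\<close> norm, \<open>S = (1/2 - 1/q) E\<close> on the constraint set, and after scaling
  the problem is to minimize the quotient \<open>E\<^sup>q / P\<^sup>2\<close>.  Coercivity of \<open>E\<close> is the spectral gap \<open>\<gamma> N\<close> of the
  harmonic oscillator.  The Dirichlet integral enters through the averages of
  \<open>\<parallel>u(\<cdot> + h) - u\<parallel>\<^sup>2\<close> over \<open>\<bar>h\<bar> < t\<close>: bounds for all of them characterize it, they are lower semicontinuous,
  and inequalities under rearrangement become statements about pairs of points.  Averages over dyadic cubes
  give the subcritical embedding and compactness in \<open>L\<^sup>2\<close>, hence a minimizer.

  Let \<open>u\<close> be a minimizer and \<open>\<bar>c\<bar> = 1\<close>.  A nonexpansive, norm-preserving folding of the plane turns \<open>c u\<close> into a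
  minimizer with nonnegative components, the first of which is the positive part of \<open>Re (c u)\<close>.
  Polarization in a half-space with \<open>0\<close> in its interior does not increase \<open>E\<close>, does not decrease \<open>P\<close>, and lowers
  the moment strictly unless the function is already polarized.  So the positive part of
  \<open>Re (c u)\<close> is radially nonincreasing; if it vanishes far out, testing the equation with some \<open>\<psi> \<ge> 0\<close> with
  \<open>\<Delta>\<psi> \<ge> K \<psi>\<close> on the support shows that it vanishes everywhere.  Thus it is zero or positive almost
  everywhere, for every \<open>c\<close>.  For a \<open>c\<close> with \<open>Re (c \<integral> u) = 0\<close> over the unit ball this forces \<open>Re (c u) = 0\<close>,
  and \<open>u\<close> is a constant phase times a positive radial function.\<close>

text \<open>Folded and polarized competitors are never differentiated. As \<mu> is the optimal
  constant in \<open>\<mu> powr (q - 2) * P\<^sup>2 <= E powr q\<close>, a competitor with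
  \<open>E\<close> not above and \<open>P\<close> not below that of a minimizer has the same
  \<open>E\<close> and \<open>P\<close>. If it also keeps the mass while the Dirichlet integral and
  the moment can only drop, both of these are unchanged as well. Symmetry is read off from equality
  in the moment alone, where the deficit of a pair of mirror points is explicit; equality in the
  Dirichlet inequality is never analysed. Polarization works on the components of a complex value,
  and the modulus is monotone in them only when they are nonnegative. The positive part of
  \<open>Re (c u)\<close> alone would not do as a competitor, since its modulus, hence
  \<open>P\<close>, may be smaller; folding stores what is missing of the modulus in the second
  component. Positivity comes from monotonicity: a radially nonincreasing function that vanishes
  outside no ball is positive, so that only compact support has to be excluded and no strong maximum
  principle enters.\<close>

abbreviation nsq :: "'a::real_normed_vector \<Rightarrow> real" where
  "nsq x \<equiv> (norm x)\<^sup>2"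

abbreviation borel_fun :: "('a::topological_space \<Rightarrow> 'b::topological_space) \<Rightarrow> bool" where
  "borel_fun f \<equiv> f \<in> borel_measurable borel"

abbreviation nn_integral_lborel :: "('a::euclidean_space \<Rightarrow> ennreal) \<Rightarrow> ennreal" (binder "LBINT+ " 10) where
  "nn_integral_lborel f \<equiv> integral\<^sup>N lborel f"

section \<open>Lebesgue measure under translations and orthogonal maps\<close>

lemma measurable_lborel_borel [simp]: "borel_measurable lborel = borel_measurable borel" by (rule measurable_cong_sets) auto

lemma nn_integral_lborel_translate:
  fixes f :: "'a::euclidean_space \<Rightarrow> ennreal"
  assumes [measurable]: "borel_fun f"
  shows "(LBINT+ x. f (x + h)) = (LBINT+ x. f x)"
proof -
  have "(LBINT+ x. f x) = (\<integral>\<^sup>+x. f x \<partial>(distr lborel borel ((+) h)))" by (simp add: lborel_distr_plus)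
  also have "\<dots> = (LBINT+ x. f (h + x))" by (subst nn_integral_distr) auto
  finally show ?thesis by (simp add: add.commute)
qed

lemma integral_lborel_translate:
  fixes f :: "'a::euclidean_space \<Rightarrow> 'b::{banach, second_countable_topology}"
  assumes [measurable]: "borel_fun f"
  shows "(LBINT x. f (x + h)) = (LBINT x. f x)"
proof -
  have "(LBINT x. f x) = (\<integral>x. f x \<partial>(distr lborel borel ((+) h)))" by (simp add: lborel_distr_plus)
  also have "\<dots> = (LBINT x. f (h + x))" by (subst integral_distr) auto
  finally show ?thesis by (simp add: add.commute)
qed

lemma integrable_lborel_translate:
  fixes f :: "'a::euclidean_space \<Rightarrow> 'b::{banach, second_countable_topology}"
  assumes "integrable lborel f"
  shows "integrable lborel (\<lambda>x. f (x + h))"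
proof -
  have "integrable (distr lborel borel ((+) h)) f" using assms by (simp add: lborel_distr_plus)
  then have "integrable lborel (\<lambda>x. f (h + x))" by (subst (asm) integrable_distr_eq) (use assms in auto)
  then show ?thesis by (simp add: add.commute)
qed

lemma borel_measurable_orthogonal:
  fixes f :: "'a::euclidean_space \<Rightarrow> 'a"
  assumes f: "orthogonal_transformation f"
  shows "borel_fun f"
proof -
  have "continuous_on UNIV f" using f orthogonal_transformation_linear linear_continuous_on linear_conv_bounded_linear by blast
  then show ?thesis by (rule borel_measurable_continuous_onI)
qed

text \<open>Both integrals are compared after averaging over a ball, which \<open>f\<close> preserves.\<close>

lemma nn_integral_lborel_orthogonal:
  fixes f :: "'a::euclidean_space \<Rightarrow> 'a"
  assumes f: "orthogonal_transformation f" and [measurable]: "borel_fun F"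
  shows "(LBINT+ x. F (f x)) = (LBINT+ x. F x)"
proof -
  note [measurable] = borel_measurable_orthogonal[OF f]
  have lin: "linear f" using f by (rule orthogonal_transformation_linear)
  obtain g where g: "\<And>x. f (g x) = x" using orthogonal_transformation_surj[OF f] by (metis surj_def)
  define B where "B = ball (0::'a) 1"
  define b where "b = emeasure lborel B"
  have b: "b \<noteq> 0" "b \<noteq> \<infinity>"
  proof -
    have "unit_ball_vol (real DIM('a)) \<noteq> 0" by (metis less_irrefl of_nat_0_le_iff unit_ball_vol_pos)
    then show "b \<noteq> 0" "b \<noteq> \<infinity>" unfolding b_def B_def by (simp_all add: emeasure_ball)
  qed
  have Bm[measurable]: "B \<in> sets borel" by (simp add: B_def)
  have "b * (LBINT+ x. F (f x)) = (LBINT+ z. indicator B z * (LBINT+ x. F (f x)))" by (subst nn_integral_multc) (auto simp: b_def)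
  also have "\<dots> = (LBINT+ z. indicator B z * (LBINT+ x. F (f x + z)))"
  proof (rule nn_integral_cong)
    fix z
    have "(LBINT+ x. F (f x)) = (LBINT+ x. F (f (x + g z)))" by (subst nn_integral_lborel_translate) auto
    then show "indicator B z * (LBINT+ x. F (f x)) = indicator B z * (LBINT+ x. F (f x + z))" by (simp add: linear_add[OF lin] g)
  qed
  also have "\<dots> = (LBINT+ z. LBINT+ x. indicator B z * F (f x + z))" by (intro nn_integral_cong nn_integral_cmult[symmetric]) measurable
  also have "\<dots> = (LBINT+ x. LBINT+ z. indicator B z * F (f x + z))" by (rule lborel_pair.Fubini') measurable
  also have "\<dots> = (LBINT+ x. LBINT+ z. indicator B (z - f x) * F z)"
  proof (rule nn_integral_cong)
    fix x
    show "(LBINT+ z. indicator B z * F (f x + z)) = (LBINT+ z. indicator B (z - f x) * F z)"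
      by (subst nn_integral_lborel_translate[symmetric, of _ "f x"]) (auto simp: add.commute)
  qed
  also have "\<dots> = (LBINT+ z. LBINT+ x. indicator B (z - f x) * F z)" by (rule lborel_pair.Fubini') measurable
  also have "\<dots> = (LBINT+ z. b * F z)"
  proof (rule nn_integral_cong)
    fix z
    have ind: "indicator B (z - f x) = (indicator B (x + - g z) :: ennreal)" for x
    proof -
      have "z - f x = f (g z - x)" by (simp add: linear_diff[OF lin] g)
      then have "norm (z - f x) = norm (x + - g z)" by (simp add: orthogonal_transformation_norm[OF f] norm_minus_commute)
      then show ?thesis by (simp add: B_def indicator_def)
    qed
    have "(LBINT+ x. indicator B (z - f x) * F z) = (LBINT+ x. indicator B (z - f x)) * F z" by (rule nn_integral_multc) measurable
    also have "(LBINT+ x. indicator B (z - f x)) = b" unfolding ind by (subst nn_integral_lborel_translate) (auto simp: b_def)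
    finally show "(LBINT+ x. indicator B (z - f x) * F z) = b * F z" .
  qed
  also have "\<dots> = b * (LBINT+ z. F z)" by (rule nn_integral_cmult) measurable
  finally show ?thesis using b by (simp add: ennreal_mult_cancel_left)
qed

text \<open>Each coordinate has a real-valued Borel representative. As \<open>Basis\<close> is
  finite, the exceptional null sets can be collected and the coordinates reassembled.\<close>

lemma borel_representative:
  fixes f :: "'a::euclidean_space \<Rightarrow> 'b::euclidean_space"
  assumes f: "f \<in> borel_measurable lebesgue"
  shows "\<exists>g\<in>borel_measurable borel. AE x in lebesgue. f x = g x"
proof -
  have "\<forall>b. \<exists>g\<in>borel_measurable borel. AE x in lborel. f x \<bullet> b = (g x::real)"
  proof
    fix b :: 'b
    have "(\<lambda>x. f x \<bullet> b) \<in> borel_measurable lebesgue" using f by measurable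
    from completion_ex_borel_measurable_real[OF this]
    show "\<exists>g\<in>borel_measurable borel. AE x in lborel. f x \<bullet> b = (g x::real)" by auto
  qed
  then obtain g where g: "\<And>b. g b \<in> borel_measurable borel" "\<And>b. AE x in lborel. f x \<bullet> b = (g b x::real)" by metis
  have "AE x in lborel. \<forall>b\<in>Basis. f x \<bullet> b = g b x" by (intro AE_finite_allI finite_Basis g)
  then have "AE x in lborel. f x = (\<Sum>b\<in>Basis. g b x *\<^sub>R b)"
    by eventually_elim (metis (no_types, lifting) euclidean_representation sum.cong)
  then have "AE x in lebesgue. f x = (\<Sum>b\<in>Basis. g b x *\<^sub>R b)" by (rule AE_completion)
  moreover have "borel_fun (\<lambda>x. (\<Sum>b\<in>Basis. g b x *\<^sub>R b))"
    by (intro borel_measurable_sum borel_measurable_scaleR g borel_measurable_const)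
  ultimately show ?thesis by (intro bexI[where x = "\<lambda>x. \<Sum>b\<in>Basis. g b x *\<^sub>R b"])
qed

section \<open>Square integrable functions: Cauchy-Schwarz, completeness, Riesz
  representation\<close>

text \<open>The measure is a parameter because the definitions of the problem integrate over
  \<open>lebesgue\<close>, whereas translations and Tonelli arguments are carried out over
  \<open>lborel\<close>.\<close>

definition square_integrable :: "'a measure \<Rightarrow> ('a \<Rightarrow> 'b::euclidean_space) \<Rightarrow> bool" where
  "square_integrable M f \<longleftrightarrow> f \<in> borel_measurable M \<and> integrable M (\<lambda>x. nsq (f x))"

lemma square_integrableD:
  assumes "square_integrable M f"
  shows "f \<in> borel_measurable M" "integrable M (\<lambda>x. nsq (f x))" using assms by (auto simp: square_integrable_def)

lemma square_integrable_iff: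
  "square_integrable M f \<longleftrightarrow> f \<in> borel_measurable M \<and> (\<integral>\<^sup>+x. ennreal (nsq (f x)) \<partial>M) < \<infinity>"
  unfolding square_integrable_def by (auto simp: integrable_iff_bounded)

lemma nn_integral_square:
  assumes "square_integrable M f"
  shows "(\<integral>\<^sup>+x. ennreal (nsq (f x)) \<partial>M) = ennreal (\<integral>x. nsq (f x) \<partial>M)"
  using assms by (intro nn_integral_eq_integral) (auto simp: square_integrable_def)

lemma norm_add_sq_le: "nsq (a + b) \<le> 2 * nsq a + 2 * nsq (b::'b::real_normed_vector)"
proof -
  have "nsq (a + b) \<le> (norm a + norm b)^2" by (intro power_mono norm_triangle_ineq) auto
  also have "\<dots> \<le> 2 * nsq a + 2 * nsq b" using sum_squares_bound[of "norm a" "norm b"] by (simp add: power2_sum)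
  finally show ?thesis .
qed

lemma norm_diff_sq_le: "nsq (a - b) \<le> 2 * nsq a + 2 * nsq (b::'b::real_normed_vector)" using norm_add_sq_le[of a "-b"] by simp

lemma square_integrable_add:
  assumes f: "square_integrable M f" and g: "square_integrable M g"
  shows "square_integrable M (\<lambda>x. f x + g x)" unfolding square_integrable_def
proof
  note [measurable] = square_integrableD(1)[OF f] square_integrableD(1)[OF g]
  show "(\<lambda>x. f x + g x) \<in> borel_measurable M" by measurable
  show "integrable M (\<lambda>x. nsq (f x + g x))"
  proof (rule Bochner_Integration.integrable_bound)
    show "integrable M (\<lambda>x. 2 * nsq (f x) + 2 * nsq (g x))" using square_integrableD(2)[OF f] square_integrableD(2)[OF g] by auto
    show "AE x in M. norm (nsq (f x + g x)) \<le> norm (2 * nsq (f x) + 2 * nsq (g x))" using norm_add_sq_le by (intro AE_I2) auto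
  qed measurable
qed

lemma square_integrable_scaleR:
  assumes f: "square_integrable M f"
  shows "square_integrable M (\<lambda>x. c *\<^sub>R f x)" using f by (auto simp: square_integrable_def power_mult_distrib)

lemma square_integrable_diff:
  assumes f: "square_integrable M f" and g: "square_integrable M g"
  shows "square_integrable M (\<lambda>x. f x - g x)" using square_integrable_add[OF f square_integrable_scaleR[OF g, of "-1"]] by simp

lemma square_integrable_bound:
  assumes f: "square_integrable M f" and [measurable]: "g \<in> borel_measurable M"
    and le: "AE x in M. norm (g x) \<le> c * norm (f x)"
  shows "square_integrable M g" unfolding square_integrable_def
proof
  show "integrable M (\<lambda>x. nsq (g x))"
  proof (rule Bochner_Integration.integrable_bound)
    show "integrable M (\<lambda>x. c^2 * nsq (f x))" using square_integrableD(2)[OF f] by auto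
    show "AE x in M. norm (nsq (g x)) \<le> norm (c^2 * nsq (f x))" using le
    proof eventually_elim
      case (elim x)
      then have "nsq (g x) \<le> (c * norm (f x))^2" by (intro power_mono) auto
      then show ?case by (simp add: power_mult_distrib)
    qed
  qed measurable
qed simp

lemma inner_le_sq: "\<bar>a \<bullet> b\<bar> \<le> (nsq a + nsq b) / 2"
proof -
  have "\<bar>a \<bullet> b\<bar> \<le> norm a * norm b" by (rule Cauchy_Schwarz_ineq2)
  also have "\<dots> \<le> (nsq a + nsq b) / 2" using sum_squares_bound[of "norm a" "norm b"] by simp
  finally show ?thesis .
qed

lemma integrable_inner_square:
  assumes f: "square_integrable M f" and g: "square_integrable M g"
  shows "integrable M (\<lambda>x. f x \<bullet> g x)"
proof (rule Bochner_Integration.integrable_bound)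
  note [measurable] = square_integrableD(1)[OF f] square_integrableD(1)[OF g]
  show "integrable M (\<lambda>x. (nsq (f x) + nsq (g x)) / 2)" using square_integrableD(2)[OF f] square_integrableD(2)[OF g] by auto
  show "(\<lambda>x. f x \<bullet> g x) \<in> borel_measurable M" by measurable
  show "AE x in M. norm (f x \<bullet> g x) \<le> norm ((nsq (f x) + nsq (g x)) / 2)"
    using inner_le_sq[of "f _" "g _"] by (intro AE_I2) (simp add: order_trans[OF _ abs_ge_self])
qed

lemma integral_norm_add_sq:
  assumes f: "square_integrable M f" and g: "square_integrable M g"
  shows "(\<integral>x. nsq (f x + g x) \<partial>M)
    = (\<integral>x. nsq (f x) \<partial>M) + 2 * (\<integral>x. f x \<bullet> g x \<partial>M) + (\<integral>x. nsq (g x) \<partial>M)"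
proof -
  have "(\<integral>x. nsq (f x + g x) \<partial>M) = (\<integral>x. nsq (f x) + 2 * (f x \<bullet> g x) + nsq (g x) \<partial>M)"
    by (intro Bochner_Integration.integral_cong) (auto simp: power2_norm_eq_inner algebra_simps inner_commute)
  then show ?thesis using square_integrableD(2)[OF f] square_integrableD(2)[OF g] integrable_inner_square[OF f g] by simp
qed

text \<open>The squared norm of \<open>f + s g\<close> is a quadratic polynomial in \<open>s\<close>
  that is nowhere negative.\<close>

lemma integral_inner_CS:
  assumes f: "square_integrable M f" and g: "square_integrable M g"
  shows "(\<integral>x. f x \<bullet> g x \<partial>M)^2 \<le> (\<integral>x. nsq (f x) \<partial>M) * (\<integral>x. nsq (g x) \<partial>M)"
proof -
  define A where "A = (\<integral>x. nsq (f x) \<partial>M)"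
  define B where "B = (\<integral>x. f x \<bullet> g x \<partial>M)"
  define C where "C = (\<integral>x. nsq (g x) \<partial>M)"
  have *: "0 \<le> A + 2 * s * B + s^2 * C" for s
  proof -
    have "0 \<le> (\<integral>x. nsq (f x + s *\<^sub>R g x) \<partial>M)" by (rule integral_nonneg_AE) auto
    also have "\<dots> = A + 2 * s * B + s^2 * C" using integral_norm_add_sq[OF f square_integrable_scaleR[OF g, of s]]
      by (simp add: A_def B_def C_def power_mult_distrib)
    finally show ?thesis .
  qed
  have A0: "0 \<le> A" and C0: "0 \<le> C" unfolding A_def C_def by (auto intro: integral_nonneg_AE)
  have "B^2 \<le> A * C"
  proof (cases "C = 0")
    case True
    have "B = 0"
    proof (rule ccontr)
      assume "B \<noteq> 0"
      \<comment> \<open>For \<open>C = 0\<close> the polynomial is affine; at this \<open>s\<close>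
        it equals \<open>-1\<close>.\<close>
      then show False using *[of "-(A+1)/(2*B)"] True A0 by (simp add: field_simps)
    qed
    then show ?thesis using True by simp
  next
    case False
    then have "C > 0" using C0 by simp
    then show ?thesis using *[of "-B/C"] by (simp add: field_simps power2_eq_square)
  qed
  then show ?thesis by (simp add: A_def B_def C_def)
qed

text \<open>Riesz-Fischer. Along a subsequence the squared increments have integrals below
  \<open>(1/4)^k\<close>; with weights \<open>2^k\<close> these still have a finite sum, and
  \<open>2 a <= (1/2)^k + 2^k a^2\<close> turns summability of the weighted squares at almost every
  point into absolute summability of the increments.\<close>

lemma L2_complete:
  fixes f :: "nat \<Rightarrow> 'a \<Rightarrow> 'b::euclidean_space"
  assumes f: "\<And>n. square_integrable M (f n)"
    and C: "\<And>e. e > 0 \<Longrightarrow> \<exists>N. \<forall>i\<ge>N. \<forall>j\<ge>N. (\<integral>x. nsq (f i x - f j x) \<partial>M) < e"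
  obtains g r where "square_integrable M g" "strict_mono (r::nat\<Rightarrow>nat)"
    "AE x in M. (\<lambda>n. f (r n) x) \<longlonglongrightarrow> g x" "(\<lambda>n. \<integral>x. nsq (f n x - g x) \<partial>M) \<longlonglongrightarrow> 0"
proof -
  note [measurable] = square_integrableD(1)[OF f]
  have "\<exists>N. \<forall>i\<ge>N. \<forall>j\<ge>N. (\<integral>x. nsq (f i x - f j x) \<partial>M) < (1/4)^k" for k :: nat by (rule C) simp
  then obtain N where N: "\<And>k i j. i \<ge> N k \<Longrightarrow> j \<ge> N k \<Longrightarrow> (\<integral>x. nsq (f i x - f j x) \<partial>M) < (1/4)^k"
    by metis
  \<comment> \<open>The sum makes \<open>r k\<close> at least \<open>N k\<close>, and the summand
    \<open>k\<close> makes \<open>r\<close> strictly increasing.\<close>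
  define r where "r k = (\<Sum>i\<le>k. N i) + k" for k
  have sm: "strict_mono r" unfolding strict_mono_Suc_iff r_def by simp
  have rN: "r k \<ge> N k" for k unfolding r_def by (simp add: trans_le_add1 member_le_sum)
  have rmono: "r k \<le> r (Suc k)" for k using sm by (simp add: strict_mono_Suc_iff less_imp_le)
  define a where "a k x = norm (f (r (Suc k)) x - f (r k) x)" for k x
  have [measurable]: "a k \<in> borel_measurable M" for k unfolding a_def by measurable
  have a_int: "(\<integral>\<^sup>+x. ennreal (2^k * (a k x)^2) \<partial>M) \<le> ennreal ((1/2)^k)" for k
  proof -
    have sq: "square_integrable M (\<lambda>x. f (r (Suc k)) x - f (r k) x)" by (intro square_integrable_diff f)
    have "(\<integral>\<^sup>+x. ennreal (2^k * (a k x)^2) \<partial>M) = ennreal (2^k) * (\<integral>\<^sup>+x. ennreal ((a k x)^2) \<partial>M)"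
      by (subst nn_integral_cmult[symmetric]) (auto simp: ennreal_mult)
    also have "\<dots> = ennreal (2^k) * ennreal (\<integral>x. (a k x)^2 \<partial>M)" using nn_integral_square[OF sq] by (simp add: a_def)
    also have "\<dots> = ennreal (2^k * (\<integral>x. (a k x)^2 \<partial>M))" by (simp add: ennreal_mult)
    also have "\<dots> \<le> ennreal (2^k * (1/4)^k)" using N[of k "r (Suc k)" "r k"] rN[of k] rmono[of k] unfolding a_def by (intro ennreal_leI) auto
    also have "(2::real)^k * (1/4)^k = (1/2)^k" by (simp flip: power_mult_distrib)
    finally show ?thesis .
  qed
  have "(\<integral>\<^sup>+x. (\<Sum>k. ennreal (2^k * (a k x)^2)) \<partial>M) = (\<Sum>k. \<integral>\<^sup>+x. ennreal (2^k * (a k x)^2) \<partial>M)"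
    by (rule nn_integral_suminf) measurable
  also have "\<dots> \<le> (\<Sum>k. ennreal ((1/2)^k))" by (intro suminf_le a_int) auto
  also have "\<dots> < \<infinity>" by (subst suminf_ennreal2) auto
  finally have "AE x in M. (\<Sum>k. ennreal (2^k * (a k x)^2)) \<noteq> \<infinity>" by (intro nn_integral_PInf_AE) auto
  then have conv: "AE x in M. convergent (\<lambda>n. f (r n) x)"
  proof eventually_elim
    case (elim x)
    have s: "summable (\<lambda>k. 2^k * (a k x)^2)" by (rule summable_suminf_not_top) (use elim in auto)
    have "summable (\<lambda>k. a k x)"
    proof (rule summable_comparison_test')
      show "summable (\<lambda>k. (1/2)^k + 2^k * (a k x)^2)" using s by (intro summable_add) auto
      fix k :: nat
      have "0 \<le> ((2::real)^k) * (a k x - (1/2)^k)^2" by simp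
      also have "\<dots> = 2^k * (a k x)^2 - 2 * a k x + (1/2)^k" by (simp add: power2_eq_square algebra_simps power_divide)
      finally have "2 * a k x \<le> (1/2)^k + 2^k * (a k x)^2" by simp
      moreover have "a k x \<ge> 0" by (simp add: a_def)
      ultimately show "norm (a k x) \<le> (1/2)^k + 2^k * (a k x)^2" by simp
    qed
    then have "summable (\<lambda>k. norm (f (r (Suc k)) x - f (r k) x))" unfolding a_def .
    then have "summable (\<lambda>k. f (r (Suc k)) x - f (r k) x)" by (rule summable_norm_cancel)
    then have "convergent (\<lambda>n. \<Sum>k<n. (f (r (Suc k)) x - f (r k) x))" unfolding summable_iff_convergent .
    then have "convergent (\<lambda>n. f (r n) x - f (r 0) x)" by (subst (asm) sum_lessThan_telescope)
    then show ?case using convergent_add[of "\<lambda>n. f (r n) x - f (r 0) x" "\<lambda>n. f (r 0) x"] by (simp add: convergent_const)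
  qed
  define g where "g x = lim (\<lambda>n. f (r n) x)" for x
  have gm[measurable]: "g \<in> borel_measurable M" unfolding g_def by measurable
  have lim: "AE x in M. (\<lambda>n. f (r n) x) \<longlonglongrightarrow> g x" using conv by eventually_elim (simp add: g_def convergent_LIMSEQ_iff)
  \<comment> \<open>Fatou along the subsequence carries the Cauchy estimate over to the
    limit.\<close>
  have Fat: "(\<integral>\<^sup>+x. ennreal (nsq (f n x - g x)) \<partial>M) \<le> ennreal e"
    if "\<And>j. j \<ge> K \<Longrightarrow> (\<integral>x. nsq (f n x - f j x) \<partial>M) < e" for n K e
  proof -
    have "(\<integral>\<^sup>+x. ennreal (nsq (f n x - g x)) \<partial>M)
      = (\<integral>\<^sup>+x. liminf (\<lambda>k. ennreal (nsq (f n x - f (r k) x))) \<partial>M)"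
    proof (rule nn_integral_cong_AE, use lim in eventually_elim)
      case (elim x)
      then have "(\<lambda>k. ennreal (nsq (f n x - f (r k) x))) \<longlonglongrightarrow> ennreal (nsq (f n x - g x))"
        by (intro tendsto_ennrealI tendsto_intros)
      then show ?case by (intro lim_imp_Liminf[symmetric]) auto
    qed
    also have "\<dots> \<le> liminf (\<lambda>k. \<integral>\<^sup>+x. ennreal (nsq (f n x - f (r k) x)) \<partial>M)"
      by (rule nn_integral_liminf) measurable
    also have "\<dots> \<le> ennreal e"
    proof (rule Liminf_le)
      show "\<forall>\<^sub>F k in sequentially. (\<integral>\<^sup>+x. ennreal (nsq (f n x - f (r k) x)) \<partial>M) \<le> ennreal e"
        using eventually_ge_at_top[of K]
      proof eventually_elim
        case (elim k)
        then have "r k \<ge> K" using seq_suble[OF sm, of k] by simp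
        then show ?case using that[of "r k"] by (subst nn_integral_square[OF square_integrable_diff[OF f f]]) (auto intro!: ennreal_leI)
      qed
    qed simp
    finally show ?thesis .
  qed
  obtain N1 where "\<And>j. j \<ge> N1 \<Longrightarrow> (\<integral>x. nsq (f N1 x - f j x) \<partial>M) < 1" using C[of 1] by force
  then have "(\<integral>\<^sup>+x. ennreal (nsq (f N1 x - g x)) \<partial>M) \<le> ennreal 1" by (rule Fat)
  then have "square_integrable M (\<lambda>x. f N1 x - g x)" unfolding square_integrable_iff by (auto intro: le_less_trans)
  from square_integrable_diff[OF f this, of N1] have g: "square_integrable M g" by simp
  have "(\<lambda>n. \<integral>x. nsq (f n x - g x) \<partial>M) \<longlonglongrightarrow> 0"
  proof (rule LIMSEQ_I)
    fix e :: real assume "e > 0"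
    then obtain K where K: "\<And>i j. i \<ge> K \<Longrightarrow> j \<ge> K \<Longrightarrow> (\<integral>x. nsq (f i x - f j x) \<partial>M) < e/2"
      using C[of "e/2"] by auto
    have "norm ((\<integral>x. nsq (f n x - g x) \<partial>M) - 0) < e" if "n \<ge> K" for n
    proof -
      have "ennreal (\<integral>x. nsq (f n x - g x) \<partial>M) \<le> ennreal (e/2)"
        using Fat[of K n "e/2"] K that by (subst nn_integral_square[symmetric]) (auto intro: square_integrable_diff f g)
      then have "(\<integral>x. nsq (f n x - g x) \<partial>M) \<le> e/2" using \<open>e > 0\<close> by (simp add: ennreal_le_iff)
      moreover have "0 \<le> (\<integral>x. nsq (f n x - g x) \<partial>M)" by (rule integral_nonneg_AE) auto
      ultimately show ?thesis using \<open>e > 0\<close> by simp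
    qed
    then show "\<exists>no. \<forall>n\<ge>no. norm ((\<integral>x. nsq (f n x - g x) \<partial>M) - 0) < e" by blast
  qed
  with g sm lim show ?thesis by (rule that)
qed

lemma tendsto_integral_inner:
  assumes s: "\<And>n. square_integrable M (s n)" and G: "square_integrable M G" and f: "square_integrable M f"
    and lim: "(\<lambda>n. \<integral>x. nsq (s n x - G x) \<partial>M) \<longlonglongrightarrow> 0"
  shows "(\<lambda>n. \<integral>x. s n x \<bullet> f x \<partial>M) \<longlonglongrightarrow> (\<integral>x. G x \<bullet> f x \<partial>M)"
proof -
  let ?F = "\<integral>x. nsq (f x) \<partial>M"
  have "(\<lambda>n. (\<integral>x. s n x \<bullet> f x \<partial>M) - (\<integral>x. G x \<bullet> f x \<partial>M)) \<longlonglongrightarrow> 0"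
  proof (rule Lim_null_comparison)
    show "\<forall>\<^sub>F n in sequentially. norm ((\<integral>x. s n x \<bullet> f x \<partial>M) - (\<integral>x. G x \<bullet> f x \<partial>M))
        \<le> sqrt ((\<integral>x. nsq (s n x - G x) \<partial>M) * ?F)"
    proof (intro always_eventually allI)
      fix n
      have "(\<integral>x. s n x \<bullet> f x \<partial>M) - (\<integral>x. G x \<bullet> f x \<partial>M) = (\<integral>x. (s n x - G x) \<bullet> f x \<partial>M)"
        using integrable_inner_square[OF s f] integrable_inner_square[OF G f] by (simp add: inner_diff_left)
      then show "norm ((\<integral>x. s n x \<bullet> f x \<partial>M) - (\<integral>x. G x \<bullet> f x \<partial>M))
          \<le> sqrt ((\<integral>x. nsq (s n x - G x) \<partial>M) * ?F)"
        using real_sqrt_le_mono[OF integral_inner_CS[OF square_integrable_diff[OF s G] f]] by simp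
    qed
    have "(\<lambda>n. sqrt ((\<integral>x. nsq (s n x - G x) \<partial>M) * ?F)) \<longlonglongrightarrow> sqrt (0 * ?F)"
      by (intro tendsto_intros lim)
    then show "(\<lambda>n. sqrt ((\<integral>x. nsq (s n x - G x) \<partial>M) * ?F)) \<longlonglongrightarrow> 0" by simp
  qed
  then show ?thesis by (rule LIM_zero_cancel)
qed

text \<open>Here \<open>T\<close> is a subspace that may fail to be closed, and \<open>bd\<close>
  is, by scaling, the bound \<open>(L f)^2 <= B\<close> times the integral of \<open>nsq f\<close>.
  The representer \<open>G\<close> is the limit of a maximizing sequence of the concave functional
  \<open>F f = 2 L f - |f|^2\<close>, so it comes with an approximation from \<open>T\<close>;
  density of test functions will follow from that.\<close>

lemma Riesz_L2:
  fixes T :: "('a \<Rightarrow> 'c::euclidean_space) set" and L :: "('a \<Rightarrow> 'c) \<Rightarrow> real"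
  assumes T: "\<And>f. f \<in> T \<Longrightarrow> square_integrable M f" and T0: "(\<lambda>x. 0) \<in> T"
    and T_add: "\<And>f g. f \<in> T \<Longrightarrow> g \<in> T \<Longrightarrow> (\<lambda>x. f x + g x) \<in> T"
    and T_scale: "\<And>f c. f \<in> T \<Longrightarrow> (\<lambda>x. c *\<^sub>R f x) \<in> T"
    and L_add: "\<And>f g. f \<in> T \<Longrightarrow> g \<in> T \<Longrightarrow> L (\<lambda>x. f x + g x) = L f + L g"
    and L_scale: "\<And>f c. f \<in> T \<Longrightarrow> L (\<lambda>x. c *\<^sub>R f x) = c * L f"
    and bd: "\<And>f. f \<in> T \<Longrightarrow> 2 * L f \<le> B + (\<integral>x. nsq (f x) \<partial>M)"
  obtains G s where "square_integrable M G" "\<And>f. f \<in> T \<Longrightarrow> L f = (\<integral>x. G x \<bullet> f x \<partial>M)"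
    "(\<integral>x. nsq (G x) \<partial>M) \<le> B" "\<And>n::nat. s n \<in> T"
    "(\<lambda>n. \<integral>x. nsq (s n x - G x) \<partial>M) \<longlonglongrightarrow> 0"
proof -
  define F where "F f = 2 * L f - (\<integral>x. nsq (f x) \<partial>M)" for f
  define m where "m = Sup (F ` T)"
  have FB: "F f \<le> B" if "f \<in> T" for f using bd[OF that] by (simp add: F_def)
  have bdd: "bdd_above (F ` T)" using FB by (intro bdd_aboveI2[where M = B])
  have Fm: "F f \<le> m" if "f \<in> T" for f unfolding m_def using that bdd by (auto intro: cSup_upper)
  have "\<exists>f\<in>T. F f > m - 1 / Suc n" for n
  proof -
    have "m - 1 / Suc n < Sup (F ` T)" by (simp add: m_def)
    then show ?thesis using T0 less_cSup_iff[of "F ` T" "m - 1 / Suc n"] bdd by auto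
  qed
  then obtain s where s: "\<And>n. s n \<in> T" "\<And>n. F (s n) > m - 1 / Suc n" by metis
  have ssq: "square_integrable M (s n)" for n using s T by blast
  have Fadd: "F (\<lambda>x. f x + t *\<^sub>R g x)
      = F f + 2 * t * (L g - (\<integral>x. f x \<bullet> g x \<partial>M)) - t^2 * (\<integral>x. nsq (g x) \<partial>M)"
    if "f \<in> T" "g \<in> T" for f g t unfolding F_def using that
    by (simp add: L_add L_scale T_scale integral_norm_add_sq T square_integrable_scaleR power_mult_distrib algebra_simps)
  \<comment> \<open>The midpoint of \<open>f\<close> and \<open>g\<close> has \<open>F\<close> equal
    to the mean of \<open>F f\<close> and \<open>F g\<close> plus a quarter of the squared distance,
    and it cannot exceed the supremum \<open>m\<close>. Hence maximizing sequences are
    Cauchy.\<close>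
  have par: "(\<integral>x. nsq (f x - g x) \<partial>M) \<le> 2 * ((m - F f) + (m - F g))" if "f \<in> T" "g \<in> T" for f g
  proof -
    have d: "(\<lambda>x. f x + (-1) *\<^sub>R g x) \<in> T" using that by (intro T_add T_scale)
    define h where "h = (\<lambda>x. f x + (-1) *\<^sub>R g x)"
    have hT: "h \<in> T" using d by (simp add: h_def)
    have "F g = F (\<lambda>x. f x + (-1) *\<^sub>R h x)" by (simp add: h_def)
    then have 1: "F g = F f - 2 * (L h - (\<integral>x. f x \<bullet> h x \<partial>M)) - (\<integral>x. nsq (h x) \<partial>M)"
      using Fadd[OF that(1) hT, of "-1"] by simp
    have "(\<lambda>x. f x + (-1/2) *\<^sub>R h x) \<in> T" using that hT by (intro T_add T_scale)
    from Fm[OF this] have 2: "F f - (L h - (\<integral>x. f x \<bullet> h x \<partial>M)) - (1/4) * (\<integral>x. nsq (h x) \<partial>M) \<le> m"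
      using Fadd[OF that(1) hT, of "-1/2"] by (simp add: power2_eq_square)
    show ?thesis using 1 2 by (simp add: h_def)
  qed
  have Cau: "\<exists>N. \<forall>i\<ge>N. \<forall>j\<ge>N. (\<integral>x. nsq (s i x - s j x) \<partial>M) < e" if "e > 0" for e
  proof -
    obtain N where N: "1 / Suc N < e / 4" using \<open>e > 0\<close> nat_approx_posE[of "e/4"] by auto
    have "(\<integral>x. nsq (s i x - s j x) \<partial>M) < e" if "i \<ge> N" "j \<ge> N" for i j
    proof -
      have "1 / Suc i \<le> 1 / Suc N" "1 / Suc j \<le> 1 / Suc N" using that by (auto simp: field_simps)
      then show ?thesis using par[OF s(1)[of i] s(1)[of j]] s(2)[of i] s(2)[of j] N by argo
    qed
    then show ?thesis by blast
  qed
  obtain G r where G: "square_integrable M G" "(\<lambda>n. \<integral>x. nsq (s n x - G x) \<partial>M) \<longlonglongrightarrow> 0"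
    using L2_complete[OF ssq Cau] by blast
  have LG: "L f = (\<integral>x. G x \<bullet> f x \<partial>M)" if "f \<in> T" for f
  proof -
    define q where "q = (\<integral>x. nsq (f x) \<partial>M)"
    have q0: "q \<ge> 0" unfolding q_def by (rule integral_nonneg_AE) auto
    define d where "d = L f - (\<integral>x. G x \<bullet> f x \<partial>M)"
    have *: "2 * t * d - t^2 * q \<le> 0" for t
    proof -
      have le: "2 * t * (L f - (\<integral>x. s n x \<bullet> f x \<partial>M)) - t^2 * q \<le> 1 / Suc n" for n
        using Fm[OF T_add[OF s(1)[of n] T_scale[OF that, of t]]] Fadd[OF s(1)[of n] that, of t] s(2)[of n] by (simp add: q_def)
      have "(\<lambda>n. 2 * t * (L f - (\<integral>x. s n x \<bullet> f x \<partial>M)) - t^2 * q) \<longlonglongrightarrow> 2 * t * d - t^2 * q"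
        unfolding d_def by (intro tendsto_intros tendsto_integral_inner ssq G T that)
      then show ?thesis by (rule LIMSEQ_le[OF _ lim_1_over_n[THEN LIMSEQ_Suc]]) (use le in auto)
    qed
    have "d = 0"
    proof (rule ccontr)
      assume "d \<noteq> 0"
      \<comment> \<open>The quadratic \<open>2 t d - t^2 q\<close> is largest at
        \<open>t = d / q\<close>; the shift to \<open>q + 1\<close> keeps it positive and covers
        \<open>q = 0\<close>.\<close>
      have "2 * (d / (q + 1)) * d - (d / (q + 1))^2 * q = d^2 * (q + 2) / (q + 1)^2"
      proof -
        define w where "w = q + 1"
        have w: "w > 0" "q = w - 1" using q0 by (auto simp: w_def)
        show ?thesis unfolding w(2) using w(1) by (simp add: field_simps power2_eq_square)
      qed
      moreover have "d^2 * (q + 2) / (q + 1)^2 > 0" using q0 \<open>d \<noteq> 0\<close> by (intro divide_pos_pos mult_pos_pos) auto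
      ultimately show False using *[of "d / (q + 1)"] by linarith
    qed
    then show ?thesis by (simp add: d_def)
  qed
  have "(\<integral>x. nsq (G x) \<partial>M) \<le> B"
  proof -
    \<comment> \<open>Completing the square, with \<open>L (s n)\<close> already expressed through
      \<open>G\<close>.\<close>
    have eq: "(\<integral>x. nsq (G x) \<partial>M) - (\<integral>x. nsq (s n x - G x) \<partial>M) = F (s n)" for n
    proof -
      have "(\<integral>x. nsq (s n x - G x) \<partial>M) = (\<integral>x. nsq (s n x + (-1) *\<^sub>R G x) \<partial>M)" by simp
      also have "\<dots> = (\<integral>x. nsq (s n x) \<partial>M) - 2 * (\<integral>x. G x \<bullet> s n x \<partial>M) + (\<integral>x. nsq (G x) \<partial>M)"
        by (subst integral_norm_add_sq[OF ssq square_integrable_scaleR[OF G(1)]]) (simp add: inner_commute)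
      finally show ?thesis by (simp add: F_def LG[OF s(1)])
    qed
    have "(\<lambda>n. (\<integral>x. nsq (G x) \<partial>M) - (\<integral>x. nsq (s n x - G x) \<partial>M)) \<longlonglongrightarrow> (\<integral>x. nsq (G x) \<partial>M) - 0"
      by (intro tendsto_intros G)
    then show ?thesis using FB[OF s(1)] by (intro LIMSEQ_le_const2[where a = B]) (auto simp: eq)
  qed
  with G LG s show ?thesis by (intro that) auto
qed

text \<open>Jensen's inequality for the average \<open>a\<close> over \<open>A\<close>: in
  \<open>|f - c|^2 = |f - a|^2 + 2 (f - a) . (a - c) + |a - c|^2\<close> the middle term integrates
  to zero over \<open>A\<close>. It is used for cubes and for balls.\<close>

lemma average_square_le:
  fixes f :: "'a \<Rightarrow> 'b::euclidean_space"
  assumes A[measurable]: "A \<in> sets M" and fin: "emeasure M A < \<infinity>" and pos: "measure M A > 0"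
    and f: "square_integrable M (\<lambda>x. indicator A x *\<^sub>R f x)"
  defines "a \<equiv> (1 / measure M A) *\<^sub>R (\<integral>x. indicator A x *\<^sub>R f x \<partial>M)"
  shows "integrable M (\<lambda>x. indicator A x *\<^sub>R f x)"
    "measure M A * nsq (a - c) \<le> (\<integral>x. indicator A x * nsq (f x - c) \<partial>M)"
    "integrable M (\<lambda>x. indicator A x * nsq (f x - c))"
proof -
  note [measurable] = square_integrableD(1)[OF f]
  have iA: "integrable M (\<lambda>x. indicator A x :: real)" using fin by simp
  show i1: "integrable M (\<lambda>x. indicator A x *\<^sub>R f x)"
  proof (rule Bochner_Integration.integrable_bound)
    show "integrable M (\<lambda>x. indicator A x + nsq (indicator A x *\<^sub>R f x))"
      using iA square_integrableD(2)[OF f] by (rule Bochner_Integration.integrable_add)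
    have "norm (indicator A x *\<^sub>R f x) \<le> norm (indicator A x + nsq (indicator A x *\<^sub>R f x))" for x
    proof (cases "x \<in> A")
      case True
      have "0 \<le> (norm (f x) - 1)^2" by simp
      then have "norm (f x) \<le> 1 + nsq (f x)" by (simp add: power2_diff) (smt (verit) norm_ge_zero)
      then show ?thesis using True by simp
    qed simp
    then show "AE x in M. norm (indicator A x *\<^sub>R f x) \<le> norm (indicator A x + nsq (indicator A x *\<^sub>R f x))" by simp
  qed measurable
  have "square_integrable M (\<lambda>x. indicator A x *\<^sub>R c)" unfolding square_integrable_def
  proof
    have "(\<lambda>x. nsq (indicator A x *\<^sub>R c)) = (\<lambda>x. indicator A x * nsq c)" by (auto simp: indicator_def)
    then show "integrable M (\<lambda>x. nsq (indicator A x *\<^sub>R c))" using iA by simp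
  qed measurable
  from square_integrableD(2)[OF square_integrable_diff[OF f this]]
  have "integrable M (\<lambda>x. nsq (indicator A x *\<^sub>R f x - indicator A x *\<^sub>R c))" .
  moreover have "(\<lambda>x. nsq (indicator A x *\<^sub>R f x - indicator A x *\<^sub>R c)) = (\<lambda>x. indicator A x * nsq (f x - c))"
    by (auto simp: indicator_def)
  ultimately show i2: "integrable M (\<lambda>x. indicator A x * nsq (f x - c))" by simp
  have ie: "integrable M (\<lambda>x. indicator A x * (nsq (a - c) - 2 * (a \<bullet> (a - c))) + 2 * ((indicator A x *\<^sub>R f x) \<bullet> (a - c)))"
    using iA i1 by (intro Bochner_Integration.integrable_add integrable_mult_right integrable_mult_left integrable_inner_left) auto
  have "measure M A * nsq (a - c)
      = (\<integral>x. indicator A x * (nsq (a - c) - 2 * (a \<bullet> (a - c))) + 2 * ((indicator A x *\<^sub>R f x) \<bullet> (a - c)) \<partial>M)"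
  proof -
    have "(\<integral>x. indicator A x *\<^sub>R f x \<partial>M) = measure M A *\<^sub>R a" using pos by (simp add: a_def)
    moreover have "(\<integral>x. indicator A x * (nsq (a - c) - 2 * (a \<bullet> (a - c))) + 2 * ((indicator A x *\<^sub>R f x) \<bullet> (a - c)) \<partial>M)
      = measure M A * (nsq (a - c) - 2 * (a \<bullet> (a - c))) + 2 * ((\<integral>x. indicator A x *\<^sub>R f x \<partial>M) \<bullet> (a - c))"
      using iA i1 by (simp del: inner_scaleR_left)
    ultimately show ?thesis by (simp add: algebra_simps)
  qed
  also have "\<dots> \<le> (\<integral>x. indicator A x * nsq (f x - c) \<partial>M)"
  proof (rule integral_mono[OF ie i2])
    fix x
    have "0 \<le> nsq (f x - a)" by simp
    also have "nsq (f x - a) = nsq (f x - c) - nsq (a - c) + 2 * (a \<bullet> (a - c)) - 2 * (f x \<bullet> (a - c))"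
      by (simp add: power2_norm_eq_inner algebra_simps inner_commute)
    finally show "indicator A x * (nsq (a - c) - 2 * (a \<bullet> (a - c))) + 2 * ((indicator A x *\<^sub>R f x) \<bullet> (a - c))
      \<le> indicator A x * nsq (f x - c)" by (cases "x \<in> A") auto
  qed
  finally show "measure M A * nsq (a - c) \<le> (\<integral>x. indicator A x * nsq (f x - c) \<partial>M)" .
qed

section \<open>Explicit smooth functions\<close>

lemma partial_deriv_eq:
  assumes "(f has_derivative f') (at x)"
  shows "partial_deriv i f x = f' (axis i 1)" using frechet_derivative_at[OF assms] by (simp add: partial_deriv_def)

text \<open>An algebra closed under partial derivatives, so that all \<open>Ck k\<close> follow by
  one induction. In \<open>atom\<close> the function \<open>F n\<close> is the n-th derivative of a
  function of one coordinate; supplying the whole sequence avoids iterated differentiation.\<close>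

inductive smooth_alg :: "(real^'n \<Rightarrow> real) \<Rightarrow> bool" where
  atom: "(\<And>n t. (F n has_real_derivative F (Suc n) t) (at t)) \<Longrightarrow> smooth_alg (\<lambda>x. F (0::nat) (x $ i))"
| const: "smooth_alg (\<lambda>x. c)"
| add: "smooth_alg f \<Longrightarrow> smooth_alg g \<Longrightarrow> smooth_alg (\<lambda>x. f x + g x)"
| mult: "smooth_alg f \<Longrightarrow> smooth_alg g \<Longrightarrow> smooth_alg (\<lambda>x. f x * g x)"

lemma has_derivative_component:
  assumes "(g has_real_derivative d) (at (x $ i))"
  shows "((\<lambda>x::real^'n. g (x $ i)) has_derivative (\<lambda>h. d * h $ i)) (at x)"
proof -
  have "((\<lambda>x::real^'n. x $ i) has_derivative (\<lambda>h. h $ i)) (at x)"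
    by (rule bounded_linear.has_derivative[OF bounded_linear_vec_nth]) (rule has_derivative_ident)
  moreover have "(g has_derivative (*) d) (at (x $ i))" using assms by (simp add: has_field_derivative_def)
  ultimately show ?thesis using has_derivative_compose by blast
qed

lemma smooth_alg_deriv:
  fixes f :: "real^'n \<Rightarrow> real"
  assumes "smooth_alg f"
  shows "(\<forall>x. f differentiable (at x)) \<and> (\<forall>i. smooth_alg (partial_deriv i f))" using assms
proof induction
  case (atom F j)
  have d: "((\<lambda>x::real^'n. F 0 (x $ j)) has_derivative (\<lambda>h. F 1 (x $ j) * h $ j)) (at x)" for x
    using atom[of 0 "x $ j"] by (intro has_derivative_component) simp
  have "smooth_alg (partial_deriv i (\<lambda>x::real^'n. F 0 (x $ j)))" for i
  proof -
    have eq: "partial_deriv i (\<lambda>x::real^'n. F 0 (x $ j)) = (\<lambda>x. F 1 (x $ j) * axis i 1 $ j)"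
      by (rule ext, rule partial_deriv_eq) (rule d)
    have "smooth_alg (\<lambda>x. (\<lambda>n. F (Suc n)) 0 (x $ j))" by (rule smooth_alg.atom) (rule atom)
    then show ?thesis unfolding eq by (intro smooth_alg.mult smooth_alg.const) simp
  qed
  then show ?case using d by (auto simp: differentiable_def)
next
  case (const c)
  have eq: "partial_deriv i (\<lambda>x::real^'n. c) = (\<lambda>x. 0)" for i
    by (rule ext, rule partial_deriv_eq[of _ "\<lambda>_. 0", simplified]) simp
  show ?case unfolding eq by (auto intro: smooth_alg.const)
next
  case (add f g)
  have eq: "partial_deriv i (\<lambda>x. f x + g x) = (\<lambda>x. partial_deriv i f x + partial_deriv i g x)" for i
  proof
    fix x
    have "((\<lambda>x. f x + g x) has_derivative (\<lambda>h. frechet_derivative f (at x) h + frechet_derivative g (at x) h)) (at x)"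
      using add.IH by (intro has_derivative_add) (auto simp: frechet_derivative_works[symmetric])
    from partial_deriv_eq[OF this] show "partial_deriv i (\<lambda>x. f x + g x) x = partial_deriv i f x + partial_deriv i g x"
      by (simp add: partial_deriv_def)
  qed
  show ?case using add.IH by (auto simp: eq intro: smooth_alg.add)
next
  case (mult f g)
  have eq: "partial_deriv i (\<lambda>x. f x * g x) = (\<lambda>x. f x * partial_deriv i g x + partial_deriv i f x * g x)" for i
  proof
    fix x
    have "((\<lambda>x. f x * g x) has_derivative (\<lambda>h. f x * frechet_derivative g (at x) h + frechet_derivative f (at x) h * g x)) (at x)"
      using mult.IH by (intro has_derivative_mult) (auto simp: frechet_derivative_works[symmetric])
    from partial_deriv_eq[OF this] show "partial_deriv i (\<lambda>x. f x * g x) x = f x * partial_deriv i g x + partial_deriv i f x * g x"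
      by (simp add: partial_deriv_def)
  qed
  show ?case unfolding eq using mult by (intro conjI allI smooth_alg.add smooth_alg.mult) auto
qed

lemma smooth_alg_Ck: "smooth_alg f \<Longrightarrow> Ck k f"
proof (induction k arbitrary: f)
  case 0
  then show ?case using smooth_alg_deriv[OF 0] by (auto intro!: continuous_at_imp_continuous_on differentiable_imp_continuous_within)
next
  case (Suc k)
  then show ?case using smooth_alg_deriv[OF Suc.prems] by (auto simp: differentiable_on_def intro: differentiable_at_withinI)
qed

lemma smooth_alg_prod:
  assumes "finite A" "\<And>i. i \<in> A \<Longrightarrow> smooth_alg (f i)"
  shows "smooth_alg (\<lambda>x. \<Prod>i\<in>A. f i x)" using assms by (induction rule: finite_induct) (auto intro: smooth_alg.const smooth_alg.mult)

subsection \<open>A flat function\<close>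

text \<open>The derivative of \<open>p (1/t) exp (-1/t)\<close> is
  \<open>(1/t)^2 (p - p') (1/t) exp (-1/t)\<close>, which is the recursion.\<close>

fun flat_poly :: "nat \<Rightarrow> real poly" where
  "flat_poly 0 = 1"
| "flat_poly (Suc n) = [:0, 0, 1:] * (flat_poly n - pderiv (flat_poly n))"

definition flat :: "nat \<Rightarrow> real \<Rightarrow> real" where
  "flat n t = (if t > 0 then poly (flat_poly n) (1 / t) * exp (- 1 / t) else 0)"

lemma tendsto_poly_exp_neg: "((\<lambda>s::real. poly p s * exp (- s)) \<longlongrightarrow> 0) at_top"
proof -
  have "((\<lambda>s::real. \<Sum>i\<le>degree p. coeff p i * (s ^ i / exp s)) \<longlongrightarrow> (\<Sum>i\<le>degree p. coeff p i * 0)) at_top"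
    by (intro tendsto_intros tendsto_power_div_exp_0)
  then show ?thesis by (simp add: poly_altdef exp_minus divide_inverse sum_distrib_right mult.assoc)
qed

lemma flat_has_derivative: "(flat n has_real_derivative flat (Suc n) t) (at t)"
proof -
  consider "t > 0" | "t < 0" | "t = 0" by linarith
  then show ?thesis
  proof cases
    case 1
    have "((\<lambda>t. poly (flat_poly n) (1 / t) * exp (- 1 / t)) has_real_derivative
        poly (pderiv (flat_poly n)) (1 / t) * (- 1 / t^2) * exp (- 1 / t)
          + poly (flat_poly n) (1 / t) * (exp (- 1 / t) * (1 / t^2))) (at t)"
      using 1 by (auto intro!: derivative_eq_intros DERIV_chain2[OF poly_DERIV] simp: power2_eq_square field_simps)
    also have "poly (pderiv (flat_poly n)) (1 / t) * (- 1 / t^2) * exp (- 1 / t)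
          + poly (flat_poly n) (1 / t) * (exp (- 1 / t) * (1 / t^2)) = flat (Suc n) t" using 1 by (simp add: flat_def power2_eq_square field_simps)
    finally show ?thesis by (rule has_field_derivative_transform_within_open[of _ _ _ "{0<..}"]) (use 1 in \<open>auto simp: flat_def\<close>)
  next
    case 2
    have "((\<lambda>_. 0) has_real_derivative 0) (at t)" by simp
    then have "(flat n has_real_derivative 0) (at t)"
      by (rule has_field_derivative_transform_within_open[of _ _ _ "{..<0}"]) (use 2 in \<open>auto simp: flat_def\<close>)
    then show ?thesis using 2 by (simp add: flat_def)
  next
    case 3
    \<comment> \<open>With \<open>s = 1/h\<close> the difference quotient at \<open>0\<close> is
      \<open>s\<close> times a polynomial in \<open>s\<close> times \<open>exp (- s)\<close>, and
      \<open>s\<close> tends to infinity.\<close>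
    have r: "((\<lambda>h. flat n h / h) \<longlongrightarrow> 0) (at_right 0)"
    proof -
      have "((\<lambda>h. poly (monom 1 1 * flat_poly n) (inverse h) * exp (- inverse h)) \<longlongrightarrow> 0) (at_right 0)"
        by (rule filterlim_compose[OF tendsto_poly_exp_neg filterlim_inverse_at_top_right])
      moreover have "\<forall>\<^sub>F h in at_right 0. poly (monom 1 1 * flat_poly n) (inverse h) * exp (- inverse h) = flat n h / h"
        using eventually_at_right_less[of "0::real"] by eventually_elim (simp add: flat_def poly_monom divide_inverse)
      ultimately show ?thesis by (rule Lim_transform_eventually)
    qed
    have l: "((\<lambda>h. flat n h / h) \<longlongrightarrow> 0) (at_left 0)"
    proof (rule Lim_transform_eventually[OF tendsto_const])
      have "\<forall>\<^sub>F h::real in at_left 0. h < 0" by (simp add: eventually_at_filter)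
      then show "\<forall>\<^sub>F h in at_left 0. 0 = flat n h / h" by eventually_elim (simp add: flat_def)
    qed
    have "((\<lambda>h. (flat n (0 + h) - flat n 0) / h) \<longlongrightarrow> 0) (at 0)" using r l by (simp add: filterlim_at_split flat_def[of n 0])
    then have "(flat n has_real_derivative 0) (at 0)" by (simp add: has_field_derivative_iff)
    then show ?thesis using 3 by (simp add: flat_def)
  qed
qed

lemma flat_affine_deriv:
  "((\<lambda>t. a ^ n * flat n (a * t + c)) has_real_derivative (a ^ Suc n * flat (Suc n) (a * t + c))) (at t)"
proof -
  have "((\<lambda>t. flat n (a * t + c)) has_real_derivative flat (Suc n) (a * t + c) * a) (at t)"
    by (rule DERIV_chain2[OF flat_has_derivative]) (auto intro!: derivative_eq_intros)
  from DERIV_cmult[OF this, of "a ^ n"] show ?thesis by (simp add: ac_simps)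
qed

lemma smooth_alg_flat: "smooth_alg (\<lambda>x. flat 0 (a * x $ i + c))"
  using smooth_alg.atom[where F = "\<lambda>n t. a ^ n * flat n (a * t + c)", OF flat_affine_deriv] by simp

lemma flat0: "flat 0 t = (if t > 0 then exp (- 1 / t) else 0)" by (simp add: flat_def)

lemma flat0_eq_0_iff: "flat 0 t = 0 \<longleftrightarrow> t \<le> 0" by (simp add: flat0 not_less)

lemma flat0_bounds: "0 \<le> flat 0 t" "flat 0 t \<le> 1" by (auto simp: flat0)

subsection \<open>Test functions\<close>

lemma Ck_add: "Ck k f \<Longrightarrow> Ck k g \<Longrightarrow> Ck k (\<lambda>x. f x + g x)"
proof (induction k arbitrary: f g)
  case (Suc k)
  then have df: "f differentiable (at x)" "g differentiable (at x)" for x by (auto simp: differentiable_on_def)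
  have eq: "partial_deriv i (\<lambda>x. f x + g x) = (\<lambda>x. partial_deriv i f x + partial_deriv i g x)" for i
  proof
    fix x
    have "((\<lambda>x. f x + g x) has_derivative (\<lambda>h. frechet_derivative f (at x) h + frechet_derivative g (at x) h)) (at x)"
      using df by (intro has_derivative_add) (auto simp: frechet_derivative_works[symmetric])
    from partial_deriv_eq[OF this] show "partial_deriv i (\<lambda>x. f x + g x) x = partial_deriv i f x + partial_deriv i g x"
      by (simp add: partial_deriv_def)
  qed
  show ?case using Suc by (auto simp: eq intro: differentiable_on_add)
qed (auto intro: continuous_intros)

lemma Ck_cmult: "Ck k f \<Longrightarrow> Ck k (\<lambda>x. c * f x)"
proof (induction k arbitrary: f)
  case (Suc k)
  then have df: "f differentiable (at x)" for x by (auto simp: differentiable_on_def)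
  have eq: "partial_deriv i (\<lambda>x. c * f x) = (\<lambda>x. c * partial_deriv i f x)" for i
  proof
    fix x
    have "((\<lambda>x. c * f x) has_derivative (\<lambda>h. c * frechet_derivative f (at x) h)) (at x)"
      using df by (intro has_derivative_mult_right) (auto simp: frechet_derivative_works[symmetric])
    from partial_deriv_eq[OF this] show "partial_deriv i (\<lambda>x. c * f x) x = c * partial_deriv i f x" by (simp add: partial_deriv_def)
  qed
  show ?case using Suc by (auto simp: eq intro: differentiable_on_mult differentiable_on_const)
qed (auto intro: continuous_intros)

lemma partial_deriv_translate:
  assumes "\<And>x. f differentiable (at x)"
  shows "partial_deriv i (\<lambda>x. f (x + a)) = (\<lambda>x. partial_deriv i f (x + a))"
proof
  fix x
  have "(f has_derivative frechet_derivative f (at (x + a))) (at (x + a))" using assms by (simp add: frechet_derivative_works[symmetric])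
  then have "((\<lambda>x. f (x + a)) has_derivative frechet_derivative f (at (x + a))) (at x)"
    by (rule has_derivative_compose[rotated]) (auto intro!: derivative_eq_intros)
  from partial_deriv_eq[OF this] show "partial_deriv i (\<lambda>x. f (x + a)) x = partial_deriv i f (x + a)" by (simp add: partial_deriv_def)
qed

lemma Ck_translate: "Ck k f \<Longrightarrow> Ck k (\<lambda>x. f (x + a))"
proof (induction k arbitrary: f)
  case 0
  have "continuous_on UNIV (f \<circ> (\<lambda>x. x + a))"
    using 0 by (intro continuous_on_compose) (auto intro!: continuous_intros intro: continuous_on_subset)
  then show ?case by (simp add: o_def)
next
  case (Suc k)
  then have df: "f differentiable (at x)" for x by (auto simp: differentiable_on_def)
  have "(\<lambda>x. f (x + a)) differentiable (at x)" for x using differentiable_compose[of f "\<lambda>x. x + a" x] df by auto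
  then show ?case using Suc by (auto simp: partial_deriv_translate[OF df] differentiable_on_def)
qed

lemma test_functionD:
  assumes "test_function \<psi>"
  shows "\<psi> differentiable (at x)" "continuous_on UNIV \<psi>" "borel_fun \<psi>"
    "(\<psi> has_derivative (\<lambda>h. \<Sum>i\<in>UNIV. h $ i * partial_deriv i \<psi> x)) (at x)"
proof -
  show d: "\<psi> differentiable (at x)" for x using assms unfolding test_function_def by (metis Ck.simps(2) differentiable_on_def UNIV_I)
  show c: "continuous_on UNIV \<psi>" using assms unfolding test_function_def by (metis Ck.simps(1))
  then show "borel_fun \<psi>" by (rule borel_measurable_continuous_onI)
  let ?D = "frechet_derivative \<psi> (at x)"
  have D: "(\<psi> has_derivative ?D) (at x)" using d by (simp add: frechet_derivative_works[symmetric])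
  then have lin: "linear ?D" by (simp add: has_derivative_linear)
  have "?D h = (\<Sum>i\<in>UNIV. h $ i * partial_deriv i \<psi> x)" for h
  proof -
    have "?D h = ?D (\<Sum>i\<in>UNIV. h $ i *\<^sub>R axis i 1)" by (metis (no_types) basis_expansion scalar_mult_eq_scaleR)
    then show ?thesis by (simp add: linear_sum[OF lin] linear_cmul[OF lin] partial_deriv_def)
  qed
  then show "(\<psi> has_derivative (\<lambda>h. \<Sum>i\<in>UNIV. h $ i * partial_deriv i \<psi> x)) (at x)"
    using D by (metis (no_types, lifting) ext)
qed

lemma compact_support_subset:
  assumes "compact (closure A)" "B \<subseteq> closure A"
  shows "compact (closure B)"
proof -
  have "closure A \<inter> closure B = closure B" using closure_minimal[OF assms(2)] by auto
  then show ?thesis using compact_Int_closed[OF assms(1), of "closure B"] by simp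
qed

lemma test_function_partial_deriv:
  assumes "test_function \<psi>"
  shows "test_function (partial_deriv i \<psi>)" unfolding test_function_def
proof
  show "\<forall>k. Ck k (partial_deriv i \<psi>)" using assms unfolding test_function_def by (metis Ck.simps(2))
  have "{x. partial_deriv i \<psi> x \<noteq> 0} \<subseteq> closure {x. \<psi> x \<noteq> 0}"
  proof (rule subsetI, rule ccontr)
    fix x assume x: "x \<in> {x. partial_deriv i \<psi> x \<noteq> 0}" "x \<notin> closure {x. \<psi> x \<noteq> 0}"
    have "((\<lambda>_. 0) has_derivative (\<lambda>_. 0)) (at x)" by simp
    then have "(\<psi> has_derivative (\<lambda>_. 0)) (at x)"
      by (rule has_derivative_transform_within_open[of _ _ _ _ "- closure {x. \<psi> x \<noteq> 0}"])
         (use x closure_subset[of "{x. \<psi> x \<noteq> 0}"] in auto)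
    from partial_deriv_eq[OF this] x(1) show False by simp
  qed
  then show "compact (closure {x. partial_deriv i \<psi> x \<noteq> 0})"
    using assms unfolding test_function_def by (blast intro: compact_support_subset)
qed

lemma test_function_add:
  assumes "test_function f" "test_function g"
  shows "test_function (\<lambda>x. f x + g x)" unfolding test_function_def
proof
  show "\<forall>k. Ck k (\<lambda>x. f x + g x)" using assms by (auto simp: test_function_def intro: Ck_add)
  have "compact (closure ({x. f x \<noteq> 0} \<union> {x. g x \<noteq> 0}))" using assms by (auto simp: test_function_def closure_Un compact_Un)
  then show "compact (closure {x. f x + g x \<noteq> 0})" by (rule compact_support_subset) (rule order_trans[OF _ closure_subset], auto)
qed

lemma test_function_cmult:
  assumes "test_function f"
  shows "test_function (\<lambda>x. c * f x)" unfolding test_function_def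
proof
  show "\<forall>k. Ck k (\<lambda>x. c * f x)" using assms by (auto simp: test_function_def intro: Ck_cmult)
  have "compact (closure {x. f x \<noteq> 0})" using assms by (auto simp: test_function_def)
  then show "compact (closure {x. c * f x \<noteq> 0})" by (rule compact_support_subset) (rule order_trans[OF _ closure_subset], auto)
qed

lemma test_function_zero: "test_function (\<lambda>x. 0)" unfolding test_function_def by (auto intro: smooth_alg_Ck smooth_alg.const)

lemma sum_axis: "(\<Sum>i\<in>UNIV. axis k 1 $ i * g i) = (g k :: real)"
  by (simp add: axis_def if_distrib[where f = "\<lambda>t. t * _"] cong: if_cong)

lemma partial_deriv_add:
  assumes "test_function f" "test_function g"
  shows "partial_deriv i (\<lambda>x. f x + g x) x = partial_deriv i f x + partial_deriv i g x"
  using partial_deriv_eq[OF has_derivative_add[OF test_functionD(4)[OF assms(1)] test_functionD(4)[OF assms(2)]]] by (simp add: sum_axis)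

lemma partial_deriv_cmult:
  assumes "test_function f"
  shows "partial_deriv i (\<lambda>x. c * f x) x = c * partial_deriv i f x"
  using partial_deriv_eq[OF has_derivative_mult_right[OF test_functionD(4)[OF assms]]] by (simp add: sum_axis)

lemma test_function_translate:
  assumes "test_function f"
  shows "test_function (\<lambda>x. f (x + a))" unfolding test_function_def
proof
  show "\<forall>k. Ck k (\<lambda>x. f (x + a))" using assms by (auto simp: test_function_def intro: Ck_translate)
  have "compact ((\<lambda>x. -a + x) ` closure {x. f x \<noteq> 0})" using assms by (intro compact_translation) (auto simp: test_function_def)
  then have c: "compact (closure ((\<lambda>x. -a + x) ` {x. f x \<noteq> 0}))" by (simp only: closure_translation)
  have "{x. f (x + a) \<noteq> 0} \<subseteq> (\<lambda>x. -a + x) ` {x. f x \<noteq> 0}"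
  proof
    fix x assume "x \<in> {x. f (x + a) \<noteq> 0}"
    then show "x \<in> (\<lambda>x. -a + x) ` {x. f x \<noteq> 0}" by (intro image_eqI[where x = "x + a"]) auto
  qed
  then show "compact (closure {x. f (x + a) \<noteq> 0})" by (intro compact_support_subset[OF c] order_trans[OF _ closure_subset])
qed

lemma test_function_bounds:
  assumes "test_function f"
  obtains C R where "C \<ge> 0" "R \<ge> 0" "\<And>x. \<bar>f x\<bar> \<le> C" "\<And>x. norm x > R \<Longrightarrow> f x = 0"
proof -
  let ?K = "closure {x. f x \<noteq> 0}"
  have K: "compact ?K" using assms by (simp add: test_function_def)
  then have "compact (f ` ?K)" using test_functionD(2)[OF assms] by (intro compact_continuous_image) (auto intro: continuous_on_subset)
  then obtain C where C: "C > 0" "\<And>x. x \<in> ?K \<Longrightarrow> \<bar>f x\<bar> \<le> C"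
    by (metis bounded_pos compact_imp_bounded image_eqI real_norm_def)
  obtain R where R: "R > 0" "\<And>x. x \<in> ?K \<Longrightarrow> norm x \<le> R" using K by (metis bounded_pos compact_imp_bounded)
  show ?thesis
  proof (rule that[of C R])
    show "\<bar>f x\<bar> \<le> C" for x using C closure_subset[of "{x. f x \<noteq> 0}"] by (cases "f x = 0") auto
    show "f x = 0" if "norm x > R" for x using R(2)[of x] that closure_subset[of "{x. f x \<noteq> 0}"] by force
  qed (use C R in auto)
qed

lemma test_function_MVT:
  assumes "test_function f"
  shows "\<exists>s. 0 < s \<and> s < 1 \<and> f (x + h) - f x = (\<Sum>i\<in>UNIV. h $ i * partial_deriv i f (x + s *\<^sub>R h))"
proof -
  have d: "((\<lambda>s. f (x + s *\<^sub>R h)) has_real_derivative (\<Sum>i\<in>UNIV. h $ i * partial_deriv i f (x + s *\<^sub>R h))) (at s)" for s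
  proof -
    have "((\<lambda>s. x + s *\<^sub>R h) has_derivative (\<lambda>t. t *\<^sub>R h)) (at s)" by (auto intro!: derivative_eq_intros)
    from has_derivative_compose[OF this test_functionD(4)[OF assms]]
    have "((\<lambda>s. f (x + s *\<^sub>R h)) has_derivative (\<lambda>t. \<Sum>i\<in>UNIV. (t *\<^sub>R h) $ i * partial_deriv i f (x + s *\<^sub>R h))) (at s)" .
    moreover have "(\<lambda>t. \<Sum>i\<in>UNIV. (t *\<^sub>R h) $ i * partial_deriv i f (x + s *\<^sub>R h)) = (*) (\<Sum>i\<in>UNIV. h $ i * partial_deriv i f (x + s *\<^sub>R h))"
      by (rule ext) (simp add: sum_distrib_left sum_distrib_right ac_simps)
    ultimately show ?thesis by (simp add: has_field_derivative_def)
  qed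
  from MVT2[of 0 1 "\<lambda>s. f (x + s *\<^sub>R h)", OF _ d] show ?thesis by auto
qed

lemma test_function_Lipschitz:
  assumes "test_function f"
  obtains L where "L \<ge> 0" "\<And>x h. \<bar>f (x + h) - f x\<bar> \<le> L * norm h"
proof -
  have "\<exists>C. \<forall>x. \<bar>partial_deriv i f x\<bar> \<le> C" for i
    using test_function_bounds[OF test_function_partial_deriv[OF assms]] by metis
  then obtain C where C: "\<And>i x. \<bar>partial_deriv i f x\<bar> \<le> C i" by metis
  then have C0: "C i \<ge> 0" for i by (meson abs_ge_zero order_trans)
  show ?thesis
  proof (rule that[of "\<Sum>i\<in>UNIV. C i"])
    show "sum C UNIV \<ge> 0" using C0 by (rule sum_nonneg)
    fix x h
    obtain s where "f (x + h) - f x = (\<Sum>i\<in>UNIV. h $ i * partial_deriv i f (x + s *\<^sub>R h))" using test_function_MVT[OF assms] by blast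
    also have "\<bar>\<dots>\<bar> \<le> (\<Sum>i\<in>UNIV. \<bar>h $ i * partial_deriv i f (x + s *\<^sub>R h)\<bar>)" by (rule sum_abs)
    also have "\<dots> \<le> (\<Sum>i\<in>UNIV. norm h * C i)" unfolding abs_mult by (intro sum_mono mult_mono C component_le_norm_cart) auto
    finally show "\<bar>f (x + h) - f x\<bar> \<le> sum C UNIV * norm h" by (simp add: sum_distrib_left mult.commute)
  qed
qed

text \<open>The indicator in the remainder lets the expansion be integrated against functions that
  are merely integrable on balls.\<close>

lemma test_function_Taylor:
  assumes "test_function f"
  obtains C R where "C \<ge> 0" "R \<ge> 0"
    "\<And>x h. norm h \<le> 1 \<Longrightarrow> \<bar>f (x + h) - f x - (\<Sum>i\<in>UNIV. h $ i * partial_deriv i f x)\<bar>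
      \<le> C * nsq h * indicator (cball 0 R) x"
proof -
  have "\<exists>L\<ge>0. \<forall>x h. \<bar>partial_deriv i f (x + h) - partial_deriv i f x\<bar> \<le> L * norm h" for i
    using test_function_Lipschitz[OF test_function_partial_deriv[OF assms]] by metis
  then obtain L where L: "\<And>i. L i \<ge> 0" "\<And>i x h. \<bar>partial_deriv i f (x + h) - partial_deriv i f x\<bar> \<le> L i * norm h" by metis
  obtain R where R: "R \<ge> 0" "\<And>x. norm x > R \<Longrightarrow> f x = 0" using test_function_bounds[OF assms] by metis
  have "\<exists>R. \<forall>x. norm x > R \<longrightarrow> partial_deriv i f x = 0" for i
    using test_function_bounds[OF test_function_partial_deriv[OF assms]] by metis
  then obtain S where S: "\<And>i x. norm x > S i \<Longrightarrow> partial_deriv i f x = 0" by metis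
  \<comment> \<open>The \<open>1\<close> keeps \<open>x + h\<close> outside the support of
    \<open>f\<close> when \<open>norm x > R'\<close> and \<open>norm h <= 1\<close>; the sum
    dominates every \<open>S i\<close>.\<close>
  define R' where "R' = R + 1 + (\<Sum>i\<in>UNIV. \<bar>S i\<bar>)"
  have SR: "S i \<le> R'" for i
  proof -
    have "\<bar>S i\<bar> \<le> (\<Sum>i\<in>UNIV. \<bar>S i\<bar>)" by (rule member_le_sum) auto
    then show ?thesis using R(1) by (simp add: R'_def)
  qed
  show ?thesis
  proof (rule that[of "\<Sum>i\<in>UNIV. L i" R'])
    show "sum L UNIV \<ge> 0" using L by (intro sum_nonneg) auto
    show "R' \<ge> 0" unfolding R'_def using R(1) by (simp add: sum_nonneg add_nonneg_nonneg)
    fix x h :: "real^'a" assume h: "norm h \<le> 1"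
    show "\<bar>f (x + h) - f x - (\<Sum>i\<in>UNIV. h $ i * partial_deriv i f x)\<bar> \<le> sum L UNIV * nsq h * indicator (cball 0 R') x"
    proof (cases "norm x \<le> R'")
      case True
      obtain s where s: "0 < s" "s < 1" "f (x + h) - f x = (\<Sum>i\<in>UNIV. h $ i * partial_deriv i f (x + s *\<^sub>R h))"
        using test_function_MVT[OF assms] by blast
      then have "\<bar>f (x + h) - f x - (\<Sum>i\<in>UNIV. h $ i * partial_deriv i f x)\<bar>
          = \<bar>\<Sum>i\<in>UNIV. h $ i * (partial_deriv i f (x + s *\<^sub>R h) - partial_deriv i f x)\<bar>"
        by (simp add: right_diff_distrib sum_subtractf)
      also have "\<dots> \<le> (\<Sum>i\<in>UNIV. \<bar>h $ i * (partial_deriv i f (x + s *\<^sub>R h) - partial_deriv i f x)\<bar>)" by (rule sum_abs)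
      also have "\<dots> \<le> (\<Sum>i\<in>UNIV. norm h * (L i * norm h))"
      proof (rule sum_mono)
        fix i
        have "\<bar>partial_deriv i f (x + s *\<^sub>R h) - partial_deriv i f x\<bar> \<le> L i * norm (s *\<^sub>R h)" by (rule L)
        also have "\<dots> \<le> L i * norm h" using s L(1)[of i] by (intro mult_left_mono) (auto intro: mult_left_le_one_le)
        finally show "\<bar>h $ i * (partial_deriv i f (x + s *\<^sub>R h) - partial_deriv i f x)\<bar> \<le> norm h * (L i * norm h)"
          unfolding abs_mult by (intro mult_mono component_le_norm_cart) auto
      qed
      also have "\<dots> = sum L UNIV * nsq h" unfolding power2_eq_square sum_distrib_right by (simp add: ac_simps)
      finally show ?thesis using True by simp
    next
      case False
      have "norm (x + h) \<ge> norm x - norm h" by (metis add_diff_cancel norm_triangle_ineq2 norm_minus_commute add.commute diff_diff_eq2)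
      then have "norm (x + h) > R" "norm x > R"
        using False h R(1) sum_nonneg[of UNIV "\<lambda>i. \<bar>S i\<bar>", OF abs_ge_zero] unfolding R'_def by linarith+
      moreover have "partial_deriv i f x = 0" for i using S[of i x] SR[of i] False by force
      ultimately show ?thesis using R False by simp
    qed
  qed
qed

text \<open>As \<open>flat 0 s\<close> tends to \<open>1\<close> for large \<open>s\<close>, the
  factors \<open>flat 0\<close> of \<open>Suc n\<close> times the distances to the faces tend to
  \<open>1\<close> inside the box, while one of them vanishes at every point outside.\<close>

lemma box_approximation:
  fixes a b :: "real^'n"
  obtains \<psi> :: "nat \<Rightarrow> real^'n \<Rightarrow> real" where "\<And>n. test_function (\<psi> n)"
    "\<And>n x. \<bar>\<psi> n x\<bar> \<le> indicator (cbox a b) x" "\<And>x. (\<lambda>n. \<psi> n x) \<longlonglongrightarrow> indicator (box a b) x"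
proof -
  define \<psi> :: "nat \<Rightarrow> real^'n \<Rightarrow> real" where
    "\<psi> n x = (\<Prod>i\<in>UNIV. flat 0 (Suc n * x $ i + - Suc n * a $ i) * flat 0 (- Suc n * x $ i + Suc n * b $ i))" for n x
  have zero: "\<psi> n x = 0" if "x \<notin> box a b" for n x
  proof -
    have "\<not> (\<forall>i. a $ i < x $ i \<and> x $ i < b $ i)" using that unfolding mem_box_cart(1) .
    then obtain i where "\<not> (a $ i < x $ i \<and> x $ i < b $ i)" by blast
    then have "Suc n * (x $ i - a $ i) \<le> 0 \<or> Suc n * (b $ i - x $ i) \<le> 0"
      by (meson mult_nonneg_nonpos diff_le_0_iff_le not_le of_nat_0_le_iff)
    then have "flat 0 (Suc n * x $ i + - Suc n * a $ i) * flat 0 (- Suc n * x $ i + Suc n * b $ i) = 0" by (auto simp: flat0 algebra_simps)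
    then show ?thesis unfolding \<psi>_def by (intro prod_zero) auto
  qed
  have nonneg: "0 \<le> \<psi> n x" and le1: "\<psi> n x \<le> 1" for n x
    unfolding \<psi>_def using flat0_bounds by (auto intro!: prod_nonneg prod_le_1 mult_le_one)
  show ?thesis
  proof (rule that[of \<psi>])
    fix n
    show "test_function (\<psi> n)" unfolding test_function_def
    proof
      have "smooth_alg (\<psi> n)" unfolding \<psi>_def by (intro smooth_alg_prod smooth_alg.mult smooth_alg_flat finite)
      then show "\<forall>k. Ck k (\<psi> n)" by (auto intro: smooth_alg_Ck)
      have "compact (closure (cbox a b))" by (simp add: compact_cbox)
      moreover have "{x. \<psi> n x \<noteq> 0} \<subseteq> closure (cbox a b)" using zero box_subset_cbox[of a b] by auto
      ultimately show "compact (closure {x. \<psi> n x \<noteq> 0})" by (rule compact_support_subset)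
    qed
    fix x
    show "\<bar>\<psi> n x\<bar> \<le> indicator (cbox a b) x"
      using zero[of x n] nonneg[of n x] le1[of n x] box_subset_cbox[of a b] by (auto simp: indicator_def)
  next
    fix x
    show "(\<lambda>n. \<psi> n x) \<longlonglongrightarrow> indicator (box a b) x"
    proof (cases "x \<in> box a b")
      case False
      then show ?thesis using zero[OF False] by simp
    next
      case True
      have lim: "(\<lambda>n. flat 0 (Suc n * d)) \<longlonglongrightarrow> 1" if "d > 0" for d :: real
      proof -
        have "(\<lambda>n. exp (- ((1 / d) * (1 / Suc n)))) \<longlonglongrightarrow> exp (- ((1 / d) * 0))"
          by (intro tendsto_intros lim_1_over_n[THEN LIMSEQ_Suc])
        moreover have "flat 0 (Suc n * d) = exp (- ((1 / d) * (1 / Suc n)))" for n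
        proof -
          have "real (Suc n) * d > 0" using that by (intro mult_pos_pos) auto
          then show ?thesis unfolding flat0 by (simp add: divide_simps)
        qed
        ultimately show ?thesis by simp
      qed
      have "(\<lambda>n. \<Prod>i\<in>UNIV. flat 0 (Suc n * (x $ i - a $ i)) * flat 0 (Suc n * (b $ i - x $ i))) \<longlonglongrightarrow> (\<Prod>i\<in>(UNIV::'n set). 1 * 1)"
        using True by (intro tendsto_prod tendsto_mult lim) (auto simp: mem_box_cart)
      moreover have "(\<Prod>i\<in>UNIV. flat 0 (Suc n * (x $ i - a $ i)) * flat 0 (Suc n * (b $ i - x $ i))) = \<psi> n x" for n
        unfolding \<psi>_def by (intro prod.cong refl) (simp add: algebra_simps)
      ultimately show ?thesis using True by simp
    qed
  qed
qed

section \<open>Functions determined by their integrals against test functions\<close>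

text \<open>On each \<open>B n\<close> the positive and negative parts of \<open>g\<close> are
  densities of two finite measures that agree on all open boxes, an intersection-stable generator;
  hence the densities agree. Since \<open>ennreal\<close> sends negative numbers to
  \<open>0\<close>, \<open>f1\<close> and \<open>f2\<close> are these two parts.\<close>

lemma AE_zero_if_box_integrals_zero:
  fixes g :: "'a::euclidean_space \<Rightarrow> real"
  assumes [measurable]: "borel_fun g"
    and int: "\<And>a b. set_integrable lborel (cbox a b) g"
    and zero: "\<And>a b. (LBINT x. indicator (box a b) x * g x) = 0"
  shows "AE x in lborel. g x = 0"
proof -
  define B where "B n = box (- (real n *\<^sub>R One)) (real n *\<^sub>R One :: 'a)" for n
  have AEn: "AE x in lborel. x \<in> B n \<longrightarrow> g x = 0" for n
  proof -
    define f1 where "f1 x = ennreal (indicator (B n) x * g x)" for x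
    define f2 where "f2 x = ennreal (indicator (B n) x * (- g x))" for x
    have [measurable]: "B n \<in> sets borel" by (simp add: B_def)
    have [measurable]: "borel_fun f1" "borel_fun f2" unfolding f1_def f2_def by measurable
    have ibox: "integrable lborel (\<lambda>x. indicator (box a b) x * g x)" for a b
    proof -
      have "set_integrable lborel (box a b) g" by (rule set_integrable_subset[OF int[of a b]]) (auto simp: box_subset_cbox)
      then show ?thesis by (simp add: set_integrable_def)
    qed
    have eq: "emeasure (density lborel f1) (box a b) = emeasure (density lborel f2) (box a b)" for a b
    proof -
      obtain c d where cd: "box a b \<inter> B n = box c d" unfolding B_def using box_Int_box by blast
      define y where "y x = indicator (box c d) x * g x" for x
      have y: "integrable lborel y" unfolding y_def by (rule ibox)
      have "(LBINT x. max 0 (y x)) - (LBINT x. max 0 (- y x)) = (LBINT x. max 0 (y x) - max 0 (- y x))"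
        using y by (intro Bochner_Integration.integral_diff[symmetric] integrable_max) auto
      also have "\<dots> = (LBINT x. y x)" by (rule Bochner_Integration.integral_cong) auto
      also have "\<dots> = 0" using zero[of c d] by (simp add: y_def)
      finally have "(LBINT x. max 0 (indicator (box c d) x * g x)) = (LBINT x. max 0 (- (indicator (box c d) x * g x)))" by (simp add: y_def)
      moreover have "(LBINT+ x. ennreal (max 0 (indicator (box c d) x * g x))) = ennreal (LBINT x. max 0 (indicator (box c d) x * g x))"
        using ibox[of c d] by (intro nn_integral_eq_integral) auto
      moreover have "(LBINT+ x. ennreal (max 0 (- (indicator (box c d) x * g x)))) = ennreal (LBINT x. max 0 (- (indicator (box c d) x * g x)))"
        using ibox[of c d] by (intro nn_integral_eq_integral) auto
      ultimately have 1: "(LBINT+ x. ennreal (max 0 (indicator (box c d) x * g x))) = (LBINT+ x. ennreal (max 0 (- (indicator (box c d) x * g x))))"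
        by simp
      have 2: "indicator (box c d) x = (indicator (box a b) x * indicator (B n) x :: real)" for x by (simp add: cd[symmetric] indicator_inter_arith)
      have "f1 x * indicator (box a b) x = ennreal (max 0 (indicator (box c d) x * g x))"
        "f2 x * indicator (box a b) x = ennreal (max 0 (- (indicator (box c d) x * g x)))" for x
        unfolding f1_def f2_def 2 by (auto simp: indicator_def max_def ennreal_neg)
      then show ?thesis using 1 by (simp add: emeasure_density)
    qed
    have eqm: "density lborel f1 = density lborel f2"
    proof (rule measure_eqI_generator_eq)
      let ?E = "range (\<lambda>(a, b). box a b::'a set)"
      show "Int_stable ?E" by (auto simp: Int_stable_def box_Int_box)
      show "?E \<subseteq> Pow UNIV" "sets (density lborel f1) = sigma_sets UNIV ?E" "sets (density lborel f2) = sigma_sets UNIV ?E"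
        by (simp_all add: borel_eq_box)
      let ?A = "\<lambda>n::nat. box (- (real n *\<^sub>R One)) (real n *\<^sub>R One) :: 'a set"
      show "range ?A \<subseteq> ?E" "(\<Union>i. ?A i) = UNIV" unfolding UN_box_eq_UNIV by auto
      show "emeasure (density lborel f1) X = emeasure (density lborel f2) X" if "X \<in> ?E" for X using that eq by auto
      show "emeasure (density lborel f1) (?A i) \<noteq> \<infinity>" for i
      proof -
        have "emeasure (density lborel f1) (?A i) \<le> (LBINT+ x. ennreal (norm (indicator (B n) x * g x)))"
          by (subst emeasure_density) (auto simp: f1_def indicator_def intro!: nn_integral_mono ennreal_leI)
        also have "\<dots> < \<infinity>" using ibox[of "- (real n *\<^sub>R One)" "real n *\<^sub>R One"] by (simp add: integrable_iff_bounded B_def)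
        finally show ?thesis by auto
      qed
    qed
    have "AE x in lborel. f1 x = f2 x" by (rule sigma_finite_measure.density_unique[OF sigma_finite_lborel _ _ eqm]) auto
    then show ?thesis
    proof eventually_elim
      case (elim x)
      show ?case
      proof
        assume "x \<in> B n"
        then have "ennreal (g x) = ennreal (- g x)" using elim by (simp add: f1_def f2_def)
        then show "g x = 0" by (metis add.inverse_inverse ennreal_eq_0_iff ennreal_neg le_cases neg_le_0_iff_le order_antisym)
      qed
    qed
  qed
  have "AE x in lborel. \<forall>n. x \<in> B n \<longrightarrow> g x = 0" unfolding AE_all_countable using AEn by blast
  then show ?thesis
  proof eventually_elim
    case (elim x)
    have "x \<in> (\<Union>n. B n)" unfolding B_def UN_box_eq_UNIV by simp
    then show ?case using elim by auto
  qed
qed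

lemma AE_zero_if_test_integrals_zero:
  fixes g :: "real^'n \<Rightarrow> real"
  assumes m[measurable]: "borel_fun g"
    and int: "\<And>a b. set_integrable lborel (cbox a b) g"
    and zero: "\<And>\<psi>. test_function \<psi> \<Longrightarrow> (LBINT x. \<psi> x * g x) = 0"
  shows "AE x in lborel. g x = 0"
proof (rule AE_zero_if_box_integrals_zero[OF m int])
  fix a b :: "real^'n"
  obtain \<psi> where \<psi>: "\<And>n. test_function (\<psi> n)"
    "\<And>n x. \<bar>\<psi> n x\<bar> \<le> indicator (cbox a b) x" "\<And>x. (\<lambda>n. \<psi> n x) \<longlonglongrightarrow> indicator (box a b) x"
    using box_approximation by metis
  have [measurable]: "borel_fun (\<psi> n)" for n using test_functionD(3)[OF \<psi>(1)] .
  have "(\<lambda>n. LBINT x. \<psi> n x * g x) \<longlonglongrightarrow> (LBINT x. indicator (box a b) x * g x)"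
  proof (rule integral_dominated_convergence[where w = "\<lambda>x. norm (indicator (cbox a b) x *\<^sub>R g x)"])
    show "integrable lborel (\<lambda>x. norm (indicator (cbox a b) x *\<^sub>R g x))"
      using int[of a b] by (simp add: set_integrable_def del: real_scaleR_def)
    show "AE x in lborel. (\<lambda>n. \<psi> n x * g x) \<longlonglongrightarrow> indicator (box a b) x * g x" by (intro AE_I2 tendsto_intros \<psi>)
    show "AE x in lborel. norm (\<psi> n x * g x) \<le> norm (indicator (cbox a b) x *\<^sub>R g x)" for n
      using \<psi>(2) by (intro AE_I2) (auto simp: abs_mult intro!: mult_right_mono order_trans[OF \<psi>(2)])
  qed measurable
  then show "(LBINT x. indicator (box a b) x * g x) = 0" using zero[OF \<psi>(1)] by (simp add: LIMSEQ_const_iff)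
qed

section \<open>A test function with large Laplacian relative to its size\<close>

lemma partial_deriv_prod:
  fixes q q' :: "'n::finite \<Rightarrow> real \<Rightarrow> real"
  assumes "\<And>j t. (q j has_real_derivative q' j t) (at t)"
  shows "partial_deriv i (\<lambda>x::real^'n. \<Prod>j\<in>UNIV. q j (x $ j)) x = (\<Prod>j\<in>UNIV. (if j = i then q' j else q j) (x $ j))"
proof -
  have "((\<lambda>x::real^'n. \<Prod>j\<in>UNIV. q j (x $ j)) has_derivative
      (\<lambda>h. \<Sum>k\<in>UNIV. (q' k (x $ k) * h $ k) * (\<Prod>j\<in>UNIV - {k}. q j (x $ j)))) (at x)"
    by (intro has_derivative_prod has_derivative_component assms)
  from partial_deriv_eq[OF this]
  have "partial_deriv i (\<lambda>x::real^'n. \<Prod>j\<in>UNIV. q j (x $ j)) x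
      = (\<Sum>k\<in>UNIV. axis i 1 $ k * (q' k (x $ k) * (\<Prod>j\<in>UNIV - {k}. q j (x $ j))))" by (simp add: ac_simps)
  also have "\<dots> = q' i (x $ i) * (\<Prod>j\<in>UNIV - {i}. q j (x $ j))" by (rule sum_axis)
  also have "\<dots> = (\<Prod>j\<in>UNIV. (if j = i then q' j else q j) (x $ j))" by (subst prod.remove[of UNIV i]) auto
  finally show ?thesis .
qed

text \<open>The left side is the second derivative of \<open>flat 0 t * flat 0 (1 - t)\<close>. With
  \<open>a = 1/t\<close> and \<open>b = 1/(1 - t)\<close> its ratio to the product is
  \<open>a^4 - 2 a^3 - 2 a^2 b^2 + b^4 - 2 b^3\<close>, and for \<open>a >= 4\<close>,
  \<open>b <= 4/3\<close> the first term prevails. So second derivative over value is as large as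
  desired near the flat end \<open>t = 0\<close>.\<close>

lemma flat_barrier:
  assumes "0 < t" "t \<le> 1/4"
  shows "flat 2 t * flat 0 (1 - t) - 2 * flat 1 t * flat 1 (1 - t) + flat 0 t * flat 2 (1 - t)
    \<ge> (1 / (4 * t^4)) * (flat 0 t * flat 0 (1 - t))"
proof -
  define a b where "a = 1 / t" and "b = 1 / (1 - t)"
  have a4: "a \<ge> 4" using assms by (simp add: a_def field_simps)
  have b: "0 < b" "b \<le> 4/3" using assms by (auto simp: b_def field_simps)
  have f: "flat 0 t = exp (- a)" "flat 1 t = a^2 * exp (- a)" "flat 2 t = (a^4 - 2 * a^3) * exp (- a)"
    using assms(1) by (auto simp: flat_def a_def numeral_2_eq_2 pderiv_pCons pderiv_mult algebra_simps power2_eq_square power4_eq_xxxx power3_eq_cube)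
  have g: "flat 0 (1 - t) = exp (- b)" "flat 1 (1 - t) = b^2 * exp (- b)" "flat 2 (1 - t) = (b^4 - 2 * b^3) * exp (- b)"
    using assms by (auto simp: flat_def b_def numeral_2_eq_2 pderiv_pCons pderiv_mult algebra_simps power2_eq_square power4_eq_xxxx power3_eq_cube)
  have "a^4 - 2 * a^3 - 2 * a^2 * b^2 + (b^4 - 2 * b^3) \<ge> a^4 / 4"
  proof -
    have "4 * a^3 \<le> a * a^3" using a4 by (intro mult_right_mono) auto
    then have 1: "2 * a^3 \<le> a^4 / 2" by (simp add: power4_eq_xxxx power3_eq_cube)
    have "b^2 \<le> (4/3)^2" using b by (intro power_mono) auto
    then have b2: "b^2 \<le> 16/9" by (simp add: power2_eq_square)
    have "(4::real)^2 \<le> a^2" using a4 by (intro power_mono) auto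
    then have a2: "16 \<le> a^2" by simp
    have "b^3 \<le> (4/3)^3" using b by (intro power_mono) auto
    then have b3: "b^3 \<le> 64/27" by (simp add: power3_eq_cube)
    have "2 * a^2 * b^2 \<le> 2 * a^2 * (16/9)" using b2 by (intro mult_left_mono) auto
    moreover have "16 * a^2 \<le> a^2 * a^2" using a2 by (intro mult_right_mono) auto
    moreover have "a^2 * a^2 = a^4" by (simp add: power4_eq_xxxx power2_eq_square)
    moreover have "16 * 16 \<le> a^2 * a^2" using a2 by (intro mult_mono) auto
    moreover have "0 \<le> b^4" using b by simp
    ultimately show ?thesis using 1 b3 by linarith
  qed
  then have "(a^4 / 4) * (exp (-a) * exp (-b)) \<le> (a^4 - 2 * a^3 - 2 * a^2 * b^2 + (b^4 - 2 * b^3)) * (exp (-a) * exp (-b))"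
    by (intro mult_right_mono) auto
  then show ?thesis unfolding f g by (simp add: a_def algebra_simps power_one_over)
qed

text \<open>A product of one-variable profiles, stretched so much that \<open>[-R, R]\<close> covers
  only a short piece next to the flat end of each profile, where the ratio of second derivative to
  value is huge. The stretching by \<open>e\<close> costs a factor \<open>e^2\<close>, but the ratio
  itself grows like the inverse fourth power of the position, which is of order
  \<open>e\<close>.\<close>

lemma laplacian_barrier:
  fixes K R :: real
  assumes "R \<ge> 0"
  obtains \<psi> :: "real^'n \<Rightarrow> real" where "test_function \<psi>" "\<And>x. \<psi> x \<ge> 0"
    "\<And>x. norm x \<le> R \<Longrightarrow> \<psi> x > 0 \<and> laplacian \<psi> x \<ge> K * \<psi> x"
proof -
  define m where "m = 2 * R + 1"
  have m: "m \<ge> 1" using assms by (simp add: m_def)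
  \<comment> \<open>Small enough for \<open>e * m <= 1/4\<close>, the range of
    \<open>flat_barrier\<close>, and for the resulting ratio \<open>1 / (4 e^2 m^4)\<close> to
    exceed the absolute value of \<open>K\<close>.\<close>
  define e where "e = 1 / (4 * (m^4 * (\<bar>K\<bar> + 1)))"
  have e: "0 < e" "e * m \<le> 1/4" "\<bar>K\<bar> \<le> e^2 * (1 / (4 * (e * m)^4))"
  proof -
    define P where "P = m^4 * (\<bar>K\<bar> + 1)"
    have m4: "m^4 > 0" using m by simp
    have P: "P > 0" unfolding P_def using m4 by (intro mult_pos_pos) auto
    have eP: "e = 1 / (4 * P)" by (simp add: e_def P_def)
    show e0: "0 < e" using P by (simp add: eP)
    have "m \<le> m^4 * 1" using m self_le_power[of m 4] by simp
    also have "\<dots> \<le> P" unfolding P_def using m by (intro mult_left_mono) auto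
    finally have mP: "m \<le> P" .
    then show "e * m \<le> 1/4" using P by (simp add: eP divide_le_eq)
    have e1: "e \<le> 1" using mP m P unfolding eP by (subst divide_le_eq_1_pos) linarith+
    define w where "w = e * e * m^4"
    have w: "w > 0" using e0 m4 by (simp add: w_def)
    have "(\<bar>K\<bar> + 1) * (4 * w) = e * (e * (4 * P))" by (simp add: w_def P_def ac_simps)
    also have "e * (4 * P) = 1" using P by (simp add: eP)
    finally have "(\<bar>K\<bar> + 1) * (4 * w) \<le> 1" using e1 by simp
    then have "\<bar>K\<bar> + 1 \<le> 1 / (4 * w)" using w by (subst pos_le_divide_eq) auto
    moreover have "1 / (4 * w) = e^2 * (1 / (4 * (e * m)^4))"
    proof -
      have "e^2 \<noteq> 0" "(e * m)^4 = e^2 * w" using e0 by (auto simp: w_def power2_eq_square power4_eq_xxxx)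
      then show ?thesis by simp
    qed
    ultimately show "\<bar>K\<bar> \<le> e^2 * (1 / (4 * (e * m)^4))" by simp
  qed
  \<comment> \<open>With this shift a coordinate in \<open>[-R, R]\<close> is sent into
    \<open>[e, e * m]\<close>, just inside the flat end.\<close>
  define c where "c = e * (R + 1)"
  define q q1 q2 where "q t = flat 0 (e * t + c) * flat 0 (- e * t + (1 - c))"
    and "q1 t = e * (flat 1 (e * t + c) * flat 0 (- e * t + (1 - c)) - flat 0 (e * t + c) * flat 1 (- e * t + (1 - c)))"
    and "q2 t = e^2 * (flat 2 (e * t + c) * flat 0 (- e * t + (1 - c)) - 2 * flat 1 (e * t + c) * flat 1 (- e * t + (1 - c))
      + flat 0 (e * t + c) * flat 2 (- e * t + (1 - c)))" for t
  have df: "((\<lambda>t. flat n (a * t + d)) has_real_derivative (flat (Suc n) (a * t + d) * a)) (at t)" for n a d t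
    by (rule DERIV_chain2[OF flat_has_derivative]) (auto intro!: derivative_eq_intros)
  have d1: "(q has_real_derivative q1 t) (at t)" for t unfolding q_def q1_def by (rule DERIV_cong[OF DERIV_mult[OF df df]]) (simp add: algebra_simps)
  have d2: "(q1 has_real_derivative q2 t) (at t)" for t unfolding q1_def q2_def
    by (rule DERIV_cong[OF DERIV_cmult[OF DERIV_diff[OF DERIV_mult[OF df df] DERIV_mult[OF df df]]]])
      (simp add: algebra_simps power2_eq_square numeral_2_eq_2)
  have q0: "q t \<ge> 0" for t unfolding q_def using flat0_bounds by simp
  have qbar: "q t > 0 \<and> q2 t \<ge> \<bar>K\<bar> * q t" if "\<bar>t\<bar> \<le> R" for t
  proof -
    define s where "s = e * t + c"
    have s: "s = e * (t + R + 1)" "- e * t + (1 - c) = 1 - s" by (auto simp: s_def c_def algebra_simps)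
    have tr: "1 \<le> t + R + 1" "t + R + 1 \<le> m" using that by (auto simp: m_def)
    have "e * (t + R + 1) > 0" using e(1) tr by (intro mult_pos_pos) auto
    then have s0: "0 < s" by (simp add: s)
    have sm: "s \<le> e * m" unfolding s using e(1) tr by (intro mult_left_mono) auto
    then have s4: "s \<le> 1/4" using e(2) by simp
    have "\<bar>K\<bar> \<le> e^2 * (1 / (4 * (e * m)^4))" by (rule e)
    also have "\<dots> \<le> e^2 * (1 / (4 * s^4))"
    proof -
      have "s^4 > 0" "s^4 \<le> (e * m)^4" using s0 sm by (auto intro: power_mono)
      then show ?thesis by (intro mult_left_mono frac_le) auto
    qed
    finally have Kle: "\<bar>K\<bar> \<le> e^2 * (1 / (4 * s^4))" .
    have "\<bar>K\<bar> * q t \<le> e^2 * (1 / (4 * s^4)) * q t" by (rule mult_right_mono[OF Kle q0])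
    also have "\<dots> = e^2 * ((1 / (4 * s^4)) * (flat 0 s * flat 0 (1 - s)))" unfolding q_def s(2) s_def[symmetric] by simp
    also have "\<dots> \<le> q2 t" unfolding q2_def s(2) s_def[symmetric] by (intro mult_left_mono flat_barrier s0 s4) auto
    finally have "\<bar>K\<bar> * q t \<le> q2 t" .
    moreover have "q t > 0" unfolding q_def s(2) s_def[symmetric] using s0 s4 by (simp add: flat0)
    ultimately show ?thesis by simp
  qed
  define \<psi> :: "real^'n \<Rightarrow> real" where "\<psi> x = (\<Prod>j\<in>UNIV. q (x $ j))" for x
  have p1: "partial_deriv i \<psi> = (\<lambda>x. \<Prod>j\<in>UNIV. (if j = i then q1 else q) (x $ j))" for i
    unfolding \<psi>_def using partial_deriv_prod[where q = "\<lambda>_. q" and q' = "\<lambda>_. q1", OF d1] by auto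
  have p2: "partial_deriv i (partial_deriv i \<psi>) x = (\<Prod>j\<in>UNIV. (if j = i then q2 else q) (x $ j))" for i x
  proof -
    have "((if j = i then q1 else q) has_real_derivative (if j = i then q2 else q1) t) (at t)" for j t using d1 d2 by auto
    from partial_deriv_prod[where q = "\<lambda>j. if j = i then q1 else q" and q' = "\<lambda>j. if j = i then q2 else q1", OF this]
    show ?thesis unfolding p1 by (auto intro!: prod.cong)
  qed
  have psi0: "\<psi> x \<ge> 0" for x unfolding \<psi>_def using q0 by (intro prod_nonneg) auto
  show ?thesis
  proof (rule that[of \<psi>])
    show "\<psi> x \<ge> 0" for x by (rule psi0)
    show "test_function \<psi>" unfolding test_function_def
    proof
      have "smooth_alg \<psi>" unfolding \<psi>_def q_def by (intro smooth_alg_prod smooth_alg.mult smooth_alg_flat finite)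
      then show "\<forall>k. Ck k \<psi>" by (auto intro: smooth_alg_Ck)
      let ?l = "(\<chi> i. - c / e) :: real^'n" and ?u = "(\<chi> i. (1 - c) / e) :: real^'n"
      have "compact (closure (cbox ?l ?u))" by (simp add: compact_cbox)
      moreover have "{x. \<psi> x \<noteq> 0} \<subseteq> closure (cbox ?l ?u)"
      proof
        fix x assume "x \<in> {x. \<psi> x \<noteq> 0}"
        then have "q (x $ i) \<noteq> 0" for i unfolding \<psi>_def by (auto simp: prod_zero_iff)
        then have "0 < e * x $ i + c" "0 < - e * x $ i + (1 - c)" for i unfolding q_def mult_eq_0_iff flat0_eq_0_iff de_Morgan_disj not_le by blast+
        then have "- c / e \<le> x $ i" "x $ i \<le> (1 - c) / e" for i using e(1) by (auto simp: field_simps less_imp_le) (smt (verit))+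
        then show "x \<in> closure (cbox ?l ?u)" by (simp add: mem_box_cart)
      qed
      ultimately show "compact (closure {x. \<psi> x \<noteq> 0})" by (rule compact_support_subset)
    qed
    fix x :: "real^'n" assume x: "norm x \<le> R"
    have xi: "\<bar>x $ i\<bar> \<le> R" for i using component_le_norm_cart[of x i] x by simp
    have pos: "\<psi> x > 0" unfolding \<psi>_def using qbar[OF xi] by (intro prod_pos) auto
    have ge: "\<bar>K\<bar> * \<psi> x \<le> partial_deriv i (partial_deriv i \<psi>) x" for i
    proof -
      have "\<bar>K\<bar> * \<psi> x = (\<bar>K\<bar> * q (x $ i)) * (\<Prod>j\<in>UNIV - {i}. q (x $ j))"
        unfolding \<psi>_def by (subst prod.remove[of UNIV i]) auto
      also have "\<dots> \<le> q2 (x $ i) * (\<Prod>j\<in>UNIV - {i}. q (x $ j))" using qbar[OF xi] q0 by (intro mult_right_mono prod_nonneg) auto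
      also have "\<dots> = partial_deriv i (partial_deriv i \<psi>) x" unfolding p2 by (subst prod.remove[of UNIV i]) auto
      finally show ?thesis .
    qed
    have "0 \<le> \<bar>K\<bar> * \<psi> x" using psi0 by simp
    then have nn: "0 \<le> partial_deriv i (partial_deriv i \<psi>) x" for i using ge[of i] by linarith
    \<comment> \<open>All second derivatives are nonnegative here, so a single one already gives the
      bound for the Laplacian.\<close>
    fix i :: 'n
    have "K * \<psi> x \<le> \<bar>K\<bar> * \<psi> x" using psi0 by (intro mult_right_mono) auto
    also have "\<dots> \<le> partial_deriv i (partial_deriv i \<psi>) x" by (rule ge)
    also have "\<dots> \<le> laplacian \<psi> x" unfolding laplacian_def using nn by (intro member_le_sum) auto
    finally show "\<psi> x > 0 \<and> laplacian \<psi> x \<ge> K * \<psi> x" using pos by simp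
  qed
qed

section \<open>Pairings of square integrable functions with test functions\<close>

lemma square_integrable_set_integrable:
  assumes f: "square_integrable M f" and A[measurable]: "A \<in> sets M" and fin: "emeasure M A < \<infinity>"
  shows "set_integrable M A f" unfolding set_integrable_def
proof (rule Bochner_Integration.integrable_bound)
  show "integrable M (\<lambda>x. indicator A x + nsq (f x))" using fin square_integrableD(2)[OF f] by (intro Bochner_Integration.integrable_add) auto
  have "norm (indicator A x *\<^sub>R f x) \<le> norm (indicator A x + nsq (f x))" for x
  proof (cases "x \<in> A")
    case True
    have "0 \<le> (norm (f x) - 1)^2" by simp
    then have "norm (f x) \<le> 1 + nsq (f x)" by (simp add: power2_diff) (smt (verit) norm_ge_zero)
    then show ?thesis using True by simp
  qed simp
  then show "AE x in M. norm (indicator A x *\<^sub>R f x) \<le> norm (indicator A x + nsq (f x))" by simp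
  show "(\<lambda>x. indicator A x *\<^sub>R f x) \<in> borel_measurable M"
    using square_integrableD(1)[OF f] A by (intro borel_measurable_scaleR borel_measurable_indicator)
qed

lemma two_inner_le: "2 * (a \<bullet> b) \<le> nsq a + nsq b" using inner_le_sq[of a b] by simp

lemma integrable_scaleR_square:
  fixes f :: "'a \<Rightarrow> real" and g :: "'a \<Rightarrow> 'b::euclidean_space"
  assumes f: "square_integrable M f" and g: "square_integrable M g"
  shows "integrable M (\<lambda>x. f x *\<^sub>R g x)"
proof (rule Bochner_Integration.integrable_bound)
  note [measurable] = square_integrableD(1)[OF f] square_integrableD(1)[OF g]
  show "integrable M (\<lambda>x. (nsq (f x) + nsq (g x)) / 2)" using square_integrableD(2)[OF f] square_integrableD(2)[OF g] by auto
  show "(\<lambda>x. f x *\<^sub>R g x) \<in> borel_measurable M" by measurable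
  have "norm (f x *\<^sub>R g x) \<le> norm ((nsq (f x) + nsq (g x)) / 2)" for x using sum_squares_bound[of "norm (f x)" "norm (g x)"] by simp
  then show "AE x in M. norm (f x *\<^sub>R g x) \<le> norm ((nsq (f x) + nsq (g x)) / 2)" by simp
qed

lemma integrable_mult_square:
  fixes f g :: "'a \<Rightarrow> real"
  assumes f: "square_integrable M f" and g: "square_integrable M g"
  shows "integrable M (\<lambda>x. f x * g x)" using integrable_scaleR_square[OF f g] by simp

lemma square_integrable_translate:
  fixes u :: "'a::euclidean_space \<Rightarrow> 'b::euclidean_space"
  assumes "square_integrable lborel u"
  shows "square_integrable lborel (\<lambda>x. u (x + h))"
proof -
  have m[measurable]: "borel_fun u" using square_integrableD(1)[OF assms] by simp
  show ?thesis unfolding square_integrable_def using integrable_lborel_translate[OF square_integrableD(2)[OF assms], of h] by auto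
qed

lemma integral_norm_sq_translate:
  fixes u :: "'a::euclidean_space \<Rightarrow> 'b::euclidean_space"
  assumes "square_integrable lborel u"
  shows "(LBINT x. nsq (u (x + h))) = (LBINT x. nsq (u x))"
proof -
  have m[measurable]: "borel_fun u" using square_integrableD(1)[OF assms] by simp
  show ?thesis using integral_lborel_translate[of "\<lambda>x. nsq (u x)" h] by simp
qed

lemma tendsto_integral_sq:
  assumes s: "\<And>n. square_integrable M (s n)" and G: "square_integrable M G"
    and lim: "(\<lambda>n. \<integral>x. nsq (s n x - G x) \<partial>M) \<longlonglongrightarrow> 0"
  shows "(\<lambda>n. \<integral>x. nsq (s n x) \<partial>M) \<longlonglongrightarrow> (\<integral>x. nsq (G x) \<partial>M)"
proof -
  have eq: "(\<integral>x. nsq (s n x) \<partial>M) = (\<integral>x. nsq (s n x - G x) \<partial>M) + 2 * (\<integral>x. s n x \<bullet> G x \<partial>M) - (\<integral>x. nsq (G x) \<partial>M)" for n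
  proof -
    have "(\<integral>x. nsq (s n x - G x) \<partial>M) = (\<integral>x. nsq (s n x + (-1) *\<^sub>R G x) \<partial>M)" by simp
    also have "\<dots> = (\<integral>x. nsq (s n x) \<partial>M) - 2 * (\<integral>x. s n x \<bullet> G x \<partial>M) + (\<integral>x. nsq (G x) \<partial>M)"
      by (subst integral_norm_add_sq[OF s square_integrable_scaleR[OF G]]) simp
    finally show ?thesis by simp
  qed
  have "(\<lambda>n. (\<integral>x. nsq (s n x - G x) \<partial>M) + 2 * (\<integral>x. s n x \<bullet> G x \<partial>M) - (\<integral>x. nsq (G x) \<partial>M))
      \<longlonglongrightarrow> 0 + 2 * (\<integral>x. G x \<bullet> G x \<partial>M) - (\<integral>x. nsq (G x) \<partial>M)"
    by (intro tendsto_intros lim tendsto_integral_inner s G)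
  then show ?thesis unfolding eq by (simp add: power2_norm_eq_inner)
qed

lemma test_function_square_integrable:
  fixes f :: "real^'n \<Rightarrow> real"
  assumes "test_function f"
  shows "square_integrable lborel f"
proof -
  obtain C R where CR: "C \<ge> 0" "R \<ge> 0" "\<And>x. \<bar>f x\<bar> \<le> C" "\<And>x. norm x > R \<Longrightarrow> f x = 0"
    by (rule test_function_bounds[OF assms]) blast
  note [measurable] = test_functionD(3)[OF assms]
  have i: "integrable lborel (\<lambda>x::real^'n. indicator (cball 0 R) x :: real)" using emeasure_lborel_cball_finite[of "0::real^'n" R] by simp
  show ?thesis unfolding square_integrable_def
  proof
    show "integrable lborel (\<lambda>x. nsq (f x))"
    proof (rule Bochner_Integration.integrable_bound)
      show "integrable lborel (\<lambda>x::real^'n. C^2 * indicator (cball 0 R) x)" using i by simp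
      have le: "(f x)^2 \<le> C^2 * indicator (cball 0 R) x" for x
        using CR(4)[of x] CR(1) CR(3)[of x] by (cases "norm x \<le> R") (auto simp: abs_le_square_iff[symmetric])
      show "AE x in lborel. norm (nsq (f x)) \<le> norm (C^2 * indicator (cball 0 R) x)"
      proof (intro AE_I2)
        fix x
        have "norm (nsq (f x)) = (f x)^2" by simp
        also note le
        also note abs_ge_self
        finally show "norm (nsq (f x)) \<le> norm (C^2 * indicator (cball 0 R) x)" by simp
      qed
    qed measurable
  qed simp
qed

text \<open>As \<open>v\<close> is only square integrable, the translation acts on the test
  function, whose Taylor remainder is quadratic in \<open>h\<close> with fixed compact
  support.\<close>

lemma test_function_integral_expansion:
  fixes v f :: "real^'n \<Rightarrow> real"
  assumes v: "square_integrable lborel v" and f: "test_function f"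
  obtains C where "C \<ge> 0" "\<And>h. norm h \<le> 1 \<Longrightarrow>
    \<bar>(LBINT x. v x * f (x - h)) - (LBINT x. v x * f x)
      + (\<Sum>j\<in>UNIV. h $ j * (LBINT x. v x * partial_deriv j f x))\<bar> \<le> C * nsq h"
proof -
  obtain C R where C: "C \<ge> 0" "R \<ge> 0" and T: "\<And>x h. norm h \<le> 1 \<Longrightarrow> \<bar>f (x + h) - f x - (\<Sum>i\<in>UNIV. h $ i * partial_deriv i f x)\<bar>
      \<le> C * nsq h * indicator (cball 0 R) x" by (rule test_function_Taylor[OF f]) blast
  have "set_integrable lborel (cball 0 R) v" using emeasure_lborel_cball_finite[of "0::real^'n" R] by (intro square_integrable_set_integrable v) auto
  then have iv: "integrable lborel (\<lambda>x. indicator (cball 0 R) x * v x)" by (simp add: set_integrable_def)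
  let ?I = "LBINT x. \<bar>indicator (cball 0 R) x * v x\<bar>"
  have i1: "integrable lborel (\<lambda>x. v x * f (x - h))" for h
    using square_integrable_translate[OF test_function_square_integrable[OF f], of "-h"] by (intro integrable_mult_square v) simp
  have i2: "integrable lborel (\<lambda>x. v x * f x)" by (intro integrable_mult_square v test_function_square_integrable f)
  have i3: "integrable lborel (\<lambda>x. v x * partial_deriv j f x)" for j
    by (intro integrable_mult_square v test_function_square_integrable test_function_partial_deriv f)
  show ?thesis
  proof (rule that[of "C * ?I"])
    have "?I \<ge> 0" by (rule integral_nonneg_AE) auto
    then show "C * ?I \<ge> 0" using C by simp
    fix h :: "real^'n" assume h: "norm h \<le> 1"
    have "(LBINT x. v x * f (x - h)) - (LBINT x. v x * f x)
      + (\<Sum>j\<in>UNIV. h $ j * (LBINT x. v x * partial_deriv j f x))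
      = (LBINT x. v x * f (x - h) - v x * f x + (\<Sum>j\<in>UNIV. h $ j * (v x * partial_deriv j f x)))" using i1 i2 i3 by simp
    also have "\<bar>\<dots>\<bar> \<le> (LBINT x. (C * nsq h) * \<bar>indicator (cball 0 R) x * v x\<bar>)"
    proof (rule order_trans[OF integral_abs_bound integral_mono])
      show "integrable lborel (\<lambda>x. \<bar>v x * f (x - h) - v x * f x + (\<Sum>j\<in>UNIV. h $ j * (v x * partial_deriv j f x))\<bar>)"
        using i1 i2 i3 by (intro integrable_abs Bochner_Integration.integrable_add Bochner_Integration.integrable_diff Bochner_Integration.integrable_sum integrable_mult_right)
      show "integrable lborel (\<lambda>x. (C * nsq h) * \<bar>indicator (cball 0 R) x * v x\<bar>)"
        by (intro integrable_mult_right integrable_abs iv)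
      fix x
      have eq: "v x * f (x - h) - v x * f x + (\<Sum>j\<in>UNIV. h $ j * (v x * partial_deriv j f x))
        = v x * (f (x + - h) - f x - (\<Sum>i\<in>UNIV. (- h) $ i * partial_deriv i f x))" by (simp add: algebra_simps sum_distrib_left sum_negf)
      have "\<bar>v x * f (x - h) - v x * f x + (\<Sum>j\<in>UNIV. h $ j * (v x * partial_deriv j f x))\<bar>
         \<le> \<bar>v x\<bar> * (C * nsq (-h) * indicator (cball 0 R) x)" unfolding eq abs_mult using T[of "-h" x] h by (intro mult_left_mono) auto
      then show "\<bar>v x * f (x - h) - v x * f x + (\<Sum>j\<in>UNIV. h $ j * (v x * partial_deriv j f x))\<bar>
         \<le> (C * nsq h) * \<bar>indicator (cball 0 R) x * v x\<bar>" by (simp add: abs_mult ac_simps)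
    qed
    also have "\<dots> = C * ?I * nsq h" by (simp add: ac_simps)
    finally show "\<bar>(LBINT x. v x * f (x - h)) - (LBINT x. v x * f x)
      + (\<Sum>j\<in>UNIV. h $ j * (LBINT x. v x * partial_deriv j f x))\<bar> \<le> C * ?I * nsq h" .
  qed
qed

section \<open>Weak gradients and translation differences\<close>

text \<open>The counterpart of \<open>has_weak_gradient\<close> over \<open>lborel\<close>, with
  function and gradient both Borel measurable and square integrable;
  \<open>has_weak_gradient_iff_wgrad\<close> connects the two.\<close>

definition wgrad :: "(real^'n \<Rightarrow> complex) \<Rightarrow> (real^'n \<Rightarrow> complex^'n) \<Rightarrow> bool" where
  "wgrad u G \<longleftrightarrow> square_integrable lborel u \<and> square_integrable lborel G \<and>
    (\<forall>\<psi> i. test_function \<psi> \<longrightarrow>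
      (LBINT x. partial_deriv i \<psi> x *\<^sub>R u x) = - (LBINT x. \<psi> x *\<^sub>R (G x $ i)))"

lemma square_integrable_vec_nth:
  assumes "square_integrable M (G :: _ \<Rightarrow> complex^'n)"
  shows "square_integrable M (\<lambda>x. G x $ i)"
proof (rule square_integrable_bound[OF assms, where c = 1])
  have [measurable]: "G \<in> borel_measurable M" by (rule square_integrableD(1)[OF assms])
  have "(\<lambda>x. x $ i) \<in> borel_measurable (borel :: (complex^'n) measure)" by (intro borel_measurable_continuous_onI continuous_intros)
  from measurable_compose[OF square_integrableD(1)[OF assms] this]
  show "(\<lambda>x. G x $ i) \<in> borel_measurable M" .
  show "AE x in M. norm (G x $ i) \<le> 1 * norm (G x)" by (intro AE_I2) (simp add: Finite_Cartesian_Product.norm_nth_le)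
qed

lemma square_integrable_Re_Im:
  assumes "square_integrable M f"
  shows "square_integrable M (\<lambda>x. Re (f x))" "square_integrable M (\<lambda>x. Im (f x))"
proof -
  have [measurable]: "f \<in> borel_measurable M" by (rule square_integrableD(1)[OF assms])
  show "square_integrable M (\<lambda>x. Re (f x))" by (rule square_integrable_bound[OF assms, where c = 1]) (auto simp: abs_Re_le_cmod)
  show "square_integrable M (\<lambda>x. Im (f x))" by (rule square_integrable_bound[OF assms, where c = 1]) (auto simp: abs_Im_le_cmod)
qed

lemma wgradD_Re_Im:
  assumes w: "wgrad u G" and \<psi>: "test_function \<psi>"
  shows "(LBINT x. Re (u x) * partial_deriv i \<psi> x) = - (LBINT x. Re (G x $ i) * \<psi> x)"
    "(LBINT x. Im (u x) * partial_deriv i \<psi> x) = - (LBINT x. Im (G x $ i) * \<psi> x)"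
proof -
  have u: "square_integrable lborel u" and G: "square_integrable lborel G" using w by (auto simp: wgrad_def)
  have i1: "integrable lborel (\<lambda>x. partial_deriv i \<psi> x *\<^sub>R u x)"
    by (intro integrable_scaleR_square test_function_square_integrable test_function_partial_deriv \<psi> u)
  have i2: "integrable lborel (\<lambda>x. \<psi> x *\<^sub>R (G x $ i))"
    by (intro integrable_scaleR_square test_function_square_integrable \<psi> square_integrable_vec_nth G)
  have eq: "(LBINT x. partial_deriv i \<psi> x *\<^sub>R u x) = - (LBINT x. \<psi> x *\<^sub>R (G x $ i))" using w \<psi> by (auto simp: wgrad_def)
  show "(LBINT x. Re (u x) * partial_deriv i \<psi> x) = - (LBINT x. Re (G x $ i) * \<psi> x)"
    using arg_cong[OF eq, of Re] i1 i2 by (simp flip: integral_Re add: mult.commute)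
  show "(LBINT x. Im (u x) * partial_deriv i \<psi> x) = - (LBINT x. Im (G x $ i) * \<psi> x)"
    using arg_cong[OF eq, of Im] i1 i2 by (simp flip: integral_Im add: mult.commute)
qed

text \<open>Duality for complex-valued functions uses the real inner product of the plane, so the
  test functions have to be complex too.\<close>

definition ctest :: "(real^'n \<Rightarrow> complex) set" where
  "ctest = {f. test_function (\<lambda>x. Re (f x)) \<and> test_function (\<lambda>x. Im (f x))}"

lemma ctest_square_integrable:
  assumes "f \<in> ctest"
  shows "square_integrable lborel f"
proof -
  have r: "square_integrable lborel (\<lambda>x. Re (f x))" and i: "square_integrable lborel (\<lambda>x. Im (f x))"
    using assms by (auto simp: ctest_def intro: test_function_square_integrable)
  have m: "borel_fun f" using square_integrableD(1)[OF r] square_integrableD(1)[OF i] by (simp add: borel_measurable_complex_iff)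
  have "(\<lambda>x. nsq (f x)) = (\<lambda>x. nsq (Re (f x)) + nsq (Im (f x)))" by (auto simp: cmod_power2)
  then show ?thesis unfolding square_integrable_def using m square_integrableD(2)[OF r] square_integrableD(2)[OF i] by auto
qed

lemma ctest_closed:
  "(\<lambda>x. 0) \<in> ctest" "f \<in> ctest \<Longrightarrow> g \<in> ctest \<Longrightarrow> (\<lambda>x. f x + g x) \<in> ctest"
  "f \<in> ctest \<Longrightarrow> (\<lambda>x. c *\<^sub>R f x) \<in> ctest"
  by (auto simp: ctest_def intro: test_function_zero test_function_add test_function_cmult)

text \<open>The Riesz lemma represents pairing with \<open>g\<close> by some \<open>G\<close> that
  is a limit of test functions. Then \<open>g - G\<close> is orthogonal to every test function, and
  testing with \<open>\<psi>\<close> and \<open>\<i> * \<psi>\<close> shows that it vanishes almost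
  everywhere.\<close>

lemma ctest_dense:
  fixes g :: "real^'n \<Rightarrow> complex"
  assumes g: "square_integrable lborel g"
  obtains s where "\<And>n::nat. s n \<in> ctest" "(\<lambda>n. LBINT x. nsq (s n x - g x)) \<longlonglongrightarrow> 0"
proof -
  define L where "L f = (LBINT x. g x \<bullet> f x)" for f
  note sq = ctest_square_integrable
  obtain G s where G: "square_integrable lborel G" and LG: "\<And>f. f \<in> ctest \<Longrightarrow> L f = (LBINT x. G x \<bullet> f x)"
    and s: "\<And>n::nat. s n \<in> ctest" "(\<lambda>n. LBINT x. nsq (s n x - G x)) \<longlonglongrightarrow> 0"
  proof (rule Riesz_L2[where T = "ctest :: (real^'n \<Rightarrow> complex) set" and L = L and B = "LBINT x. nsq (g x)" and M = lborel])
    show "2 * L f \<le> (LBINT x. nsq (g x)) + (LBINT x. nsq (f x))" if "f \<in> ctest" for f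
    proof -
      have "2 * L f = (LBINT x. 2 * (g x \<bullet> f x))" by (simp add: L_def)
      also have "\<dots> \<le> (LBINT x. nsq (g x) + nsq (f x))" using square_integrableD(2)[OF g] square_integrableD(2)[OF sq[OF that]]
        by (intro integral_mono integrable_mult_right integrable_inner_square g sq that Bochner_Integration.integrable_add)
          (auto intro: two_inner_le)
      finally show ?thesis using square_integrableD(2)[OF g] square_integrableD(2)[OF sq[OF that]] by simp
    qed
    show "L (\<lambda>x. f x + h x) = L f + L h" if "f \<in> ctest" "h \<in> ctest" for f h
      unfolding L_def inner_add_right by (intro Bochner_Integration.integral_add integrable_inner_square g sq that)
    show "L (\<lambda>x. c *\<^sub>R f x) = c * L f" for f c unfolding L_def by simp
  qed (auto intro: sq ctest_closed)
  have i: "square_integrable lborel (\<lambda>x. g x - G x)" by (rule square_integrable_diff[OF g G])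
  have z: "(LBINT x. (g x - G x) \<bullet> f x) = 0" if "f \<in> ctest" for f
    using LG[OF that] integrable_inner_square[OF g sq[OF that]] integrable_inner_square[OF G sq[OF that]] by (simp add: L_def inner_diff_left)
  have "AE x in lborel. Re (g x - G x) = 0"
  proof (rule AE_zero_if_test_integrals_zero)
    show "borel_fun (\<lambda>x. Re (g x - G x))" using square_integrableD(1)[OF square_integrable_Re_Im(1)[OF i]] by simp
    show "set_integrable lborel (cbox a b) (\<lambda>x. Re (g x - G x))" for a b
      by (intro square_integrable_set_integrable square_integrable_Re_Im i) (simp_all add: emeasure_lborel_cbox_finite[simplified])
    fix \<psi> :: "real^'n \<Rightarrow> real" assume "test_function \<psi>"
    then have "(\<lambda>x. complex_of_real (\<psi> x)) \<in> ctest" by (simp add: ctest_def test_function_zero)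
    from z[OF this] show "(LBINT x. \<psi> x * Re (g x - G x)) = 0" by (simp add: inner_complex_def mult.commute)
  qed
  moreover have "AE x in lborel. Im (g x - G x) = 0"
  proof (rule AE_zero_if_test_integrals_zero)
    show "borel_fun (\<lambda>x. Im (g x - G x))" using square_integrableD(1)[OF square_integrable_Re_Im(2)[OF i]] by simp
    show "set_integrable lborel (cbox a b) (\<lambda>x. Im (g x - G x))" for a b
      by (intro square_integrable_set_integrable square_integrable_Re_Im i) (simp_all add: emeasure_lborel_cbox_finite[simplified])
    fix \<psi> :: "real^'n \<Rightarrow> real" assume "test_function \<psi>"
    then have "(\<lambda>x. \<i> * complex_of_real (\<psi> x)) \<in> ctest" by (simp add: ctest_def test_function_zero)
    from z[OF this] show "(LBINT x. \<psi> x * Im (g x - G x)) = 0" by (simp add: inner_complex_def mult.commute)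
  qed
  ultimately have ae: "AE x in lborel. g x = G x" by eventually_elim (simp add: complex_eq_iff)
  have "(LBINT x. nsq (s n x - g x)) = (LBINT x. nsq (s n x - G x))" for n
  proof (rule integral_cong_AE)
    have [measurable]: "borel_fun g" "borel_fun G" "borel_fun (s n)"
      using square_integrableD(1)[OF g] square_integrableD(1)[OF G] square_integrableD(1)[OF sq[OF s(1)]] by auto
    show "(\<lambda>x. nsq (s n x - g x)) \<in> borel_measurable lborel" "(\<lambda>x. nsq (s n x - G x)) \<in> borel_measurable lborel" by measurable
    show "AE x in lborel. nsq (s n x - g x) = nsq (s n x - G x)" using ae by eventually_elim simp
  qed
  with s show ?thesis by (intro that[of s]) auto
qed

text \<open>The pairing of \<open>u\<close> with the translates of a test function is differentiable along the translation,
  with derivative given by the weak gradient; the mean value theorem and duality then bound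
  the translation difference of \<open>u\<close>.\<close>

lemma test_pairing_deriv:
  fixes v \<psi> :: "real^'n \<Rightarrow> real"
  assumes v: "square_integrable lborel v" and g: "\<And>i. square_integrable lborel (g i)"
    and weak: "\<And>\<psi> i. test_function \<psi> \<Longrightarrow> (LBINT x. v x * partial_deriv i \<psi> x) = - (LBINT x. g i x * \<psi> x)"
    and \<psi>: "test_function \<psi>"
  shows "((\<lambda>s. LBINT x. v x * \<psi> (x - s *\<^sub>R h)) has_real_derivative
      (LBINT x. (\<Sum>i\<in>UNIV. h $ i * g i x) * \<psi> (x - s *\<^sub>R h))) (at s)"
proof -
  define f where "f = (\<lambda>x. \<psi> (x - s *\<^sub>R h))"
  have f: "test_function f" unfolding f_def using test_function_translate[OF \<psi>, of "- s *\<^sub>R h"] by simp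
  define A where "A s = (LBINT x. v x * \<psi> (x - s *\<^sub>R h))" for s
  define D where "D = (LBINT x. (\<Sum>i\<in>UNIV. h $ i * g i x) * \<psi> (x - s *\<^sub>R h))"
  obtain C where C: "C \<ge> 0" "\<And>h. norm h \<le> 1 \<Longrightarrow>
    \<bar>(LBINT x. v x * f (x - h)) - (LBINT x. v x * f x)
      + (\<Sum>j\<in>UNIV. h $ j * (LBINT x. v x * partial_deriv j f x))\<bar> \<le> C * nsq h"
    by (rule test_function_integral_expansion[OF v f]) blast
  have D: "D = (\<Sum>i\<in>UNIV. h $ i * (LBINT x. g i x * f x))"
  proof -
    have "D = (LBINT x. (\<Sum>i\<in>UNIV. h $ i * (g i x * f x)))" unfolding D_def f_def by (simp add: sum_distrib_right mult.assoc)
    also have "\<dots> = (\<Sum>i\<in>UNIV. h $ i * (LBINT x. g i x * f x))"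
      using integrable_mult_square[OF g test_function_square_integrable[OF f]] by simp
    finally show ?thesis .
  qed
  have est: "\<bar>(A (s + d) - A s) / d - D\<bar> \<le> C * nsq h * \<bar>d\<bar>" if d: "d \<noteq> 0" "\<bar>d\<bar> * norm h \<le> 1" for d
  proof -
    have "(\<Sum>j\<in>UNIV. (d *\<^sub>R h) $ j * (LBINT x. v x * partial_deriv j f x)) = - d * D"
      unfolding weak[OF f] D by (simp add: sum_distrib_left sum_negf[symmetric] ac_simps)
    moreover have "A (s + d) = (LBINT x. v x * f (x - d *\<^sub>R h))" unfolding A_def f_def by (simp add: algebra_simps)
    moreover have "A s = (LBINT x. v x * f x)" unfolding A_def f_def ..
    ultimately have "\<bar>A (s + d) - A s - d * D\<bar> \<le> C * nsq (d *\<^sub>R h)" using C(2)[of "d *\<^sub>R h"] d by simp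
    also have "\<dots> = (C * nsq h * \<bar>d\<bar>) * \<bar>d\<bar>" by (simp add: power_mult_distrib power2_eq_square)
    finally have "\<bar>A (s + d) - A s - d * D\<bar> / \<bar>d\<bar> \<le> C * nsq h * \<bar>d\<bar>" using d by (simp add: divide_le_eq)
    moreover have "\<bar>A (s + d) - A s - d * D\<bar> / \<bar>d\<bar> = \<bar>(A (s + d) - A s) / d - D\<bar>"
      using d by (simp add: abs_divide[symmetric] diff_divide_distrib)
    ultimately show ?thesis by simp
  qed
  have "((\<lambda>d. (A (s + d) - A s) / d - D) \<longlongrightarrow> 0) (at 0)"
  proof (rule Lim_null_comparison)
    have "\<forall>\<^sub>F d in at (0::real). \<bar>d\<bar> * norm h \<le> 1 \<and> d \<noteq> 0"
    proof (rule eventually_conj)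
      have "((\<lambda>d::real. \<bar>d\<bar> * norm h) \<longlongrightarrow> \<bar>0\<bar> * norm h) (at 0)" by (intro tendsto_intros)
      then have "\<forall>\<^sub>F d in at (0::real). \<bar>d\<bar> * norm h < 1" by (rule order_tendstoD) simp
      then show "\<forall>\<^sub>F d in at (0::real). \<bar>d\<bar> * norm h \<le> 1" by eventually_elim simp
      show "\<forall>\<^sub>F d in at (0::real). d \<noteq> 0" by (simp add: eventually_at_filter)
    qed
    then show "\<forall>\<^sub>F d in at 0. norm ((A (s + d) - A s) / d - D) \<le> C * nsq h * \<bar>d\<bar>" by eventually_elim (simp add: est)
    have "((\<lambda>d::real. C * nsq h * \<bar>d\<bar>) \<longlongrightarrow> C * nsq h * \<bar>0\<bar>) (at 0)" by (intro tendsto_intros)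
    then show "((\<lambda>d::real. C * nsq h * \<bar>d\<bar>) \<longlongrightarrow> 0) (at 0)" by simp
  qed
  then have "((\<lambda>d. (A (s + d) - A s) / d) \<longlongrightarrow> D) (at 0)" by (rule LIM_zero_cancel)
  then have "(A has_real_derivative D) (at s)" by (simp only: DERIV_def)
  then show ?thesis by (simp add: A_def[abs_def] D_def)
qed

text \<open>The derivative in direction \<open>h\<close> of a function whose gradient is
  \<open>z\<close>.\<close>

definition dirdiv :: "real^'n \<Rightarrow> complex^'n \<Rightarrow> complex" where
  "dirdiv h z = (\<Sum>i\<in>UNIV. h $ i *\<^sub>R (z $ i))"

text \<open>The values are in \<open>ennreal\<close>, so that Tonelli and Fatou apply to functions
  not yet known to be square integrable.\<close>

definition transl_sq :: "'a::euclidean_space \<Rightarrow> ('a \<Rightarrow> 'b::euclidean_space) \<Rightarrow> ennreal" where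
  "transl_sq h u = (LBINT+ x. ennreal (nsq (u (x + h) - u x)))"

lemma square_integrable_sum:
  assumes "finite A" "\<And>i. i \<in> A \<Longrightarrow> square_integrable M (f i)"
  shows "square_integrable M (\<lambda>x. \<Sum>i\<in>A. f i x)" using assms
proof (induction rule: finite_induct)
  case empty
  show ?case by (simp add: square_integrable_def)
qed (simp add: square_integrable_add)

lemma square_integrable_dirdiv:
  assumes "square_integrable M G"
  shows "square_integrable M (\<lambda>x. dirdiv h (G x))" unfolding dirdiv_def
  by (intro square_integrable_sum square_integrable_scaleR square_integrable_vec_nth assms finite)

lemma translation_bound:
  fixes u :: "real^'n \<Rightarrow> complex"
  assumes w: "wgrad u G"
  shows "(LBINT x. nsq (u (x + h) - u x)) \<le> (LBINT x. nsq (dirdiv h (G x)))"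
proof -
  have u: "square_integrable lborel u" and G: "square_integrable lborel G" using w by (auto simp: wgrad_def)
  define D where "D x = dirdiv h (G x)" for x
  have Dsq: "square_integrable lborel D" unfolding D_def by (rule square_integrable_dirdiv[OF G])
  define d where "d x = u (x + h) - u x" for x
  have dsq: "square_integrable lborel d" unfolding d_def by (intro square_integrable_diff square_integrable_translate u)
  have main: "(LBINT x. d x \<bullet> f x)^2 \<le> (LBINT x. nsq (D x)) * (LBINT x. nsq (f x))" if f: "f \<in> ctest" for f
  proof -
    have fr: "test_function (\<lambda>x. Re (f x))" and fi: "test_function (\<lambda>x. Im (f x))" using f by (auto simp: ctest_def)
    have fsq: "square_integrable lborel f" by (rule ctest_square_integrable[OF f])
    have fsqs: "square_integrable lborel (\<lambda>x. f (x - a))" for a using square_integrable_translate[OF fsq, of "-a"] by simp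
    define A where "A s = (LBINT x. Re (u x) * Re (f (x - s *\<^sub>R h))) + (LBINT x. Im (u x) * Im (f (x - s *\<^sub>R h)))" for s
    have Aeq: "A s = (LBINT x. u x \<bullet> f (x - s *\<^sub>R h))" for s unfolding A_def inner_complex_def
      by (intro Bochner_Integration.integral_add[symmetric] integrable_mult_square square_integrable_Re_Im u fsqs)
    define A' where "A' s = (LBINT x. D x \<bullet> f (x - s *\<^sub>R h))" for s
    have der: "(A has_real_derivative A' s) (at s)" for s
    proof -
      have "A' s = (LBINT x. Re (D x) * Re (f (x - s *\<^sub>R h))) + (LBINT x. Im (D x) * Im (f (x - s *\<^sub>R h)))"
        unfolding A'_def inner_complex_def by (intro Bochner_Integration.integral_add integrable_mult_square square_integrable_Re_Im Dsq fsqs)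
      also have "\<dots> = (LBINT x. (\<Sum>i\<in>UNIV. h $ i * Re (G x $ i)) * Re (f (x - s *\<^sub>R h))) + (LBINT x. (\<Sum>i\<in>UNIV. h $ i * Im (G x $ i)) * Im (f (x - s *\<^sub>R h)))"
        by (simp add: D_def dirdiv_def)
      finally have A's: "A' s = \<dots>" .
      show ?thesis unfolding A's A_def[abs_def]
        by (intro DERIV_add test_pairing_deriv square_integrable_Re_Im square_integrable_vec_nth u G fr fi wgradD_Re_Im[OF w])
    qed
    obtain s where s: "A 1 - A 0 = A' s" using MVT2[of 0 1 A A'] der by auto
    have "A 1 = (LBINT x. u (x + h) \<bullet> f x)"
    proof -
      have [measurable]: "borel_fun u" "borel_fun f"
        using square_integrableD(1)[OF u] square_integrableD(1)[OF fsq] by auto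
      show ?thesis unfolding Aeq by (subst integral_lborel_translate[symmetric, of _ h]) auto
    qed
    moreover have "A 0 = (LBINT x. u x \<bullet> f x)" unfolding Aeq by simp
    ultimately have "(LBINT x. d x \<bullet> f x) = A' s"
      using integrable_inner_square[OF square_integrable_translate[OF u] fsq, of h] integrable_inner_square[OF u fsq] s
      by (simp add: d_def inner_diff_left)
    moreover have "(A' s)^2 \<le> (LBINT x. nsq (D x)) * (LBINT x. nsq (f (x - s *\<^sub>R h)))"
      unfolding A'_def by (rule integral_inner_CS[OF Dsq fsqs])
    moreover have "(LBINT x. nsq (f (x - s *\<^sub>R h))) = (LBINT x. nsq (f x))"
      using integral_norm_sq_translate[OF fsq, of "- s *\<^sub>R h"] by simp
    ultimately show ?thesis by simp
  qed
  obtain s where s: "\<And>n::nat. s n \<in> ctest" "(\<lambda>n. LBINT x. nsq (s n x - d x)) \<longlonglongrightarrow> 0"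
    by (rule ctest_dense[OF dsq]) blast
  note ssq = ctest_square_integrable[OF s(1)]
  let ?d = "LBINT x. nsq (d x)" and ?D = "LBINT x. nsq (D x)"
  \<comment> \<open>By density the test function may approach \<open>d\<close> itself, which turns
    the dual estimate into one for the norm of \<open>d\<close>.\<close>
  have "(\<lambda>n. (LBINT x. s n x \<bullet> d x)^2) \<longlonglongrightarrow> (LBINT x. d x \<bullet> d x)^2"
    by (intro tendsto_intros tendsto_integral_inner ssq dsq s)
  moreover have "(\<lambda>n. ?D * (LBINT x. nsq (s n x))) \<longlonglongrightarrow> ?D * ?d" by (intro tendsto_intros tendsto_integral_sq ssq dsq s)
  ultimately have "(LBINT x. d x \<bullet> d x)^2 \<le> ?D * ?d" by (rule LIMSEQ_le) (use main[OF s(1)] in \<open>auto simp: inner_commute\<close>)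
  moreover have "(LBINT x. d x \<bullet> d x) = ?d" by (simp add: power2_norm_eq_inner)
  ultimately have "?d * ?d \<le> ?D * ?d" by (simp only: power2_eq_square[of ?d])
  moreover have "?d \<ge> 0" "?D \<ge> 0" by (auto intro: integral_nonneg_AE)
  ultimately have "?d \<le> ?D" by (cases "?d = 0") (auto simp: mult_le_cancel_right)
  then show ?thesis by (simp add: d_def D_def)
qed

section \<open>Averages of translation differences over balls\<close>

lemma ball_cball_borel [measurable]: "ball c r \<in> sets borel" "cball c r \<in> sets borel" by simp_all

lemma integrable_on_ball:
  fixes f :: "'a::euclidean_space \<Rightarrow> real"
  assumes [measurable]: "borel_fun f" and C: "\<And>h. norm h < t \<Longrightarrow> \<bar>f h\<bar> \<le> C"
  shows "integrable lborel (\<lambda>h. indicator (ball 0 t) h * f h)"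
proof (rule Bochner_Integration.integrable_bound)
  show "integrable lborel (\<lambda>h::'a. C * indicator (ball 0 t) h)" using emeasure_lborel_ball_finite[of "0::'a" t] by simp
  show "AE h in lborel. norm (indicator (ball 0 t) h * f h) \<le> norm (C * indicator (ball 0 t) h :: real)"
  proof (intro AE_I2)
    fix h :: 'a
    show "norm (indicator (ball 0 t) h * f h) \<le> norm (C * indicator (ball 0 t) h :: real)" using C[of h] by (cases "norm h < t") auto
  qed
  show "(\<lambda>h. indicator (ball 0 t) h * f h) \<in> borel_measurable lborel" using assms(1) by simp
qed

text \<open>By symmetry every coordinate gives the same constant, so the choice of \<^const>\<open>undefined\<close> is immaterial.\<close>

definition kap :: "'n::finite itself \<Rightarrow> real \<Rightarrow> real" where
  "kap N t = (LBINT h. indicator (ball 0 t) h * ((h::real^'n) $ undefined)^2)"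

lemma integrable_ball_inner_sq:
  "integrable lborel (\<lambda>h::real^'n. indicator (ball 0 t) h * (h \<bullet> a)^2)"
proof (rule integrable_on_ball[where C = "t^2 * nsq a"])
  fix h :: "real^'n" assume h: "norm h < t"
  have "\<bar>h \<bullet> a\<bar>^2 \<le> (norm h * norm a)^2" by (intro power_mono Cauchy_Schwarz_ineq2) auto
  also have "\<dots> \<le> (t * norm a)^2" using h by (intro power_mono mult_right_mono) auto
  finally show "\<bar>(h \<bullet> a)^2\<bar> \<le> t^2 * nsq a" by (simp add: power_mult_distrib)
qed measurable

lemma kap_pos:
  assumes "t > 0"
  shows "kap TYPE('n::finite) t > 0"
proof -
  define i :: 'n where "i = undefined"
  \<comment> \<open>The ball of radius \<open>t/4\<close> about \<open>c\<close> lies in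
    \<open>ball 0 t\<close>, and the chosen coordinate is at least \<open>t/4\<close> on it.\<close>
  define c :: "real^'n" where "c = (t/2) *\<^sub>R axis i 1"
  have nc: "norm c = t/2" using assms by (simp add: c_def)
  have ib: "integrable lborel (\<lambda>h::real^'n. (t/4)^2 * indicator (ball c (t/4)) h)" using emeasure_lborel_ball_finite[of c "t/4"] by simp
  have "0 < (t/4)^2 * measure lborel (ball c (t/4))" using content_ball_pos[of "t/4" c] assms by (simp add: measure_completion)
  also have "\<dots> = (LBINT h. (t/4)^2 * indicator (ball c (t/4)) h)" by simp
  also have "\<dots> \<le> (LBINT h. indicator (ball 0 t) h * (h $ i)^2)"
  proof (rule integral_mono[OF ib])
    show "integrable lborel (\<lambda>h::real^'n. indicator (ball 0 t) h * (h $ i)^2)"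
      using integrable_ball_inner_sq[of t "axis i 1 :: real^'n"] by (simp add: inner_axis)
    fix h :: "real^'n"
    show "(t/4)^2 * indicator (ball c (t/4)) h \<le> indicator (ball 0 t) h * (h $ i)^2"
    proof (cases "h \<in> ball c (t/4)")
      case True
      then have d: "norm (c - h) < t/4" by (simp add: dist_norm)
      have "norm h \<le> norm c + norm (c - h)" by (metis norm_triangle_sub norm_minus_commute)
      then have "norm h < t" using d nc assms by simp
      moreover have "\<bar>c $ i - h $ i\<bar> \<le> norm (c - h)" using component_le_norm_cart[of "c - h" i] by simp
      then have "t/4 \<le> h $ i" using d by (simp add: c_def)
      then have "(t/4)^2 \<le> (h $ i)^2" using assms by (intro power_mono) auto
      ultimately show ?thesis using True by simp
    qed simp
  qed
  finally show ?thesis by (simp add: kap_def i_def)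
qed

text \<open>An orthogonal map takes the coordinate axis of \<open>kap\<close> to the direction of
  \<open>a\<close> and preserves the ball.\<close>

lemma nn_integral_ball_inner_sq:
  fixes a :: "real^'n"
  shows "(LBINT+ h. ennreal (indicator (ball 0 t) h * (h \<bullet> a)^2)) = ennreal (kap TYPE('n) t * nsq a)"
proof (cases "a = 0")
  case False
  define e :: "real^'n" where "e = axis undefined 1"
  have "norm e = norm ((1 / norm a) *\<^sub>R a)" using False by (simp add: e_def)
  then obtain f where f: "orthogonal_transformation f" "f e = (1 / norm a) *\<^sub>R a" using orthogonal_transformation_exists by blast
  have fa: "f h \<bullet> a = norm a * h $ undefined" for h
  proof -
    have "f h \<bullet> a = norm a * (f h \<bullet> f e)" using False by (simp add: f(2))
    also have "f h \<bullet> f e = h \<bullet> e" using f(1) by (simp add: orthogonal_transformation_def)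
    finally show ?thesis by (simp add: e_def inner_axis)
  qed
  have "(LBINT+ h. ennreal (indicator (ball 0 t) h * (h \<bullet> a)^2)) = (LBINT+ h. ennreal (indicator (ball 0 t) (f h) * (f h \<bullet> a)^2))"
    by (rule nn_integral_lborel_orthogonal[OF f(1), symmetric]) measurable
  also have "\<dots> = (LBINT+ h. ennreal (nsq a * (indicator (ball 0 t) h * ((h::real^'n) $ undefined)^2)))"
    by (intro nn_integral_cong) (simp add: fa power_mult_distrib indicator_def orthogonal_transformation_norm[OF f(1)])
  also have "\<dots> = ennreal (LBINT h. nsq a * (indicator (ball 0 t) h * ((h::real^'n) $ undefined)^2))"
    using integrable_ball_inner_sq[of t e] by (intro nn_integral_eq_integral integrable_mult_right) (auto simp: e_def inner_axis)
  also have "\<dots> = ennreal (kap TYPE('n) t * nsq a)" by (simp add: kap_def mult.commute)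
  finally show ?thesis .
qed simp

lemma integral_ball_inner_sq:
  fixes a :: "real^'n"
  assumes "t > 0"
  shows "(LBINT h. indicator (ball 0 t) h * (h \<bullet> a)^2) = kap TYPE('n) t * nsq a"
proof -
  have "ennreal (LBINT h. indicator (ball 0 t) h * (h \<bullet> a)^2) = ennreal (kap TYPE('n) t * nsq a)"
    unfolding nn_integral_ball_inner_sq[symmetric] by (rule nn_integral_eq_integral[symmetric, OF integrable_ball_inner_sq]) simp
  moreover have "0 \<le> (LBINT h. indicator (ball 0 t) h * (h \<bullet> a)^2)" by (rule integral_nonneg_AE) simp
  moreover have "0 \<le> kap TYPE('n) t * nsq a" using kap_pos[OF assms, where 'n = 'n] by simp
  ultimately show ?thesis by (simp only: ennreal_inj)
qed

text \<open>The polarization identity for the quadratic form in \<open>a\<close> just computed: the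
  matrix of second moments of the ball is \<open>kap\<close> times the identity.\<close>

lemma integral_ball_components:
  fixes i j :: "'n::finite"
  assumes "t > 0"
  shows "integrable lborel (\<lambda>h::real^'n. indicator (ball 0 t) h * (h $ i * h $ j))"
    "(LBINT h. indicator (ball 0 t) h * ((h::real^'n) $ i * h $ j)) = (if i = j then kap TYPE('n) t else 0)"
proof -
  let ?a = "axis i 1 :: real^'n" and ?b = "axis j 1 :: real^'n"
  have eq: "indicator (ball 0 t) h * (h $ i * h $ j) = (indicator (ball 0 t) h * (h \<bullet> (?a + ?b))^2
      - indicator (ball 0 t) h * (h \<bullet> ?a)^2 - indicator (ball 0 t) h * (h \<bullet> ?b)^2) / 2" for h :: "real^'n"
    by (simp add: inner_add_right inner_axis power2_eq_square algebra_simps)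
  show "integrable lborel (\<lambda>h::real^'n. indicator (ball 0 t) h * (h $ i * h $ j))"
    unfolding eq by (intro integrable_divide Bochner_Integration.integrable_diff integrable_ball_inner_sq)
  have "(LBINT h. indicator (ball 0 t) h * ((h::real^'n) $ i * h $ j))
      = (kap TYPE('n) t * nsq (?a + ?b) - kap TYPE('n) t * (norm ?a)^2 - kap TYPE('n) t * (norm ?b)^2) / 2"
    unfolding eq using integrable_ball_inner_sq[of t ?a] integrable_ball_inner_sq[of t ?b] integrable_ball_inner_sq[of t "?a + ?b"]
    by (simp only: integral_divide_zero Bochner_Integration.integral_diff Bochner_Integration.integrable_diff integral_ball_inner_sq[OF assms])
  also have "nsq (?a + ?b) = (if i = j then 4 else 2)" by (auto simp: power2_norm_eq_inner inner_add_left inner_add_right inner_axis_axis)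
  finally show "(LBINT h. indicator (ball 0 t) h * ((h::real^'n) $ i * h $ j)) = (if i = j then kap TYPE('n) t else 0)" by auto
qed

lemma transl_sq_measurable [measurable]:
  assumes [measurable]: "borel_fun u"
  shows "borel_fun (\<lambda>h. transl_sq h u)"
proof -
  have "borel_fun (\<lambda>h. LBINT+ x. ennreal (nsq (u (x + h) - u x)))" by measurable
  then show ?thesis by (simp add: transl_sq_def[abs_def])
qed

text \<open>The form in which a bound \<open>B\<close> on the Dirichlet integral is handled: for
  square integrable \<open>u\<close> it is equivalent to a weak gradient of squared norm at most
  \<open>B\<close>. The factor \<open>kap\<close> is what a unit gradient contributes to the left
  side, see \<open>nn_integral_ball_dirdiv\<close>. Only values of \<open>u\<close> occur, so the
  bound survives limits in mean square and rearrangements.\<close>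

definition grad_bound :: "(real^'n \<Rightarrow> complex) \<Rightarrow> real \<Rightarrow> bool" where
  "grad_bound u B \<longleftrightarrow> (\<forall>t>0. (LBINT+ h. indicator (ball 0 t) h * transl_sq h u) \<le> ennreal (kap TYPE('n) t * B))"

lemma dirdiv_norm_sq:
  "nsq (dirdiv h z) = (h \<bullet> (\<chi> i. Re (z $ i)))^2 + (h \<bullet> (\<chi> i. Im (z $ i)))^2"
  by (simp add: cmod_power2 dirdiv_def inner_vec_def)

lemma norm_sq_Re_Im_vec:
  "nsq (z::complex^'n) = nsq (\<chi> i. Re (z $ i)) + nsq (\<chi> i. Im (z $ i))"
  by (simp add: power2_norm_eq_inner inner_vec_def inner_complex_def sum.distrib)

lemma nn_integral_ball_dirdiv:
  fixes z :: "complex^'n::finite"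
  assumes "t > 0"
  shows "(LBINT+ h. indicator (ball 0 t) h * ennreal (nsq (dirdiv h z))) = ennreal (kap TYPE('n) t * nsq z)"
proof -
  have "(LBINT+ h. indicator (ball 0 t) h * ennreal (nsq (dirdiv h z)))
    = (LBINT+ h. ennreal (indicator (ball 0 t) h * (h \<bullet> (\<chi> i. Re (z $ i)))^2) + ennreal (indicator (ball 0 t) h * (h \<bullet> (\<chi> i. Im (z $ i)))^2))"
    by (intro nn_integral_cong) (auto simp: dirdiv_norm_sq indicator_def)
  also have "\<dots> = ennreal (kap TYPE('n) t * nsq (\<chi> i. Re (z $ i))) + ennreal (kap TYPE('n) t * nsq (\<chi> i. Im (z $ i)))"
    by (subst nn_integral_add) (auto simp: nn_integral_ball_inner_sq)
  also have "\<dots> = ennreal (kap TYPE('n) t * nsq z)"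
    using kap_pos[OF assms, where 'n = 'n] by (simp add: norm_sq_Re_Im_vec[of z] distrib_left flip: ennreal_plus)
  finally show ?thesis .
qed

lemma borel_measurable_dirdiv [measurable (raw)]:
  fixes g :: "'a \<Rightarrow> complex^'n::finite"
  assumes "f \<in> borel_measurable M" "g \<in> borel_measurable M"
  shows "(\<lambda>x. dirdiv (f x) (g x)) \<in> borel_measurable M"
proof -
  have "borel_fun (\<lambda>(h, z::complex^'n). dirdiv h z)"
    unfolding dirdiv_def split_def by (intro borel_measurable_continuous_onI continuous_intros)
  moreover have "(\<lambda>x. (f x, g x)) \<in> borel_measurable M" using assms by (rule borel_measurable_Pair)
  ultimately show ?thesis using measurable_compose[of "\<lambda>x. (f x, g x)" M borel "\<lambda>(h, z). dirdiv h z" borel] by simp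
qed

lemma nn_integral_ball_dirdiv_fun:
  fixes G :: "real^'n \<Rightarrow> complex^'n"
  assumes "t > 0" and G: "square_integrable lborel G"
  shows "(LBINT+ h. indicator (ball 0 t) h * (LBINT+ x. ennreal (nsq (dirdiv h (G x)))))
    = ennreal (kap TYPE('n) t * (LBINT x. nsq (G x)))"
proof -
  have Gm[measurable]: "borel_fun G" using square_integrableD(1)[OF G] by simp
  have "(LBINT+ h. indicator (ball 0 t) h * (LBINT+ x. ennreal (nsq (dirdiv h (G x)))))
    = (LBINT+ h. LBINT+ x. indicator (ball 0 t) h * ennreal (nsq (dirdiv h (G x))))"
    by (intro nn_integral_cong nn_integral_cmult[symmetric]) measurable
  also have "\<dots> = (LBINT+ x. LBINT+ h. indicator (ball 0 t) h * ennreal (nsq (dirdiv h (G x))))" by (rule lborel_pair.Fubini') measurable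
  also have "\<dots> = (LBINT+ x. ennreal (kap TYPE('n) t) * ennreal (nsq (G x)))"
    using kap_pos[OF assms(1), where 'n = 'n] by (simp add: nn_integral_ball_dirdiv[OF assms(1)] ennreal_mult)
  also have "\<dots> = ennreal (kap TYPE('n) t) * (LBINT+ x. ennreal (nsq (G x)))" by (rule nn_integral_cmult) measurable
  also have "\<dots> = ennreal (kap TYPE('n) t * (LBINT x. nsq (G x)))"
    unfolding nn_integral_square[OF G] using kap_pos[OF assms(1), where 'n = 'n] by (simp add: ennreal_mult)
  finally show ?thesis .
qed

lemma transl_sq_eq:
  assumes "square_integrable lborel u"
  shows "transl_sq h u = ennreal (LBINT x. nsq (u (x + h) - u x))" unfolding transl_sq_def
  by (intro nn_integral_square square_integrable_diff square_integrable_translate assms)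

lemma grad_bound_of_wgrad:
  fixes u :: "real^'n \<Rightarrow> complex"
  assumes w: "wgrad u G"
  shows "grad_bound u (LBINT x. nsq (G x))" unfolding grad_bound_def
proof (intro allI impI)
  fix t :: real assume t: "t > 0"
  have u: "square_integrable lborel u" and G: "square_integrable lborel G" using w by (auto simp: wgrad_def)
  have "(LBINT+ h. indicator (ball 0 t) h * transl_sq h u)
    \<le> (LBINT+ h. indicator (ball 0 t) h * (LBINT+ x. ennreal (nsq (dirdiv h (G x)))))" by (intro nn_integral_mono mult_left_mono)
      (auto simp: transl_sq_eq[OF u] nn_integral_square[OF square_integrable_dirdiv[OF G]] intro!: ennreal_leI translation_bound[OF w])
  then show "(LBINT+ h. indicator (ball 0 t) h * transl_sq h u) \<le> ennreal (kap TYPE('n) t * (LBINT x. nsq (G x)))"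
    by (simp add: nn_integral_ball_dirdiv_fun[OF t G])
qed

section \<open>A weak gradient from bounded averages\<close>

definition vtest :: "(real^'n \<Rightarrow> complex^'n) set" where
  "vtest = {\<Psi>. \<forall>i. (\<lambda>x. \<Psi> x $ i) \<in> ctest}"

lemma vtest_square_integrable:
  assumes "\<Psi> \<in> vtest"
  shows "square_integrable lborel \<Psi>"
proof -
  have sq: "square_integrable lborel (\<lambda>x. \<Psi> x $ i)" for i using assms by (auto simp: vtest_def intro: ctest_square_integrable)
  have "\<Psi> = (\<lambda>x. \<Sum>i\<in>UNIV. axis i (\<Psi> x $ i))" by (auto simp: vec_eq_iff axis_def if_distrib cong: if_cong)
  moreover have "square_integrable lborel (\<lambda>x. \<Sum>i\<in>UNIV. axis i (\<Psi> x $ i) :: complex^'a)"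
  proof (intro square_integrable_sum finite)
    fix i :: 'a
    have "borel_fun (\<lambda>z. axis i z :: complex^'a)" unfolding axis_def
    proof (intro borel_measurable_continuous_onI continuous_on_vec_lambda)
      fix j show "continuous_on UNIV (\<lambda>z::complex. if j = i then z else 0)" by (cases "j = i") auto
    qed
    then have "(\<lambda>x. axis i (\<Psi> x $ i) :: complex^'a) \<in> borel_measurable lborel"
      using measurable_compose[OF square_integrableD(1)[OF sq]] by blast
    then show "square_integrable lborel (\<lambda>x. axis i (\<Psi> x $ i) :: complex^'a)" by (rule square_integrable_bound[OF sq[of i], where c = 1])
        (auto simp: norm_eq_sqrt_inner inner_axis_axis)
  qed
  ultimately show ?thesis by simp
qed

lemma sum_nonneg_bound:
  fixes x :: "real^'n"
  assumes "\<And>i. C i \<ge> 0"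
  shows "(\<Sum>i\<in>UNIV. \<bar>x $ i\<bar> * C i) \<le> norm x * sum C UNIV"
  unfolding sum_distrib_left by (intro sum_mono mult_right_mono component_le_norm_cart assms)

text \<open>The converse: integrating \<open>2 a b \<le> a\<^sup>2 + b\<^sup>2\<close> for the difference of \<open>u\<close> against \<open>h \<cdot> \<Psi>\<close>
  over \<open>\<bar>h\<bar> < t\<close> and letting \<open>t \<rightarrow> 0\<close> gives the hypothesis of the Riesz lemma for
  \<open>\<Psi> \<mapsto> - \<integral> u div \<Psi>\<close>.\<close>

lemma divergence_bound:
  fixes u :: "real^'n \<Rightarrow> complex"
  assumes u: "square_integrable lborel u" and B: "grad_bound u B" and B0: "B \<ge> 0" and \<Psi>: "\<Psi> \<in> vtest"
  defines "A \<equiv> \<lambda>i j. (LBINT x. Re (u x) * partial_deriv j (\<lambda>x. Re (\<Psi> x $ i)) x)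
      + (LBINT x. Im (u x) * partial_deriv j (\<lambda>x. Im (\<Psi> x $ i)) x)"
  shows "2 * (- (\<Sum>i\<in>UNIV. A i i)) \<le> B + (LBINT x. nsq (\<Psi> x))"
proof -
  have pr: "test_function (\<lambda>x. Re (\<Psi> x $ i))" and pi: "test_function (\<lambda>x. Im (\<Psi> x $ i))" for i
    using \<Psi> by (auto simp: vtest_def ctest_def)
  have \<Psi>sq: "square_integrable lborel \<Psi>" by (rule vtest_square_integrable[OF \<Psi>])
  have \<Psi>c: "square_integrable lborel (\<lambda>x. \<Psi> x $ i)" for i by (rule square_integrable_vec_nth[OF \<Psi>sq])
  have \<Psi>s: "square_integrable lborel (\<lambda>x. \<Psi> (x - h) $ i)" for i h using square_integrable_translate[OF \<Psi>c, of "-h"] by simp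
  \<comment> \<open>Moving the translation from \<open>u\<close> to the test field gives this
    difference of pairings, whose first order term in \<open>h\<close> is minus the sum of
    \<open>h $ j * A i j\<close>.\<close>
  define J where "J i h = (LBINT x. u x \<bullet> (\<Psi> (x - h) $ i)) - (LBINT x. u x \<bullet> (\<Psi> x $ i))" for i h
  have "\<exists>C\<ge>0. \<forall>h. norm h \<le> 1 \<longrightarrow> \<bar>J i h + (\<Sum>j\<in>UNIV. h $ j * A i j)\<bar> \<le> C * nsq h" for i
  proof -
    obtain C1 where C1: "C1 \<ge> 0" "\<And>h. norm h \<le> 1 \<Longrightarrow>
      \<bar>(LBINT x. Re (u x) * Re (\<Psi> (x - h) $ i)) - (LBINT x. Re (u x) * Re (\<Psi> x $ i))
        + (\<Sum>j\<in>UNIV. h $ j * (LBINT x. Re (u x) * partial_deriv j (\<lambda>x. Re (\<Psi> x $ i)) x))\<bar> \<le> C1 * nsq h"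
      by (rule test_function_integral_expansion[OF square_integrable_Re_Im(1)[OF u] pr[of i]]) blast
    obtain C2 where C2: "C2 \<ge> 0" "\<And>h. norm h \<le> 1 \<Longrightarrow>
      \<bar>(LBINT x. Im (u x) * Im (\<Psi> (x - h) $ i)) - (LBINT x. Im (u x) * Im (\<Psi> x $ i))
        + (\<Sum>j\<in>UNIV. h $ j * (LBINT x. Im (u x) * partial_deriv j (\<lambda>x. Im (\<Psi> x $ i)) x))\<bar> \<le> C2 * nsq h"
      by (rule test_function_integral_expansion[OF square_integrable_Re_Im(2)[OF u] pi[of i]]) blast
    have split: "(LBINT x. u x \<bullet> f x) = (LBINT x. Re (u x) * Re (f x)) + (LBINT x. Im (u x) * Im (f x))"
      if "square_integrable lborel f" for f unfolding inner_complex_def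
      by (intro Bochner_Integration.integral_add integrable_mult_square square_integrable_Re_Im u that)
    have "\<bar>J i h + (\<Sum>j\<in>UNIV. h $ j * A i j)\<bar> \<le> (C1 + C2) * nsq h" if "norm h \<le> 1" for h
    proof -
      have "(\<Sum>j\<in>UNIV. h $ j * A i j) = (\<Sum>j\<in>UNIV. h $ j * (LBINT x. Re (u x) * partial_deriv j (\<lambda>x. Re (\<Psi> x $ i)) x))
        + (\<Sum>j\<in>UNIV. h $ j * (LBINT x. Im (u x) * partial_deriv j (\<lambda>x. Im (\<Psi> x $ i)) x))"
        unfolding A_def by (simp add: distrib_left sum.distrib)
      then show ?thesis using C1(2)[OF that] C2(2)[OF that] unfolding J_def split[OF \<Psi>s] split[OF \<Psi>c] distrib_right by linarith
    qed
    then show ?thesis using C1(1) C2(1) by (intro exI[of _ "C1 + C2"]) auto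
  qed
  then obtain C where C: "\<And>i. C i \<ge> 0" "\<And>i h. norm h \<le> 1 \<Longrightarrow> \<bar>J i h + (\<Sum>j\<in>UNIV. h $ j * A i j)\<bar> \<le> C i * nsq h"
    by metis
  define S where "S = sum C UNIV"
  have S0: "S \<ge> 0" unfolding S_def by (intro sum_nonneg C)
  define T where "T h = (LBINT x. nsq (u (x + h) - u x))" for h
  define Q where "Q h = (LBINT x. nsq (dirdiv h (\<Psi> x)))" for h
  have Dsq: "square_integrable lborel (\<lambda>x. dirdiv h (\<Psi> x))" for h by (rule square_integrable_dirdiv[OF \<Psi>sq])
  have dsq: "square_integrable lborel (\<lambda>x. u (x + h) - u x)" for h by (intro square_integrable_diff square_integrable_translate u)
  \<comment> \<open>The quadratic part and the cubic error of twice the pairing of the translation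
    difference with \<open>dirdiv h \<Psi>\<close>; integrated over the ball, the error is of lower
    order as \<open>t\<close> tends to \<open>0\<close>.\<close>
  define l where "l h = - 2 * (\<Sum>i\<in>UNIV. \<Sum>j\<in>UNIV. (h $ i * h $ j) * A i j) - 2 * S * (norm h)^3" for h :: "real^'n"
  have point: "l h \<le> T h + Q h" if h: "norm h \<le> 1" for h
  proof -
    have I: "(LBINT x. (u (x + h) - u x) \<bullet> dirdiv h (\<Psi> x)) = (\<Sum>i\<in>UNIV. h $ i * J i h)"
    proof -
      have [measurable]: "borel_fun u" "borel_fun (\<lambda>x. \<Psi> x $ i)" for i
        using square_integrableD(1)[OF u] square_integrableD(1)[OF \<Psi>c] by auto
      have tr: "(LBINT x. u (x + h) \<bullet> (\<Psi> x $ i)) = (LBINT x. u x \<bullet> (\<Psi> (x - h) $ i))" for i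
        by (subst integral_lborel_translate[symmetric, of "\<lambda>x. u x \<bullet> (\<Psi> (x - h) $ i)" h]) (auto intro!: borel_measurable_inner measurable_compose[of "\<lambda>x. x - h"])
      have "(LBINT x. (u (x + h) - u x) \<bullet> dirdiv h (\<Psi> x))
        = (LBINT x. (\<Sum>i\<in>UNIV. h $ i * (u (x + h) \<bullet> (\<Psi> x $ i) - u x \<bullet> (\<Psi> x $ i))))"
        by (simp add: dirdiv_def inner_sum_right inner_diff_left)
      also have "\<dots> = (\<Sum>i\<in>UNIV. h $ i * ((LBINT x. u (x + h) \<bullet> (\<Psi> x $ i)) - (LBINT x. u x \<bullet> (\<Psi> x $ i))))"
        using integrable_inner_square[OF square_integrable_translate[OF u] \<Psi>c] integrable_inner_square[OF u \<Psi>c] by simp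
      finally show ?thesis by (simp add: tr J_def)
    qed
    have "2 * (LBINT x. (u (x + h) - u x) \<bullet> dirdiv h (\<Psi> x)) \<le> T h + Q h"
    proof -
      have "2 * (LBINT x. (u (x + h) - u x) \<bullet> dirdiv h (\<Psi> x)) = (LBINT x. 2 * ((u (x + h) - u x) \<bullet> dirdiv h (\<Psi> x)))" by simp
      also have "\<dots> \<le> (LBINT x. nsq (u (x + h) - u x) + nsq (dirdiv h (\<Psi> x)))"
        using square_integrableD(2)[OF dsq] square_integrableD(2)[OF Dsq]
        by (intro integral_mono integrable_mult_right integrable_inner_square dsq Dsq Bochner_Integration.integrable_add two_inner_le)
      finally show ?thesis using square_integrableD(2)[OF dsq] square_integrableD(2)[OF Dsq] by (simp add: T_def Q_def)
    qed
    moreover have "l h \<le> 2 * (\<Sum>i\<in>UNIV. h $ i * J i h)"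
    proof -
      have "\<bar>(\<Sum>i\<in>UNIV. h $ i * J i h) + (\<Sum>i\<in>UNIV. \<Sum>j\<in>UNIV. (h $ i * h $ j) * A i j)\<bar>
        = \<bar>\<Sum>i\<in>UNIV. h $ i * (J i h + (\<Sum>j\<in>UNIV. h $ j * A i j))\<bar>"
        by (simp add: distrib_left sum.distrib sum_distrib_left mult.assoc)
      also have "\<dots> \<le> (\<Sum>i\<in>UNIV. \<bar>h $ i * (J i h + (\<Sum>j\<in>UNIV. h $ j * A i j))\<bar>)" by (rule sum_abs)
      also have "\<dots> \<le> (\<Sum>i\<in>UNIV. \<bar>h $ i\<bar> * (C i * nsq h))"
        unfolding abs_mult using C(2)[OF h] by (intro sum_mono mult_left_mono) auto
      also have "\<dots> \<le> norm h * (\<Sum>i\<in>UNIV. C i * nsq h)" using C(1) by (intro sum_nonneg_bound) auto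
      also have "\<dots> = S * (norm h)^3" unfolding S_def sum_distrib_right[symmetric] by (simp add: power2_eq_square power3_eq_cube)
      finally show ?thesis unfolding l_def by linarith
    qed
    ultimately show ?thesis by (simp add: I)
  qed
  define P where "P = (LBINT x. nsq (\<Psi> x))"
  have P0: "P \<ge> 0" unfolding P_def by (rule integral_nonneg_AE) auto
  define a where "a = (\<Sum>i\<in>UNIV. A i i)"
  define b where "b = 2 * S * real CARD('n)"
  have step: "- 2 * a - b * t \<le> B + P" if t: "0 < t" "t \<le> 1" for t
  proof -
    let ?k = "kap TYPE('n) t"
    have k: "?k > 0" by (rule kap_pos[OF t(1)])
    have cont: "borel_fun (\<lambda>h::real^'n. (norm h)^3)" by measurable
    have i3: "integrable lborel (\<lambda>h::real^'n. indicator (ball 0 t) h * (norm h)^3)"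
      by (rule integrable_on_ball[OF cont, where C = "t^3"]) (auto intro: power_mono)
    have in2: "(\<lambda>h::real^'n. indicator (ball 0 t) h * nsq h) = (\<lambda>h. \<Sum>i\<in>UNIV. indicator (ball 0 t) h * (h $ i * h $ i))"
      by (rule ext) (simp add: power2_norm_eq_inner inner_vec_def sum_distrib_left)
    have n2: "(LBINT h. indicator (ball 0 t) h * nsq (h::real^'n)) = real CARD('n) * ?k"
      unfolding in2 by (subst Bochner_Integration.integral_sum) (simp_all add: integral_ball_components[OF t(1)])
    have i2: "integrable lborel (\<lambda>h::real^'n. indicator (ball 0 t) h * nsq h)"
      unfolding in2 using integral_ball_components(1)[OF t(1)] by (intro Bochner_Integration.integrable_sum)
    have n3: "(LBINT h. indicator (ball 0 t) h * (norm (h::real^'n))^3) \<le> t * (real CARD('n) * ?k)"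
    proof -
      have "(LBINT h. indicator (ball 0 t) h * (norm (h::real^'n))^3) \<le> (LBINT h. t * (indicator (ball 0 t) h * nsq (h::real^'n)))"
        by (intro integral_mono i3 integrable_mult_right i2)
          (auto simp: indicator_def power2_eq_square power3_eq_cube mult.assoc intro!: mult_right_mono)
      then show ?thesis by (simp add: n2)
    qed
    \<comment> \<open>The products \<open>h $ i * h $ j\<close> have integral zero over the ball off
      the diagonal, so that integration leaves only the trace of \<open>A\<close>, the pairing of
      \<open>u\<close> with the divergence.\<close>
    have lw: "(\<lambda>h. indicator (ball 0 t) h * l h) = (\<lambda>h. (\<Sum>i\<in>UNIV. \<Sum>j\<in>UNIV. (indicator (ball 0 t) h * (h $ i * h $ j)) * (- 2 * A i j)) - (2 * S) * (indicator (ball 0 t) h * (norm h)^3))"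
      by (rule ext) (simp add: l_def algebra_simps sum_distrib_left sum_distrib_right sum_negf)
    have il: "integrable lborel (\<lambda>h. indicator (ball 0 t) h * l h)"
      unfolding lw by (intro Bochner_Integration.integrable_diff Bochner_Integration.integrable_sum integrable_mult_left integrable_mult_right i3 integral_ball_components(1) t)
    have "(LBINT h. indicator (ball 0 t) h * l h) = (\<Sum>i\<in>UNIV. \<Sum>j\<in>UNIV. (if i = j then ?k else 0) * (- 2 * A i j)) - (2 * S) * (LBINT h. indicator (ball 0 t) h * (norm (h::real^'n))^3)"
      unfolding lw by (subst Bochner_Integration.integral_diff)
        (auto intro!: Bochner_Integration.integrable_sum integrable_mult_left integrable_mult_right i3 integral_ball_components(1) t
          simp: integral_ball_components[OF t(1)] simp del: mult_minus_right mult_minus_left)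
    also have "(\<Sum>i\<in>UNIV. \<Sum>j\<in>UNIV. (if i = j then ?k else 0) * (- 2 * A i j)) = - 2 * ?k * a"
    proof -
      have "(\<Sum>j\<in>UNIV. (if i = j then ?k else 0) * (- 2 * A i j)) = ?k * (- 2 * A i i)" for i
        by (simp add: if_distrib[where f = "\<lambda>t. t * _"] sum_negf cong: if_cong)
      then show ?thesis by (simp add: a_def sum_distrib_left sum_negf ac_simps)
    qed
    finally have lint: "(LBINT h. indicator (ball 0 t) h * l h) \<ge> ?k * (- 2 * a - b * t)"
      using mult_left_mono[OF n3, of "2 * S"] S0 by (simp add: b_def algebra_simps)
    \<comment> \<open>\<open>l h\<close> may be negative, and only its positive part can be compared
      with the nonnegative integrals.\<close>
    have "ennreal (LBINT h. indicator (ball 0 t) h * l h) \<le> ennreal (LBINT h. max 0 (indicator (ball 0 t) h * l h))"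
      by (intro ennreal_leI integral_mono il integrable_max) auto
    also have "\<dots> = (LBINT+ h. ennreal (max 0 (indicator (ball 0 t) h * l h)))"
      by (intro nn_integral_eq_integral[symmetric] integrable_max il) auto
    also have "\<dots> \<le> (LBINT+ h. indicator (ball 0 t) h * transl_sq h u + indicator (ball 0 t) h * (LBINT+ x. ennreal (nsq (dirdiv h (\<Psi> x)))))"
    proof (rule nn_integral_mono)
      fix h :: "real^'n"
      have TQ: "T h \<ge> 0" "Q h \<ge> 0" by (auto simp: T_def Q_def intro: integral_nonneg_AE)
      have "max 0 (indicator (ball 0 t) h * l h) \<le> indicator (ball 0 t) h * (T h + Q h)" using point[of h] t TQ by (auto simp: indicator_def)
      then have "ennreal (max 0 (indicator (ball 0 t) h * l h)) \<le> ennreal (indicator (ball 0 t) h * (T h + Q h))" by (rule ennreal_leI)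
      also have "\<dots> = indicator (ball 0 t) h * transl_sq h u + indicator (ball 0 t) h * (LBINT+ x. ennreal (nsq (dirdiv h (\<Psi> x))))"
        unfolding transl_sq_eq[OF u] nn_integral_square[OF Dsq] using TQ
        by (cases "h \<in> ball 0 t") (simp_all add: T_def[symmetric] Q_def[symmetric] ennreal_plus)
      finally show "ennreal (max 0 (indicator (ball 0 t) h * l h)) \<le> \<dots>" .
    qed
    also have "\<dots> = (LBINT+ h. indicator (ball 0 t) h * transl_sq h u) + (LBINT+ h. indicator (ball 0 t) h * (LBINT+ x. ennreal (nsq (dirdiv h (\<Psi> x)))))"
    proof (rule nn_integral_add)
      have [measurable]: "borel_fun u" "borel_fun \<Psi>"
        using square_integrableD(1)[OF u] square_integrableD(1)[OF \<Psi>sq] by auto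
      show "(\<lambda>h. indicator (ball 0 t) h * transl_sq h u) \<in> borel_measurable lborel" by measurable
      show "(\<lambda>h. indicator (ball 0 t) h * (LBINT+ x. ennreal (nsq (dirdiv h (\<Psi> x))))) \<in> borel_measurable lborel" by measurable
    qed
    also have "\<dots> \<le> ennreal (?k * B) + ennreal (?k * P)"
      using B t unfolding grad_bound_def P_def by (intro add_mono) (auto simp: nn_integral_ball_dirdiv_fun[OF t(1) \<Psi>sq])
    also have "\<dots> \<le> ennreal (?k * B + ?k * P)" using k P0 B0 by (subst ennreal_plus) (auto intro!: add_mono ennreal_leI mult_left_mono)
    finally have "(LBINT h. indicator (ball 0 t) h * l h) \<le> ?k * B + ?k * P" using k P0 B0 by (subst (asm) ennreal_le_iff) auto
    then have "?k * (- 2 * a - b * t) \<le> ?k * (B + P)" using lint by (simp add: distrib_left)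
    then show ?thesis using k by simp
  qed
  have "- 2 * a \<le> B + P"
  proof (rule tendsto_upperbound[of "\<lambda>t. - 2 * a - b * t" _ "at_right 0"])
    have "((\<lambda>t. - 2 * a - b * t) \<longlongrightarrow> - 2 * a - b * 0) (at_right 0)" by (intro tendsto_intros)
    then show "((\<lambda>t. - 2 * a - b * t) \<longlongrightarrow> - 2 * a) (at_right 0)" by simp
    show "\<forall>\<^sub>F t in at_right 0. - 2 * a - b * t \<le> B + P" unfolding eventually_at_right_field using step by (intro exI[of _ 1]) auto
  qed simp
  then show ?thesis by (simp add: a_def P_def)
qed

text \<open>The Riesz lemma on test vector fields. The form of its hypothesis yields the norm bound
  \<open>B\<close> without loss, so lower semicontinuity of the Dirichlet integral holds with
  constant one.\<close>

lemma wgrad_of_grad_bound: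
  fixes u :: "real^'n \<Rightarrow> complex"
  assumes u: "square_integrable lborel u" and B: "grad_bound u B" and B0: "B \<ge> 0"
  obtains G where "wgrad u G" "(LBINT x. nsq (G x)) \<le> B"
proof -
  define A where "A \<Psi> i = (LBINT x. Re (u x) * partial_deriv i (\<lambda>x. Re (\<Psi> x $ i)) x)
      + (LBINT x. Im (u x) * partial_deriv i (\<lambda>x. Im (\<Psi> x $ i)) x)" for \<Psi> :: "real^'n \<Rightarrow> complex^'n" and i
  define L where "L \<Psi> = - (\<Sum>i\<in>UNIV. A \<Psi> i)" for \<Psi>
  have tst: "test_function (\<lambda>x. Re (\<Psi> x $ i))" "test_function (\<lambda>x. Im (\<Psi> x $ i))" if "\<Psi> \<in> vtest" for \<Psi> :: "real^'n \<Rightarrow> complex^'n" and i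
    using that by (auto simp: vtest_def ctest_def)
  have ir: "integrable lborel (\<lambda>x. Re (u x) * partial_deriv i f x)" "integrable lborel (\<lambda>x. Im (u x) * partial_deriv i f x)" if "test_function f" for f i
    by (intro integrable_mult_square square_integrable_Re_Im u test_function_square_integrable test_function_partial_deriv that)+
  obtain G and s :: "nat \<Rightarrow> _" where G: "square_integrable lborel G" and LG: "\<And>\<Psi>. \<Psi> \<in> vtest \<Longrightarrow> L \<Psi> = (LBINT x. G x \<bullet> \<Psi> x)"
    and GB: "(LBINT x. nsq (G x)) \<le> B"
  proof (rule Riesz_L2[where T = "vtest :: (real^'n \<Rightarrow> complex^'n) set" and L = L and B = B and M = lborel])
    show "2 * L \<Psi> \<le> B + (LBINT x. nsq (\<Psi> x))" if "\<Psi> \<in> vtest" for \<Psi>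
      using divergence_bound[OF u B B0 that] by (simp add: L_def A_def)
    show "L (\<lambda>x. f x + g x) = L f + L g" if "f \<in> vtest" "g \<in> vtest" for f g
    proof -
      have "A (\<lambda>x. f x + g x) i = A f i + A g i" for i
        using ir[OF tst(1)[OF that(1)], of i i] ir[OF tst(1)[OF that(2)], of i i] ir[OF tst(2)[OF that(1)], of i i] ir[OF tst(2)[OF that(2)], of i i]
        by (simp add: A_def partial_deriv_add[OF tst(1)[OF that(1)] tst(1)[OF that(2)]] partial_deriv_add[OF tst(2)[OF that(1)] tst(2)[OF that(2)]] distrib_left)
      then show ?thesis by (simp add: L_def sum.distrib)
    qed
    show "L (\<lambda>x. c *\<^sub>R f x) = c * L f" if "f \<in> vtest" for f c
    proof -
      have "A (\<lambda>x. c *\<^sub>R f x) i = c * A f i" for i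
        by (simp add: A_def partial_deriv_cmult[OF tst(1)[OF that]] partial_deriv_cmult[OF tst(2)[OF that]] distrib_left mult.left_commute)
      then show ?thesis by (simp add: L_def sum_distrib_left)
    qed
  qed (auto intro: vtest_square_integrable ctest_closed simp: vtest_def)
  have "wgrad u G" unfolding wgrad_def
  proof (intro conjI allI impI u G)
    fix \<psi> :: "real^'n \<Rightarrow> real" and i assume \<psi>: "test_function \<psi>"
    have i1: "integrable lborel (\<lambda>x. partial_deriv i \<psi> x *\<^sub>R u x)"
      by (intro integrable_scaleR_square test_function_square_integrable test_function_partial_deriv \<psi> u)
    have i2: "integrable lborel (\<lambda>x. \<psi> x *\<^sub>R (G x $ i))"
      by (intro integrable_scaleR_square test_function_square_integrable \<psi> square_integrable_vec_nth G)
    have pd0: "partial_deriv j (\<lambda>x. 0) x = 0" for j and x :: "real^'n"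
      using partial_deriv_eq[of "\<lambda>x::real^'n. 0::real" "\<lambda>x. 0" x j] by simp
    have comp: "G x \<bullet> axis i z = (G x $ i) \<bullet> z" for x z by (simp add: inner_axis)
    \<comment> \<open>Fields with a single component, real or purely imaginary, isolate the real and
      imaginary parts of the i-th component of \<open>G\<close>.\<close>
    have v1: "(\<lambda>x. axis i (complex_of_real (\<psi> x))) \<in> vtest" unfolding vtest_def
    proof (intro CollectI allI)
      fix j show "(\<lambda>x. axis i (complex_of_real (\<psi> x)) $ j) \<in> ctest"
        by (cases "j = i") (simp_all add: ctest_def axis_def \<psi> test_function_zero)
    qed
    have v2: "(\<lambda>x. axis i (\<i> * complex_of_real (\<psi> x))) \<in> vtest" unfolding vtest_def
    proof (intro CollectI allI)
      fix j show "(\<lambda>x. axis i (\<i> * complex_of_real (\<psi> x)) $ j) \<in> ctest"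
        by (cases "j = i") (simp_all add: ctest_def axis_def \<psi> test_function_zero)
    qed
    have "- (LBINT x. Re (u x) * partial_deriv i \<psi> x) = (LBINT x. Re (G x $ i) * \<psi> x)"
    proof -
      have "A (\<lambda>x. axis i (complex_of_real (\<psi> x))) j = (if j = i then (LBINT x. Re (u x) * partial_deriv i \<psi> x) else 0)" for j
        by (auto simp: A_def axis_def pd0)
      then show ?thesis using LG[OF v1] by (simp add: L_def comp inner_complex_def)
    qed
    moreover have "- (LBINT x. Im (u x) * partial_deriv i \<psi> x) = (LBINT x. Im (G x $ i) * \<psi> x)"
    proof -
      have "A (\<lambda>x. axis i (\<i> * complex_of_real (\<psi> x))) j = (if j = i then (LBINT x. Im (u x) * partial_deriv i \<psi> x) else 0)" for j
        by (auto simp: A_def axis_def pd0)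
      then show ?thesis using LG[OF v2] by (simp add: L_def comp inner_complex_def)
    qed
    ultimately show "(LBINT x. partial_deriv i \<psi> x *\<^sub>R u x) = - (LBINT x. \<psi> x *\<^sub>R (G x $ i))"
      using i1 i2 by (simp add: complex_eq_iff mult.commute flip: integral_Re integral_Im)
  qed
  then show ?thesis using GB by (rule that)
qed

section \<open>From Lebesgue to Borel measurability\<close>

lemma set_integrable_lebesgue_iff:
  fixes f :: "'a::euclidean_space \<Rightarrow> 'b::{banach, second_countable_topology}"
  assumes "borel_fun f" "K \<in> sets borel"
  shows "set_integrable lebesgue K f \<longleftrightarrow> set_integrable lborel K f"
  unfolding set_integrable_def using assms by (intro integrable_completion) simp

lemma integral_lebesgue_eq:
  fixes f :: "'a::euclidean_space \<Rightarrow> 'b::{banach, second_countable_topology}"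
  assumes "borel_fun f"
  shows "(\<integral>x. f x \<partial>lebesgue) = (LBINT x. f x)" using assms by (intro integral_completion) simp

lemma borel_imp_lebesgue: "f \<in> borel_measurable borel \<Longrightarrow> f \<in> borel_measurable lebesgue" by (simp add: measurable_completion)

lemma square_integrable_lebesgue_iff:
  assumes "borel_fun f"
  shows "square_integrable lebesgue f \<longleftrightarrow> square_integrable lborel f"
proof -
  have "integrable lebesgue (\<lambda>x. nsq (f x)) \<longleftrightarrow> integrable lborel (\<lambda>x. nsq (f x))"
    using assms by (intro integrable_completion) simp
  then show ?thesis using assms by (simp add: square_integrable_def borel_imp_lebesgue)
qed

lemma L2_iff: "f \<in> L2 \<longleftrightarrow> square_integrable lebesgue f" by (simp add: L2_def square_integrable_def)

lemma square_integrable_cong_AE: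
  assumes "AE x in M. f x = g x" "f \<in> borel_measurable M" "g \<in> borel_measurable M"
  shows "square_integrable M f \<longleftrightarrow> square_integrable M g"
proof -
  have [measurable]: "f \<in> borel_measurable M" "g \<in> borel_measurable M" by fact+
  have "integrable M (\<lambda>x. nsq (f x)) \<longleftrightarrow> integrable M (\<lambda>x. nsq (g x))"
    using assms(1) by (intro integrable_cong_AE) (measurable, auto)
  then show ?thesis using assms by (simp add: square_integrable_def)
qed

lemma locally_integrable_square:
  fixes f :: "real^'n \<Rightarrow> 'b::euclidean_space"
  assumes "square_integrable lebesgue f"
  shows "locally_integrable f" unfolding locally_integrable_def
proof (intro allI impI)
  fix K :: "(real^'n) set" assume "compact K"
  then have "K \<in> lmeasurable" by (rule lmeasurable_compact)
  then show "set_integrable lebesgue K f" by (intro square_integrable_set_integrable assms) (auto simp: fmeasurable_def)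
qed

lemma locally_integrable_measurable:
  fixes f :: "real^'n \<Rightarrow> 'b::{banach, second_countable_topology}"
  assumes "locally_integrable f"
  shows "f \<in> borel_measurable lebesgue"
proof (rule borel_measurable_LIMSEQ_metric)
  fix k :: nat
  have "set_integrable lebesgue (cball 0 (real k)) f" using assms by (auto simp: locally_integrable_def)
  then show "(\<lambda>x. indicator (cball 0 (real k)) x *\<^sub>R f x) \<in> borel_measurable lebesgue"
    by (simp add: set_integrable_def borel_measurable_integrable)
next
  fix x :: "real^'n"
  obtain N where N: "norm x \<le> real N" using real_arch_simple by blast
  have "\<forall>\<^sub>F k in sequentially. indicator (cball 0 (real k)) x *\<^sub>R f x = f x"
    using eventually_ge_at_top[of N] by eventually_elim (use N in auto)
  then show "(\<lambda>k. indicator (cball 0 (real k)) x *\<^sub>R f x) \<longlonglongrightarrow> f x" by (rule tendsto_eventually)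
qed

lemma integrable_test_times_locally_integrable:
  fixes g :: "real^'n \<Rightarrow> 'b::{banach, second_countable_topology}"
  assumes g: "locally_integrable g" and \<psi>: "test_function \<psi>"
  shows "integrable lebesgue (\<lambda>x. \<psi> x *\<^sub>R g x)"
proof -
  obtain C R where CR: "C \<ge> 0" "R \<ge> 0" "\<And>x. \<bar>\<psi> x\<bar> \<le> C" "\<And>x. norm x > R \<Longrightarrow> \<psi> x = 0"
    by (rule test_function_bounds[OF \<psi>]) blast
  have [measurable]: "g \<in> borel_measurable lebesgue" "\<psi> \<in> borel_measurable lebesgue"
    using locally_integrable_measurable[OF g] borel_imp_lebesgue[OF test_functionD(3)[OF \<psi>]] by auto
  have "set_integrable lebesgue (cball 0 R) g" using g by (auto simp: locally_integrable_def)
  then have "integrable lebesgue (\<lambda>x. C *\<^sub>R (indicator (cball 0 R) x *\<^sub>R g x))"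
    unfolding set_integrable_def by (rule integrable_scaleR_right)
  then show ?thesis
  proof (rule Bochner_Integration.integrable_bound)
    show "(\<lambda>x. \<psi> x *\<^sub>R g x) \<in> borel_measurable lebesgue" by measurable
    show "AE x in lebesgue. norm (\<psi> x *\<^sub>R g x) \<le> norm (C *\<^sub>R (indicator (cball 0 R) x *\<^sub>R g x))"
    proof (intro AE_I2)
      fix x
      show "norm (\<psi> x *\<^sub>R g x) \<le> norm (C *\<^sub>R (indicator (cball 0 R) x *\<^sub>R g x))"
        using CR(1) CR(3)[of x] CR(4)[of x] by (cases "norm x \<le> R") (auto intro: mult_right_mono)
    qed
  qed
qed

lemma AE_zero_of_test_integrals:
  fixes g :: "real^'n \<Rightarrow> complex"
  assumes g: "locally_integrable g"
    and zero: "\<And>\<psi>. test_function \<psi> \<Longrightarrow> (\<integral>x. \<psi> x *\<^sub>R g x \<partial>lebesgue) = 0"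
  shows "AE x in lebesgue. g x = 0"
proof -
  have gm[measurable]: "g \<in> borel_measurable lebesgue" by (rule locally_integrable_measurable[OF g])
  obtain f where f[measurable]: "borel_fun f" and fg: "AE x in lebesgue. g x = f x" using borel_representative[OF gm] by blast
  have fm[measurable]: "f \<in> borel_measurable lebesgue" by (rule borel_imp_lebesgue[OF f])
  have int: "set_integrable lborel (cbox a b) f" for a b
  proof -
    have "set_integrable lebesgue (cbox a b) g" using g by (auto simp: locally_integrable_def compact_cbox)
    moreover have "AE x in lebesgue. indicator (cbox a b) x *\<^sub>R g x = indicator (cbox a b) x *\<^sub>R f x" using fg by eventually_elim simp
    then have "set_integrable lebesgue (cbox a b) g \<longleftrightarrow> set_integrable lebesgue (cbox a b) f" unfolding set_integrable_def
      by (intro integrable_cong_AE borel_measurable_scaleR borel_measurable_indicator gm fm) auto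
    ultimately show ?thesis by (simp add: set_integrable_lebesgue_iff)
  qed
  have z: "(LBINT x. \<psi> x *\<^sub>R f x) = 0" "integrable lborel (\<lambda>x. \<psi> x *\<^sub>R f x)" if \<psi>: "test_function \<psi>" for \<psi>
  proof -
    have [measurable]: "borel_fun \<psi>" "\<psi> \<in> borel_measurable lebesgue"
      using test_functionD(3)[OF \<psi>] borel_imp_lebesgue by auto
    have ae: "AE x in lebesgue. \<psi> x *\<^sub>R g x = \<psi> x *\<^sub>R f x" using fg by eventually_elim simp
    have "(\<integral>x. \<psi> x *\<^sub>R g x \<partial>lebesgue) = (\<integral>x. \<psi> x *\<^sub>R f x \<partial>lebesgue)"
      by (rule integral_cong_AE) (measurable, rule ae)
    then show "(LBINT x. \<psi> x *\<^sub>R f x) = 0" using zero[OF \<psi>] by (simp add: integral_lebesgue_eq)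
    have "integrable lebesgue (\<lambda>x. \<psi> x *\<^sub>R g x) \<longleftrightarrow> integrable lebesgue (\<lambda>x. \<psi> x *\<^sub>R f x)"
      by (rule integrable_cong_AE) (measurable, rule ae)
    then have "integrable lebesgue (\<lambda>x. \<psi> x *\<^sub>R f x)" using integrable_test_times_locally_integrable[OF g \<psi>] by simp
    then show "integrable lborel (\<lambda>x. \<psi> x *\<^sub>R f x)" by (simp add: integrable_completion)
  qed
  have "AE x in lborel. Re (f x) = 0"
  proof (rule AE_zero_if_test_integrals_zero)
    show "set_integrable lborel (cbox a b) (\<lambda>x. Re (f x))" for a b
      using integrable_Re[OF int[of a b, unfolded set_integrable_def]] by (simp add: set_integrable_def)
    show "(LBINT x. \<psi> x * Re (f x)) = 0" if "test_function \<psi>" for \<psi> using integral_Re[OF z(2)[OF that]] z(1)[OF that] by simp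
  qed measurable
  moreover have "AE x in lborel. Im (f x) = 0"
  proof (rule AE_zero_if_test_integrals_zero)
    show "set_integrable lborel (cbox a b) (\<lambda>x. Im (f x))" for a b
      using integrable_Im[OF int[of a b, unfolded set_integrable_def]] by (simp add: set_integrable_def)
    show "(LBINT x. \<psi> x * Im (f x)) = 0" if "test_function \<psi>" for \<psi> using integral_Im[OF z(2)[OF that]] z(1)[OF that] by simp
  qed measurable
  ultimately have "AE x in lborel. f x = 0" by eventually_elim (simp add: complex_eq_iff)
  then have "AE x in lebesgue. f x = 0" by (rule AE_completion)
  with fg show ?thesis by eventually_elim simp
qed

lemma borel_measurable_vec_nth':
  assumes "(G :: _ \<Rightarrow> complex^'n) \<in> borel_measurable M"
  shows "(\<lambda>x. G x $ i) \<in> borel_measurable M"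
proof -
  have "(\<lambda>x. x $ i) \<in> borel_measurable (borel :: (complex^'n) measure)" by (intro borel_measurable_continuous_onI continuous_intros)
  from measurable_compose[OF assms this] show ?thesis .
qed

lemma locally_integrable_nth:
  fixes G :: "real^'n \<Rightarrow> complex^'n"
  assumes "locally_integrable G"
  shows "locally_integrable (\<lambda>x. G x $ i)" unfolding locally_integrable_def
proof (intro allI impI)
  fix K :: "(real^'n) set" assume K: "compact K"
  have "set_integrable lebesgue K G" using assms K by (auto simp: locally_integrable_def)
  then have "integrable lebesgue (\<lambda>x. indicator K x *\<^sub>R G x)" by (simp add: set_integrable_def)
  then have "integrable lebesgue (\<lambda>x. (indicator K x *\<^sub>R G x) $ i)" by (rule integrable_bounded_linear[OF bounded_linear_vec_nth])
  then show "set_integrable lebesgue K (\<lambda>x. G x $ i)" by (simp add: set_integrable_def)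
qed

lemma weak_gradient_unique:
  assumes G: "has_weak_gradient u G" and H: "has_weak_gradient u H"
  shows "AE x in lebesgue. G x = H x"
proof -
  have lG: "locally_integrable G" and lH: "locally_integrable H" using G H by (auto simp: has_weak_gradient_def)
  have "AE x in lebesgue. G x $ i - H x $ i = 0" for i
  proof (rule AE_zero_of_test_integrals)
    show "locally_integrable (\<lambda>x. G x $ i - H x $ i)" using locally_integrable_nth[OF lG, of i] locally_integrable_nth[OF lH, of i]
      by (auto simp: locally_integrable_def intro!: set_integral_diff(1))
    fix \<psi> :: "real^'a \<Rightarrow> real" assume \<psi>: "test_function \<psi>"
    show "(\<integral>x. \<psi> x *\<^sub>R (G x $ i - H x $ i) \<partial>lebesgue) = 0"
      using integrable_test_times_locally_integrable[OF locally_integrable_nth[OF lG] \<psi>, of i]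
        integrable_test_times_locally_integrable[OF locally_integrable_nth[OF lH] \<psi>, of i] G H \<psi>
      by (auto simp: scaleR_diff_right has_weak_gradient_def)
  qed
  then have "AE x in lebesgue. \<forall>i\<in>UNIV. G x $ i - H x $ i = 0" by (intro AE_finite_allI) auto
  then show ?thesis by eventually_elim (simp add: vec_eq_iff)
qed

lemma has_weak_gradient_iff_wgrad:
  assumes u: "borel_fun u" and G: "borel_fun G"
    and sq: "square_integrable lborel u" "square_integrable lborel G"
  shows "has_weak_gradient u G \<longleftrightarrow> wgrad u G"
proof -
  have l: "locally_integrable u" "locally_integrable G" using sq u G by (auto intro!: locally_integrable_square simp: square_integrable_lebesgue_iff)
  have "(\<integral>x. partial_deriv i \<psi> x *\<^sub>R u x \<partial>lebesgue) = (LBINT x. partial_deriv i \<psi> x *\<^sub>R u x)"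
    "(\<integral>x. \<psi> x *\<^sub>R (G x $ i) \<partial>lebesgue) = (LBINT x. \<psi> x *\<^sub>R (G x $ i))" if "test_function \<psi>" for \<psi> i
    using u borel_measurable_vec_nth'[OF G] test_functionD(3)[OF that] test_functionD(3)[OF test_function_partial_deriv[OF that]]
    by (auto intro!: integral_lebesgue_eq borel_measurable_scaleR)
  then show ?thesis using l sq by (auto simp: has_weak_gradient_def wgrad_def)
qed

lemma wgrad_measurable:
  assumes "wgrad u G"
  shows "borel_fun u" "borel_fun G" "square_integrable lborel u" "square_integrable lborel G"
  using assms by (auto simp: wgrad_def dest: square_integrableD(1))

lemma weak_gradient_integral:
  assumes w: "wgrad u G"
  shows "(\<integral>x. nsq (weak_gradient u x) \<partial>lebesgue) = (LBINT x. nsq (G x))"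
proof -
  note m = wgrad_measurable[OF w]
  have h: "has_weak_gradient u G" using has_weak_gradient_iff_wgrad[OF m] w by simp
  then have h': "has_weak_gradient u (weak_gradient u)" unfolding weak_gradient_def by (metis someI)
  have [measurable]: "weak_gradient u \<in> borel_measurable lebesgue" "G \<in> borel_measurable lebesgue"
    using h' m borel_imp_lebesgue by (auto simp: has_weak_gradient_def intro: locally_integrable_measurable)
  have ae: "AE x in lebesgue. nsq (weak_gradient u x) = nsq (G x)" using weak_gradient_unique[OF h' h] by eventually_elim simp
  have "(\<integral>x. nsq (weak_gradient u x) \<partial>lebesgue) = (\<integral>x. nsq (G x) \<partial>lebesgue)"
    by (rule integral_cong_AE) (measurable, rule ae)
  also have "\<dots> = (LBINT x. nsq (G x))" using m(2) by (intro integral_lebesgue_eq) simp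
  finally show ?thesis .
qed

text \<open>The gradient provided by \<open>H1\<close> is only Lebesgue measurable and is exchanged
  for a Borel representative.\<close>

lemma H1_iff_wgrad:
  assumes u: "borel_fun u"
  shows "u \<in> H1 \<longleftrightarrow> (\<exists>G. wgrad u G)"
proof
  assume "\<exists>G. wgrad u G"
  then obtain G where w: "wgrad u G" by blast
  note m = wgrad_measurable[OF w]
  have "has_weak_gradient u G" using has_weak_gradient_iff_wgrad[OF m] w by simp
  then show "u \<in> H1" using m by (auto simp: H1_def L2_iff square_integrable_lebesgue_iff)
next
  assume "u \<in> H1"
  then obtain G where uL: "square_integrable lebesgue u" and GL: "square_integrable lebesgue G" and h: "has_weak_gradient u G"
    by (auto simp: H1_def L2_iff)
  have Gm[measurable]: "G \<in> borel_measurable lebesgue" by (rule square_integrableD(1)[OF GL])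
  obtain H where Hb: "borel_fun H" and GH: "AE x in lebesgue. G x = H x" using borel_representative[OF Gm] by blast
  have Hm[measurable]: "H \<in> borel_measurable lebesgue" by (rule borel_imp_lebesgue[OF Hb])
  have HL: "square_integrable lebesgue H" using square_integrable_cong_AE[OF GH Gm Hm] GL by simp
  have "has_weak_gradient u H" unfolding has_weak_gradient_def
  proof (intro conjI allI impI)
    show "locally_integrable u" using h by (simp add: has_weak_gradient_def)
    show "locally_integrable H" by (rule locally_integrable_square[OF HL])
    fix \<psi> :: "real^'a \<Rightarrow> real" and i assume \<psi>: "test_function \<psi>"
    have [measurable]: "\<psi> \<in> borel_measurable lebesgue" by (rule borel_imp_lebesgue[OF test_functionD(3)[OF \<psi>]])
    have [measurable]: "(\<lambda>x. G x $ i) \<in> borel_measurable lebesgue" "(\<lambda>x. H x $ i) \<in> borel_measurable lebesgue"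
      by (intro borel_measurable_vec_nth' Gm Hm)+
    have ae: "AE x in lebesgue. \<psi> x *\<^sub>R (G x $ i) = \<psi> x *\<^sub>R (H x $ i)" using GH by eventually_elim simp
    have "(\<integral>x. \<psi> x *\<^sub>R (G x $ i) \<partial>lebesgue) = (\<integral>x. \<psi> x *\<^sub>R (H x $ i) \<partial>lebesgue)"
      by (rule integral_cong_AE) (measurable, rule ae)
    then show "(\<integral>x. partial_deriv i \<psi> x *\<^sub>R u x \<partial>lebesgue) = - (\<integral>x. \<psi> x *\<^sub>R (H x $ i) \<partial>lebesgue)"
      using h \<psi> by (simp add: has_weak_gradient_def)
  qed
  then have "wgrad u H" using has_weak_gradient_iff_wgrad[OF u Hb] uL HL u Hb by (simp add: square_integrable_lebesgue_iff)
  then show "\<exists>G. wgrad u G" by blast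
qed

text \<open>Equality of the predicates makes the choices \<open>weak_gradient u\<close> and
  \<open>weak_gradient v\<close> literally the same function.\<close>

lemma has_weak_gradient_cong_AE:
  assumes ae: "AE x in lebesgue. u x = v x" and m[measurable]: "u \<in> borel_measurable lebesgue" "v \<in> borel_measurable lebesgue"
  shows "has_weak_gradient u = has_weak_gradient v"
proof -
  have imp: "has_weak_gradient v G" if h: "has_weak_gradient u G" and ae: "AE x in lebesgue. u x = v x"
    and m[measurable]: "u \<in> borel_measurable lebesgue" "v \<in> borel_measurable lebesgue" for u v :: "real^'a \<Rightarrow> complex" and G
    unfolding has_weak_gradient_def
  proof (intro conjI allI impI)
    show "locally_integrable G" using h by (simp add: has_weak_gradient_def)
    show "locally_integrable v" unfolding locally_integrable_def
    proof (intro allI impI)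
      fix K :: "(real^'a) set" assume K: "compact K"
      then have [measurable]: "K \<in> sets lebesgue" using lmeasurable_compact by auto
      have "set_integrable lebesgue K u" using h K by (auto simp: has_weak_gradient_def locally_integrable_def)
      moreover have "AE x in lebesgue. indicator K x *\<^sub>R u x = indicator K x *\<^sub>R v x" using ae by eventually_elim simp
      then have "set_integrable lebesgue K u \<longleftrightarrow> set_integrable lebesgue K v"
        unfolding set_integrable_def by (intro integrable_cong_AE) measurable
      ultimately show "set_integrable lebesgue K v" by simp
    qed
    fix \<psi> :: "real^'a \<Rightarrow> real" and i assume \<psi>: "test_function \<psi>"
    have [measurable]: "partial_deriv i \<psi> \<in> borel_measurable lebesgue"
      by (rule borel_imp_lebesgue[OF test_functionD(3)[OF test_function_partial_deriv[OF \<psi>]]])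
    have ae': "AE x in lebesgue. partial_deriv i \<psi> x *\<^sub>R u x = partial_deriv i \<psi> x *\<^sub>R v x" using ae by eventually_elim simp
    have "(\<integral>x. partial_deriv i \<psi> x *\<^sub>R u x \<partial>lebesgue) = (\<integral>x. partial_deriv i \<psi> x *\<^sub>R v x \<partial>lebesgue)"
      by (rule integral_cong_AE) (measurable, rule ae')
    then show "(\<integral>x. partial_deriv i \<psi> x *\<^sub>R v x \<partial>lebesgue) = - (\<integral>x. \<psi> x *\<^sub>R (G x $ i) \<partial>lebesgue)"
      using h \<psi> by (simp add: has_weak_gradient_def)
  qed
  have ae': "AE x in lebesgue. v x = u x" using ae by eventually_elim simp
  show ?thesis using imp[OF _ ae m] imp[OF _ ae' m(2,1)] by blast
qed

section \<open>The energy space and its functionals\<close>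

definition mass :: "(real^'n \<Rightarrow> complex) \<Rightarrow> real" where
  "mass u = (LBINT x. nsq (u x))"

definition moment :: "(real^'n \<Rightarrow> complex) \<Rightarrow> real" where
  "moment u = (LBINT x. nsq x * nsq (u x))"

text \<open>\<open>weak_gradient u\<close> is an arbitrary choice in its class and may fail to be
  Borel measurable, hence the integral over \<open>lebesgue\<close>.\<close>

definition dirichlet :: "(real^'n \<Rightarrow> complex) \<Rightarrow> real" where
  "dirichlet u = (\<integral>x. nsq (weak_gradient u x) \<partial>lebesgue)"

text \<open>The Borel measurable elements of \<^const>\<open>Sigma_space\<close>.\<close>

definition bsigma :: "(real^'n \<Rightarrow> complex) set" where
  "bsigma = {u. (\<exists>G. wgrad u G) \<and> square_integrable lborel (\<lambda>x. norm x *\<^sub>R u x)}"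

lemma mass_nonneg: "mass u \<ge> 0" and moment_nonneg: "moment u \<ge> 0" and dirichlet_nonneg: "dirichlet u \<ge> 0"
  by (auto simp: mass_def moment_def dirichlet_def intro!: integral_nonneg_AE)

lemma dirichlet_eq: "wgrad u G \<Longrightarrow> dirichlet u = (LBINT x. nsq (G x))" unfolding dirichlet_def by (rule weak_gradient_integral)

lemma bsigmaE:
  assumes "u \<in> bsigma"
  obtains G where "wgrad u G" "dirichlet u = (LBINT x. nsq (G x))" using assms dirichlet_eq by (auto simp: bsigma_def)

lemma bsigmaD:
  assumes "u \<in> bsigma"
  shows "borel_fun u" "square_integrable lborel u" "square_integrable lborel (\<lambda>x. norm x *\<^sub>R u x)"
  using assms by (auto simp: bsigma_def dest: wgrad_measurable)

lemma grad_bound_dirichlet: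
  assumes "u \<in> bsigma"
  shows "grad_bound u (dirichlet u)"
proof -
  obtain G where G: "wgrad u G" "dirichlet u = (LBINT x. nsq (G x))" by (rule bsigmaE[OF assms])
  show ?thesis using grad_bound_of_wgrad[OF G(1)] by (simp add: G(2))
qed

text \<open>How limits, folded functions and polarized functions enter the space: for these only the
  averages of translation differences are controlled.\<close>

lemma bsigma_of_grad_bound:
  assumes "square_integrable lborel u" "square_integrable lborel (\<lambda>x. norm x *\<^sub>R u x)" "grad_bound u B" "B \<ge> 0"
  shows "u \<in> bsigma" "dirichlet u \<le> B"
proof -
  obtain G where G: "wgrad u G" "(LBINT x. nsq (G x)) \<le> B" by (rule wgrad_of_grad_bound[OF assms(1,3,4)]) blast
  show "u \<in> bsigma" using G assms by (auto simp: bsigma_def)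
  show "dirichlet u \<le> B" using G by (simp add: dirichlet_eq[OF G(1)])
qed

lemma dirdiv_norm_le: "norm (dirdiv h z) \<le> norm h * norm z"
proof -
  have "norm (dirdiv h z) \<le> (\<Sum>i\<in>UNIV. \<bar>h $ i\<bar> * norm (z $ i))" unfolding dirdiv_def by (rule order_trans[OF norm_sum]) simp
  also have "\<dots> \<le> L2_set (\<lambda>i. h $ i) UNIV * L2_set (\<lambda>i. norm (z $ i)) UNIV"
    using L2_set_mult_ineq[of "\<lambda>i. h $ i" "\<lambda>i. norm (z $ i)" UNIV] by simp
  finally show ?thesis by (simp add: norm_vec_def real_norm_def L2_set_def)
qed

lemma transl_sq_le_dirichlet:
  assumes "u \<in> bsigma"
  shows "transl_sq h u \<le> ennreal (nsq h * dirichlet u)"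
proof -
  obtain G where G: "wgrad u G" "dirichlet u = (LBINT x. nsq (G x))" by (rule bsigmaE[OF assms])
  note m = wgrad_measurable[OF G(1)]
  have "(LBINT x. nsq (u (x + h) - u x)) \<le> (LBINT x. nsq (dirdiv h (G x)))" by (rule translation_bound[OF G(1)])
  also have "\<dots> \<le> (LBINT x. nsq h * nsq (G x))"
  proof (rule integral_mono)
    show "integrable lborel (\<lambda>x. nsq (dirdiv h (G x)))" by (rule square_integrableD(2)[OF square_integrable_dirdiv[OF m(4)]])
    show "integrable lborel (\<lambda>x. nsq h * nsq (G x))" by (intro integrable_mult_right square_integrableD(2)[OF m(4)])
    show "nsq (dirdiv h (G x)) \<le> nsq h * nsq (G x)" for x using dirdiv_norm_le[of h "G x"] by (simp flip: power_mult_distrib)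
  qed
  also have "\<dots> = nsq h * dirichlet u" by (simp add: G(2))
  finally show ?thesis unfolding transl_sq_eq[OF m(3)] by (rule ennreal_leI)
qed

lemma wgrad_add:
  assumes u: "wgrad u G" and v: "wgrad v H"
  shows "wgrad (\<lambda>x. u x + v x) (\<lambda>x. G x + H x)" unfolding wgrad_def
proof (intro conjI allI impI)
  note mu = wgrad_measurable[OF u] and mv = wgrad_measurable[OF v]
  show "square_integrable lborel (\<lambda>x. u x + v x)" "square_integrable lborel (\<lambda>x. G x + H x)"
    using mu mv by (auto intro: square_integrable_add)
  fix \<psi> :: "real^'a \<Rightarrow> real" and i assume \<psi>: "test_function \<psi>"
  note sq = test_function_square_integrable[OF \<psi>] test_function_square_integrable[OF test_function_partial_deriv[OF \<psi>]]
  have "integrable lborel (\<lambda>x. partial_deriv i \<psi> x *\<^sub>R u x)" "integrable lborel (\<lambda>x. partial_deriv i \<psi> x *\<^sub>R v x)"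
    "integrable lborel (\<lambda>x. \<psi> x *\<^sub>R (G x $ i))" "integrable lborel (\<lambda>x. \<psi> x *\<^sub>R (H x $ i))"
    by (intro integrable_scaleR_square sq square_integrable_vec_nth mu mv)+
  then show "(LBINT x. partial_deriv i \<psi> x *\<^sub>R (u x + v x)) = - (LBINT x. \<psi> x *\<^sub>R ((G x + H x) $ i))"
    using u v \<psi> by (simp add: wgrad_def scaleR_add_right)
qed

lemma square_integrable_cmult:
  fixes f :: "'a \<Rightarrow> complex"
  assumes "square_integrable M f"
  shows "square_integrable M (\<lambda>x. c * f x)" using assms by (auto simp: square_integrable_def norm_mult power_mult_distrib)

lemma wgrad_cmult:
  assumes u: "wgrad u G"
  shows "wgrad (\<lambda>x. c * u x) (\<lambda>x. \<chi> i. c * G x $ i)"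
    "(LBINT x. nsq (\<chi> i. c * G x $ i)) = nsq c * (LBINT x. nsq (G x))"
proof -
  note mu = wgrad_measurable[OF u]
  have nrm: "nsq (\<chi> i. c * z $ i) = nsq c * nsq z" for z :: "complex^'a"
    by (simp add: norm_vec_def L2_set_def norm_mult power_mult_distrib sum_distrib_left sum_nonneg)
  then show n: "(LBINT x. nsq (\<chi> i. c * G x $ i)) = nsq c * (LBINT x. nsq (G x))" by simp
  have "borel_fun (\<lambda>z. (\<chi> i. c * z $ i) :: complex^'a)"
    by (intro borel_measurable_continuous_onI continuous_on_vec_lambda continuous_intros)
  from measurable_compose[OF mu(2) this]
  have m: "borel_fun (\<lambda>x. (\<chi> i. c * G x $ i) :: complex^'a)" .
  show "wgrad (\<lambda>x. c * u x) (\<lambda>x. \<chi> i. c * G x $ i)" unfolding wgrad_def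
  proof (intro conjI allI impI)
    show "square_integrable lborel (\<lambda>x. c * u x)" by (rule square_integrable_cmult[OF mu(3)])
    show "square_integrable lborel (\<lambda>x. (\<chi> i. c * G x $ i) :: complex^'a)"
      using m square_integrableD(2)[OF mu(4)] by (simp add: square_integrable_def nrm)
    fix \<psi> :: "real^'a \<Rightarrow> real" and i assume \<psi>: "test_function \<psi>"
    have "(LBINT x. partial_deriv i \<psi> x *\<^sub>R (c * u x)) = c * (LBINT x. partial_deriv i \<psi> x *\<^sub>R u x)"
      by (simp add: mult_scaleR_right[symmetric] del: mult_scaleR_right)
    also have "\<dots> = - (c * (LBINT x. \<psi> x *\<^sub>R (G x $ i)))" using u \<psi> by (simp add: wgrad_def)
    also have "c * (LBINT x. \<psi> x *\<^sub>R (G x $ i)) = (LBINT x. \<psi> x *\<^sub>R (c * G x $ i))"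
      by (simp add: mult_scaleR_right[symmetric] del: mult_scaleR_right)
    finally show "(LBINT x. partial_deriv i \<psi> x *\<^sub>R (c * u x)) = - (LBINT x. \<psi> x *\<^sub>R ((\<chi> i. c * G x $ i) $ i))" by simp
  qed
qed

lemma bsigma_cmult:
  assumes "u \<in> bsigma"
  shows "(\<lambda>x. c * u x) \<in> bsigma" "dirichlet (\<lambda>x. c * u x) = nsq c * dirichlet u"
    "mass (\<lambda>x. c * u x) = nsq c * mass u" "moment (\<lambda>x. c * u x) = nsq c * moment u"
proof -
  obtain G where G: "wgrad u G" "dirichlet u = (LBINT x. nsq (G x))" by (rule bsigmaE[OF assms])
  note w = wgrad_cmult[OF G(1), of c]
  show "dirichlet (\<lambda>x. c * u x) = nsq c * dirichlet u" using w(2) by (simp add: dirichlet_eq[OF w(1)] G(2))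
  have "square_integrable lborel (\<lambda>x. norm x *\<^sub>R (c * u x))" using square_integrable_cmult[OF bsigmaD(3)[OF assms], of c] by simp
  then show "(\<lambda>x. c * u x) \<in> bsigma" using w(1) by (auto simp: bsigma_def)
  show "mass (\<lambda>x. c * u x) = nsq c * mass u" "moment (\<lambda>x. c * u x) = nsq c * moment u"
    by (simp_all add: mass_def moment_def norm_mult power_mult_distrib mult.left_commute)
qed

lemma bsigma_add:
  assumes u: "u \<in> bsigma" and v: "v \<in> bsigma"
  shows "(\<lambda>x. u x + v x) \<in> bsigma" "dirichlet (\<lambda>x. u x + v x) \<le> 2 * dirichlet u + 2 * dirichlet v"
    "mass (\<lambda>x. u x + v x) \<le> 2 * mass u + 2 * mass v"
proof -
  obtain G where G: "wgrad u G" "dirichlet u = (LBINT x. nsq (G x))" by (rule bsigmaE[OF u])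
  obtain H where H: "wgrad v H" "dirichlet v = (LBINT x. nsq (H x))" by (rule bsigmaE[OF v])
  have w: "wgrad (\<lambda>x. u x + v x) (\<lambda>x. G x + H x)" by (rule wgrad_add[OF G(1) H(1)])
  have le: "(LBINT x. nsq (f x + g x)) \<le> 2 * (LBINT x. nsq (f x)) + 2 * (LBINT x. nsq (g x))"
    if f: "square_integrable lborel f" and g: "square_integrable lborel g" for f g :: "real^'a \<Rightarrow> 'c::euclidean_space"
  proof -
    have "(LBINT x. nsq (f x + g x)) \<le> (LBINT x. 2 * nsq (f x) + 2 * nsq (g x))"
      using square_integrableD(2)[OF f] square_integrableD(2)[OF g] square_integrableD(2)[OF square_integrable_add[OF f g]]
      by (intro integral_mono norm_add_sq_le) auto
    then show ?thesis using square_integrableD(2)[OF f] square_integrableD(2)[OF g] by simp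
  qed
  show "dirichlet (\<lambda>x. u x + v x) \<le> 2 * dirichlet u + 2 * dirichlet v"
    unfolding dirichlet_eq[OF w] G(2) H(2) using wgrad_measurable[OF G(1)] wgrad_measurable[OF H(1)] by (intro le) auto
  show "mass (\<lambda>x. u x + v x) \<le> 2 * mass u + 2 * mass v" unfolding mass_def using bsigmaD[OF u] bsigmaD[OF v] by (intro le) auto
  have "square_integrable lborel (\<lambda>x. norm x *\<^sub>R (u x + v x))"
    using square_integrable_add[OF bsigmaD(3)[OF u] bsigmaD(3)[OF v]] by (simp add: scaleR_add_right)
  then show "(\<lambda>x. u x + v x) \<in> bsigma" using w by (auto simp: bsigma_def)
qed

subsection \<open>The spectral gap of the harmonic oscillator\<close>

text \<open>The uncertainty inequality comes from computing \<open>\<integral> x\<^sub>i \<bar>u\<bar>\<^sup>2\<close> for a translate of \<open>u\<close> in the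
  direction \<open>x\<^sub>i\<close> in two ways.\<close>

lemma uncertainty_component:
  fixes u :: "real^'n \<Rightarrow> complex"
  assumes w: "wgrad u G" and xu: "square_integrable lborel (\<lambda>x. norm x *\<^sub>R u x)"
  shows "(mass u)^2 \<le> 4 * (LBINT x. nsq (G x $ i)) * (LBINT x. (x $ i)^2 * nsq (u x))"
proof -
  note m = wgrad_measurable[OF w]
  have um[measurable]: "borel_fun u" by (rule m)
  have xi[measurable]: "borel_fun (\<lambda>x::real^'n. x $ i)" by (intro borel_measurable_continuous_onI continuous_intros)
  define q where "q x = x $ i *\<^sub>R u x" for x
  have qm[measurable]: "borel_fun q" unfolding q_def by measurable
  have q: "square_integrable lborel q"
  proof (rule square_integrable_bound[OF xu, where c = 1])
    show "AE x in lborel. norm (q x) \<le> 1 * norm (norm x *\<^sub>R u x)"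
      unfolding q_def by (intro AE_I2) (auto intro!: mult_right_mono component_le_norm_cart)
  qed simp
  define g where "g = (LBINT x. nsq (G x $ i))"
  define X where "X = (LBINT x. nsq (q x))"
  define Y where "Y = (LBINT x. q x \<bullet> u x)"
  have step: "(mass u)^2 \<le> g * (4 * X - 4 * t * Y + 2 * t^2 * mass u)" if t: "t > 0" for t
  proof -
    define e where "e = (t *\<^sub>R axis i 1 :: real^'n)"
    define d where "d x = u (x + e) - u x" for x
    define qt where "qt x = q (x + e) - t *\<^sub>R u (x + e)" for x
    have sqt: "square_integrable lborel (\<lambda>x. q x - t *\<^sub>R u x)" by (intro square_integrable_diff square_integrable_scaleR q m)
    have qt_eq: "qt x = x $ i *\<^sub>R u (x + e)" for x by (simp add: qt_def q_def e_def algebra_simps)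
    have dsq: "square_integrable lborel d" unfolding d_def by (intro square_integrable_diff square_integrable_translate m)
    have qtsq: "square_integrable lborel qt" using square_integrable_translate[OF sqt, of e] unfolding qt_def[abs_def] .
    have ut: "square_integrable lborel (\<lambda>x. u (x + e))" by (intro square_integrable_translate m)
    have d2: "(LBINT x. nsq (d x)) \<le> t^2 * g"
    proof -
      have "dirdiv e z = t *\<^sub>R (z $ i)" for z :: "complex^'n"
      proof -
        have "dirdiv e z = (\<Sum>j\<in>UNIV. if j = i then t *\<^sub>R (z $ i) else 0)"
          unfolding dirdiv_def by (rule sum.cong) (auto simp: e_def axis_def)
        then show ?thesis by simp
      qed
      then show ?thesis using translation_bound[OF w, of e] by (simp add: d_def g_def power_mult_distrib)
    qed
    have qt2: "(LBINT x. nsq (qt x)) = X - 2 * t * Y + t^2 * mass u"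
    proof -
      have "(LBINT x. nsq (qt x)) = (LBINT x. nsq (q x - t *\<^sub>R u x))" unfolding qt_def using integral_norm_sq_translate[OF sqt, of e] by simp
      also have "\<dots> = (LBINT x. nsq (q x + (- t) *\<^sub>R u x))" by simp
      also have "\<dots> = X - 2 * t * Y + t^2 * mass u"
        by (subst integral_norm_add_sq[OF q square_integrable_scaleR[OF m(3)]]) (simp add: X_def Y_def mass_def power_mult_distrib)
      finally show ?thesis .
    qed
    have "(LBINT x. u (x + e) \<bullet> qt x) = (LBINT x. u x \<bullet> (q x - t *\<^sub>R u x))"
      unfolding qt_def by (rule integral_lborel_translate) measurable
    also have "\<dots> = Y - t * mass u" using integrable_inner_square[OF m(3) q] integrable_inner_square[OF m(3) m(3)]
      by (simp add: inner_diff_right Y_def mass_def inner_commute power2_norm_eq_inner)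
    finally have a: "(LBINT x. u (x + e) \<bullet> qt x) = Y - t * mass u" .
    \<comment> \<open>The left side is \<open>x $ i\<close> times the increment of the squared
      modulus of \<open>u\<close> from \<open>x\<close> to \<open>x + e\<close>. A shift of the
      variable makes its integral \<open>- t * mass u\<close>.\<close>
    have pt: "d x \<bullet> (q x + qt x) = u (x + e) \<bullet> qt x - q x \<bullet> u x" for x
      by (simp add: d_def qt_eq q_def inner_diff_left inner_add_right algebra_simps inner_commute)
    have "(LBINT x. d x \<bullet> (q x + qt x)) = - t * mass u"
      unfolding pt using integrable_inner_square[OF ut qtsq] integrable_inner_square[OF q m(3)] a by (simp add: Y_def)
    then have "(t * mass u)^2 \<le> (LBINT x. nsq (d x)) * (LBINT x. nsq (q x + qt x))"
      using integral_inner_CS[OF dsq square_integrable_add[OF q qtsq]] by simp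
    also have "\<dots> \<le> (t^2 * g) * (2 * X + 2 * (X - 2 * t * Y + t^2 * mass u))"
    proof (rule mult_mono[OF d2])
      have "(LBINT x. nsq (q x + qt x)) \<le> (LBINT x. 2 * nsq (q x) + 2 * nsq (qt x))"
        using square_integrableD(2)[OF q] square_integrableD(2)[OF qtsq] square_integrableD(2)[OF square_integrable_add[OF q qtsq]]
        by (intro integral_mono norm_add_sq_le) auto
      then show "(LBINT x. nsq (q x + qt x)) \<le> 2 * X + 2 * (X - 2 * t * Y + t^2 * mass u)"
        using square_integrableD(2)[OF q] square_integrableD(2)[OF qtsq] by (simp add: X_def qt2[unfolded X_def])
      show "0 \<le> t^2 * g" unfolding g_def by (intro mult_nonneg_nonneg integral_nonneg_AE) auto
      show "0 \<le> (LBINT x. nsq (q x + qt x))" by (rule integral_nonneg_AE) auto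
    qed
    finally have "t^2 * (mass u)^2 \<le> t^2 * (g * (4 * X - 4 * t * Y + 2 * t^2 * mass u))" by (simp add: algebra_simps power_mult_distrib)
    then show ?thesis using t by simp
  qed
  have "(mass u)^2 \<le> g * (4 * X)"
  proof (rule tendsto_lowerbound[of "\<lambda>t. g * (4 * X - 4 * t * Y + 2 * t^2 * mass u)" _ "at_right 0"])
    have "((\<lambda>t. g * (4 * X - 4 * t * Y + 2 * t^2 * mass u)) \<longlongrightarrow> g * (4 * X - 4 * 0 * Y + 2 * 0^2 * mass u)) (at_right 0)"
      by (intro tendsto_intros)
    then show "((\<lambda>t. g * (4 * X - 4 * t * Y + 2 * t^2 * mass u)) \<longlongrightarrow> g * (4 * X)) (at_right 0)" by simp
    show "\<forall>\<^sub>F t in at_right 0. (mass u)^2 \<le> g * (4 * X - 4 * t * Y + 2 * t^2 * mass u)"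
      unfolding eventually_at_right_field using step by (intro exI[of _ 1]) auto
  qed simp
  moreover have "X = (LBINT x. (x $ i)^2 * nsq (u x))" by (simp add: X_def q_def power_mult_distrib)
  ultimately show ?thesis by (simp add: g_def mult.left_commute)
qed

text \<open>The arithmetic-geometric mean inequality turns each one-dimensional uncertainty
  inequality into \<open>\<gamma> * mass u <= g i + \<gamma>^2 * X i\<close>; summation over the
  coordinates produces the lowest eigenvalue of the oscillator.\<close>

lemma spectral_gap:
  fixes u :: "real^'n \<Rightarrow> complex"
  assumes u: "u \<in> bsigma" and \<gamma>: "\<gamma> > 0"
  shows "\<gamma> * real CARD('n) * mass u \<le> dirichlet u + \<gamma>^2 * moment u"
proof -
  obtain G where G: "wgrad u G" "dirichlet u = (LBINT x. nsq (G x))" by (rule bsigmaE[OF u])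
  note m = wgrad_measurable[OF G(1)] bsigmaD[OF u]
  have um[measurable]: "borel_fun u" by (rule m)
  define g where "g i = (LBINT x. nsq (G x $ i))" for i
  define X where "X i = (LBINT x. (x $ i)^2 * nsq (u x))" for i
  have comp: "\<gamma> * mass u \<le> g i + \<gamma>^2 * X i" for i
  proof -
    have nn: "0 \<le> g i" "0 \<le> X i" by (auto simp: g_def X_def intro!: integral_nonneg_AE)
    have "(mass u)^2 \<le> 4 * g i * X i" unfolding g_def X_def by (rule uncertainty_component[OF G(1) m(7)])
    then have "\<gamma>^2 * (mass u)^2 \<le> \<gamma>^2 * (4 * g i * X i)" by (intro mult_left_mono) auto
    also have "\<dots> \<le> (g i + \<gamma>^2 * X i)^2"
    proof -
      have "0 \<le> (g i - \<gamma>^2 * X i)^2" by simp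
      then show ?thesis by (simp add: power2_sum power2_diff algebra_simps)
    qed
    finally have "(\<gamma> * mass u)^2 \<le> (g i + \<gamma>^2 * X i)^2" by (simp add: power_mult_distrib)
    then show ?thesis by (rule power2_le_imp_le) (use nn in auto)
  qed
  have "\<gamma> * real CARD('n) * mass u = (\<Sum>i\<in>(UNIV::'n set). \<gamma> * mass u)" by simp
  also have "\<dots> \<le> (\<Sum>i\<in>UNIV. g i + \<gamma>^2 * X i)" by (intro sum_mono comp)
  also have "\<dots> = (\<Sum>i\<in>UNIV. g i) + \<gamma>^2 * (\<Sum>i\<in>UNIV. X i)" by (simp add: sum.distrib sum_distrib_left)
  also have "(\<Sum>i\<in>UNIV. g i) = dirichlet u" unfolding G(2) g_def by (subst Bochner_Integration.integral_sum[symmetric])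
       (auto intro: square_integrableD(2)[OF square_integrable_vec_nth[OF m(4)]] simp: norm_vec_def L2_set_def sum_nonneg)
  also have "(\<Sum>i\<in>UNIV. X i) = moment u"
  proof -
    have "integrable lborel (\<lambda>x. (x $ i)^2 * nsq (u x))" for i
    proof -
      have "square_integrable lborel (\<lambda>x. x $ i *\<^sub>R u x)"
      proof (rule square_integrable_bound[OF m(7), where c = 1])
        show "AE x in lborel. norm (x $ i *\<^sub>R u x) \<le> 1 * norm (norm x *\<^sub>R u x)"
          by (intro AE_I2) (auto intro!: mult_right_mono component_le_norm_cart)
      qed (auto intro!: borel_measurable_scaleR borel_measurable_continuous_onI continuous_intros)
      from square_integrableD(2)[OF this] show ?thesis by (simp add: power_mult_distrib)
    qed
    then have "(\<Sum>i\<in>UNIV. X i) = (LBINT x. (\<Sum>i\<in>UNIV. (x $ i)^2 * nsq (u x)))"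
      unfolding X_def by (intro Bochner_Integration.integral_sum[symmetric])
    also have "\<dots> = moment u"
    proof -
      have "nsq x = (\<Sum>i\<in>UNIV. (x $ i)^2)" for x :: "real^'n" by (simp add: norm_vec_def L2_set_def sum_nonneg)
      then show ?thesis unfolding moment_def by (simp add: sum_distrib_right)
    qed
    finally show ?thesis .
  qed
  finally show ?thesis .
qed

subsection \<open>Averages over dyadic cubes\<close>

definition cube_idx :: "nat \<Rightarrow> real^'n \<Rightarrow> int^'n" where
  "cube_idx k x = (\<chi> i. \<lfloor>2^k * x $ i\<rfloor>)"

definition cube :: "nat \<Rightarrow> int^'n \<Rightarrow> (real^'n) set" where
  "cube k m = {y. cube_idx k y = m}"

definition cube_coef :: "nat \<Rightarrow> (real^'n \<Rightarrow> complex) \<Rightarrow> int^'n \<Rightarrow> complex" where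
  "cube_coef k u m = (LBINT y. indicator (cube k m) y *\<^sub>R u y)"

definition cube_avg :: "nat \<Rightarrow> (real^'n \<Rightarrow> complex) \<Rightarrow> real^'n \<Rightarrow> complex" where
  "cube_avg k u x = (2^k)^CARD('n) *\<^sub>R cube_coef k u (cube_idx k x)"

lemma cube_idx_eq_iff: "cube_idx k x = cube_idx k y \<longleftrightarrow> (\<forall>i. \<lfloor>2^k * x $ i\<rfloor> = \<lfloor>2^k * y $ i\<rfloor>)"
  by (simp add: cube_idx_def vec_eq_iff)

lemma borel_measurable_component [measurable (raw)]:
  assumes "f \<in> borel_measurable M"
  shows "(\<lambda>x. (f x :: real^'n) $ i) \<in> borel_measurable M"
proof -
  have "borel_fun (\<lambda>x::real^'n. x $ i)" by (intro borel_measurable_continuous_onI continuous_intros)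
  from measurable_compose[OF assms this] show ?thesis .
qed

text \<open>The indicator of a cube as a kernel in two points. It is jointly measurable, which
  Tonelli requires, because it is a product over the coordinates.\<close>

definition same_cube :: "nat \<Rightarrow> real^'n \<Rightarrow> real^'n \<Rightarrow> real" where
  "same_cube k x y = indicator (cube k (cube_idx k x)) y"

lemma same_cube_eq_prod: "same_cube k x y = (\<Prod>i\<in>UNIV. indicator {z. \<lfloor>fst z\<rfloor> = \<lfloor>snd z\<rfloor>} (2^k * x $ i, 2^k * y $ i))"
proof (cases "cube_idx k x = cube_idx k y")
  case True
  then show ?thesis by (simp add: same_cube_def cube_def cube_idx_eq_iff)
next
  case False
  then obtain i where "\<lfloor>2^k * x $ i\<rfloor> \<noteq> \<lfloor>2^k * y $ i\<rfloor>" by (auto simp: cube_idx_eq_iff)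
  then have "(\<Prod>i\<in>UNIV. indicator {z. \<lfloor>fst z\<rfloor> = \<lfloor>snd z\<rfloor>} (2^k * x $ i, 2^k * y $ i)) = (0::real)"
    by (intro prod_zero bexI[of _ i]) auto
  moreover have "same_cube k x y = 0" using False by (auto simp: same_cube_def cube_def)
  ultimately show ?thesis by simp
qed

lemma floor_eq_set_borel [measurable]: "{z::real\<times>real. \<lfloor>fst z\<rfloor> = \<lfloor>snd z\<rfloor>} \<in> sets borel"
proof -
  have "{z \<in> space (borel \<Otimes>\<^sub>M borel). real_of_int \<lfloor>fst z\<rfloor> = real_of_int \<lfloor>snd z\<rfloor>} \<in> sets (borel \<Otimes>\<^sub>M borel :: (real \<times> real) measure)"
    by measurable
  then show ?thesis unfolding borel_prod by simp
qed

lemma same_cube_measurable [measurable (raw)]: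
  assumes f: "f \<in> borel_measurable M" and g: "g \<in> borel_measurable M"
  shows "(\<lambda>x. same_cube k (f x) (g x)) \<in> borel_measurable M" unfolding same_cube_eq_prod
proof (intro borel_measurable_prod)
  fix i
  have "(\<lambda>x. (2^k * f x $ i, 2^k * g x $ i)) \<in> borel_measurable M" using f g by measurable
  from measurable_compose[OF this borel_measurable_indicator[OF floor_eq_set_borel]]
  show "(\<lambda>x. indicator {z. \<lfloor>fst z\<rfloor> = \<lfloor>snd z\<rfloor>} (2^k * f x $ i, 2^k * g x $ i) :: real) \<in> borel_measurable M" .
qed

lemma same_cube_sym: "same_cube k x y = same_cube k y x" by (auto simp: same_cube_def cube_def indicator_def)

lemma cube_borel [measurable]: "cube k m \<in> sets borel"
proof -
  have "cube k m = {y\<in>space borel. \<forall>i\<in>UNIV. real_of_int \<lfloor>2^k * y $ i\<rfloor> = real_of_int (m $ i)}"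
    by (auto simp: cube_def cube_idx_def vec_eq_iff)
  also have "\<dots> \<in> sets borel" by measurable
  finally show ?thesis .
qed

lemma cube_measure:
  fixes m :: "int^'n::finite"
  shows "emeasure lborel (cube k m) = ennreal ((1 / 2^k)^CARD('n))" "measure lborel (cube k m) = (1 / 2^k)^CARD('n)"
proof -
  let ?a = "(\<chi> i. real_of_int (m $ i) / 2^k) :: real^'n" and ?b = "(\<chi> i. (real_of_int (m $ i) + 1) / 2^k) :: real^'n"
  have sub: "box ?a ?b \<subseteq> cube k m" "cube k m \<subseteq> cbox ?a ?b"
    by (auto simp: mem_box_cart cube_def cube_idx_def vec_eq_iff field_simps floor_eq_iff less_imp_le)
  have ne: "cbox ?a ?b \<noteq> {}" by (auto simp: interval_ne_empty_cart divide_right_mono)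
  have "measure lborel (cbox ?a ?b) = (\<Prod>i\<in>(UNIV::'n set). ?b $ i - ?a $ i)" using content_cbox_cart[OF ne] by simp
  also have "\<dots> = (1 / 2^k)^CARD('n)" by (simp add: diff_divide_distrib[symmetric])
  finally have mc: "measure lborel (cbox ?a ?b) = (1 / 2^k)^CARD('n)" .
  have c: "emeasure lborel (cbox ?a ?b) = ennreal ((1 / 2^k)^CARD('n))"
    using emeasure_lborel_cbox_finite[of ?a ?b] mc emeasure_eq_ennreal_measure[of lborel "cbox ?a ?b"] by auto
  have "emeasure lborel (box ?a ?b) = emeasure lborel (cbox ?a ?b)" by (simp add: emeasure_lborel_box_eq emeasure_lborel_cbox_eq)
  then have "emeasure lborel (cbox ?a ?b) \<le> emeasure lborel (cube k m)" using emeasure_mono[OF sub(1), of lborel] by simp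
  moreover have "emeasure lborel (cube k m) \<le> emeasure lborel (cbox ?a ?b)" using sub(2) by (intro emeasure_mono) auto
  ultimately show e: "emeasure lborel (cube k m) = ennreal ((1 / 2^k)^CARD('n))" using c by (simp add: antisym)
  show "measure lborel (cube k m) = (1 / 2^k)^CARD('n)" using e by (simp add: measure_def)
qed

lemma cube_diam:
  fixes x y :: "real^'n"
  assumes "cube_idx k x = cube_idx k y"
  shows "norm (x - y) \<le> real CARD('n) / 2^k"
proof -
  have "\<bar>(x - y) $ i\<bar> \<le> 1 / 2^k" for i
  proof -
    have "\<lfloor>2^k * x $ i\<rfloor> = \<lfloor>2^k * y $ i\<rfloor>" using assms by (simp add: cube_idx_eq_iff)
    then have "\<bar>2^k * x $ i - 2^k * y $ i\<bar> \<le> 1" by linarith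
    then have "\<bar>2^k * (x - y) $ i\<bar> \<le> 1" by (simp add: right_diff_distrib)
    then have "\<bar>(x - y) $ i\<bar> * 2^k \<le> 1" by (simp add: abs_mult mult.commute)
    then show ?thesis by (simp add: pos_le_divide_eq)
  qed
  then have "(\<Sum>i\<in>UNIV. \<bar>(x - y) $ i\<bar>) \<le> (\<Sum>i\<in>(UNIV::'n set). 1 / 2^k)" by (intro sum_mono)
  then show ?thesis using norm_le_l1_cart[of "x - y"] by simp
qed

lemma cube_avg_measurable [measurable]:
  assumes [measurable]: "borel_fun u"
  shows "borel_fun (cube_avg k u)"
proof -
  have "borel_fun (\<lambda>x. LBINT y. same_cube k x y *\<^sub>R u y)" by measurable
  then show ?thesis unfolding cube_avg_def[abs_def] cube_coef_def same_cube_def by measurable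
qed

text \<open>Jensen's inequality on the cube of \<open>x\<close>; the factor is the inverse of its
  volume. The value \<open>c\<close> is free: it will be \<open>0\<close>, \<open>u x\<close>, or an
  average over a coarser cube.\<close>

lemma cube_average_le:
  fixes u :: "real^'n \<Rightarrow> complex"
  assumes u: "square_integrable lborel u"
  shows "ennreal (nsq (cube_avg k u x - c)) \<le> ennreal ((2^k)^CARD('n)) * (LBINT+ y. ennreal (same_cube k x y * nsq (u y - c)))"
proof -
  let ?Q = "cube k (cube_idx k x)"
  have um[measurable]: "borel_fun u" using square_integrableD(1)[OF u] by simp
  have sq: "square_integrable lborel (\<lambda>y. indicator ?Q y *\<^sub>R u y)"
    by (rule square_integrable_bound[OF u, where c = 1]) (auto simp: indicator_def)
  have pos: "measure lborel ?Q > 0" by (simp add: cube_measure)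
  have fin: "emeasure lborel ?Q < \<infinity>" by (simp add: cube_measure)
  note av = average_square_le[OF _ fin pos sq]
  have eq: "(1 / measure lborel ?Q) *\<^sub>R (LBINT x. indicator ?Q x *\<^sub>R u x) = cube_avg k u x"
    by (simp add: cube_avg_def cube_coef_def cube_measure power_divide)
  have "(2^k)^CARD('n) * (measure lborel ?Q * nsq (cube_avg k u x - c)) \<le> (2^k)^CARD('n) * (LBINT y. indicator ?Q y * nsq (u y - c))"
    using av(2)[of c] unfolding eq by (intro mult_left_mono) auto
  then have "nsq (cube_avg k u x - c) \<le> (2^k)^CARD('n) * (LBINT y. same_cube k x y * nsq (u y - c))"
    by (simp add: cube_measure same_cube_def power_divide)
  then have "ennreal (nsq (cube_avg k u x - c)) \<le> ennreal ((2^k)^CARD('n) * (LBINT y. same_cube k x y * nsq (u y - c)))" by (rule ennreal_leI)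
  also have "\<dots> = ennreal ((2^k)^CARD('n)) * ennreal (LBINT y. same_cube k x y * nsq (u y - c))"
    by (intro ennreal_mult integral_nonneg_AE) (auto simp: same_cube_def)
  also have "ennreal (LBINT y. same_cube k x y * nsq (u y - c)) = (LBINT+ y. ennreal (same_cube k x y * nsq (u y - c)))"
    using av(3)[of c] by (intro nn_integral_eq_integral[symmetric]) (auto simp: same_cube_def)
  finally show ?thesis .
qed

lemma nn_integral_same_cube: "(LBINT+ y. ennreal (same_cube k x y)) = ennreal ((1 / 2^k)^CARD('n))" for x :: "real^'n"
  by (simp add: same_cube_def ennreal_indicator cube_measure)

lemma cube_avg_sq_le:
  fixes u :: "real^'n \<Rightarrow> complex"
  assumes u: "square_integrable lborel u"
  shows "(LBINT+ x. ennreal (nsq (cube_avg k u x))) \<le> ennreal (mass u)"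
proof -
  have um[measurable]: "borel_fun u" using square_integrableD(1)[OF u] by simp
  let ?N = "CARD('n)"
  have "(LBINT+ x. ennreal (nsq (cube_avg k u x)))
    \<le> (LBINT+ x. ennreal ((2^k)^?N) * (LBINT+ y. ennreal (same_cube k x y * nsq (u y))))"
    using cube_average_le[OF u, of k _ 0] by (intro nn_integral_mono) simp
  also have "\<dots> = ennreal ((2^k)^?N) * (LBINT+ x. LBINT+ y. ennreal (same_cube k x y * nsq (u y)))" by (rule nn_integral_cmult) measurable
  also have "(LBINT+ x. LBINT+ y. ennreal (same_cube k x y * nsq (u y)))
    = (LBINT+ y. LBINT+ x. ennreal (same_cube k x y * nsq (u y)))" by (rule lborel_pair.Fubini') measurable
  also have "\<dots> = (LBINT+ y. ennreal ((1 / 2^k)^?N) * ennreal (nsq (u y)))"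
  proof (rule nn_integral_cong)
    fix y
    have "(LBINT+ x. ennreal (same_cube k x y * nsq (u y))) = (LBINT+ x. ennreal (same_cube k y x) * ennreal (nsq (u y)))"
      by (intro nn_integral_cong) (simp add: same_cube_sym[of k _ y] ennreal_mult'' flip: ennreal_mult)
    also have "\<dots> = ennreal ((1 / 2^k)^?N) * ennreal (nsq (u y))" by (subst nn_integral_multc) (auto simp: nn_integral_same_cube)
    finally show "(LBINT+ x. ennreal (same_cube k x y * nsq (u y))) = ennreal ((1 / 2^k)^?N) * ennreal (nsq (u y))" .
  qed
  also have "\<dots> = ennreal ((1 / 2^k)^?N) * ennreal (mass u)" using nn_integral_square[OF u] by (subst nn_integral_cmult) (auto simp: mass_def)
  also have "ennreal ((2^k)^?N) * (ennreal ((1 / 2^k)^?N) * ennreal (mass u)) = ennreal (mass u)"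
    unfolding mult.assoc[symmetric] by (subst ennreal_mult[symmetric]) (auto simp: power_divide)
  finally show ?thesis .
qed

text \<open>Two points of a cube of side \<open>1 / 2^k\<close> are at distance at most
  \<open>N / 2^k\<close>. The square of this distance gives the first factor, and the volume of the
  ball of that radius relative to the cube gives the second.\<close>

definition cube_const :: "'n::finite itself \<Rightarrow> real" where
  "cube_const N = real CARD('n)^2 * (real CARD('n)^CARD('n) * measure lborel (cball (0::real^'n) 1))"

lemma cube_const_nonneg: "cube_const TYPE('n::finite) \<ge> 0" by (simp add: cube_const_def)

lemma measure_cball_scale:
  assumes "r \<ge> 0"
  shows "emeasure lborel (cball (0::real^'n) r) = ennreal (r^CARD('n) * measure lborel (cball (0::real^'n) 1))"
  using assms by (simp add: emeasure_cball measure_def enn2real_ennreal)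

text \<open>A Poincare inequality on all cubes at once: by Jensen the error is bounded by
  differences of \<open>u\<close> between points of one cube, and these are translation differences
  by vectors of length at most \<open>\<rho>\<close>.\<close>

lemma cube_avg_approx:
  fixes u :: "real^'n \<Rightarrow> complex"
  assumes u: "square_integrable lborel u" and M: "\<And>h. transl_sq h u \<le> ennreal (nsq h * M)" "M \<ge> 0"
  shows "(LBINT+ x. ennreal (nsq (cube_avg k u x - u x))) \<le> ennreal (cube_const TYPE('n) * M / 4^k)"
proof -
  have um[measurable]: "borel_fun u" using square_integrableD(1)[OF u] by simp
  let ?N = "CARD('n)"
  define \<rho> where "\<rho> = real ?N / 2^k"
  have \<rho>: "\<rho> \<ge> 0" by (simp add: \<rho>_def)
  have "(LBINT+ x. ennreal (nsq (cube_avg k u x - u x)))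
    \<le> (LBINT+ x. ennreal ((2^k)^?N) * (LBINT+ y. ennreal (same_cube k x y * nsq (u y - u x))))" by (intro nn_integral_mono cube_average_le u)
  also have "\<dots> = ennreal ((2^k)^?N) * (LBINT+ x. LBINT+ y. ennreal (same_cube k x y * nsq (u y - u x)))" by (rule nn_integral_cmult) measurable
  also have "\<dots> \<le> ennreal ((2^k)^?N) * (LBINT+ x. LBINT+ h. indicator (cball 0 \<rho>) h * ennreal (nsq (u (x + h) - u x)))"
  proof (rule mult_left_mono[OF nn_integral_mono])
    fix x
    have "(LBINT+ y. ennreal (same_cube k x y * nsq (u y - u x))) = (LBINT+ h. ennreal (same_cube k x (h + x) * nsq (u (h + x) - u x)))"
      by (rule nn_integral_lborel_translate[symmetric]) measurable
    also have "\<dots> \<le> (LBINT+ h. indicator (cball 0 \<rho>) h * ennreal (nsq (u (x + h) - u x)))"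
    proof (rule nn_integral_mono)
      fix h :: "real^'n"
      show "ennreal (same_cube k x (h + x) * nsq (u (h + x) - u x)) \<le> indicator (cball 0 \<rho>) h * ennreal (nsq (u (x + h) - u x))"
      proof (cases "cube_idx k (h + x) = cube_idx k x")
        case True
        then have "h \<in> cball 0 \<rho>" using cube_diam[OF True] by (simp add: \<rho>_def)
        then show ?thesis using True by (simp add: same_cube_def cube_def add.commute)
      qed (simp add: same_cube_def cube_def)
    qed
    finally show "(LBINT+ y. ennreal (same_cube k x y * nsq (u y - u x))) \<le> (LBINT+ h. indicator (cball 0 \<rho>) h * ennreal (nsq (u (x + h) - u x)))" .
  qed simp
  also have "(LBINT+ x. LBINT+ h. indicator (cball 0 \<rho>) h * ennreal (nsq (u (x + h) - u x)))
    = (LBINT+ h. LBINT+ x. indicator (cball 0 \<rho>) h * ennreal (nsq (u (x + h) - u x)))" by (rule lborel_pair.Fubini') measurable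
  also have "\<dots> = (LBINT+ h. indicator (cball 0 \<rho>) h * transl_sq h u)"
    unfolding transl_sq_def by (intro nn_integral_cong nn_integral_cmult) measurable
  also have "\<dots> \<le> (LBINT+ h. ennreal (\<rho>^2 * M) * indicator (cball (0::real^'n) \<rho>) h)"
  proof (rule nn_integral_mono)
    fix h :: "real^'n"
    show "indicator (cball 0 \<rho>) h * transl_sq h u \<le> ennreal (\<rho>^2 * M) * indicator (cball 0 \<rho>) h"
    proof (cases "norm h \<le> \<rho>")
      case True
      have "transl_sq h u \<le> ennreal (nsq h * M)" by (rule M)
      also have "\<dots> \<le> ennreal (\<rho>^2 * M)" using True M(2) by (intro ennreal_leI mult_right_mono power_mono) auto
      finally show ?thesis using True by simp
    qed simp
  qed
  also have "\<dots> = ennreal (\<rho>^2 * M) * ennreal (\<rho>^?N * measure lborel (cball (0::real^'n) 1))"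
    by (subst nn_integral_cmult_indicator) (auto simp: measure_cball_scale[OF \<rho>])
  also have "ennreal ((2^k)^?N) * \<dots> = ennreal ((2^k)^?N * (\<rho>^2 * M * (\<rho>^?N * measure lborel (cball (0::real^'n) 1))))"
    using \<rho> M(2) by (simp add: ennreal_mult)
  also have "(2^k)^?N * (\<rho>^2 * M * (\<rho>^?N * measure lborel (cball (0::real^'n) 1))) = cube_const TYPE('n) * M / 4^k"
  proof -
    have "(2^k)^?N * \<rho>^?N = real ?N^?N" by (simp add: \<rho>_def flip: power_mult_distrib)
    moreover have "\<rho>^2 = real ?N^2 / 4^k" by (simp add: \<rho>_def power_divide power_mult[symmetric] mult.commute[of k]) (simp add: power_mult)
    moreover have "(2^k)^?N * (\<rho>^2 * M * (\<rho>^?N * c)) = \<rho>^2 * ((2^k)^?N * \<rho>^?N) * M * c" for c by (simp only: ac_simps)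
    ultimately show ?thesis by (simp add: cube_const_def)
  qed
  \<comment> \<open>The chain rewrites inside a product and leaves monotonicity of the
    multiplication as a premise.\<close>
  finally have "(\<And>x y. x \<le> y \<Longrightarrow> ennreal ((2^k)^?N) * x \<le> ennreal ((2^k)^?N) * y) \<Longrightarrow> ?thesis" .
  then show ?thesis by (metis mult_left_mono zero_le)
qed

lemma cube_refine: "cube_idx (Suc k) x = cube_idx (Suc k) y \<Longrightarrow> cube_idx k x = cube_idx k y"
proof -
  assume a: "cube_idx (Suc k) x = cube_idx (Suc k) y"
  have "\<lfloor>2^k * x $ i\<rfloor> = \<lfloor>2^k * y $ i\<rfloor>" for i
  proof -
    have "\<lfloor>2 * (2^k * x $ i)\<rfloor> = \<lfloor>2 * (2^k * y $ i)\<rfloor>" using a by (auto simp: cube_idx_eq_iff mult.assoc)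
    moreover have "\<lfloor>t\<rfloor> = \<lfloor>2 * t\<rfloor> div 2" for t :: real by linarith
    ultimately show ?thesis by metis
  qed
  then show ?thesis by (simp add: cube_idx_eq_iff)
qed

text \<open>A pointwise bound from an integral one: the coarse average is constant on the fine cube
  of \<open>x\<close>, so Jensen there bounds the increment by the approximation error of the whole
  coarse level divided by the volume of the fine cube.\<close>

lemma cube_avg_step:
  fixes u :: "real^'n \<Rightarrow> complex"
  assumes u: "square_integrable lborel u" and M: "\<And>h. transl_sq h u \<le> ennreal (nsq h * M)" "M \<ge> 0"
  shows "nsq (cube_avg (Suc k) u x - cube_avg k u x) \<le> (2^Suc k)^CARD('n) * (cube_const TYPE('n) * M / 4^k)"
proof -
  have um[measurable]: "borel_fun u" using square_integrableD(1)[OF u] by simp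
  have "ennreal (nsq (cube_avg (Suc k) u x - cube_avg k u x))
    \<le> ennreal ((2^Suc k)^CARD('n)) * (LBINT+ y. ennreal (same_cube (Suc k) x y * nsq (u y - cube_avg k u x)))" by (rule cube_average_le[OF u])
  also have "\<dots> \<le> ennreal ((2^Suc k)^CARD('n)) * (LBINT+ y. ennreal (nsq (cube_avg k u y - u y)))"
  proof (intro mult_left_mono nn_integral_mono)
    fix y
    show "ennreal (same_cube (Suc k) x y * nsq (u y - cube_avg k u x)) \<le> ennreal (nsq (cube_avg k u y - u y))"
    proof (cases "cube_idx (Suc k) y = cube_idx (Suc k) x")
      case True
      then have "cube_avg k u y = cube_avg k u x" unfolding cube_avg_def using cube_refine[OF True] by simp
      then show ?thesis using True by (simp add: same_cube_def cube_def norm_minus_commute)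
    qed (simp add: same_cube_def cube_def)
  qed simp
  also have "\<dots> \<le> ennreal ((2^Suc k)^CARD('n)) * ennreal (cube_const TYPE('n) * M / 4^k)"
    by (intro mult_left_mono cube_avg_approx[OF u M]) auto
  also have "\<dots> = ennreal ((2^Suc k)^CARD('n) * (cube_const TYPE('n) * M / 4^k))"
    using M(2) cube_const_nonneg[where 'n = 'n] by (intro ennreal_mult[symmetric]) auto
  finally show ?thesis using M(2) cube_const_nonneg[where 'n = 'n] by (subst (asm) ennreal_le_iff) auto
qed

text \<open>The squared errors decay like \<open>(1/4)^k\<close> in the mean, so they are summable
  at almost every point.\<close>

lemma cube_avg_tendsto:
  fixes u :: "real^'n \<Rightarrow> complex"
  assumes u: "square_integrable lborel u" and M: "\<And>h. transl_sq h u \<le> ennreal (nsq h * M)" "M \<ge> 0"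
  shows "AE x in lborel. (\<lambda>k. cube_avg k u x) \<longlonglongrightarrow> u x"
proof -
  have um[measurable]: "borel_fun u" using square_integrableD(1)[OF u] by simp
  have "(LBINT+ x. (\<Sum>k. ennreal (nsq (cube_avg k u x - u x)))) = (\<Sum>k. (LBINT+ x. ennreal (nsq (cube_avg k u x - u x))))"
    by (rule nn_integral_suminf) measurable
  also have "\<dots> \<le> (\<Sum>k. ennreal (cube_const TYPE('n) * M * (1/4)^k))"
    using cube_avg_approx[OF u M] by (intro suminf_le) (auto simp: power_divide)
  also have "\<dots> < \<infinity>"
    using M(2) cube_const_nonneg[where 'n = 'n] by (subst suminf_ennreal2) (auto intro!: summable_mult summable_geometric)
  finally have "AE x in lborel. (\<Sum>k. ennreal (nsq (cube_avg k u x - u x))) \<noteq> \<infinity>" by (intro nn_integral_PInf_AE) auto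
  then show ?thesis
  proof eventually_elim
    case (elim x)
    have "summable (\<lambda>k. nsq (cube_avg k u x - u x))" by (rule summable_suminf_not_top) (use elim in auto)
    then have "(\<lambda>k. nsq (cube_avg k u x - u x)) \<longlonglongrightarrow> 0" by (rule summable_LIMSEQ_zero)
    then have "(\<lambda>k. sqrt (nsq (cube_avg k u x - u x))) \<longlonglongrightarrow> sqrt 0" by (intro tendsto_intros)
    then have "(\<lambda>k. norm (cube_avg k u x - u x)) \<longlonglongrightarrow> 0" by simp
    then have "(\<lambda>k. cube_avg k u x - u x) \<longlonglongrightarrow> 0" by (rule tendsto_norm_zero_cancel)
    then show ?case by (rule LIM_zero_cancel)
  qed
qed

subsection \<open>Subcritical embedding\<close>

text \<open>If \<open>S\<close> is the sum on the right, each \<open>a k\<close> is at most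
  \<open>(1 - \<tau>) * \<tau>^k * S powr (1/r)\<close>, and these geometric weights sum up to
  \<open>1\<close>. This gives a bound on the r-th power of a telescoping sum by separate r-th
  powers.\<close>

lemma norm_powr_le_series:
  fixes a :: "nat \<Rightarrow> real" and A :: "nat \<Rightarrow> complex"
  assumes lim: "A \<longlonglongrightarrow> z" and a0: "norm (A 0) \<le> a 0" and aS: "\<And>k. norm (A (Suc k) - A k) \<le> a (Suc k)"
    and a: "\<And>k. a k \<ge> 0" and \<tau>: "0 < \<tau>" "\<tau> < 1" and r: "r > 0"
  shows "ennreal (norm z powr r) \<le> (\<Sum>k. ennreal ((a k / ((1 - \<tau>) * \<tau>^k)) powr r))"
proof (cases "(\<Sum>k. ennreal ((a k / ((1 - \<tau>) * \<tau>^k)) powr r)) = top")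
  case True
  then show ?thesis by simp
next
  case False
  define w where "w k = (1 - \<tau>) * \<tau>^k" for k
  have w: "w k > 0" for k using \<tau> by (simp add: w_def)
  have sm: "summable (\<lambda>k. (a k / w k) powr r)" by (rule summable_suminf_not_top) (use False in \<open>auto simp: w_def\<close>)
  define S where "S = (\<Sum>k. (a k / w k) powr r)"
  have S0: "S \<ge> 0" unfolding S_def by (rule suminf_nonneg[OF sm]) simp
  have ak: "a k \<le> w k * S powr (1 / r)" for k
  proof -
    have "(a k / w k) powr r \<le> S" unfolding S_def using sum_le_suminf[OF sm, of "{k}"] by simp
    then have "((a k / w k) powr r) powr (1 / r) \<le> S powr (1 / r)" using r by (intro powr_mono2) auto
    then have "a k / w k \<le> S powr (1 / r)" using a[of k] w[of k] r by (simp add: powr_powr)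
    then show ?thesis using w[of k] by (simp add: divide_le_eq mult.commute)
  qed
  have wsum: "(\<Sum>k\<le>n. w k) \<le> 1" for n
  proof -
    have "(\<Sum>k\<le>n. w k) = 1 - \<tau>^Suc n" unfolding w_def sum_distrib_left[symmetric] using \<tau> by (subst sum_gp0) (simp add: field_simps)
    then show ?thesis using \<tau> by simp
  qed
  have An: "norm (A n) \<le> (\<Sum>k\<le>n. a k)" for n
  proof (induction n)
    case (Suc n)
    have "norm (A (Suc n)) \<le> norm (A n) + norm (A (Suc n) - A n)" by (metis norm_triangle_sub)
    then show ?case using Suc aS[of n] by simp
  qed (use a0 in simp)
  have "norm (A n) \<le> S powr (1 / r)" for n
  proof -
    have "norm (A n) \<le> (\<Sum>k\<le>n. w k * S powr (1 / r))" using An[of n] sum_mono[of "{..n}" a] ak by (meson order_trans)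
    also have "\<dots> = (\<Sum>k\<le>n. w k) * S powr (1 / r)" by (simp add: sum_distrib_right)
    also have "\<dots> \<le> 1 * S powr (1 / r)" using wsum by (intro mult_right_mono) auto
    finally show ?thesis by simp
  qed
  then have "norm z \<le> S powr (1 / r)" by (intro LIMSEQ_le_const2[OF tendsto_norm[OF lim]]) auto
  then have "norm z powr r \<le> (S powr (1 / r)) powr r" using r by (intro powr_mono2) auto
  also have "\<dots> = S" using S0 r by (simp add: powr_powr)
  finally have "ennreal (norm z powr r) \<le> ennreal S" by (rule ennreal_leI)
  also have "ennreal S = (\<Sum>k. ennreal ((a k / w k) powr r))" unfolding S_def by (rule suminf_ennreal2[symmetric]) (use sm in auto)
  finally show ?thesis by (simp add: w_def)
qed

lemma ennreal_double_sum:
  assumes "a \<ge> 0" "b \<ge> 0"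
  shows "2 * ennreal a + 2 * ennreal b = ennreal (2 * a + 2 * b)" using assms by (simp add: ennreal_mult)

text \<open>Telescoping over the dyadic levels. The k-th increment has square at most
  \<open>D * 2^(k N) / 4^k\<close> pointwise and at most \<open>D / 4^k\<close> in the integral;
  interpolating, its r-th power has integral of order \<open>2 powr (- e * k)\<close>. The condition
  \<open>sub\<close> says exactly \<open>e > 0\<close>.\<close>

lemma subcritical_embedding:
  fixes M r :: real
  assumes r: "2 < r" and sub: "(r - 2) * (real CARD('n) - 2) < 4" and M: "M \<ge> 0"
  shows "\<exists>C\<ge>0. \<forall>u :: real^'n \<Rightarrow> complex. square_integrable lborel u \<longrightarrow>
    (\<forall>h. transl_sq h u \<le> ennreal (nsq h * M)) \<longrightarrow> mass u \<le> M \<longrightarrow>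
    (LBINT+ x. ennreal (norm (u x) powr r)) \<le> ennreal C"
proof -
  let ?N = "CARD('n)"
  define cc where "cc = cube_const TYPE('n)"
  have cc: "cc \<ge> 0" unfolding cc_def by (rule cube_const_nonneg)
  \<comment> \<open>One constant for level \<open>0\<close>, controlled by the mass, and for the
    later levels; the \<open>16\<close> covers the factors \<open>4\<close> and \<open>10\<close>
    lost between neighbouring levels.\<close>
  define D where "D = 16 * (cc + 1) * (M + 1)"
  have D: "D > 0" "M \<le> D" "16 * (cc * M) \<le> D"
  proof -
    show "D > 0" unfolding D_def using cc M by (intro mult_pos_pos) auto
    have "D = 16 * (cc * M) + 16 * cc + 16 * M + 16" by (simp add: D_def algebra_simps)
    moreover have "cc * M \<ge> 0" using cc M by simp
    ultimately show "M \<le> D" "16 * (cc * M) \<le> D" using cc M by linarith+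
  qed
  define e where "e = 2 - (r - 2) * (real ?N - 2) / 2"
  have e: "e > 0" using sub by (simp add: e_def)
  \<comment> \<open>Half of the decay exponent \<open>e\<close> pays for the weights of
    \<open>norm_powr_le_series\<close>; the other half remains as the ratio \<open>q\<close> of a
    convergent series.\<close>
  define \<tau> where "\<tau> = 2 powr (- e / (2 * r))"
  have \<tau>: "0 < \<tau>" "\<tau> < 1" using e r by (auto simp: \<tau>_def powr_less_one divide_neg_pos)
  define q where "q = 2 powr (- e / 2)"
  have q: "0 < q" "q < 1" using e by (auto simp: q_def powr_less_one)
  define K where "K = (1 - \<tau>) powr (- r) * D powr ((r - 2) / 2) * D"
  have K: "K \<ge> 0" using D by (simp add: K_def)
  have coef: "((1 - \<tau>) * \<tau>^k) powr (- r) * ((D * (2^(k * ?N) / 4^k)) powr ((r - 2) / 2) * (D / 4^k)) = K * q^k" for k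
  proof -
    have 4: "(4::real)^k = 2 powr (2 * real k)"
      by (simp add: powr_realpow[symmetric] powr_powr flip: powr_numeral) (simp add: powr_powr[symmetric] powr_realpow)
    have 1: "(2::real)^(k * ?N) / 4^k = 2 powr (real k * (real ?N - 2))"
      unfolding 4 by (simp add: powr_diff[symmetric] powr_realpow[symmetric] algebra_simps)
    have 2: "1 / 4^k = 2 powr (- 2 * real k)" unfolding 4 by (simp add: powr_minus_divide)
    have 3: "((1 - \<tau>) * \<tau>^k) powr (- r) = (1 - \<tau>) powr (- r) * 2 powr (e / 2 * real k)"
    proof -
      have "(\<tau>^k) powr (- r) = 2 powr (e / 2 * real k)" unfolding \<tau>_def using r by (simp add: powr_realpow[symmetric] powr_powr field_simps)
      then show ?thesis using \<tau> by (simp add: powr_mult)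
    qed
    have 5: "(D * (2^(k * ?N) / 4^k)) powr ((r - 2) / 2) = D powr ((r - 2) / 2) * 2 powr (real k * (real ?N - 2) * ((r - 2) / 2))"
      unfolding 1 using D by (simp add: powr_mult powr_powr)
    have "((1 - \<tau>) * \<tau>^k) powr (- r) * ((D * (2^(k * ?N) / 4^k)) powr ((r - 2) / 2) * (D * (1 / 4^k)))
      = K * (2 powr (e / 2 * real k) * (2 powr (real k * (real ?N - 2) * ((r - 2) / 2)) * 2 powr (- 2 * real k)))"
      unfolding 2 3 5 K_def by (simp add: ac_simps)
    also have "2 powr (e / 2 * real k) * (2 powr (real k * (real ?N - 2) * ((r - 2) / 2)) * 2 powr (- 2 * real k)) = (2::real) powr (- e / 2 * real k)"
      unfolding powr_add[symmetric] by (rule arg_cong[of _ _ "\<lambda>s. 2 powr s"]) (simp add: e_def field_simps)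
    also have "\<dots> = q^k" by (simp add: q_def powr_realpow[symmetric] powr_powr)
    finally show ?thesis by simp
  qed
  define C where "C = K / (1 - q)"
  have C: "C \<ge> 0" using K q by (simp add: C_def)
  have main: "(LBINT+ x. ennreal (norm (u x) powr r)) \<le> ennreal C"
    if u: "square_integrable lborel u" and tr: "\<And>h. transl_sq h u \<le> ennreal (nsq h * M)" and mu: "mass u \<le> M"
    for u :: "real^'n \<Rightarrow> complex"
  proof -
    have um[measurable]: "borel_fun u" using square_integrableD(1)[OF u] by simp
    define a where "a k x = (case k of 0 \<Rightarrow> norm (cube_avg 0 u x) | Suc j \<Rightarrow> norm (cube_avg (Suc j) u x - cube_avg j u x))" for k x
    have am[measurable]: "borel_fun (a k)" for k unfolding a_def by (cases k) auto
    have a0: "a k x \<ge> 0" for k x by (auto simp: a_def split: nat.split)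
    have b1: "(a k x)^2 \<le> D * (2^(k * ?N) / 4^k)" for k x
    proof (cases k)
      case 0
      have "ennreal (nsq (cube_avg 0 u x - 0)) \<le> ennreal ((2^0)^?N) * (LBINT+ y. ennreal (same_cube 0 x y * nsq (u y - 0)))"
        by (rule cube_average_le[OF u])
      also have "\<dots> \<le> (LBINT+ y. ennreal (nsq (u y)))" by (auto intro!: nn_integral_mono ennreal_leI simp: same_cube_def indicator_def)
      also have "\<dots> = ennreal (mass u)" using nn_integral_square[OF u] by (simp add: mass_def)
      finally have "nsq (cube_avg 0 u x) \<le> mass u" by (simp add: ennreal_le_iff mass_nonneg)
      then show ?thesis using mu D 0 by (simp add: a_def)
    next
      case (Suc j)
      have "(a k x)^2 \<le> (2^Suc j)^?N * (cc * M / 4^j)" using cube_avg_step[OF u tr M, of j x] Suc by (simp add: a_def cc_def)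
      also have "\<dots> = 4 * (cc * M) * (2^(k * ?N) / 4^k)" by (simp add: Suc power_add power_mult)
      also have "\<dots> \<le> D * (2^(k * ?N) / 4^k)" using D cc M by (intro mult_right_mono) (auto intro: order_trans[OF _ D(3)])
      finally show ?thesis .
    qed
    have b2: "(LBINT+ x. ennreal ((a k x)^2)) \<le> ennreal (D / 4^k)" for k
    proof (cases k)
      case 0
      have "(LBINT+ x. ennreal ((a k x)^2)) \<le> ennreal (mass u)" using cube_avg_sq_le[OF u, of 0] 0 by (simp add: a_def)
      also have "\<dots> \<le> ennreal (D / 4^k)" using mu D 0 by (intro ennreal_leI) simp
      finally show ?thesis .
    next
      case (Suc j)
      have "(LBINT+ x. ennreal ((a k x)^2))
        \<le> (LBINT+ x. 2 * ennreal (nsq (cube_avg (Suc j) u x - u x)) + 2 * ennreal (nsq (cube_avg j u x - u x)))"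
      proof (rule nn_integral_mono)
        fix x
        have "(a k x)^2 \<le> 2 * nsq (cube_avg (Suc j) u x - u x) + 2 * nsq (cube_avg j u x - u x)"
          using norm_diff_sq_le[of "cube_avg (Suc j) u x - u x" "cube_avg j u x - u x"] Suc by (simp add: a_def)
        then have "ennreal ((a k x)^2) \<le> ennreal (2 * nsq (cube_avg (Suc j) u x - u x) + 2 * nsq (cube_avg j u x - u x))" by (rule ennreal_leI)
        then show "ennreal ((a k x)^2) \<le> 2 * ennreal (nsq (cube_avg (Suc j) u x - u x)) + 2 * ennreal (nsq (cube_avg j u x - u x))"
          by (simp add: ennreal_plus ennreal_mult)
      qed
      also have "\<dots> = 2 * (LBINT+ x. ennreal (nsq (cube_avg (Suc j) u x - u x))) + 2 * (LBINT+ x. ennreal (nsq (cube_avg j u x - u x)))"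
        by (subst nn_integral_add) (auto simp: nn_integral_cmult)
      also have "\<dots> \<le> 2 * ennreal (cc * M / 4^Suc j) + 2 * ennreal (cc * M / 4^j)"
        unfolding cc_def by (intro add_mono mult_left_mono cube_avg_approx u tr M) auto
      also have "\<dots> = ennreal (2 * (cc * M / 4^Suc j) + 2 * (cc * M / 4^j))" using cc M by (intro ennreal_double_sum) auto
      also have "\<dots> \<le> ennreal (D / 4^k)"
      proof (rule ennreal_leI)
        have "2 * (cc * M / 4^Suc j) + 2 * (cc * M / 4^j) = (10 * (cc * M)) / 4^k" by (simp add: Suc field_simps)
        also have "\<dots> \<le> D / 4^k" using D cc M by (intro divide_right_mono) (auto intro: order_trans[OF _ D(3)])
        finally show "2 * (cc * M / 4^Suc j) + 2 * (cc * M / 4^j) \<le> D / 4^k" .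
      qed
      finally show ?thesis .
    qed
    have b3: "(LBINT+ x. ennreal ((a k x / ((1 - \<tau>) * \<tau>^k)) powr r)) \<le> ennreal (K * q^k)" for k
    proof -
      define w where "w = (1 - \<tau>) * \<tau>^k"
      have w: "w > 0" using \<tau> by (simp add: w_def)
      define E where "E = (D * (2^(k * ?N) / 4^k)) powr ((r - 2) / 2)"
      have pt: "(a k x / w) powr r \<le> (w powr (- r) * E) * (a k x)^2" for x
      proof (cases "a k x = 0")
        case False
        then have ap: "a k x > 0" using a0[of k x] by simp
        have "(a k x / w) powr r = w powr (- r) * a k x powr r" using w a0[of k x] by (simp add: powr_divide powr_minus_divide)
        also have "a k x powr r = ((a k x)^2) powr ((r - 2) / 2) * (a k x)^2"
        proof -
          have s: "(a k x)^2 = a k x powr 2" using ap by simp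
          have "((a k x)^2) powr ((r - 2) / 2) * (a k x)^2 = a k x powr (2 * ((r - 2) / 2) + 2)" unfolding s powr_powr powr_add[symmetric] ..
          also have "2 * ((r - 2) / 2) + 2 = r" by (simp add: field_simps)
          finally show ?thesis by simp
        qed
        also have "((a k x)^2) powr ((r - 2) / 2) * (a k x)^2 \<le> E * (a k x)^2"
          unfolding E_def using r by (intro mult_right_mono powr_mono2 b1) auto
        finally show ?thesis by (simp add: mult_left_mono mult.assoc)
      qed (simp)
      have nn: "w powr (- r) * E \<ge> 0" by (simp add: E_def)
      have "(LBINT+ x. ennreal ((a k x / w) powr r)) \<le> (LBINT+ x. ennreal (w powr (- r) * E) * ennreal ((a k x)^2))"
        using pt nn by (intro nn_integral_mono) (simp flip: ennreal_mult add: ennreal_leI)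
      also have "\<dots> = ennreal (w powr (- r) * E) * (LBINT+ x. ennreal ((a k x)^2))" by (rule nn_integral_cmult) measurable
      also have "\<dots> \<le> ennreal (w powr (- r) * E) * ennreal (D / 4^k)" by (intro mult_left_mono b2) simp
      also have "\<dots> = ennreal (w powr (- r) * (E * (D / 4^k)))" using nn D by (subst ennreal_mult[symmetric]) (auto simp: mult.assoc)
      also have "w powr (- r) * (E * (D / 4^k)) = K * q^k" using coef[of k] by (simp add: w_def E_def)
      finally show ?thesis by (simp add: w_def)
    qed
    have "(LBINT+ x. ennreal (norm (u x) powr r)) \<le> (LBINT+ x. (\<Sum>k. ennreal ((a k x / ((1 - \<tau>) * \<tau>^k)) powr r)))"
    proof (rule nn_integral_mono_AE, use cube_avg_tendsto[OF u tr M] in eventually_elim)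
      case (elim x)
      show ?case using r by (intro norm_powr_le_series[OF elim _ _ a0 \<tau>]) (auto simp: a_def)
    qed
    also have "\<dots> = (\<Sum>k. (LBINT+ x. ennreal ((a k x / ((1 - \<tau>) * \<tau>^k)) powr r)))" by (rule nn_integral_suminf) measurable
    also have "\<dots> \<le> (\<Sum>k. ennreal (K * q^k))" by (intro suminf_le b3) auto
    also have "\<dots> = ennreal (\<Sum>k. K * q^k)" using K q by (intro suminf_ennreal2 summable_mult summable_geometric) auto
    also have "(\<Sum>k. K * q^k) = C" using q suminf_mult[OF summable_geometric[of q], of K] suminf_geometric[of q] by (simp add: C_def)
    finally show ?thesis .
  qed
  show ?thesis by (intro exI[of _ C] conjI allI impI C main) auto
qed

subsection \<open>Compactness in the mean-square norm\<close>

lemma finite_int_vec: "finite {m :: int^'n::finite. \<forall>i. m $ i \<in> {-K..K}}"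
proof -
  have "{m :: int^'n. \<forall>i. m $ i \<in> {-K..K}} \<subseteq> (\<lambda>f. \<chi> i. f i) ` (PiE UNIV (\<lambda>_. {-K..K}))"
  proof
    fix m :: "int^'n" assume "m \<in> {m. \<forall>i. m $ i \<in> {-K..K}}"
    then show "m \<in> (\<lambda>f. \<chi> i. f i) ` (PiE UNIV (\<lambda>_. {-K..K}))"
      by (intro image_eqI[where x = "\<lambda>i. m $ i"]) (auto simp: vec_eq_iff)
  qed
  then show ?thesis by (rule finite_subset) (intro finite_imageI finite_PiE, auto)
qed

lemma cube_idx_surj: "\<exists>x :: real^'n. cube_idx k x = m"
  by (intro exI[of _ "\<chi> i. real_of_int (m $ i) / 2^k"]) (simp add: cube_idx_def vec_eq_iff)

text \<open>The volume factor is at least \<open>1\<close> and is discarded: to extract a diagonal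
  subsequence each coefficient only has to be bounded.\<close>

lemma cube_coef_bound:
  fixes u :: "real^'n \<Rightarrow> complex"
  assumes u: "square_integrable lborel u"
  shows "nsq (cube_coef k u m) \<le> mass u"
proof -
  have um[measurable]: "borel_fun u" using square_integrableD(1)[OF u] by simp
  obtain x where x: "cube_idx k x = m" using cube_idx_surj by blast
  let ?P = "(2^k)^CARD('n) :: real"
  have P: "?P \<ge> 1" by (simp add: one_le_power)
  have "ennreal (nsq (cube_avg k u x - 0)) \<le> ennreal ?P * (LBINT+ y. ennreal (same_cube k x y * nsq (u y - 0)))" by (rule cube_average_le[OF u])
  also have "\<dots> \<le> ennreal ?P * (LBINT+ y. ennreal (nsq (u y)))"
    by (intro mult_left_mono nn_integral_mono ennreal_leI) (auto simp: same_cube_def indicator_def)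
  also have "\<dots> = ennreal (?P * mass u)" using nn_integral_square[OF u] by (simp add: mass_def ennreal_mult)
  finally have "nsq (cube_avg k u x) \<le> ?P * mass u" by (simp add: ennreal_le_iff mass_nonneg)
  then have "?P^2 * nsq (cube_coef k u m) \<le> ?P * mass u" by (simp add: cube_avg_def x power_mult_distrib)
  then have "?P * (?P * nsq (cube_coef k u m)) \<le> ?P * mass u" by (simp add: power2_eq_square mult.assoc)
  then have "?P * nsq (cube_coef k u m) \<le> mass u" using P by (simp only: mult_le_cancel_left_pos)
  moreover have "1 * nsq (cube_coef k u m) \<le> ?P * nsq (cube_coef k u m)" using P by (intro mult_right_mono) auto
  ultimately show ?thesis by simp
qed

lemma ennreal_splitting_bound:
  fixes B \<iota> c d e f g :: real
  assumes "A \<le> B * \<iota> + (4 * c + 4 * d) + (e * f + e * g)"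
    "0 \<le> B" "0 \<le> \<iota>" "0 \<le> c" "0 \<le> d" "0 \<le> e" "0 \<le> f" "0 \<le> g"
  shows "ennreal A \<le> ennreal B * ennreal \<iota> + (4 * ennreal c + 4 * ennreal d) + (ennreal e * ennreal f + ennreal e * ennreal g)"
proof -
  have "ennreal (B * \<iota> + (4 * c + 4 * d) + (e * f + e * g)) = ennreal B * ennreal \<iota> + (4 * ennreal c + 4 * ennreal d) + (ennreal e * ennreal f + ennreal e * ennreal g)"
    using assms by (simp add: ennreal_mult)
  then show ?thesis using ennreal_leI[OF assms(1)] by simp
qed

text \<open>Inside a large ball a function is close to its cube averages at a fine scale, uniformly
  along the sequence, and there only finitely many coefficients matter; outside, the moment bounds
  the mass. So convergence of all coefficients makes a subsequence Cauchy in mean square.\<close>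

lemma L2_compactness:
  fixes u :: "nat \<Rightarrow> real^'n \<Rightarrow> complex"
  assumes u: "\<And>n. square_integrable lborel (u n)" and tr: "\<And>n h. transl_sq h (u n) \<le> ennreal (nsq h * M)"
    and mu: "\<And>n. mass (u n) \<le> M" and xu: "\<And>n. square_integrable lborel (\<lambda>x. norm x *\<^sub>R u n x)" and mo: "\<And>n. moment (u n) \<le> M"
  obtains r v where "strict_mono (r :: nat \<Rightarrow> nat)" "square_integrable lborel v"
    "AE x in lborel. (\<lambda>n. u (r n) x) \<longlonglongrightarrow> v x" "(\<lambda>n. LBINT x. nsq (u (r n) x - v x)) \<longlonglongrightarrow> 0"
proof -
  have M: "M \<ge> 0" using mu[of 0] mass_nonneg[of "u 0"] by simp
  have um[measurable]: "borel_fun (u n)" for n using square_integrableD(1)[OF u] by simp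
  let ?N = "CARD('n)"
  \<comment> \<open>Scale and cube together form one countable index set, which yields a single
    subsequence along which all coefficients converge.\<close>
  define f where "f n p = cube_coef (fst p) (u n) (snd p)" for n and p :: "nat \<times> (int^'n)"
  have fb: "norm (f n p) \<le> sqrt M" for n p
    using cube_coef_bound[OF u, of "fst p" n "snd p"] mu[of n] unfolding f_def by (intro real_le_rsqrt) simp
  have cnt: "countable (UNIV :: (nat \<times> (int^'n)) set)" by (rule countableI_type)
  obtain r where r: "strict_mono (r :: nat \<Rightarrow> nat)" and conv: "\<And>p. p \<in> UNIV \<Longrightarrow> \<exists>l. (\<lambda>n. f (r n) p) \<longlonglongrightarrow> l"
    using function_convergent_subsequence[OF cnt, of f "sqrt M"] fb by blast
  define v where "v n = u (r n)" for n
  have v: "square_integrable lborel (v n)" for n by (simp add: v_def u)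
  have vm[measurable]: "borel_fun (v n)" for n by (simp add: v_def)
  have Cau: "\<exists>N. \<forall>i\<ge>N. \<forall>j\<ge>N. (LBINT x. nsq (v i x - v j x)) < \<epsilon>" if "\<epsilon> > 0" for \<epsilon>
  proof -
    obtain R where R: "R > 0" "4 * M / R^2 < \<epsilon> / 4"
    proof -
      \<comment> \<open>Makes the tail contribution \<open>4 * M / R^2\<close> of two functions
        smaller than \<open>\<epsilon> / 4\<close>.\<close>
      define R where "R = sqrt (16 * (M + 1) / \<epsilon>)"
      have "16 * (M + 1) / \<epsilon> > 0" using M \<open>\<epsilon> > 0\<close> by simp
      then have "R > 0" "R^2 = 16 * (M + 1) / \<epsilon>" by (auto simp: R_def)
      moreover have "4 * M / (16 * (M + 1) / \<epsilon>) < \<epsilon> / 4" using M \<open>\<epsilon> > 0\<close> by (simp add: field_simps)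
      ultimately show ?thesis using that by metis
    qed
    define cc where "cc = cube_const TYPE('n)"
    have cc: "cc \<ge> 0" unfolding cc_def by (rule cube_const_nonneg)
    have "(\<lambda>k. 8 * (cc * M * (1 / 4)^k)) \<longlonglongrightarrow> 8 * (cc * M * 0)" by (intro tendsto_intros LIMSEQ_power_zero) simp
    then have "\<forall>\<^sub>F k in sequentially. 8 * (cc * M * (1 / 4)^k) < \<epsilon> / 4"
      by (rule order_tendstoD) (use \<open>\<epsilon> > 0\<close> in simp)
    then obtain k where k: "8 * (cc * M / 4^k) < \<epsilon> / 4" by (auto simp: eventually_sequentially power_divide)
    let ?P = "(2^k)^?N :: real"
    define V where "V = measure lborel (cball (0::real^'n) R)"
    have eV: "emeasure lborel (cball (0::real^'n) R) = ennreal V"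
      unfolding V_def using emeasure_lborel_cball_finite[of "0::real^'n" R] by (intro emeasure_eq_ennreal_measure) auto
    have V: "V \<ge> 0" by (simp add: V_def)
    \<comment> \<open>The difference of two averages is the coefficient difference times the inverse
      volume \<open>?P\<close>; integrated over the ball of volume \<open>V\<close>, twice its
      square is at most \<open>\<epsilon> / 4\<close> with this choice.\<close>
    define \<delta> where "\<delta> = \<epsilon> / (8 * (?P^2 * (V + 1)))"
    have den: "8 * (?P^2 * (V + 1)) > 0" using V by (intro mult_pos_pos) auto
    have \<delta>: "\<delta> > 0" unfolding \<delta>_def using \<open>\<epsilon> > 0\<close> den by (rule divide_pos_pos)
    define K where "K = \<lceil>2^k * R\<rceil> + 1"
    \<comment> \<open>Only finitely many cubes meet the ball, so one index \<open>N0\<close> serves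
      for all of them.\<close>
    define F where "F = {m :: int^'n. \<forall>i. m $ i \<in> {-K..K}}"
    have F: "finite F" unfolding F_def by (rule finite_int_vec)
    have idxF: "cube_idx k x \<in> F" if "norm x \<le> R" for x
    proof -
      have "\<lfloor>2^k * x $ i\<rfloor> \<in> {-K..K}" for i
      proof -
        define t B where "t = 2^k * x $ i" and "B = 2^k * R"
        have "\<bar>t\<bar> \<le> B" unfolding t_def B_def using order_trans[OF component_le_norm_cart that, of i] by (simp add: abs_mult)
        then have "t \<le> B" "- B \<le> t" by auto
        then have "\<lfloor>t\<rfloor> \<le> \<lceil>B\<rceil> + 1" "- (\<lceil>B\<rceil> + 1) \<le> \<lfloor>t\<rfloor>" by linarith+
        then show ?thesis by (simp add: K_def t_def B_def)
      qed
      then show ?thesis by (simp add: F_def cube_idx_def)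
    qed
    have "\<exists>N. \<forall>i\<ge>N. \<forall>j\<ge>N. nsq (f (r i) (k, m) - f (r j) (k, m)) < \<delta>" for m
    proof -
      obtain l where "(\<lambda>n. f (r n) (k, m)) \<longlonglongrightarrow> l" using conv by blast
      then have "Cauchy (\<lambda>n. f (r n) (k, m))" by (simp add: LIMSEQ_imp_Cauchy)
      then obtain N where "\<And>i j. i \<ge> N \<Longrightarrow> j \<ge> N \<Longrightarrow> norm (f (r i) (k, m) - f (r j) (k, m)) < sqrt \<delta>"
        using CauchyD[of _ "sqrt \<delta>"] \<delta> by (metis real_sqrt_gt_zero)
      then have "\<And>i j. i \<ge> N \<Longrightarrow> j \<ge> N \<Longrightarrow> nsq (f (r i) (k, m) - f (r j) (k, m)) < (sqrt \<delta>)^2"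
        by (intro power_strict_mono) auto
      then show ?thesis using \<delta> by auto
    qed
    then obtain N where N: "\<And>m i j. i \<ge> N m \<Longrightarrow> j \<ge> N m \<Longrightarrow> nsq (f (r i) (k, m) - f (r j) (k, m)) < \<delta>" by metis
    define N0 where "N0 = (\<Sum>m\<in>F. N m)"
    have N0: "N m \<le> N0" if "m \<in> F" for m unfolding N0_def using that F by (intro member_le_sum) auto
    have "(LBINT x. nsq (v i x - v j x)) < \<epsilon>" if ij: "i \<ge> N0" "j \<ge> N0" for i j
    proof -
      have pt: "nsq (v i x - v j x) \<le> 2 * (?P^2 * \<delta>) * indicator (cball 0 R) x
         + (4 * nsq (cube_avg k (v i) x - v i x) + 4 * nsq (cube_avg k (v j) x - v j x))
         + (2 / R^2 * (nsq x * nsq (v i x)) + 2 / R^2 * (nsq x * nsq (v j x)))" for x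
      proof (cases "norm x \<le> R")
        case True
        let ?A = "cube_avg k (v i) x - cube_avg k (v j) x"
        let ?B = "(v i x - cube_avg k (v i) x) - (v j x - cube_avg k (v j) x)"
        have "nsq (v i x - v j x) = nsq (?A + ?B)" by (simp add: algebra_simps)
        also have "\<dots> \<le> 2 * (norm ?A)^2 + 2 * (norm ?B)^2" by (rule norm_add_sq_le)
        also have "(norm ?B)^2 \<le> 2 * nsq (v i x - cube_avg k (v i) x) + 2 * nsq (v j x - cube_avg k (v j) x)" by (rule norm_diff_sq_le)
        also have "(norm ?A)^2 \<le> ?P^2 * \<delta>"
        proof -
          let ?m = "cube_idx k x"
          have "?A = ?P *\<^sub>R (f (r i) (k, ?m) - f (r j) (k, ?m))" by (simp add: cube_avg_def f_def v_def scaleR_diff_right)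
          then have "(norm ?A)^2 = ?P^2 * nsq (f (r i) (k, ?m) - f (r j) (k, ?m))" by (simp add: power_mult_distrib)
          also have "\<dots> \<le> ?P^2 * \<delta>" using N[of ?m i j] N0[OF idxF[OF True]] ij by (intro mult_left_mono less_imp_le) auto
          finally show ?thesis .
        qed
        finally have "nsq (v i x - v j x) \<le> 2 * (?P^2 * \<delta>) + 2 * (2 * nsq (v i x - cube_avg k (v i) x) + 2 * nsq (v j x - cube_avg k (v j) x))"
          by simp
        moreover have "0 \<le> 2 / R^2 * (nsq x * nsq (v i x)) + 2 / R^2 * (nsq x * nsq (v j x))" by simp
        moreover have "norm (cube_avg k (v i) x - v i x) = norm (v i x - cube_avg k (v i) x)" for i by (rule norm_minus_commute)
        moreover have "indicator (cball 0 R) x = (1::real)" using True by simp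
        moreover have "A \<le> b + (4 * c + 4 * d) + e" if "A \<le> b + 2 * (2 * c + 2 * d)" "0 \<le> e" for A b c d e :: real using that by simp
        ultimately show ?thesis by (simp only: mult_1_right)
      next
        case False
        have "nsq (v i x - v j x) \<le> 1 * (2 * nsq (v i x) + 2 * nsq (v j x))" using norm_diff_sq_le by simp
        also have "\<dots> \<le> (nsq x / R^2) * (2 * nsq (v i x) + 2 * nsq (v j x))"
          using False R by (intro mult_right_mono) (auto simp: pos_le_divide_eq intro!: power_mono)
        also have "\<dots> = 2 / R^2 * (nsq x * nsq (v i x)) + 2 / R^2 * (nsq x * nsq (v j x))"
          by (simp add: add_divide_distrib distrib_left ac_simps)
        finally have "nsq (v i x - v j x) \<le> 2 / R^2 * (nsq x * nsq (v i x)) + 2 / R^2 * (nsq x * nsq (v j x))" .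
        moreover have "0 \<le> 4 * nsq (cube_avg k (v i) x - v i x) + 4 * nsq (cube_avg k (v j) x - v j x)" by simp
        moreover have "indicator (cball 0 R) x = (0::real)" using False by simp
        moreover have "A \<le> b * 0 + c + e" if "A \<le> e" "0 \<le> c" for A b c e :: real using that by simp
        ultimately show ?thesis by (simp only:)
      qed
      have mo_eq: "(LBINT+ x. ennreal (nsq x * nsq (v i x))) \<le> ennreal M" for i using nn_integral_square[OF xu[of "r i"]] mo[of "r i"]
        by (simp add: power_mult_distrib moment_def v_def ennreal_leI)
      have ap: "(LBINT+ x. ennreal (nsq (cube_avg k (v i) x - v i x))) \<le> ennreal (cc * M / 4^k)" for i
        unfolding v_def cc_def by (rule cube_avg_approx[OF u tr M])
      have R2: "2 / R^2 \<ge> 0" by simp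
      have "ennreal (LBINT x. nsq (v i x - v j x)) = (LBINT+ x. ennreal (nsq (v i x - v j x)))"
        by (rule nn_integral_square[OF square_integrable_diff[OF v v], symmetric])
      also have "\<dots> \<le> (LBINT+ x. ennreal (2 * (?P^2 * \<delta>)) * indicator (cball 0 R) x
         + (4 * ennreal (nsq (cube_avg k (v i) x - v i x)) + 4 * ennreal (nsq (cube_avg k (v j) x - v j x)))
         + (ennreal (2 / R^2) * ennreal (nsq x * nsq (v i x)) + ennreal (2 / R^2) * ennreal (nsq x * nsq (v j x))))"
      proof (rule nn_integral_mono)
        fix x :: "real^'n"
        show "ennreal (nsq (v i x - v j x)) \<le> ennreal (2 * (?P^2 * \<delta>)) * indicator (cball 0 R) x
         + (4 * ennreal (nsq (cube_avg k (v i) x - v i x)) + 4 * ennreal (nsq (cube_avg k (v j) x - v j x)))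
         + (ennreal (2 / R^2) * ennreal (nsq x * nsq (v i x)) + ennreal (2 / R^2) * ennreal (nsq x * nsq (v j x)))"
          unfolding ennreal_indicator[symmetric] using \<delta> by (intro ennreal_splitting_bound pt) auto
      qed
      also have "\<dots> = ennreal (2 * (?P^2 * \<delta>)) * ennreal V
         + (4 * (LBINT+ x. ennreal (nsq (cube_avg k (v i) x - v i x))) + 4 * (LBINT+ x. ennreal (nsq (cube_avg k (v j) x - v j x))))
         + (ennreal (2 / R^2) * (LBINT+ x. ennreal (nsq x * nsq (v i x))) + ennreal (2 / R^2) * (LBINT+ x. ennreal (nsq x * nsq (v j x))))"
        by (simp add: nn_integral_add nn_integral_cmult nn_integral_cmult_indicator eV)
      also have "\<dots> \<le> ennreal (2 * (?P^2 * \<delta>)) * ennreal V + (4 * ennreal (cc * M / 4^k) + 4 * ennreal (cc * M / 4^k))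
         + (ennreal (2 / R^2) * ennreal M + ennreal (2 / R^2) * ennreal M)" by (intro add_mono mult_left_mono ap mo_eq) auto
      also have "\<dots> = ennreal (2 * (?P^2 * \<delta>) * V + 8 * (cc * M / 4^k) + 4 * M / R^2)"
      proof -
        have t1: "ennreal (2 * (?P^2 * \<delta>)) * ennreal V = ennreal (2 * (?P^2 * \<delta>) * V)" using \<delta> V by (simp add: ennreal_mult)
        have t2: "4 * ennreal (cc * M / 4^k) + 4 * ennreal (cc * M / 4^k) = ennreal (8 * (cc * M / 4^k))"
        proof -
          have "4 * ennreal c + 4 * ennreal c = ennreal (8 * c)" if "0 \<le> c" for c using that by (simp add: ennreal_mult flip: distrib_right)
          then show ?thesis using cc M by simp
        qed
        have t3: "ennreal (2 / R^2) * ennreal M + ennreal (2 / R^2) * ennreal M = ennreal (4 * M / R^2)"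
        proof -
          have "ennreal (2 / R^2) * ennreal M + ennreal (2 / R^2) * ennreal M = ennreal (2 / R^2 * M) + ennreal (2 / R^2 * M)"
            by (simp only: ennreal_mult[OF R2 M])
          also have "\<dots> = ennreal (2 / R^2 * M + 2 / R^2 * M)" using R2 M by (intro ennreal_plus[symmetric]) auto
          also have "2 / R^2 * M + 2 / R^2 * M = 4 * M / R^2" by simp
          finally show ?thesis .
        qed
        have n: "0 \<le> 2 * (?P^2 * \<delta>) * V" "0 \<le> 8 * (cc * M / 4^k)" "0 \<le> 4 * M / R^2" using \<delta> V cc M by auto
        show ?thesis unfolding t1 t2 t3 using n by (simp add: ennreal_plus del: times_divide_eq_right)
      qed
      finally have "(LBINT x. nsq (v i x - v j x)) \<le> 2 * (?P^2 * \<delta>) * V + 8 * (cc * M / 4^k) + 4 * M / R^2"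
        using \<delta> V cc M by (subst (asm) ennreal_le_iff) auto
      moreover have "2 * (?P^2 * \<delta>) * V \<le> \<epsilon> / 4"
      proof -
        have "2 * (?P^2 * \<delta>) * V \<le> 2 * (?P^2 * \<delta>) * (V + 1)" using \<delta> V by (intro mult_left_mono) auto
        also have "\<dots> = (8 * (?P^2 * (V + 1))) * \<delta> / 4" by simp
        also have "(8 * (?P^2 * (V + 1))) * \<delta> = \<epsilon>" 
        proof -
          have "X * (\<epsilon> / X) = \<epsilon>" if "X > 0" for X using that by simp
          then show ?thesis unfolding \<delta>_def using den by blast
        qed
        finally show ?thesis by simp
      qed
      ultimately show ?thesis using k R(2) \<open>\<epsilon> > 0\<close> by linarith
    qed
    then show ?thesis by blast
  qed
  obtain w s where w: "square_integrable lborel w" "strict_mono (s::nat\<Rightarrow>nat)"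
    "AE x in lborel. (\<lambda>n. v (s n) x) \<longlonglongrightarrow> w x" "(\<lambda>n. LBINT x. nsq (v n x - w x)) \<longlonglongrightarrow> 0"
    by (rule L2_complete[OF v Cau]) blast
  show ?thesis
  proof (rule that[of "r \<circ> s" w])
    show "strict_mono (r \<circ> s)" using r w(2) by (rule strict_mono_o)
    show "square_integrable lborel w" by (rule w)
    show "AE x in lborel. (\<lambda>n. u ((r \<circ> s) n) x) \<longlonglongrightarrow> w x" using w(3) by (simp add: v_def)
    show "(\<lambda>n. LBINT x. nsq (u ((r \<circ> s) n) x - w x)) \<longlonglongrightarrow> 0"
      using LIMSEQ_subseq_LIMSEQ[OF w(4) w(2)] by (simp add: v_def o_def)
  qed
qed

subsection \<open>The singular weight\<close>

text \<open>On the shell between radii \<open>(1/2)^k\<close> and \<open>2 * (1/2)^k\<close> the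
  weight is at most \<open>2 powr (a * k)\<close>, and the enclosing ball has volume of order
  \<open>2 powr (- k * N)\<close>. The series is geometric with ratio
  \<open>q = 2 powr (a - N)\<close>.\<close>

lemma singular_weight_integrable:
  assumes a: "0 < a" "a < real CARD('n::finite)"
  shows "(LBINT+ x. indicator (ball 0 1) x * ennreal (norm (x::real^'n) powr (- a))) < \<infinity>"
proof -
  let ?N = "CARD('n)"
  let ?V = "unit_ball_vol (real DIM(real^'n))"
  define q where "q = 2 powr (a - real ?N)"
  have q: "0 < q" "q < 1" using a by (auto simp: q_def powr_less_one)
  have "(LBINT+ x. indicator (ball 0 1) x * ennreal (norm (x::real^'n) powr (- a)))
    \<le> (LBINT+ x. (\<Sum>k. ennreal (2 powr (a * real (Suc k))) * indicator (ball (0::real^'n) (2 * (1/2)^k)) x))"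
  proof (rule nn_integral_mono)
    fix x :: "real^'n"
    show "indicator (ball 0 1) x * ennreal (norm x powr (- a)) \<le> (\<Sum>k. ennreal (2 powr (a * real (Suc k))) * indicator (ball 0 (2 * (1/2)^k)) x)"
    proof (cases "0 < norm x \<and> norm x < 1")
      case True
      obtain n where n: "(1/2)^n < norm x" using real_arch_pow_inv[of "norm x" "1/2"] True by auto
      define k where "k = (LEAST k. (1/2)^k \<le> norm x)"
      have k1: "(1/2)^k \<le> norm x" unfolding k_def by (rule LeastI[of _ n]) (use n in simp)
      have "k \<noteq> 0" using k1 True by (intro notI) simp
      then obtain j where j: "k = Suc j" by (auto simp: gr0_conv_Suc)
      have k2: "norm x < (1/2)^j" using not_less_Least[of j "\<lambda>k. (1/2)^k \<le> norm x"] j by (simp add: k_def)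
      have "norm x powr (- a) \<le> ((1/2)^k) powr (- a)" using k1 a by (intro powr_mono2') auto
      also have "((1/2)^k) powr (- a) = 2 powr (a * real k)"
        by (simp add: powr_realpow[symmetric] powr_powr powr_divide powr_minus_divide mult.commute flip: powr_minus)
      also have "\<dots> \<le> 2 powr (a * real (Suc k))" using a by (intro powr_mono) auto
      finally have "ennreal (norm x powr (- a)) \<le> ennreal (2 powr (a * real (Suc k)))" by (rule ennreal_leI)
      moreover have "x \<in> ball 0 (2 * (1/2)^k)" using k2 j by simp
      ultimately have "indicator (ball 0 1) x * ennreal (norm x powr (- a)) \<le> ennreal (2 powr (a * real (Suc k))) * indicator (ball 0 (2 * (1/2)^k)) x"
        using True by simp
      also have "\<dots> \<le> (\<Sum>k. ennreal (2 powr (a * real (Suc k))) * indicator (ball 0 (2 * (1/2)^k)) x)"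
      proof -
        have "f k \<le> (\<Sum>k. f k)" for f :: "nat \<Rightarrow> ennreal" using sum_le_suminf[of f "{k}"] by simp
        then show ?thesis .
      qed
      finally show ?thesis .
    next
      \<comment> \<open>At the origin the integrand is \<open>0\<close>, as
        \<open>0 powr (- a) = 0\<close>.\<close>
      case False
      then have "indicator (ball 0 1) x * ennreal (norm x powr (- a)) = 0" by (cases "x = 0") (auto simp: indicator_def)
      then show ?thesis by (simp only: zero_le)
    qed
  qed
  also have "\<dots> = (\<Sum>k. (LBINT+ x. ennreal (2 powr (a * real (Suc k))) * indicator (ball (0::real^'n) (2 * (1/2)^k)) x))"
    by (rule nn_integral_suminf) measurable
  also have "\<dots> = (\<Sum>k. ennreal ((2 powr a * ?V * 2^?N) * q^k))"
  proof (rule suminf_cong)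
    fix k
    have "(LBINT+ x. ennreal (2 powr (a * real (Suc k))) * indicator (ball (0::real^'n) (2 * (1/2)^k)) x)
      = ennreal (2 powr (a * real (Suc k))) * ennreal (?V * (2 * (1/2)^k)^?N)" by (subst nn_integral_cmult_indicator) (auto simp: emeasure_ball)
    also have "\<dots> = ennreal (2 powr (a * real (Suc k)) * (?V * (2 * (1/2)^k)^?N))" by (intro ennreal_mult[symmetric]) auto
    also have "2 powr (a * real (Suc k)) * (?V * (2 * (1/2)^k)^?N) = (2 powr a * ?V * 2^?N) * q^k"
    proof -
      have e1: "((1/2::real)^k)^?N = 2 powr (- real (k * ?N))"
        by (simp only: power_mult[symmetric] power_one_over powr_minus_divide powr_realpow zero_less_numeral)
      have "q^k = q powr real k" using q by (simp only: powr_realpow)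
      also have "\<dots> = 2 powr ((a - real ?N) * real k)" unfolding q_def by (rule powr_powr)
      also have "(a - real ?N) * real k = a * real k + - real (k * ?N)" by (simp add: algebra_simps)
      finally have e2: "q^k = 2 powr (a * real k) * 2 powr (- real (k * ?N))" by (simp only: powr_add)
      have e3: "2 powr (a * real (Suc k)) = 2 powr a * 2 powr (a * real k)" unfolding powr_add[symmetric] by (simp add: algebra_simps)
      show ?thesis unfolding power_mult_distrib e1 e2 e3 by (simp only: ac_simps)
    qed
    finally show "(LBINT+ x. ennreal (2 powr (a * real (Suc k))) * indicator (ball (0::real^'n) (2 * (1/2)^k)) x) = ennreal ((2 powr a * ?V * 2^?N) * q^k)" .
  qed
  also have "\<dots> < \<infinity>" using q by (subst suminf_ennreal2) (auto intro!: summable_mult summable_geometric)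
  finally show ?thesis .
qed

section \<open>Inequalities for real powers\<close>

text \<open>Split at \<open>y powr (r - \<alpha>) = 1 / \<eta>\<close>: above it the r-th power
  absorbs \<open>y powr \<alpha>\<close>, below it \<open>y powr (\<alpha> - 2)\<close> is bounded
  by the constant.\<close>

lemma powr_interpolation:
  assumes "2 < \<alpha>" "\<alpha> < r" "\<eta> > 0"
  shows "\<exists>C\<ge>0. \<forall>y\<ge>0. y powr \<alpha> \<le> \<eta> * y powr r + C * (y::real)^2"
proof (intro exI[of _ "(1/\<eta>) powr ((\<alpha> - 2) / (r - \<alpha>))"] conjI allI impI)
  fix y :: real assume y: "y \<ge> 0"
  let ?C = "(1/\<eta>) powr ((\<alpha> - 2) / (r - \<alpha>))"
  show "y powr \<alpha> \<le> \<eta> * y powr r + ?C * y^2"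
  proof (cases "y = 0")
    case False
    then have y0: "y > 0" using y by simp
    show ?thesis
    proof (cases "1 / \<eta> \<le> y powr (r - \<alpha>)")
      case True
      then have "1 \<le> \<eta> * y powr (r - \<alpha>)" using assms by (simp add: field_simps)
      then have "y powr \<alpha> * 1 \<le> y powr \<alpha> * (\<eta> * y powr (r - \<alpha>))" by (intro mult_left_mono) auto
      also have "\<dots> = \<eta> * y powr r" using y0 by (simp flip: powr_add)
      finally show ?thesis by (simp add: add_increasing2)
    next
      case False
      then have "(y powr (r - \<alpha>)) powr ((\<alpha> - 2) / (r - \<alpha>)) \<le> ?C" using assms by (intro powr_mono2) auto
      then have "y powr (\<alpha> - 2) \<le> ?C" using assms by (simp add: powr_powr)
      then have "y powr (\<alpha> - 2) * y^2 \<le> ?C * y^2" by (intro mult_right_mono) auto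
      moreover have "y powr (\<alpha> - 2) * y^2 = y powr \<alpha>"
      proof -
        have "y^2 = y powr 2" using y0 by simp
        then show ?thesis by (simp only: powr_add[symmetric] diff_add_cancel)
      qed
      ultimately show ?thesis using assms by (simp add: add_increasing)
    qed
  qed simp
qed simp

text \<open>Split according to which of \<open>B\<close> and
  \<open>\<theta> * A powr (s - 1)\<close> is larger; in each case a single term on the right
  suffices.\<close>

lemma Young_with_parameter:
  assumes s: "s > 1" and \<theta>: "\<theta> > 0" and AB: "A \<ge> 0" "B \<ge> (0::real)"
  shows "A * B \<le> \<theta> * A powr s + \<theta> powr (- 1 / (s - 1)) * B powr (s / (s - 1))"
proof (cases "A = 0 \<or> B = 0")
  case True
  then show ?thesis using \<theta> by auto
next
  case False
  then have A: "A > 0" and B: "B > 0" using AB by auto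
  show ?thesis
  proof (cases "B \<le> \<theta> * A powr (s - 1)")
    case True
    then have "A * B \<le> A * (\<theta> * A powr (s - 1))" using A by (intro mult_left_mono) auto
    also have "\<dots> = \<theta> * (A powr 1 * A powr (s - 1))" using A by simp
    also have "A powr 1 * A powr (s - 1) = A powr s" unfolding powr_add[symmetric] by simp
    finally show ?thesis by (simp add: add_increasing2)
  next
    case False
    then have "A powr (s - 1) \<le> B / \<theta>" using \<theta> by (simp add: field_simps)
    then have "(A powr (s - 1)) powr (1 / (s - 1)) \<le> (B / \<theta>) powr (1 / (s - 1))" using s by (intro powr_mono2) auto
    then have "A \<le> (B / \<theta>) powr (1 / (s - 1))" using s A by (simp add: powr_powr)
    then have "A * B \<le> (B / \<theta>) powr (1 / (s - 1)) * B" using B by (intro mult_right_mono) auto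
    also have "\<dots> = \<theta> powr (- 1 / (s - 1)) * (B powr (1 / (s - 1)) * B powr 1)"
      using B \<theta> by (simp add: powr_divide powr_minus_divide)
    also have "B powr (1 / (s - 1)) * B powr 1 = B powr (s / (s - 1))" unfolding powr_add[symmetric] using s by (simp add: field_simps)
    finally show ?thesis using \<theta> by (simp add: add_increasing)
  qed
qed

text \<open>The weighted arithmetic-geometric mean inequality for \<open>t powr q\<close> and
  \<open>1\<close> with weights \<open>1/q\<close> and \<open>1 - 1/q\<close>.\<close>

lemma Bernoulli_powr:
  fixes t q :: real
  assumes "t \<ge> 0" "q \<ge> 1"
  shows "1 + q * (t - 1) \<le> t powr q"
proof (cases "t = 0")
  case False
  have "(t powr q) powr (1 / q) * 1 powr (1 - 1 / q) \<le> (1 / q) * t powr q + (1 - 1 / q) * 1"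
    using assms False by (intro Youngs_inequality_0) (auto simp: divide_le_eq_1)
  then have "t \<le> (1 / q) * t powr q + (1 - 1 / q)" using assms False by (simp add: powr_powr)
  then have "q * t \<le> q * ((1 / q) * t powr q + (1 - 1 / q))" using assms by (intro mult_left_mono) auto
  then show ?thesis using assms by (simp add: algebra_simps)
qed (use assms in simp)

text \<open>The supporting hyperplane at \<open>a\<close> of the convex function
  \<open>norm z powr q\<close>. It bounds the weighted power from below without any differentiation
  under the integral.\<close>

lemma norm_powr_convex:
  fixes a z :: "'b::real_inner"
  assumes q: "q \<ge> 1"
  shows "norm a powr q + q * norm a powr (q - 2) * (a \<bullet> (z - a)) \<le> norm z powr q"
proof (cases "a = 0")
  case False
  then have a: "norm a > 0" by simp
  have "a \<bullet> (z - a) \<le> norm a * norm z - nsq a" using norm_cauchy_schwarz[of a z] by (simp add: inner_diff_right power2_norm_eq_inner)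
  also have "\<dots> = nsq a * (norm z / norm a - 1)" using a by (simp add: field_simps power2_eq_square)
  finally have "norm a powr q + q * norm a powr (q - 2) * (a \<bullet> (z - a))
    \<le> norm a powr q + q * norm a powr (q - 2) * (nsq a * (norm z / norm a - 1))" using q by (intro add_left_mono mult_left_mono) auto
  also have "\<dots> = norm a powr q * (1 + q * (norm z / norm a - 1))"
  proof -
    have "nsq a = norm a powr 2" using a by simp
    then have "norm a powr (q - 2) * nsq a = norm a powr q" by (simp only: powr_add[symmetric] diff_add_cancel)
    then show ?thesis by (simp add: distrib_left ac_simps)
  qed
  also have "\<dots> \<le> norm a powr q * (norm z / norm a) powr q" using q by (intro mult_left_mono Bernoulli_powr) auto
  also have "\<dots> = norm z powr q" using a by (simp add: powr_divide)
  finally show ?thesis .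
qed (use q in simp)

subsection \<open>Borel representatives\<close>

lemma sigma_iff_bsigma:
  assumes u: "borel_fun u"
  shows "u \<in> Sigma_space \<longleftrightarrow> u \<in> bsigma"
proof -
  have "borel_fun (\<lambda>x. norm x *\<^sub>R u x)" using u by measurable
  then show ?thesis by (simp add: Sigma_space_def bsigma_def H1_iff_wgrad[OF u] L2_iff square_integrable_lebesgue_iff)
qed

lemma mass_pos_iff:
  assumes "u \<in> bsigma"
  shows "mass u > 0 \<longleftrightarrow> \<not> (AE x in lebesgue. u x = 0)"
proof -
  have um[measurable]: "borel_fun u" by (rule bsigmaD[OF assms])
  have "mass u = 0 \<longleftrightarrow> (AE x in lborel. nsq (u x) = 0)"
    unfolding mass_def using square_integrableD(2)[OF bsigmaD(2)[OF assms]] by (rule integral_nonneg_eq_0_iff_AE) simp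
  also have "\<dots> \<longleftrightarrow> (AE x in lebesgue. u x = 0)" by (simp add: AE_completion_iff)
  finally show ?thesis using mass_nonneg[of u] by linarith
qed

lemma sigma_nonzero_iff:
  assumes u: "borel_fun u"
  shows "u \<in> Sigma_nonzero \<longleftrightarrow> u \<in> bsigma \<and> mass u > 0"
  using sigma_iff_bsigma[OF u] mass_pos_iff by (auto simp: Sigma_nonzero_def)

definition energy :: "real \<Rightarrow> real \<Rightarrow> (real^'n \<Rightarrow> complex) \<Rightarrow> real" where
  "energy \<gamma> \<omega> u = dirichlet u + \<gamma>^2 * moment u + \<omega> * mass u"

lemma H_norm_sq_eq_energy:
  assumes u[measurable]: "borel_fun u"
  shows "H_norm_sq \<gamma> \<omega> u = energy \<gamma> \<omega> u"
proof -
  have "(\<integral>x. nsq x * nsq (u x) \<partial>lebesgue) = moment u" "(\<integral>x. nsq (u x) \<partial>lebesgue) = mass u"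
    unfolding moment_def mass_def by (intro integral_lebesgue_eq; measurable)+
  then show ?thesis by (simp add: H_norm_sq_def energy_def dirichlet_def)
qed

text \<open>All functionals of the problem depend only on the class modulo null sets, so they may be
  evaluated at a Borel representative.\<close>

lemma sigma_representative:
  assumes u: "u \<in> Sigma_space"
  obtains v where "v \<in> bsigma" "AE x in lebesgue. u x = v x" "borel_fun v"
    "H_norm_sq \<gamma> \<omega> u = energy \<gamma> \<omega> v" "P_fun b p u = P_fun b p v"
    "u \<in> Sigma_nonzero \<longleftrightarrow> mass v > 0"
proof -
  have uL: "square_integrable lebesgue u" using u by (auto simp: Sigma_space_def H1_def L2_iff)
  have um[measurable]: "u \<in> borel_measurable lebesgue" by (rule square_integrableD(1)[OF uL])
  obtain v where vb[measurable]: "borel_fun v" and ae: "AE x in lebesgue. u x = v x" using borel_representative[OF um] by blast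
  have vm[measurable]: "v \<in> borel_measurable lebesgue" by (rule borel_imp_lebesgue[OF vb])
  have hw: "has_weak_gradient u = has_weak_gradient v" by (rule has_weak_gradient_cong_AE[OF ae um vm])
  then have wg: "weak_gradient u = weak_gradient v" by (simp add: weak_gradient_def)
  have nm[measurable]: "(\<lambda>x::real^'a. norm x) \<in> borel_measurable lebesgue" "(\<lambda>x::real^'a. norm x powr - b) \<in> borel_measurable lebesgue"
    and id[measurable]: "(\<lambda>x::real^'a. x) \<in> borel_measurable lebesgue" by (intro borel_imp_lebesgue; measurable)+
  have "u \<in> L2 \<longleftrightarrow> v \<in> L2" unfolding L2_iff by (rule square_integrable_cong_AE[OF ae um vm])
  moreover have "AE x in lebesgue. norm x *\<^sub>R u x = norm x *\<^sub>R v x" using ae by eventually_elim simp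
  then have "(\<lambda>x. norm x *\<^sub>R u x) \<in> L2 \<longleftrightarrow> (\<lambda>x. norm x *\<^sub>R v x) \<in> L2"
    unfolding L2_iff by (intro square_integrable_cong_AE borel_measurable_scaleR nm um vm)
  ultimately have "v \<in> Sigma_space" using u hw by (simp add: Sigma_space_def H1_def)
  then have v: "v \<in> bsigma" using sigma_iff_bsigma[OF vb] by simp
  have ae_cong: "AE x in lebesgue. F x (u x) = F x (v x)" for F :: "real^'a \<Rightarrow> complex \<Rightarrow> real" using ae by eventually_elim simp
  have "(\<integral>x. nsq x * nsq (u x) \<partial>lebesgue) = (\<integral>x. nsq x * nsq (v x) \<partial>lebesgue)"
    by (rule integral_cong_AE[OF _ _ ae_cong]) measurable
  moreover have "(\<integral>x. nsq (u x) \<partial>lebesgue) = (\<integral>x. nsq (v x) \<partial>lebesgue)"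
    by (rule integral_cong_AE[OF _ _ ae_cong]) measurable
  ultimately have H: "H_norm_sq \<gamma> \<omega> u = energy \<gamma> \<omega> v"
    unfolding H_norm_sq_eq_energy[OF vb, symmetric] by (simp add: H_norm_sq_def wg)
  have P: "P_fun b p u = P_fun b p v" unfolding P_fun_def by (rule integral_cong_AE[OF _ _ ae_cong]) measurable
  have "(AE x in lebesgue. u x = 0) \<longleftrightarrow> (AE x in lebesgue. v x = 0)"
  proof
    assume "AE x in lebesgue. u x = 0"
    with ae show "AE x in lebesgue. v x = 0" by eventually_elim simp
  next
    assume "AE x in lebesgue. v x = 0"
    with ae show "AE x in lebesgue. u x = 0" by eventually_elim simp
  qed
  then have "u \<in> Sigma_nonzero \<longleftrightarrow> mass v > 0" using u mass_pos_iff[OF v] by (simp add: Sigma_nonzero_def)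
  with v ae vb H P show ?thesis by (rule that)
qed

text \<open>Kept in \<open>ennreal\<close> until finiteness is proved on
  \<open>bsigma\<close>.\<close>

definition weighted_power :: "real \<Rightarrow> real \<Rightarrow> (real^'n \<Rightarrow> complex) \<Rightarrow> ennreal" where
  "weighted_power b q u = (LBINT+ x. ennreal (norm x powr (- b) * norm (u x) powr q))"

subsection \<open>Test functions as elements of the energy space\<close>

text \<open>A linear form of quadratic size near \<open>0\<close> vanishes; it is tested with a
  small multiple of its own vector.\<close>

lemma linear_term_zero:
  fixes D :: "real^'n"
  assumes C: "\<And>h. norm h \<le> 1 \<Longrightarrow> \<bar>h \<bullet> D\<bar> \<le> C * nsq h"
  shows "D = 0"
proof (rule ccontr)
  assume D: "D \<noteq> 0"
  define C' where "C' = max C 1"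
  have C': "C' \<ge> 1" "\<And>h. norm h \<le> 1 \<Longrightarrow> \<bar>h \<bullet> D\<bar> \<le> C' * nsq h"
    using C by (auto simp: C'_def intro!: order_trans[OF C mult_right_mono])
  \<comment> \<open>The first bound makes \<open>t *\<^sub>R D\<close> admissible, the second makes
    the quadratic side at most half of the linear one.\<close>
  define t where "t = min (1 / norm D) (1 / (2 * C'))"
  have t: "t > 0" "t * norm D \<le> 1" "t * C' \<le> 1/2" using D C'(1) by (auto simp: t_def min_def field_simps)
  have "\<bar>(t *\<^sub>R D) \<bullet> D\<bar> \<le> C' * nsq (t *\<^sub>R D)" using t by (intro C'(2)) simp
  then have "t * nsq D \<le> (t * C') * (t * nsq D)"
    using t power2_norm_eq_inner[of D] by (simp add: abs_mult power_mult_distrib power2_eq_square mult_ac)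
  also have "\<dots> \<le> (1/2) * (t * nsq D)" using t by (intro mult_right_mono) auto
  finally show False using t(1) D by simp
qed

text \<open>The integral of \<open>f x * g (x - h)\<close> is also that of
  \<open>g x * f (x + h)\<close>. Expanding both in \<open>h\<close> and comparing the linear terms
  gives the formula.\<close>

lemma test_function_integral_by_parts:
  fixes f g :: "real^'n \<Rightarrow> real"
  assumes f: "test_function f" and g: "test_function g"
  shows "(LBINT x. f x * partial_deriv j g x) = - (LBINT x. partial_deriv j f x * g x)"
proof -
  have fs: "square_integrable lborel f" and gs: "square_integrable lborel g" using f g by (auto intro: test_function_square_integrable)
  obtain C1 where C1: "\<And>h. norm h \<le> 1 \<Longrightarrow>
    \<bar>(LBINT x. f x * g (x - h)) - (LBINT x. f x * g x)
      + (\<Sum>j\<in>UNIV. h $ j * (LBINT x. f x * partial_deriv j g x))\<bar> \<le> C1 * nsq h"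
    using test_function_integral_expansion[OF fs g] by blast
  obtain C2 where C2: "\<And>h. norm h \<le> 1 \<Longrightarrow>
    \<bar>(LBINT x. g x * f (x - h)) - (LBINT x. g x * f x)
      + (\<Sum>j\<in>UNIV. h $ j * (LBINT x. g x * partial_deriv j f x))\<bar> \<le> C2 * nsq h"
    using test_function_integral_expansion[OF gs f] by blast
  define D :: "real^'n" where "D = (\<chi> j. (LBINT x. f x * partial_deriv j g x) + (LBINT x. g x * partial_deriv j f x))"
  have [measurable]: "borel_fun f" "borel_fun g" using f g by (auto intro: test_functionD)
  have "D = 0"
  proof (rule linear_term_zero[where C = "C1 + C2"])
    fix h :: "real^'n" assume h: "norm h \<le> 1"
    have tr: "(LBINT x. g x * f (x + h)) = (LBINT x. f x * g (x - h))"
      using integral_lborel_translate[of "\<lambda>x. f x * g (x - h)" h] by (simp add: mult.commute)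
    have sw: "(LBINT x. g x * f x) = (LBINT x. f x * g x)" by (simp add: mult.commute)
    have D: "h \<bullet> D = (\<Sum>j\<in>UNIV. h $ j * (LBINT x. f x * partial_deriv j g x)) + (\<Sum>j\<in>UNIV. h $ j * (LBINT x. g x * partial_deriv j f x))"
      by (simp add: inner_vec_def D_def distrib_left sum.distrib)
    have m: "(\<Sum>j\<in>UNIV. (- h) $ j * (LBINT x. g x * partial_deriv j f x)) = - (\<Sum>j\<in>UNIV. h $ j * (LBINT x. g x * partial_deriv j f x))"
      by (simp add: sum_negf)
    have "\<bar>(LBINT x. f x * g (x - h)) - (LBINT x. f x * g x)
      - (\<Sum>j\<in>UNIV. h $ j * (LBINT x. g x * partial_deriv j f x))\<bar> \<le> C2 * nsq h" using C2[of "- h"] h unfolding m sw by (simp add: tr)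
    with C1[OF h] show "\<bar>h \<bullet> D\<bar> \<le> (C1 + C2) * nsq h" unfolding D distrib_right by linarith
  qed
  then have "D $ j = 0" by simp
  then show ?thesis by (simp add: D_def mult.commute)
qed

lemma wgrad_test:
  fixes f :: "real^'n \<Rightarrow> real"
  assumes f: "test_function f"
  shows "wgrad (\<lambda>x. complex_of_real (f x)) (\<lambda>x. \<chi> i. complex_of_real (partial_deriv i f x))" (is "wgrad ?u ?G")
proof -
  have fs: "square_integrable lborel f" and ds: "square_integrable lborel (partial_deriv i f)" for i
    using f by (auto intro: test_function_square_integrable test_function_partial_deriv)
  note [measurable] = square_integrableD(1)[OF fs, simplified] square_integrableD(1)[OF ds, simplified]
  have us: "square_integrable lborel ?u" using fs by (simp add: square_integrable_def)
  have nG: "nsq (?G x) = (\<Sum>i\<in>UNIV. nsq (partial_deriv i f x))" for x by (simp add: norm_vec_def L2_set_def sum_nonneg)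
  have Gm: "?G \<in> borel_measurable borel"
  proof -
    have "continuous_on UNIV (partial_deriv i f)" for i using test_functionD(2)[OF test_function_partial_deriv[OF f]] .
    then have "continuous_on UNIV ?G" by (intro continuous_on_vec_lambda continuous_on_of_real)
    then show ?thesis by (rule borel_measurable_continuous_onI)
  qed
  have Gs: "square_integrable lborel ?G" unfolding square_integrable_def nG using Gm square_integrableD(2)[OF ds] by auto
  have "(LBINT x. partial_deriv i \<psi> x *\<^sub>R ?u x) = - (LBINT x. \<psi> x *\<^sub>R (?G x $ i))" if \<psi>: "test_function \<psi>" for \<psi> i
  proof -
    have "(LBINT x. partial_deriv i \<psi> x *\<^sub>R ?u x) = complex_of_real (LBINT x. f x * partial_deriv i \<psi> x)"
      by (subst integral_complex_of_real[symmetric]) (simp add: scaleR_conv_of_real mult.commute)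
    moreover have "(LBINT x. \<psi> x *\<^sub>R (?G x $ i)) = complex_of_real (LBINT x. partial_deriv i f x * \<psi> x)"
      by (subst integral_complex_of_real[symmetric]) (simp add: scaleR_conv_of_real mult.commute)
    ultimately show ?thesis by (simp add: test_function_integral_by_parts[OF f \<psi>])
  qed
  then show ?thesis using us Gs by (simp add: wgrad_def)
qed

lemma test_in_bsigma:
  fixes f :: "real^'n \<Rightarrow> real"
  assumes f: "test_function f"
  shows "(\<lambda>x. complex_of_real (f x)) \<in> bsigma"
proof -
  note w = wgrad_test[OF f]
  have [measurable]: "borel_fun f" by (rule test_functionD[OF f])
  obtain C R where R: "R \<ge> 0" "\<And>x. norm x > R \<Longrightarrow> f x = 0" using test_function_bounds[OF f] by metis
  have "square_integrable lborel (\<lambda>x. norm x *\<^sub>R complex_of_real (f x))"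
  proof (rule square_integrable_bound[OF wgrad_measurable(3)[OF w], where c = R])
    show "AE x in lborel. norm (norm x *\<^sub>R complex_of_real (f x)) \<le> R * norm (complex_of_real (f x))"
    proof (rule AE_I2)
      fix x :: "real^'n"
      show "norm (norm x *\<^sub>R complex_of_real (f x)) \<le> R * norm (complex_of_real (f x))"
        using R(2)[of x] by (cases "norm x > R") (auto intro: mult_right_mono)
    qed
  qed measurable
  then show ?thesis using w by (auto simp: bsigma_def)
qed

lemma bsigma_nontrivial: "\<exists>u :: real^'n \<Rightarrow> complex. u \<in> bsigma \<and> mass u > 0"
proof -
  obtain \<psi> :: "real^'n \<Rightarrow> real" where \<psi>: "test_function \<psi>" "\<And>x. norm x \<le> 1 \<Longrightarrow> \<psi> x > 0"
    using laplacian_barrier[of 1 0] by (metis zero_le_one)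
  note u = test_in_bsigma[OF \<psi>(1)]
  have "\<not> (AE x in lebesgue. complex_of_real (\<psi> x) = 0)"
  proof
    assume "AE x in lebesgue. complex_of_real (\<psi> x) = 0"
    then have "AE x in lebesgue. x \<notin> ball (0::real^'n) 1"
    proof eventually_elim
      case (elim x)
      then have "\<psi> x = 0" by simp
      then show ?case using \<psi>(2)[of x] by auto
    qed
    moreover have "{x :: real^'n. \<not> (x \<notin> ball 0 1)} = ball 0 1" by auto
    ultimately have "emeasure lebesgue (ball (0::real^'n) 1) = 0"
      using AE_iff_measurable[of "ball (0::real^'n) 1" lebesgue "\<lambda>x. x \<notin> ball 0 1"] by simp
    then have "measure lborel (ball (0::real^'n) 1) = 0" by (simp add: measure_def)
    then show False using content_ball_pos[of 1 "0::real^'n"] by (simp add: measure_completion)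
  qed
  then show ?thesis using u mass_pos_iff[OF u] by blast
qed

lemma powr_eq_square_powr:
  fixes t :: real
  assumes "t \<ge> 0"
  shows "t powr q = (t^2) powr (q / 2)"
proof (cases "t = 0")
  case False
  then have "t^2 = t powr 2" using assms by simp
  then show ?thesis by (simp only: powr_powr) simp
qed simp

section \<open>Bounds for the energy and for the weighted power\<close>

locale ground_state =
  fixes \<gamma> b p \<omega> :: real and N :: "'n::finite itself"
  assumes \<gamma>: "\<gamma> > 0" and b: "0 < b" "b < real CARD('n)" and b2: "b < 2"
    and p: "1 < p" and sub: "ereal p < two_circ CARD('n) b"
    and \<omega>: "\<omega> > - \<gamma> * real CARD('n)"
begin

definition "q = p + 1"

abbreviation "E \<equiv> energy \<gamma> \<omega> :: (real^'n \<Rightarrow> complex) \<Rightarrow> real"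
abbreviation "W \<equiv> weighted_power b q :: (real^'n \<Rightarrow> complex) \<Rightarrow> ennreal"

definition P :: "(real^'n \<Rightarrow> complex) \<Rightarrow> real" where
  "P u = enn2real (W u)"

lemma q: "q > 2" using p by (simp add: q_def)

text \<open>The two exponents below make both Hoelder's inequality against \<open>\<bar>x\<bar>\<^sup>-\<^sup>b\<close> near the origin and the
  subcritical embedding available.\<close>

lemma exponents:
  obtains r1 r where "q * real CARD('n) / (real CARD('n) - b) < r1" "q < r1" "r1 < r" "(r - 2) * (real CARD('n) - 2) < 4"
proof -
  let ?N = "real CARD('n)"
  define r0 where "r0 = q * ?N / (?N - b)"
  have "q * (?N - b) < q * ?N" using q b by (intro mult_strict_left_mono) auto
  then have r0: "q < r0" using b by (simp add: r0_def pos_less_divide_eq)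
  show ?thesis
  proof (cases "CARD('n) \<ge> 3")
    case True
    then have N2: "?N - 2 > 0" by simp
    \<comment> \<open>The Sobolev exponent: \<open>r0 < R0\<close> is a rearrangement of the bound
      on \<open>p\<close> by \<open>two_circ\<close>, and \<open>r < R0\<close> is the condition of
      \<open>subcritical_embedding\<close>.\<close>
    define R0 where "R0 = 2 * ?N / (?N - 2)"
    have "p < 1 + (4 - 2 * b) / (?N - 2)" using sub True by (simp add: two_circ_def)
    then have "q < 2 + (4 - 2 * b) / (?N - 2)" by (simp add: q_def)
    also have "\<dots> = 2 * (?N - b) / (?N - 2)" using N2 by (simp add: field_simps)
    finally have "q * (?N - 2) < 2 * (?N - b)" using N2 by (simp add: pos_less_divide_eq)
    then have "(q * (?N - 2)) * ?N < (2 * (?N - b)) * ?N" using N2 by (intro mult_strict_right_mono) auto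
    then have "q * ?N * (?N - 2) < 2 * ?N * (?N - b)" by (simp add: algebra_simps)
    then have "r0 < R0" unfolding r0_def R0_def using N2 b by (simp add: divide_less_eq less_divide_eq)
    then obtain r1 where r1: "r0 < r1" "r1 < R0" using dense by blast
    then obtain r where r: "r1 < r" "r < R0" using dense by blast
    have "(r - 2) * (?N - 2) < 4" using r(2) N2 by (simp add: R0_def pos_less_divide_eq algebra_simps)
    then show ?thesis using that[of r1 r] r0 r1 r by (simp add: r0_def)
  next
    case False
    then have "?N \<le> 2" by simp
    then have "(r0 + 2 - 2) * (?N - 2) \<le> 0" using r0 q by (intro mult_nonneg_nonpos) auto
    then show ?thesis using that[of "r0 + 1" "r0 + 2"] r0 by (simp add: r0_def)
  qed
qed

text \<open>In the unit ball Young's inequality separates the singular weight, raised to a power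
  that is still integrable, from \<open>norm u powr r1\<close>; outside, the weight is at most
  \<open>1\<close>. Powers strictly between \<open>2\<close> and \<open>r\<close> are then
  interpolated. All contributions except the mass are made small uniformly on sets of bounded
  Dirichlet integral and mass.\<close>

lemma weighted_power_estimate:
  assumes \<eta>: "\<eta> > 0" and M: "M \<ge> 0"
  shows "\<exists>K\<ge>0. \<forall>u\<in>bsigma. dirichlet u \<le> M \<longrightarrow> mass u \<le> M \<longrightarrow> W u \<le> ennreal (\<eta> + K * mass u)"
proof -
  obtain r1 r where r: "q * real CARD('n) / (real CARD('n) - b) < r1" "q < r1" "r1 < r" "(r - 2) * (real CARD('n) - 2) < 4" by (rule exponents) blast
  \<comment> \<open>Chosen so that the conjugate exponent \<open>s / (s - 1)\<close> is
    \<open>r1 / q\<close>; the lower bound on \<open>r1\<close> amounts to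
    \<open>b * s < N\<close>.\<close>
  define s where "s = r1 / (r1 - q)"
  have s: "s > 1" using r q by (simp add: s_def less_divide_eq)
  have "q * real CARD('n) < r1 * (real CARD('n) - b)" using r(1) b by (simp add: pos_divide_less_eq)
  then have "b * r1 < real CARD('n) * (r1 - q)" by (simp add: algebra_simps)
  then have bs: "0 < b * s" "b * s < real CARD('n)" using r q b s by (auto simp: s_def pos_divide_less_eq)
  define J where "J = enn2real (LBINT+ x. indicator (ball 0 1) x * ennreal (norm (x::real^'n) powr (- (b * s))))"
  have J: "(LBINT+ x. indicator (ball 0 1) x * ennreal (norm (x::real^'n) powr (- (b * s)))) = ennreal J" "J \<ge> 0"
    unfolding J_def using singular_weight_integrable[OF bs] by auto
  have "2 < r" using r q by linarith
  from subcritical_embedding[OF this r(4) M] obtain C where C: "C \<ge> 0"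
    "\<And>u :: real^'n \<Rightarrow> complex. square_integrable lborel u \<Longrightarrow>
      (\<And>h. transl_sq h u \<le> ennreal (nsq h * M)) \<Longrightarrow> mass u \<le> M \<Longrightarrow>
      (LBINT+ x. ennreal (norm (u x) powr r)) \<le> ennreal C" by blast
  define \<theta> where "\<theta> = \<eta> / (2 * (J + 1))"
  have \<theta>: "\<theta> > 0" "\<theta> * J \<le> \<eta> / 2" using \<eta> J(2) by (auto simp: \<theta>_def field_simps)
  define C1 where "C1 = \<theta> powr (- 1 / (s - 1))"
  have C1: "C1 > 0" using \<theta> by (simp add: C1_def)
  define \<epsilon> where "\<epsilon> = (\<eta> / 2) / (C1 + 1) / (C + 1)"
  have \<epsilon>: "\<epsilon> > 0" "(C1 + 1) * \<epsilon> * C \<le> \<eta> / 2"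
  proof -
    show "\<epsilon> > 0" unfolding \<epsilon>_def using \<eta> C(1) C1 by (intro divide_pos_pos) auto
    have cancel: "a * (x / a / d) * c = x * (c / d)" if "a \<noteq> 0" for a x d c :: real using that by simp
    have "(C1 + 1) * \<epsilon> * C = (\<eta> / 2) * (C / (C + 1))" unfolding \<epsilon>_def using C1 by (intro cancel) linarith
    also have "\<dots> \<le> (\<eta> / 2) * 1" using \<eta> C(1) by (intro mult_left_mono) auto
    finally show "(C1 + 1) * \<epsilon> * C \<le> \<eta> / 2" by simp
  qed
  obtain K1 where K1: "K1 \<ge> 0" "\<And>y. y \<ge> 0 \<Longrightarrow> y powr r1 \<le> \<epsilon> * y powr r + K1 * y^2"
    using powr_interpolation[of r1 r \<epsilon>] r q \<epsilon> by auto
  obtain K2 where K2: "K2 \<ge> 0" "\<And>y. y \<ge> 0 \<Longrightarrow> y powr q \<le> \<epsilon> * y powr r + K2 * y^2"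
    using powr_interpolation[of q r \<epsilon>] r q \<epsilon> by auto
  define K where "K = C1 * K1 + K2"
  have K: "K \<ge> 0" using C1 K1 K2 by (simp add: K_def)
  have pt: "\<rho> powr (- b) * y powr q \<le> \<theta> * (\<iota> * \<rho> powr (- (b * s))) + ((C1 + 1) * \<epsilon> * y powr r + K * y^2)"
    if "\<rho> > 0" "y \<ge> 0" "\<iota> = (if \<rho> < 1 then 1 else 0)" for \<rho> y \<iota> :: real
  proof (cases "\<rho> < 1")
    case True
    have ss: "s / (s - 1) = r1 / q" using r q by (simp add: s_def field_simps)
    have "\<rho> powr (- b) * y powr q \<le> \<theta> * (\<rho> powr (- b)) powr s + C1 * (y powr q) powr (s / (s - 1))"
      unfolding C1_def by (rule Young_with_parameter[OF s \<theta>(1)]) auto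
    also have "(\<rho> powr (- b)) powr s = \<rho> powr (- (b * s))" by (simp add: powr_powr)
    also have "(y powr q) powr (s / (s - 1)) = y powr r1" using q by (simp add: ss powr_powr)
    also have "C1 * y powr r1 \<le> C1 * (\<epsilon> * y powr r + K1 * y^2)" using C1 K1(2)[OF that(2)] by (intro mult_left_mono) auto
    finally have "\<rho> powr (- b) * y powr q \<le> \<theta> * \<rho> powr (- (b * s)) + C1 * (\<epsilon> * y powr r + K1 * y^2)" by simp
    moreover have "0 \<le> \<epsilon> * y powr r + K2 * y^2" using \<epsilon> K2 by simp
    ultimately show ?thesis using True that(3) by (simp add: K_def algebra_simps)
  next
    case False
    have "\<rho> powr (- b) \<le> 1" using False b powr_mono2'[of "- b" 1 \<rho>] by simp
    then have "\<rho> powr (- b) * y powr q \<le> 1 * y powr q" by (intro mult_right_mono) auto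
    also have "\<dots> \<le> \<epsilon> * y powr r + K2 * y^2" using K2(2)[OF that(2)] by simp
    finally have "\<rho> powr (- b) * y powr q \<le> \<epsilon> * y powr r + K2 * y^2" .
    moreover have "0 \<le> C1 * (\<epsilon> * y powr r + K1 * y^2)" using \<epsilon> K1 C1 by simp
    ultimately show ?thesis using False that(3) by (simp add: K_def algebra_simps)
  qed
  show ?thesis
  proof (intro exI[of _ K] conjI ballI impI K)
    fix u :: "real^'n \<Rightarrow> complex" assume u: "u \<in> bsigma" and D: "dirichlet u \<le> M" and m: "mass u \<le> M"
    have um[measurable]: "borel_fun u" by (rule bsigmaD[OF u])
    have tr: "transl_sq h u \<le> ennreal (nsq h * M)" for h
      by (rule order_trans[OF transl_sq_le_dirichlet[OF u]]) (intro ennreal_leI mult_left_mono D, simp)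
    have "W u \<le> (LBINT+ x. ennreal \<theta> * (indicator (ball 0 1) x * ennreal (norm x powr (- (b * s))))
        + (ennreal ((C1 + 1) * \<epsilon>) * ennreal (norm (u x) powr r) + ennreal K * ennreal (nsq (u x))))" unfolding weighted_power_def
    proof (rule nn_integral_mono_AE)
      show "AE x in lborel. ennreal (norm x powr (- b) * norm (u x) powr q) \<le> ennreal \<theta> * (indicator (ball 0 1) x * ennreal (norm x powr (- (b * s))))
        + (ennreal ((C1 + 1) * \<epsilon>) * ennreal (norm (u x) powr r) + ennreal K * ennreal (nsq (u x)))" using AE_lborel_singleton[of 0]
      proof eventually_elim
        case (elim x)
        let ?i = "if norm x < 1 then 1 else 0 :: real"
        have e: "ennreal (\<theta> * (?i * \<rho>) + (e * f + K * g)) = ennreal \<theta> * (ennreal ?i * ennreal \<rho>) + (ennreal e * ennreal f + ennreal K * ennreal g)"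
          if "0 \<le> \<rho>" "0 \<le> e" "0 \<le> f" "0 \<le> g" for \<rho> e f g using that \<theta> K by (simp add: ennreal_mult)
        have i: "indicator (ball 0 1) x = ennreal ?i" by (simp add: indicator_def)
        have "ennreal (norm x powr (- b) * norm (u x) powr q) \<le> ennreal (\<theta> * (?i * norm x powr (- (b * s))) + ((C1 + 1) * \<epsilon> * norm (u x) powr r + K * nsq (u x)))"
          using pt[of "norm x" "norm (u x)" ?i] elim by (intro ennreal_leI) auto
        also have "\<dots> = ennreal \<theta> * (ennreal ?i * ennreal (norm x powr (- (b * s)))) + (ennreal ((C1 + 1) * \<epsilon>) * ennreal (norm (u x) powr r) + ennreal K * ennreal (nsq (u x)))"
          using C1 \<epsilon> by (intro e) auto
        finally show ?case unfolding i .
      qed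
    qed
    also have "\<dots> = ennreal \<theta> * ennreal J + (ennreal ((C1 + 1) * \<epsilon>) * (LBINT+ x. ennreal (norm (u x) powr r)) + ennreal K * ennreal (mass u))"
      using nn_integral_square[OF bsigmaD(2)[OF u]] by (simp add: nn_integral_add nn_integral_cmult J(1)[symmetric] mass_def)
    also have "\<dots> \<le> ennreal \<theta> * ennreal J + (ennreal ((C1 + 1) * \<epsilon>) * ennreal C + ennreal K * ennreal (mass u))"
      by (intro add_left_mono add_right_mono mult_left_mono C(2) bsigmaD[OF u] tr m) auto
    also have "\<dots> = ennreal (\<theta> * J + ((C1 + 1) * \<epsilon> * C + K * mass u))"
      using \<theta> J C1 \<epsilon> C K mass_nonneg[of u] by (simp add: ennreal_mult)
    also have "\<dots> \<le> ennreal (\<eta> + K * mass u)" using \<theta>(2) \<epsilon>(2) by (intro ennreal_leI) simp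
    finally show "W u \<le> ennreal (\<eta> + K * mass u)" .
  qed
qed

lemma W_finite:
  assumes "u \<in> bsigma"
  shows "W u < \<infinity>" "W u = ennreal (P u)" "P u \<ge> 0"
proof -
  have "max (dirichlet u) (mass u) \<ge> 0" using mass_nonneg[of u] by simp
  from weighted_power_estimate[OF zero_less_one this] assms obtain K where "W u \<le> ennreal (1 + K * mass u)" by force
  then show "W u < \<infinity>" using le_less_trans by (metis ennreal_less_top infinity_ennreal_def)
  then show "W u = ennreal (P u)" "P u \<ge> 0" by (auto simp: P_def)
qed

text \<open>On sets of bounded Dirichlet integral, smallness of the mass alone makes
  \<open>P\<close> small. Convergence in mean square of a minimizing sequence will therefore be
  enough for \<open>P\<close>.\<close>

lemma P_small:
  assumes "M \<ge> 0" "\<epsilon> > 0"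
  shows "\<exists>\<delta>>0. \<forall>u\<in>bsigma. dirichlet u \<le> M \<longrightarrow> mass u \<le> M \<longrightarrow> mass u \<le> \<delta> \<longrightarrow> P u \<le> \<epsilon>"
proof -
  from weighted_power_estimate[of "\<epsilon>/2" M] assms obtain K where K: "K \<ge> 0"
    "\<And>u. u \<in> bsigma \<Longrightarrow> dirichlet u \<le> M \<Longrightarrow> mass u \<le> M \<Longrightarrow> W u \<le> ennreal (\<epsilon>/2 + K * mass u)" by auto
  define \<delta> where "\<delta> = \<epsilon> / (2 * (K + 1))"
  have \<delta>: "\<delta> > 0" "K * \<delta> \<le> \<epsilon> / 2" using assms K(1) by (auto simp: \<delta>_def field_simps)
  have "P u \<le> \<epsilon>" if u: "u \<in> bsigma" "dirichlet u \<le> M" "mass u \<le> M" "mass u \<le> \<delta>" for u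
  proof -
    have "K * mass u \<le> K * \<delta>" using K that by (intro mult_left_mono) auto
    then have "ennreal (\<epsilon>/2 + K * mass u) \<le> ennreal \<epsilon>" using \<delta> by (intro ennreal_leI) simp
    then have "ennreal (P u) \<le> ennreal \<epsilon>" using K(2)[OF u(1-3)] W_finite(2)[OF u(1)] by simp
    then show ?thesis using assms by (simp add: ennreal_le_iff)
  qed
  then show ?thesis using \<delta>(1) by blast
qed

lemma P_fun_eq:
  assumes u: "u \<in> bsigma"
  shows "P_fun b p u = P u" "integrable lborel (\<lambda>x. norm x powr (- b) * norm (u x) powr q)"
    "P u = (LBINT x. norm x powr (- b) * norm (u x) powr q)"
proof -
  have um[measurable]: "borel_fun u" by (rule bsigmaD[OF u])
  have m: "borel_fun (\<lambda>x. norm x powr (- b) * norm (u x) powr q)" by measurable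
  show i: "integrable lborel (\<lambda>x. norm x powr (- b) * norm (u x) powr q)"
    using W_finite(1)[OF u] by (simp add: integrable_iff_bounded weighted_power_def)
  have "W u = ennreal (LBINT x. norm x powr (- b) * norm (u x) powr q)" unfolding weighted_power_def by (rule nn_integral_eq_integral[OF i]) simp
  moreover have "0 \<le> (LBINT x. norm x powr (- b) * norm (u x) powr q)" by (rule integral_nonneg_AE) simp
  ultimately show eq: "P u = (LBINT x. norm x powr (- b) * norm (u x) powr q)" by (simp add: P_def)
  show "P_fun b p u = P u" unfolding P_fun_def eq q_def[symmetric] by (rule integral_lebesgue_eq[OF m])
qed

lemma P_cmult:
  assumes u: "u \<in> bsigma"
  shows "P (\<lambda>x. c * u x) = norm c powr q * P u"
proof -
  have "P (\<lambda>x. c * u x) = (LBINT x. norm c powr q * (norm x powr (- b) * norm (u x) powr q))"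
    unfolding P_fun_eq(3)[OF bsigma_cmult(1)[OF u]] by (simp add: norm_mult powr_mult mult.left_commute)
  then show ?thesis by (simp add: P_fun_eq(3)[OF u])
qed

lemma E_cmult:
  assumes u: "u \<in> bsigma"
  shows "E (\<lambda>x. c * u x) = nsq c * E u" using bsigma_cmult[OF u, of c] by (simp add: energy_def algebra_simps)

lemma P_pos:
  assumes u: "u \<in> bsigma" and m: "mass u > 0"
  shows "P u > 0"
proof (rule ccontr)
  assume "\<not> P u > 0"
  then have P0: "P u = 0" using W_finite(3)[OF u] by simp
  have "AE x in lborel. norm x powr (- b) * norm (u x) powr q = 0"
    using P0 integral_nonneg_eq_0_iff_AE[OF P_fun_eq(2)[OF u]] unfolding P_fun_eq(3)[OF u] by simp
  \<comment> \<open>The weight is positive except at the origin, where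
    \<open>0 powr (- b) = 0\<close>; that point is a null set.\<close>
  then have "AE x in lborel. u x = 0" using AE_lborel_singleton[of 0] by eventually_elim simp
  then have "AE x in lebesgue. u x = 0" by (rule AE_completion)
  then show False using mass_pos_iff[OF u] m by simp
qed

text \<open>By the spectral gap a negative \<open>\<omega>\<close> above \<open>- \<gamma> N\<close>
  consumes only a fraction of \<open>T = dirichlet + \<gamma>^2 * moment\<close>. Bounding the
  remainder by the gap once more brings back the mass.\<close>

lemma coercive:
  obtains \<kappa> where "\<kappa> > 0" "\<And>u :: real^'n \<Rightarrow> complex. u \<in> bsigma \<Longrightarrow> \<kappa> * (dirichlet u + moment u + mass u) \<le> E u"
proof -
  let ?N = "real CARD('n)"
  have gN: "\<gamma> * ?N > 0" using \<gamma> by simp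
  \<comment> \<open>The share of \<open>T\<close> that is left: all of it for nonnegative
    \<open>\<omega>\<close>, and \<open>1 + \<omega> / (\<gamma> N) > 0\<close> otherwise.\<close>
  define \<theta> where "\<theta> = min 1 (1 + \<omega> / (\<gamma> * ?N))"
  have "1 + \<omega> / (\<gamma> * ?N) > 0" using pos_less_divide_eq[OF gN, of "- 1" \<omega>] \<omega> by simp
  then have \<theta>: "\<theta> > 0" by (simp add: \<theta>_def)
  define c where "c = min 1 (min (\<gamma>^2) (\<gamma> * ?N))"
  have c: "c > 0" "c \<le> 1" "c \<le> \<gamma>^2" "c \<le> \<gamma> * ?N" using \<gamma> gN by (auto simp: c_def)
  show ?thesis
  proof (rule that[of "\<theta> / 2 * c"])
    show "\<theta> / 2 * c > 0" using \<theta> c by simp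
    fix u :: "real^'n \<Rightarrow> complex" assume u: "u \<in> bsigma"
    define T where "T = dirichlet u + \<gamma>^2 * moment u"
    have gap: "\<gamma> * ?N * mass u \<le> T" unfolding T_def by (rule spectral_gap[OF u \<gamma>])
    have T0: "T \<ge> 0" using dirichlet_nonneg[of u] moment_nonneg[of u] by (simp add: T_def)
    have "\<theta> * T \<le> T + \<omega> * mass u"
    proof (cases "\<omega> \<ge> 0")
      case True
      have "\<theta> * T \<le> 1 * T" using T0 by (intro mult_right_mono) (auto simp: \<theta>_def)
      then show ?thesis using True mass_nonneg[of u] by (simp add: add_increasing2)
    next
      case False
      then have "(\<omega> / (\<gamma> * ?N)) * T \<le> (\<omega> / (\<gamma> * ?N)) * (\<gamma> * ?N * mass u)"
        using gap gN by (intro mult_left_mono_neg) (auto simp: divide_nonpos_pos)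
      also have "\<dots> = \<omega> * mass u" using \<gamma> by simp
      finally have "(1 + \<omega> / (\<gamma> * ?N)) * T \<le> T + \<omega> * mass u" by (simp add: distrib_right)
      moreover have "\<theta> * T \<le> (1 + \<omega> / (\<gamma> * ?N)) * T" using T0 by (intro mult_right_mono) (auto simp: \<theta>_def)
      ultimately show ?thesis by linarith
    qed
    moreover have "\<theta> / 2 * c * (dirichlet u + moment u + mass u) \<le> \<theta> * T"
    proof -
      have "c * (dirichlet u + moment u + mass u) \<le> 1 * dirichlet u + \<gamma>^2 * moment u + (\<gamma> * ?N) * mass u" unfolding distrib_left
        using c dirichlet_nonneg[of u] moment_nonneg[of u] mass_nonneg[of u] by (intro add_mono mult_right_mono) auto
      also have "\<dots> \<le> 2 * T" using gap unfolding T_def by argo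
      finally have "\<theta> / 2 * (c * (dirichlet u + moment u + mass u)) \<le> \<theta> / 2 * (2 * T)" using \<theta> by (intro mult_left_mono) auto
      then show ?thesis by simp
    qed
    moreover have "T + \<omega> * mass u = E u" by (simp add: energy_def T_def)
    ultimately show "\<theta> / 2 * c * (dirichlet u + moment u + mass u) \<le> E u" by linarith
  qed
qed

lemma E_pos:
  assumes u: "u \<in> bsigma" and m: "mass u > 0"
  shows "E u > 0"
proof -
  obtain \<kappa> where k: "\<kappa> > 0" "\<And>u :: real^'n \<Rightarrow> complex. u \<in> bsigma \<Longrightarrow> \<kappa> * (dirichlet u + moment u + mass u) \<le> E u"
    by (rule coercive) blast
  have "0 < \<kappa> * (dirichlet u + moment u + mass u)" using k(1) m dirichlet_nonneg[of u] moment_nonneg[of u] by (intro mult_pos_pos) auto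
  then show ?thesis using k(2)[OF u] by simp
qed

text \<open>By homogeneity it suffices to treat functions of energy \<open>h0\<close>, a value for
  which coercivity makes Dirichlet integral and mass so small that \<open>P <= 1\<close>.\<close>

lemma P_le_E:
  obtains h0 where "h0 > 0" "\<And>u. u \<in> bsigma \<Longrightarrow> mass u > 0 \<Longrightarrow> P u \<le> (E u / h0) powr (q / 2)"
proof -
  obtain \<kappa> where k: "\<kappa> > 0" "\<And>u :: real^'n \<Rightarrow> complex. u \<in> bsigma \<Longrightarrow> \<kappa> * (dirichlet u + moment u + mass u) \<le> E u"
    by (rule coercive) blast
  from P_small[of 1 1] obtain \<delta> where \<delta>: "\<delta> > 0" "\<And>u. u \<in> bsigma \<Longrightarrow> dirichlet u \<le> 1 \<Longrightarrow> mass u \<le> 1 \<Longrightarrow> mass u \<le> \<delta> \<Longrightarrow> P u \<le> 1"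
    by auto
  define h0 where "h0 = \<kappa> * min 1 \<delta>"
  have h0: "h0 > 0" using k \<delta> by (simp add: h0_def)
  show ?thesis
  proof (rule that[OF h0])
    fix u :: "real^'n \<Rightarrow> complex" assume u: "u \<in> bsigma" and m: "mass u > 0"
    have E0: "E u > 0" by (rule E_pos[OF u m])
    define c where "c = complex_of_real (sqrt (h0 / E u))"
    have c2: "nsq c = h0 / E u" using h0 E0 by (simp add: c_def)
    define v where "v = (\<lambda>x. c * u x)"
    have v: "v \<in> bsigma" unfolding v_def by (rule bsigma_cmult[OF u])
    have "E v = h0" unfolding v_def E_cmult[OF u] c2 using E0 by simp
    then have "\<kappa> * (dirichlet v + moment v + mass v) \<le> \<kappa> * min 1 \<delta>" using k(2)[OF v] by (simp add: h0_def)
    then have "dirichlet v + moment v + mass v \<le> min 1 \<delta>" using k(1) by simp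
    then have "P v \<le> 1" using dirichlet_nonneg[of v] moment_nonneg[of v] mass_nonneg[of v] by (intro \<delta>(2) v) auto
    moreover have "P v = (h0 / E u) powr (q / 2) * P u"
    proof -
      have "norm c powr q = (nsq c) powr (q / 2)" by (rule powr_eq_square_powr) simp
      then show ?thesis unfolding v_def P_cmult[OF u] c2 by simp
    qed
    ultimately have "(h0 / E u) powr (q / 2) * P u \<le> 1" by simp
    then have "(E u / h0) powr (q / 2) * ((h0 / E u) powr (q / 2) * P u) \<le> (E u / h0) powr (q / 2) * 1" by (intro mult_left_mono) auto
    moreover have "(E u / h0) powr (q / 2) * (h0 / E u) powr (q / 2) = 1" using h0 E0 by (simp flip: powr_mult)
    ultimately show "P u \<le> (E u / h0) powr (q / 2)" by (simp add: mult.assoc[symmetric])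
  qed
qed

subsection \<open>The Nehari level\<close>

text \<open>On the constraint set \<open>P = E\<close>, so the action there is
  \<open>s0 * E\<close>.\<close>

definition "s0 = 1/2 - 1/q"

lemma s0: "s0 > 0" using q by (simp add: s0_def field_simps)

definition "nehari = {u :: real^'n \<Rightarrow> complex. u \<in> bsigma \<and> mass u > 0 \<and> E u = P u}"

definition "\<mu> = Inf (E ` nehari)"

text \<open>\<open>E\<close> is homogeneous of degree \<open>2\<close> and \<open>P\<close> of
  degree \<open>q\<close>, so the factor \<open>t\<close> has to satisfy
  \<open>t powr (q - 2) = E u / P u\<close>.\<close>

lemma nehari_scale:
  assumes u: "u \<in> bsigma" and m: "mass u > 0"
  obtains c where "(\<lambda>x. c * u x) \<in> nehari" "E (\<lambda>x. c * u x) = (E u / P u) powr (2 / (q - 2)) * E u"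
proof -
  have EP: "E u > 0" "P u > 0" using E_pos[OF u m] P_pos[OF u m] by auto
  define t where "t = (E u / P u) powr (1 / (q - 2))"
  have t: "t > 0" using EP by (simp add: t_def)
  have t2: "t powr (q - 2) = E u / P u" using q EP by (simp add: t_def powr_powr)
  have nc: "norm (complex_of_real t) = t" using t by simp
  have tsq: "t^2 = t powr 2" using t by simp
  have "t powr q = t powr (q - 2) * t^2" unfolding tsq powr_add[symmetric] by simp
  then have "t powr q * P u = t^2 * E u" using EP by (simp add: t2)
  then have "(\<lambda>x. complex_of_real t * u x) \<in> nehari"
    using t m bsigma_cmult[OF u, of "complex_of_real t"] E_cmult[OF u, of "complex_of_real t"] P_cmult[OF u, of "complex_of_real t"]
    by (simp add: nehari_def)
  moreover have "E (\<lambda>x. complex_of_real t * u x) = (E u / P u) powr (2 / (q - 2)) * E u"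
    unfolding E_cmult[OF u] nc tsq using EP by (simp add: t_def powr_powr)
  ultimately show ?thesis by (rule that)
qed

lemma bump_in_bsigma: "\<exists>u :: real^'n \<Rightarrow> complex. u \<in> bsigma \<and> mass u > 0" by (rule bsigma_nontrivial)

text \<open>With \<open>E = P\<close>, the estimate of \<open>P\<close> by a power of
  \<open>E\<close> with exponent \<open>q/2 > 1\<close> keeps \<open>E\<close> away from
  zero.\<close>

lemma nehari_lower_bound:
  obtains m0 where "m0 > 0" "\<And>u. u \<in> nehari \<Longrightarrow> m0 \<le> E u"
proof -
  obtain h0 where h0: "h0 > 0" "\<And>u. u \<in> bsigma \<Longrightarrow> mass u > 0 \<Longrightarrow> P u \<le> (E u / h0) powr (q / 2)"
    by (rule P_le_E) blast
  show ?thesis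
  proof (rule that[of "h0 powr (q / (q - 2))"])
    show "h0 powr (q / (q - 2)) > 0" using h0 by simp
    fix u assume "u \<in> nehari"
    then have u: "u \<in> bsigma" "mass u > 0" "E u = P u" by (auto simp: nehari_def)
    have E0: "E u > 0" by (rule E_pos[OF u(1,2)])
    have "E u \<le> (E u / h0) powr (q / 2)" using h0(2)[OF u(1,2)] u(3) by simp
    then have "E u * h0 powr (q / 2) \<le> E u powr (q / 2)" using E0 h0 by (simp add: powr_divide pos_le_divide_eq)
    also have "E u powr (q / 2) = E u * E u powr (q / 2 - 1)" using E0 by (simp add: powr_diff)
    finally have "h0 powr (q / 2) \<le> E u powr ((q - 2) / 2)" using E0 by (simp add: diff_divide_distrib)
    then have "(h0 powr (q / 2)) powr (2 / (q - 2)) \<le> (E u powr ((q - 2) / 2)) powr (2 / (q - 2))" using q by (intro powr_mono2) auto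
    moreover have "(q - 2) / 2 * (2 / (q - 2)) = 1" "q / 2 * (2 / (q - 2)) = q / (q - 2)" using q by auto
    ultimately show "h0 powr (q / (q - 2)) \<le> E u" using E0 by (simp only: powr_powr powr_one less_imp_le)
  qed
qed

lemma nehari_nonempty: "nehari \<noteq> {}" using bump_in_bsigma nehari_scale by (metis empty_iff)

lemma \<mu>_pos: "\<mu> > 0" and \<mu>_le: "u \<in> nehari \<Longrightarrow> \<mu> \<le> E u"
proof -
  obtain m0 where m0: "m0 > 0" "\<And>u. u \<in> nehari \<Longrightarrow> m0 \<le> E u" by (rule nehari_lower_bound) blast
  have "m0 \<le> \<mu>" unfolding \<mu>_def using nehari_nonempty m0(2) by (intro cINF_greatest)
  then show "\<mu> > 0" using m0 by simp
  have "bdd_below (E ` nehari)" using m0(2) by (intro bdd_belowI2)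
  then show "\<mu> \<le> E u" if "u \<in> nehari" unfolding \<mu>_def using that by (rule cINF_lower)
qed

text \<open>The bound \<open>\<mu> <= E\<close> in scale-invariant form. Competitors then do not
  have to be moved back onto the constraint set.\<close>

lemma nehari_quotient:
  assumes u: "u \<in> bsigma" and m: "mass u > 0"
  shows "\<mu> powr (q - 2) * (P u)^2 \<le> E u powr q"
proof -
  obtain c where c: "(\<lambda>x. c * u x) \<in> nehari" "E (\<lambda>x. c * u x) = (E u / P u) powr (2 / (q - 2)) * E u"
    by (rule nehari_scale[OF u m]) blast
  have EP: "E u > 0" "P u > 0" using E_pos[OF u m] P_pos[OF u m] by auto
  have "\<mu> powr (q - 2) \<le> ((E u / P u) powr (2 / (q - 2)) * E u) powr (q - 2)"
    using \<mu>_le[OF c(1)] \<mu>_pos q by (intro powr_mono2) (auto simp: c(2))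
  also have "\<dots> = (E u / P u) powr 2 * E u powr (q - 2)"
  proof -
    have "q - 2 \<noteq> 0" using q by linarith
    then have "2 / (q - 2) * (q - 2) = 2" by (metis nonzero_divide_eq_eq)
    then show ?thesis using EP by (simp only: powr_mult powr_powr powr_ge_zero less_imp_le)
  qed
  also have "\<dots> = E u powr q / (P u)^2" using EP by (simp add: powr_divide powr_diff)
  finally show ?thesis using EP by (simp add: pos_le_divide_eq)
qed

text \<open>The infimum is not affected by restricting to Borel measurable functions, since
  representatives have the same functionals; the factor \<open>s0 > 0\<close> passes through the
  infimum.\<close>

lemma level_eq: "d_level TYPE('n) \<gamma> b p \<omega> = s0 * \<mu>"
  and minimizer_borel_iff: "u \<in> borel_measurable borel \<Longrightarrow> is_minimizer \<gamma> b p \<omega> u \<longleftrightarrow> u \<in> nehari \<and> E u = \<mu>"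
proof -
  have K: "K_fun \<gamma> b p \<omega> u = E u - P u" and S: "S_fun \<gamma> b p \<omega> u = 1/2 * E u - 1/q * P u" if "u \<in> bsigma" for u :: "real^'n \<Rightarrow> complex"
    using that by (simp_all add: K_fun_def S_fun_def H_norm_sq_eq_energy bsigmaD P_fun_eq q_def)
  have SN: "S_fun \<gamma> b p \<omega> u = s0 * E u" if "u \<in> nehari" for u using that S by (simp add: nehari_def s0_def algebra_simps)
  have set: "{S_fun \<gamma> b p \<omega> u | u :: real^'n \<Rightarrow> complex. u \<in> Sigma_nonzero \<and> K_fun \<gamma> b p \<omega> u = 0} = (\<lambda>e. s0 * e) ` (E ` nehari)"
  proof (intro equalityI subsetI)
    fix y assume "y \<in> {S_fun \<gamma> b p \<omega> u | u :: real^'n \<Rightarrow> complex. u \<in> Sigma_nonzero \<and> K_fun \<gamma> b p \<omega> u = 0}"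
    then obtain u :: "real^'n \<Rightarrow> complex" where u: "u \<in> Sigma_nonzero" "K_fun \<gamma> b p \<omega> u = 0" "y = S_fun \<gamma> b p \<omega> u" by auto
    then have "u \<in> Sigma_space" by (simp add: Sigma_nonzero_def)
    then obtain v where v: "v \<in> bsigma" "borel_fun v" "H_norm_sq \<gamma> \<omega> u = E v" "P_fun b p u = P_fun b p v" "u \<in> Sigma_nonzero \<longleftrightarrow> mass v > 0"
      by (rule sigma_representative[where \<gamma> = \<gamma> and \<omega> = \<omega> and b = b and p = p]) blast
    have "K_fun \<gamma> b p \<omega> u = K_fun \<gamma> b p \<omega> v" "S_fun \<gamma> b p \<omega> u = S_fun \<gamma> b p \<omega> v"
      by (simp_all add: K_fun_def S_fun_def v H_norm_sq_eq_energy[OF v(2)])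
    moreover have "v \<in> nehari" using u v K[OF v(1)] calculation by (simp add: nehari_def)
    ultimately show "y \<in> (\<lambda>e. s0 * e) ` (E ` nehari)" using u(3) SN by auto
  next
    fix y assume "y \<in> (\<lambda>e. s0 * e) ` (E ` nehari)"
    then obtain u where u: "u \<in> nehari" "y = s0 * E u" by auto
    then have ub: "u \<in> bsigma" "mass u > 0" "E u = P u" by (auto simp: nehari_def)
    then have "u \<in> Sigma_nonzero" "K_fun \<gamma> b p \<omega> u = 0" using sigma_nonzero_iff[OF bsigmaD(1)[OF ub(1)]] K[OF ub(1)] by auto
    then show "y \<in> {S_fun \<gamma> b p \<omega> u | u :: real^'n \<Rightarrow> complex. u \<in> Sigma_nonzero \<and> K_fun \<gamma> b p \<omega> u = 0}"
      using SN[OF u(1)] u(2) by (intro CollectI exI[of _ u]) auto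
  qed
  have "Inf ((\<lambda>e. s0 * e) ` (E ` nehari)) = s0 * Inf (E ` nehari)"
  proof (rule antisym)
    show "Inf ((\<lambda>e. s0 * e) ` (E ` nehari)) \<le> s0 * Inf (E ` nehari)"
    proof -
      have "Inf ((\<lambda>e. s0 * e) ` (E ` nehari)) / s0 \<le> Inf (E ` nehari)"
      proof (rule cINF_greatest[OF nehari_nonempty])
        fix u assume u: "u \<in> nehari"
        have "bdd_below ((\<lambda>e. s0 * e) ` (E ` nehari))" using \<mu>_le s0 by (intro bdd_belowI[of _ "s0 * \<mu>"]) (auto intro: mult_left_mono)
        then have "Inf ((\<lambda>e. s0 * e) ` (E ` nehari)) \<le> s0 * E u" using u by (intro cInf_lower) auto
        then show "Inf ((\<lambda>e. s0 * e) ` (E ` nehari)) / s0 \<le> E u" using s0 by (simp add: divide_le_eq mult.commute)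
      qed
      then show ?thesis using s0 by (simp add: divide_le_eq mult.commute)
    qed
    show "s0 * Inf (E ` nehari) \<le> Inf ((\<lambda>e. s0 * e) ` (E ` nehari))"
      using nehari_nonempty s0 \<mu>_le by (intro cInf_greatest) (auto simp: \<mu>_def intro: mult_left_mono)
  qed
  then show lev: "d_level TYPE('n) \<gamma> b p \<omega> = s0 * \<mu>" unfolding d_level_def set \<mu>_def .
  show "is_minimizer \<gamma> b p \<omega> u \<longleftrightarrow> u \<in> nehari \<and> E u = \<mu>" if um: "borel_fun u"
  proof
    assume "is_minimizer \<gamma> b p \<omega> u"
    then have a: "u \<in> Sigma_nonzero" "K_fun \<gamma> b p \<omega> u = 0" "S_fun \<gamma> b p \<omega> u = s0 * \<mu>" by (auto simp: is_minimizer_def lev)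
    then have ub: "u \<in> bsigma" "mass u > 0" using sigma_nonzero_iff[OF um] by auto
    then have n: "u \<in> nehari" using K[OF ub(1)] a by (simp add: nehari_def)
    then show "u \<in> nehari \<and> E u = \<mu>" using SN[OF n] a(3) s0 by simp
  next
    assume n: "u \<in> nehari \<and> E u = \<mu>"
    then have ub: "u \<in> bsigma" "mass u > 0" "E u = P u" by (auto simp: nehari_def)
    then show "is_minimizer \<gamma> b p \<omega> u" using n SN[of u] K[OF ub(1)] sigma_nonzero_iff[OF um] by (simp add: is_minimizer_def lev)
  qed
qed

end

context ground_state
begin

subsection \<open>Existence of a minimizer\<close>

lemma mass_pos_of_P_pos:
  assumes u: "u \<in> bsigma" and P: "P u > 0"
  shows "mass u > 0"
proof (rule ccontr)
  assume "\<not> mass u > 0"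
  then have "AE x in lebesgue. u x = 0" using mass_pos_iff[OF u] by simp
  then have "AE x in lborel. u x = 0" by (simp add: AE_completion_iff)
  then have "AE x in lborel. norm x powr (- b) * norm (u x) powr q = 0" by eventually_elim simp
  then have "P u = 0" unfolding P_fun_eq(3)[OF u] by (rule integral_eq_zero_AE)
  then show False using P by simp
qed

text \<open>\<open>\<mu> powr (q - 2) * (P u)^2 <= E u powr q <= \<mu> powr q\<close> together with
  \<open>P u >= \<mu>\<close> leaves only equality. Every new minimizer, as a limit or as a
  rearrangement, is recognized in this way.\<close>

lemma quotient_rigidity:
  assumes u: "u \<in> bsigma" and E: "E u \<le> \<mu>" and P: "P u \<ge> \<mu>"
  shows "u \<in> nehari" "E u = \<mu>" "P u = \<mu>"
proof -
  have m: "mass u > 0" using mass_pos_of_P_pos[OF u] P \<mu>_pos by simp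
  have E0: "E u > 0" by (rule E_pos[OF u m])
  have eq: "\<mu> powr (q - 2) * \<mu>^2 = \<mu> powr q"
  proof -
    have "\<mu>^2 = \<mu> powr 2" using \<mu>_pos by simp
    then show ?thesis unfolding \<open>\<mu>^2 = \<mu> powr 2\<close> powr_add[symmetric] by simp
  qed
  have "\<mu> powr (q - 2) * (P u)^2 \<le> E u powr q" by (rule nehari_quotient[OF u m])
  moreover have "E u powr q \<le> \<mu> powr q" using E E0 q by (intro powr_mono2) auto
  ultimately have "\<mu> powr (q - 2) * (P u)^2 \<le> \<mu> powr (q - 2) * \<mu>^2" unfolding eq by linarith
  then have "(P u)^2 \<le> \<mu>^2" using \<mu>_pos by simp
  then have "P u \<le> \<mu>" using \<mu>_pos by (simp add: power2_le_iff_abs_le)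
  then show Pm: "P u = \<mu>" using P by simp
  have "\<mu> powr q \<le> E u powr q" using nehari_quotient[OF u m] unfolding Pm eq .
  then have "\<mu> \<le> E u" using powr_less_mono2[of q "E u" \<mu>] E0 q by (force simp: not_le[symmetric])
  then show "E u = \<mu>" using E by simp
  then show "u \<in> nehari" using u m Pm by (simp add: nehari_def)
qed

text \<open>Convexity bounds \<open>|c|^q\<close> from below by
  \<open>|a|^q - q |a|^(q-1) |a - c|\<close>, and Young's inequality absorbs the product into a
  small multiple of \<open>|a|^q\<close>. It shows that \<open>P\<close> does not drop in the limit
  if \<open>P\<close> of the difference tends to zero.\<close>

lemma P_almost_subadditive:
  assumes \<theta>: "\<theta> > 0"
  obtains K where "K \<ge> 0" "\<And>u v. u \<in> bsigma \<Longrightarrow> v \<in> bsigma \<Longrightarrow> (1 - q * \<theta>) * P u \<le> P v + K * P (\<lambda>x. u x - v x)"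
proof -
  \<comment> \<open>Conjugate to \<open>q\<close>: then \<open>(q - 1) * s = q\<close> and
    \<open>s / (s - 1) = q\<close>.\<close>
  define s where "s = q / (q - 1)"
  have s: "s > 1" using q by (simp add: s_def)
  have s': "s - 1 = 1 / (q - 1)" "s / (s - 1) = q" using q by (auto simp: s_def field_simps)
  define K where "K = q * \<theta> powr (- 1 / (s - 1))"
  have K: "K \<ge> 0" using q by (simp add: K_def)
  have pt: "(1 - q * \<theta>) * norm a powr q \<le> norm c powr q + K * norm (a - c) powr q" for a c :: complex
  proof -
    have "norm a powr q + q * norm a powr (q - 2) * (a \<bullet> (c - a)) \<le> norm c powr q" using q by (intro norm_powr_convex) simp
    moreover have "- (q * norm a powr (q - 2) * (a \<bullet> (c - a))) \<le> q * (norm a powr (q - 1) * norm (a - c))"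
    proof -
      have "- (a \<bullet> (c - a)) = a \<bullet> (a - c)" by (simp add: inner_diff_right)
      also have "\<dots> \<le> norm a * norm (a - c)" by (rule norm_cauchy_schwarz)
      finally have "(q * norm a powr (q - 2)) * (- (a \<bullet> (c - a))) \<le> (q * norm a powr (q - 2)) * (norm a * norm (a - c))"
        using q by (intro mult_left_mono) auto
      moreover have eq: "norm a powr (q - 2) * norm a = norm a powr (q - 1)"
      proof (cases "a = 0")
        case False
        then have "norm a powr (q - 2) * norm a powr 1 = norm a powr (q - 1)" unfolding powr_add[symmetric] by simp
        then show ?thesis using False by simp
      qed simp
      moreover have "(q * norm a powr (q - 2)) * (norm a * norm (a - c)) = q * (norm a powr (q - 1) * norm (a - c))"
        unfolding eq[symmetric] by (simp add: mult.assoc)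
      ultimately show ?thesis by simp
    qed
    moreover have "q * (norm a powr (q - 1) * norm (a - c)) \<le> q * (\<theta> * norm a powr q + \<theta> powr (- 1 / (s - 1)) * norm (a - c) powr q)"
    proof (intro mult_left_mono)
      have "norm a powr (q - 1) * norm (a - c) \<le> \<theta> * (norm a powr (q - 1)) powr s + \<theta> powr (- 1 / (s - 1)) * norm (a - c) powr (s / (s - 1))"
        by (rule Young_with_parameter[OF s \<theta>]) auto
      moreover have "(q - 1) * s = q" using q by (simp add: s_def)
      ultimately show "norm a powr (q - 1) * norm (a - c) \<le> \<theta> * norm a powr q + \<theta> powr (- 1 / (s - 1)) * norm (a - c) powr q"
        by (simp add: powr_powr s'(2))
    qed (use q in simp)
    ultimately show ?thesis unfolding K_def by (simp add: algebra_simps)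
  qed
  show ?thesis
  proof (rule that[OF K])
    fix u v :: "real^'n \<Rightarrow> complex" assume u: "u \<in> bsigma" and v: "v \<in> bsigma"
    have d: "(\<lambda>x. u x - v x) \<in> bsigma" using bsigma_add(1)[OF u bsigma_cmult(1)[OF v, of "- 1"]] by simp
    have "(1 - q * \<theta>) * P u = (LBINT x. (1 - q * \<theta>) * (norm x powr (- b) * norm (u x) powr q))" by (simp add: P_fun_eq(3)[OF u])
    also have "\<dots> \<le> (LBINT x. norm x powr (- b) * norm (v x) powr q + K * (norm x powr (- b) * norm (u x - v x) powr q))"
    proof (rule integral_mono)
      show "integrable lborel (\<lambda>x. (1 - q * \<theta>) * (norm x powr (- b) * norm (u x) powr q))"
        by (rule integrable_mult_right[OF P_fun_eq(2)[OF u]])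
      show "integrable lborel (\<lambda>x. norm x powr (- b) * norm (v x) powr q + K * (norm x powr (- b) * norm (u x - v x) powr q))"
        by (intro Bochner_Integration.integrable_add integrable_mult_right P_fun_eq(2) v d)
      fix x :: "real^'n"
      have "norm x powr (- b) * ((1 - q * \<theta>) * norm (u x) powr q) \<le> norm x powr (- b) * (norm (v x) powr q + K * norm (u x - v x) powr q)"
        by (intro mult_left_mono pt) simp
      then show "(1 - q * \<theta>) * (norm x powr (- b) * norm (u x) powr q) \<le> norm x powr (- b) * norm (v x) powr q + K * (norm x powr (- b) * norm (u x - v x) powr q)"
        by (simp add: algebra_simps)
    qed
    also have "\<dots> = P v + K * P (\<lambda>x. u x - v x)" unfolding P_fun_eq(3)[OF v] P_fun_eq(3)[OF d]
      by (subst Bochner_Integration.integral_add[OF P_fun_eq(2)[OF v] integrable_mult_right[OF P_fun_eq(2)[OF d]]]) simp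
    finally show "(1 - q * \<theta>) * P u \<le> P v + K * P (\<lambda>x. u x - v x)" .
  qed
qed

text \<open>Along a minimizing sequence the Dirichlet integral and the moment can only drop in the
  limit, the mass converges, and \<open>P\<close> does not drop. So the limit satisfies
  \<open>E <= \<mu> <= P\<close>, which is all that \<open>quotient_rigidity\<close> asks
  for.\<close>

lemma minimizer_exists: "\<exists>v\<in>nehari. E v = \<mu>"
proof -
  have "\<exists>u\<in>nehari. E u < \<mu> + 1 / Suc n" for n
  proof -
    have "Inf (E ` nehari) < \<mu> + 1 / Suc n" by (simp add: \<mu>_def)
    then show ?thesis using cInf_lessD[of "E ` nehari"] nehari_nonempty by auto
  qed
  then obtain u where u: "\<And>n. u n \<in> nehari" "\<And>n. E (u n) < \<mu> + 1 / Suc n" by metis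
  have ub: "u n \<in> bsigma" "E (u n) = P (u n)" for n using u(1)[of n] by (auto simp: nehari_def)
  obtain \<kappa> where \<kappa>: "\<kappa> > 0" "\<And>u :: real^'n \<Rightarrow> complex. u \<in> bsigma \<Longrightarrow> \<kappa> * (dirichlet u + moment u + mass u) \<le> E u"
    by (rule coercive) blast
  define M where "M = (\<mu> + 1) / \<kappa>"
  have M0: "M \<ge> 0" using \<kappa> \<mu>_pos by (simp add: M_def)
  have bd: "dirichlet (u n) \<le> M" "moment (u n) \<le> M" "mass (u n) \<le> M" for n
  proof -
    have "1 / real (Suc n) \<le> 1" by simp
    then have "\<kappa> * (dirichlet (u n) + moment (u n) + mass (u n)) \<le> \<mu> + 1" using \<kappa>(2)[OF ub(1)[of n]] u(2)[of n] by linarith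
    then have "dirichlet (u n) + moment (u n) + mass (u n) \<le> M" using \<kappa>(1) by (simp add: M_def pos_le_divide_eq mult.commute)
    then show "dirichlet (u n) \<le> M" "moment (u n) \<le> M" "mass (u n) \<le> M"
      using dirichlet_nonneg[of "u n"] moment_nonneg[of "u n"] mass_nonneg[of "u n"] by linarith+
  qed
  have tr: "transl_sq h (u n) \<le> ennreal (nsq h * M)" for n h
    by (rule order_trans[OF transl_sq_le_dirichlet[OF ub(1)]]) (intro ennreal_leI mult_left_mono bd, simp)
  obtain r1 v where r1: "strict_mono (r1 :: nat \<Rightarrow> nat)" and vs: "square_integrable lborel v"
    and ae1: "AE x in lborel. (\<lambda>n. u (r1 n) x) \<longlonglongrightarrow> v x" and L2: "(\<lambda>n. LBINT x. nsq (u (r1 n) x - v x)) \<longlonglongrightarrow> 0"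
    by (rule L2_compactness[of u M, OF bsigmaD(2)[OF ub(1)] tr bd(3) bsigmaD(3)[OF ub(1)] bd(2)]) blast
  \<comment> \<open>Semicontinuity is applied to the Dirichlet integral and to the moment
    separately, so each of them is made to converge; \<open>\<omega>\<close> may be negative, but it
    multiplies the mass, which converges anyway.\<close>
  have "compact ({0..M} \<times> {0..M})" by (intro compact_Times) auto
  moreover have "\<forall>n. (dirichlet (u (r1 n)), moment (u (r1 n))) \<in> {0..M} \<times> {0..M}" using bd dirichlet_nonneg moment_nonneg by auto
  ultimately obtain l r2 where r2: "strict_mono (r2 :: nat \<Rightarrow> nat)" and l: "((\<lambda>n. (dirichlet (u (r1 n)), moment (u (r1 n)))) \<circ> r2) \<longlonglongrightarrow> l"
    unfolding compact_def by meson
  define w where "w n = u (r1 (r2 n))" for n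
  have wb: "w n \<in> bsigma" "E (w n) = P (w n)" for n using ub by (auto simp: w_def)
  have D: "(\<lambda>n. dirichlet (w n)) \<longlonglongrightarrow> fst l" and X: "(\<lambda>n. moment (w n)) \<longlonglongrightarrow> snd l"
    using tendsto_fst[OF l] tendsto_snd[OF l] by (simp_all add: w_def o_def)
  have L2: "(\<lambda>n. LBINT x. nsq (w n x - v x)) \<longlonglongrightarrow> 0" using LIMSEQ_subseq_LIMSEQ[OF L2 r2] by (simp add: w_def o_def)
  have ae: "AE x in lborel. (\<lambda>n. w n x) \<longlonglongrightarrow> v x" using ae1
  proof eventually_elim
    case (elim x)
    from LIMSEQ_subseq_LIMSEQ[OF elim r2] show ?case by (simp add: w_def o_def)
  qed
  note vm[measurable] = square_integrableD(1)[OF vs, simplified]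
  have wm[measurable]: "borel_fun (w n)" for n by (rule bsigmaD[OF wb(1)])
  note ws = bsigmaD(2)[OF wb(1)]
  have l0: "fst l \<ge> 0" "snd l \<ge> 0" by (auto intro!: LIMSEQ_le_const[OF D] LIMSEQ_le_const[OF X] dirichlet_nonneg moment_nonneg)
  have mom: "(LBINT+ x. ennreal (nsq (norm x *\<^sub>R v x))) \<le> ennreal (snd l)"
  proof -
    have "(LBINT+ x. ennreal (nsq (norm x *\<^sub>R v x))) \<le> (LBINT+ x. liminf (\<lambda>n. ennreal (nsq (norm x *\<^sub>R w n x))))"
    proof (rule nn_integral_mono_AE)
      show "AE x in lborel. ennreal (nsq (norm x *\<^sub>R v x)) \<le> liminf (\<lambda>n. ennreal (nsq (norm x *\<^sub>R w n x)))" using ae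
      proof eventually_elim
        case (elim x)
        have "(\<lambda>n. ennreal (nsq (norm x *\<^sub>R w n x))) \<longlonglongrightarrow> ennreal (nsq (norm x *\<^sub>R v x))"
          by (intro tendsto_intros tendsto_ennrealI elim)
        from lim_imp_Liminf[OF trivial_limit_sequentially this] show ?case by (simp only: order_refl)
      qed
    qed
    also have "\<dots> \<le> liminf (\<lambda>n. LBINT+ x. ennreal (nsq (norm x *\<^sub>R w n x)))" by (rule nn_integral_liminf) measurable
    also have "(\<lambda>n. LBINT+ x. ennreal (nsq (norm x *\<^sub>R w n x))) = (\<lambda>n. ennreal (moment (w n)))"
      using nn_integral_square[OF bsigmaD(3)[OF wb(1)]] by (simp add: moment_def power_mult_distrib)
    also have "liminf (\<lambda>n. ennreal (moment (w n))) = ennreal (snd l)" by (intro lim_imp_Liminf tendsto_ennrealI X) simp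
    finally show ?thesis .
  qed
  have xv: "square_integrable lborel (\<lambda>x. norm x *\<^sub>R v x)" unfolding square_integrable_iff using mom le_less_trans[OF mom] by auto
  have momv: "moment v \<le> snd l" using mom l0 unfolding nn_integral_square[OF xv] by (simp add: moment_def power_mult_distrib ennreal_le_iff)
  \<comment> \<open>For fixed \<open>h\<close> the translation difference is a bounded operator in
    mean square, so it converges with the sequence.\<close>
  have trl: "(\<lambda>n. transl_sq h (w n)) \<longlonglongrightarrow> transl_sq h v" for h
  proof -
    have "(\<lambda>n. LBINT x. nsq ((w n (x + h) - w n x) - (v (x + h) - v x))) \<longlonglongrightarrow> 0"
    proof (rule tendsto_sandwich[OF _ _ tendsto_const tendsto_mult_right_zero[OF L2, of 4]])
      have "(LBINT x. nsq ((w n (x + h) - w n x) - (v (x + h) - v x))) \<le> 4 * (LBINT x. nsq (w n x - v x))" for n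
      proof -
        have ds: "square_integrable lborel (\<lambda>x. w n x - v x)" by (intro square_integrable_diff ws vs)
        have "(LBINT x. nsq ((w n (x + h) - w n x) - (v (x + h) - v x))) \<le> (LBINT x. 2 * nsq (w n (x + h) - v (x + h)) + 2 * nsq (w n x - v x))"
        proof (rule integral_mono)
          show "integrable lborel (\<lambda>x. nsq ((w n (x + h) - w n x) - (v (x + h) - v x)))"
            by (intro square_integrableD(2)[of lborel "\<lambda>x. (w n (x + h) - w n x) - (v (x + h) - v x)"] square_integrable_diff square_integrable_translate ws vs)
          show "integrable lborel (\<lambda>x. 2 * nsq (w n (x + h) - v (x + h)) + 2 * nsq (w n x - v x))"
            using square_integrableD(2)[OF ds] square_integrableD(2)[OF square_integrable_translate[OF ds, of h]] by auto
          show "nsq ((w n (x + h) - w n x) - (v (x + h) - v x)) \<le> 2 * nsq (w n (x + h) - v (x + h)) + 2 * nsq (w n x - v x)" for x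
            using norm_diff_sq_le[of "w n (x + h) - v (x + h)" "w n x - v x"] by (simp add: algebra_simps)
        qed
        also have "\<dots> = 4 * (LBINT x. nsq (w n x - v x))"
          using square_integrableD(2)[OF ds] square_integrableD(2)[OF square_integrable_translate[OF ds, of h]] integral_norm_sq_translate[OF ds, of h] by simp
        finally show ?thesis .
      qed
      then show "\<forall>\<^sub>F n in sequentially. (LBINT x. nsq ((w n (x + h) - w n x) - (v (x + h) - v x))) \<le> 4 * (LBINT x. nsq (w n x - v x))"
        by simp
    qed simp
    then have "(\<lambda>n. LBINT x. nsq (w n (x + h) - w n x)) \<longlonglongrightarrow> (LBINT x. nsq (v (x + h) - v x))"
      by (intro tendsto_integral_sq square_integrable_diff square_integrable_translate ws vs)
    then show ?thesis unfolding transl_sq_eq[OF ws] transl_sq_eq[OF vs] by (rule tendsto_ennrealI)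
  qed
  \<comment> \<open>Fatou in the variable \<open>h\<close> carries the averaged bound to the limit;
    no weak convergence of gradients enters.\<close>
  have gb: "grad_bound v (fst l)" unfolding grad_bound_def
  proof (intro allI impI)
    fix t :: real assume t: "t > 0"
    have "(LBINT+ h. indicator (ball 0 t) h * transl_sq h v) = (LBINT+ h. liminf (\<lambda>n. indicator (ball 0 t) h * transl_sq h (w n)))"
    proof (rule nn_integral_cong)
      fix h :: "real^'n"
      have "(\<lambda>n. indicator (ball 0 t) h * transl_sq h (w n)) \<longlonglongrightarrow> indicator (ball 0 t) h * transl_sq h v"
        using trl[of h] by (cases "h \<in> ball 0 t") auto
      then show "indicator (ball 0 t) h * transl_sq h v = liminf (\<lambda>n. indicator (ball 0 t) h * transl_sq h (w n))"
        by (rule lim_imp_Liminf[OF trivial_limit_sequentially, symmetric])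
    qed
    also have "\<dots> \<le> liminf (\<lambda>n. LBINT+ h. indicator (ball 0 t) h * transl_sq h (w n))" by (rule nn_integral_liminf) measurable
    also have "\<dots> \<le> liminf (\<lambda>n. ennreal (kap TYPE('n) t * dirichlet (w n)))"
      using grad_bound_dirichlet[OF wb(1)] t by (intro Liminf_mono) (auto simp: grad_bound_def)
    also have "\<dots> = ennreal (kap TYPE('n) t * fst l)" by (intro lim_imp_Liminf tendsto_ennrealI tendsto_intros D) simp
    finally show "(LBINT+ h. indicator (ball 0 t) h * transl_sq h v) \<le> ennreal (kap TYPE('n) t * fst l)" .
  qed
  have v: "v \<in> bsigma" "dirichlet v \<le> fst l" using bsigma_of_grad_bound[OF vs xv gb l0(1)] by auto
  have ms: "(\<lambda>n. mass (w n)) \<longlonglongrightarrow> mass v" unfolding mass_def by (rule tendsto_integral_sq[OF ws vs L2])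
  have Elim: "(\<lambda>n. E (w n)) \<longlonglongrightarrow> \<mu>"
  proof (rule tendsto_sandwich)
    show "\<forall>\<^sub>F n in sequentially. \<mu> \<le> E (w n)" using \<mu>_le u(1) by (simp add: w_def)
    have "E (w n) \<le> \<mu> + 1 / Suc n" for n
    proof -
      have "n \<le> r2 n" "r2 n \<le> r1 (r2 n)" using r1 r2 by (simp_all add: seq_suble)
      then have "1 / Suc (r1 (r2 n)) \<le> 1 / Suc n" by (intro divide_left_mono) auto
      then show ?thesis using u(2)[of "r1 (r2 n)"] by (simp add: w_def)
    qed
    then show "\<forall>\<^sub>F n in sequentially. E (w n) \<le> \<mu> + 1 / Suc n" by simp
    show "(\<lambda>n. \<mu> + 1 / Suc n) \<longlonglongrightarrow> \<mu>"
      using tendsto_add[OF tendsto_const LIMSEQ_inverse_real_of_nat, of \<mu>] by (simp add: inverse_eq_divide)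
  qed simp
  have "(\<lambda>n. E (w n)) \<longlonglongrightarrow> fst l + \<gamma>^2 * snd l + \<omega> * mass v"
    unfolding energy_def by (intro tendsto_intros D X ms)
  then have "\<mu> = fst l + \<gamma>^2 * snd l + \<omega> * mass v" by (rule LIMSEQ_unique[OF Elim])
  moreover have "\<gamma>^2 * moment v \<le> \<gamma>^2 * snd l" using momv by (intro mult_left_mono) auto
  ultimately have Ev: "E v \<le> \<mu>" using v(2) by (simp add: energy_def)
  have d: "(\<lambda>x. w n x - v x) \<in> bsigma" for n using bsigma_add(1)[OF wb(1)[of n] bsigma_cmult(1)[OF v(1), of "- 1"]] by simp
  have Pd: "(\<lambda>n. P (\<lambda>x. w n x - v x)) \<longlonglongrightarrow> 0"
  proof (rule LIMSEQ_I)
    fix e :: real assume e: "e > 0"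
    \<comment> \<open>A bound for the Dirichlet integral and the mass of all differences, as each is
      at most twice the sum of those of the two functions.\<close>
    define M' where "M' = 2 * M + 2 * dirichlet v + 2 * mass v"
    have M': "M' \<ge> 0" using M0 dirichlet_nonneg[of v] mass_nonneg[of v] by (simp add: M'_def)
    from P_small[OF M', of "e/2"] e obtain \<delta> where \<delta>: "\<delta> > 0"
      "\<And>u. u \<in> bsigma \<Longrightarrow> dirichlet u \<le> M' \<Longrightarrow> mass u \<le> M' \<Longrightarrow> mass u \<le> \<delta> \<Longrightarrow> P u \<le> e/2" by auto
    from LIMSEQ_D[OF L2 \<delta>(1)] obtain n0 where n0: "\<And>n. n \<ge> n0 \<Longrightarrow> mass (\<lambda>x. w n x - v x) < \<delta>"
      by (auto simp: mass_def)
    have "norm (P (\<lambda>x. w n x - v x) - 0) < e" if n: "n \<ge> n0" for n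
    proof -
      have eq: "(\<lambda>x. w n x + (- 1) * v x) = (\<lambda>x. w n x - v x)" by simp
      have "dirichlet (\<lambda>x. w n x - v x) \<le> 2 * dirichlet (w n) + 2 * dirichlet (\<lambda>x. (- 1) * v x)"
        "mass (\<lambda>x. w n x - v x) \<le> 2 * mass (w n) + 2 * mass (\<lambda>x. (- 1) * v x)"
        using bsigma_add(2,3)[OF wb(1)[of n] bsigma_cmult(1)[OF v(1), of "- 1"]] unfolding eq by blast+
      then have "dirichlet (\<lambda>x. w n x - v x) \<le> M'" "mass (\<lambda>x. w n x - v x) \<le> M'"
        using bd[of "r1 (r2 n)"] bsigma_cmult[OF v(1), of "- 1"] dirichlet_nonneg[of v] mass_nonneg[of v] by (auto simp: M'_def w_def)
      then have "P (\<lambda>x. w n x - v x) \<le> e/2" using n0[OF n] by (intro \<delta>(2) d) auto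
      then show ?thesis using W_finite(3)[OF d, of n] e by simp
    qed
    then show "\<exists>no. \<forall>n\<ge>no. norm (P (\<lambda>x. w n x - v x) - 0) < e" by blast
  qed
  have Pl: "(\<lambda>n. P (w n)) \<longlonglongrightarrow> \<mu>" using Elim unfolding wb(2) .
  have th: "(1 - q * \<theta>) * \<mu> \<le> P v" if \<theta>: "\<theta> > 0" for \<theta>
  proof -
    obtain K where K: "K \<ge> 0" "\<And>u v. u \<in> bsigma \<Longrightarrow> v \<in> bsigma \<Longrightarrow> (1 - q * \<theta>) * P u \<le> P v + K * P (\<lambda>x. u x - v x)"
      by (rule P_almost_subadditive[OF \<theta>]) blast
    have l1: "(\<lambda>n. P v + K * P (\<lambda>x. w n x - v x)) \<longlonglongrightarrow> P v + K * 0" by (intro tendsto_intros Pd)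
    have l2: "(\<lambda>n. (1 - q * \<theta>) * P (w n)) \<longlonglongrightarrow> (1 - q * \<theta>) * \<mu>" by (intro tendsto_intros Pl)
    have "(1 - q * \<theta>) * \<mu> \<le> P v + K * 0" by (rule LIMSEQ_le[OF l2 l1]) (use K(2)[OF wb(1) v(1)] in auto)
    then show ?thesis by simp
  qed
  have "\<mu> \<le> P v"
  proof (rule field_le_epsilon)
    fix e :: real assume e: "e > 0"
    \<comment> \<open>Chosen so that the loss \<open>q * \<theta> * \<mu>\<close> equals the
      prescribed error \<open>e\<close>.\<close>
    define \<theta> where "\<theta> = e / (q * \<mu>)"
    have "\<theta> > 0" "q * \<theta> * \<mu> = e" using e q \<mu>_pos by (auto simp: \<theta>_def)
    then show "\<mu> \<le> P v + e" using th[of \<theta>] by (simp add: left_diff_distrib)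
  qed
  then show ?thesis using quotient_rigidity[OF v(1) Ev] by blast
qed

end

context ground_state
begin

subsection \<open>The Euler-Lagrange equation\<close>

lemma nonlinear_integrable:
  fixes u v :: "real^'n \<Rightarrow> complex"
  assumes u: "u \<in> bsigma" and v: "v \<in> bsigma"
  shows "integrable lborel (\<lambda>x. norm x powr (- b) * (norm (u x) powr (q - 1) * norm (v x)))"
proof (rule Bochner_Integration.integrable_bound)
  have [measurable]: "borel_fun u" "borel_fun v" using u v by (auto dest: bsigmaD)
  show "integrable lborel (\<lambda>x. norm x powr (- b) * norm (u x) powr q + norm x powr (- b) * norm (v x) powr q)"
    by (intro Bochner_Integration.integrable_add P_fun_eq(2) u v)
  show "(\<lambda>x. norm x powr (- b) * (norm (u x) powr (q - 1) * norm (v x))) \<in> borel_measurable lborel" by measurable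
  \<comment> \<open>Both factors are bounded through the larger of \<open>s\<close> and
    \<open>t\<close>.\<close>
  have max: "s powr (q - 1) * t \<le> s powr q + t powr q" if "s \<ge> 0" "t \<ge> 0" for s t :: real
  proof -
    define m where "m = max s t"
    have m: "m \<ge> 0" "s \<le> m" "t \<le> m" using that by (auto simp: m_def)
    have "s powr (q - 1) * t \<le> m powr (q - 1) * m" using m that q by (intro mult_mono powr_mono2) auto
    also have "\<dots> = m powr q"
    proof (cases "m = 0")
      case False
      then have "m powr (q - 1) * m powr 1 = m powr q" unfolding powr_add[symmetric] by simp
      then show ?thesis using False m by simp
    qed simp
    also have "\<dots> \<le> s powr q + t powr q" by (auto simp: m_def max_def)
    finally show ?thesis .
  qed
  have "norm x powr (- b) * (norm (u x) powr (q - 1) * norm (v x)) \<le> norm x powr (- b) * (norm (u x) powr q + norm (v x) powr q)" for x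
    by (intro mult_left_mono max) auto
  then show "AE x in lborel. norm (norm x powr (- b) * (norm (u x) powr (q - 1) * norm (v x)))
      \<le> norm (norm x powr (- b) * norm (u x) powr q + norm x powr (- b) * norm (v x) powr q)" by (intro AE_I2) (simp add: distrib_left)
qed

lemma powr_mult_self: "(norm (z::'z::real_normed_vector)) powr (q - 2) * norm z = norm z powr (q - 1)"
proof (cases "z = 0")
  case False
  then have "norm z powr (q - 2) * norm z powr 1 = norm z powr (q - 1)" unfolding powr_add[symmetric] by simp
  then show ?thesis using False by simp
qed simp

lemma nonlinear_inner_integrable:
  fixes u v :: "real^'n \<Rightarrow> complex"
  assumes u: "u \<in> bsigma" and v: "v \<in> bsigma"
  shows "integrable lborel (\<lambda>x. norm x powr (- b) * (norm (u x) powr (q - 2) * (u x \<bullet> v x)))"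
proof (rule Bochner_Integration.integrable_bound[OF nonlinear_integrable[OF u v]])
  have [measurable]: "borel_fun u" "borel_fun v" using u v by (auto dest: bsigmaD)
  show "(\<lambda>x. norm x powr (- b) * (norm (u x) powr (q - 2) * (u x \<bullet> v x))) \<in> borel_measurable lborel" by measurable
  have "norm (u x) powr (q - 2) * \<bar>u x \<bullet> v x\<bar> \<le> norm (u x) powr (q - 1) * norm (v x)" for x
  proof -
    have "norm (u x) powr (q - 2) * \<bar>u x \<bullet> v x\<bar> \<le> norm (u x) powr (q - 2) * (norm (u x) * norm (v x))"
      by (intro mult_left_mono Cauchy_Schwarz_ineq2) simp
    then show ?thesis unfolding powr_mult_self[symmetric] by (simp only: mult.assoc)
  qed
  then have "norm x powr (- b) * (norm (u x) powr (q - 2) * \<bar>u x \<bullet> v x\<bar>) \<le> norm x powr (- b) * (norm (u x) powr (q - 1) * norm (v x))" for x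
    by (rule mult_left_mono) simp
  then show "AE x in lborel. norm (norm x powr (- b) * (norm (u x) powr (q - 2) * (u x \<bullet> v x)))
      \<le> norm (norm x powr (- b) * (norm (u x) powr (q - 1) * norm (v x)))" by (intro AE_I2) (simp add: abs_mult)
qed

text \<open>Along the line \<open>u + s v\<close> the energy is an exact quadratic in
  \<open>s\<close>, while \<open>P\<close> is only bounded below by its tangent
  \<open>\<mu> + s q L\<close>, which convexity provides for both signs of \<open>s\<close>. The
  quotient inequality with this tangent has equality at \<open>s = 0\<close>, so the derivative
  there vanishes.\<close>

lemma euler_lagrange:
  fixes u v :: "real^'n \<Rightarrow> complex"
  assumes un: "u \<in> nehari" and uE: "E u = \<mu>" and uG: "wgrad u G" and v: "v \<in> bsigma" and vH: "wgrad v H"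
  shows "(LBINT x. G x \<bullet> H x) + \<gamma>^2 * (LBINT x. nsq x * (u x \<bullet> v x)) + \<omega> * (LBINT x. u x \<bullet> v x)
    = (LBINT x. norm x powr (- b) * (norm (u x) powr (q - 2) * (u x \<bullet> v x)))" (is "?B = ?L")
proof -
  have u: "u \<in> bsigma" and uP: "P u = \<mu>" using un uE by (auto simp: nehari_def)
  define C where "C = E v"
  have par: "(\<lambda>x. u x + complex_of_real s * v x) \<in> bsigma"
    "E (\<lambda>x. u x + complex_of_real s * v x) = \<mu> + 2 * s * ?B + s^2 * C"
    "P (\<lambda>x. u x + complex_of_real s * v x) \<ge> \<mu> + s * q * ?L" for s
  proof -
    define v' where "v' = (\<lambda>x. complex_of_real s * v x)"
    define H' where "H' = (\<lambda>x. \<chi> i. complex_of_real s * H x $ i)"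
    have H': "H' x = s *\<^sub>R H x" for x unfolding vec_eq_iff vector_scaleR_component by (simp add: H'_def) (simp add: scaleR_conv_of_real)
    have v': "v' x = s *\<^sub>R v x" for x by (simp add: v'_def scaleR_conv_of_real)
    have vb: "v' \<in> bsigma" and vw: "wgrad v' H'" unfolding v'_def H'_def by (rule bsigma_cmult(1)[OF v] wgrad_cmult(1)[OF vH])+
    show b: "(\<lambda>x. u x + complex_of_real s * v x) \<in> bsigma" using bsigma_add(1)[OF u vb] by (simp add: v'_def)
    have D: "dirichlet (\<lambda>x. u x + v' x) = dirichlet u + 2 * s * (LBINT x. G x \<bullet> H x) + s^2 * dirichlet v"
    proof -
      have "dirichlet (\<lambda>x. u x + v' x) = (LBINT x. nsq (G x + H' x))" by (rule dirichlet_eq[OF wgrad_add[OF uG vw]])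
      also have "\<dots> = (LBINT x. nsq (G x)) + 2 * (LBINT x. G x \<bullet> H' x) + (LBINT x. nsq (H' x))"
        using uG vw by (intro integral_norm_add_sq) (auto dest: wgrad_measurable)
      finally show ?thesis unfolding dirichlet_eq[OF uG] dirichlet_eq[OF vH] H' by (simp add: power_mult_distrib)
    qed
    have Mo: "moment (\<lambda>x. u x + v' x) = moment u + 2 * s * (LBINT x. nsq x * (u x \<bullet> v x)) + s^2 * moment v"
    proof -
      have "moment (\<lambda>x. u x + v' x) = (LBINT x. nsq (norm x *\<^sub>R u x + norm x *\<^sub>R v' x))"
        by (simp add: moment_def scaleR_add_right[symmetric] power_mult_distrib del: scaleR_add_right)
      also have "\<dots> = (LBINT x. nsq (norm x *\<^sub>R u x)) + 2 * (LBINT x. (norm x *\<^sub>R u x) \<bullet> (norm x *\<^sub>R v' x)) + (LBINT x. nsq (norm x *\<^sub>R v' x))"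
        by (intro integral_norm_add_sq bsigmaD u vb)
      also have "(LBINT x. (norm x *\<^sub>R u x) \<bullet> (norm x *\<^sub>R v' x)) = (LBINT x. s * (nsq x * (u x \<bullet> v x)))"
        by (intro Bochner_Integration.integral_cong) (simp_all add: v' power2_eq_square)
      also have "(LBINT x. nsq (norm x *\<^sub>R v' x)) = moment v'" by (simp add: moment_def power_mult_distrib)
      also have "moment v' = s^2 * moment v" using bsigma_cmult(4)[OF v, of "complex_of_real s"] by (simp add: v'_def)
      finally show ?thesis by (simp add: moment_def power_mult_distrib)
    qed
    have Ma: "mass (\<lambda>x. u x + v' x) = mass u + 2 * s * (LBINT x. u x \<bullet> v x) + s^2 * mass v"
    proof -
      have "mass (\<lambda>x. u x + v' x) = mass u + 2 * (LBINT x. u x \<bullet> v' x) + mass v'"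
        unfolding mass_def by (intro integral_norm_add_sq bsigmaD u vb)
      then show ?thesis by (simp add: mass_def power_mult_distrib v')
    qed
    show "E (\<lambda>x. u x + complex_of_real s * v x) = \<mu> + 2 * s * ?B + s^2 * C"
      using D Mo Ma unfolding uE[symmetric] C_def energy_def v'_def by (simp add: algebra_simps)
    have "\<mu> + s * q * ?L = (LBINT x. norm x powr (- b) * norm (u x) powr q + s * q * (norm x powr (- b) * (norm (u x) powr (q - 2) * (u x \<bullet> v x))))"
      unfolding uP[symmetric] P_fun_eq(3)[OF u]
      by (subst Bochner_Integration.integral_add[OF P_fun_eq(2)[OF u] integrable_mult_right[OF nonlinear_inner_integrable[OF u v]]]) simp
    also have "\<dots> \<le> P (\<lambda>x. u x + complex_of_real s * v x)" unfolding P_fun_eq(3)[OF b]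
    proof (rule integral_mono[OF _ P_fun_eq(2)[OF b]])
      show "integrable lborel (\<lambda>x. norm x powr (- b) * norm (u x) powr q + s * q * (norm x powr (- b) * (norm (u x) powr (q - 2) * (u x \<bullet> v x))))"
        by (intro Bochner_Integration.integrable_add P_fun_eq(2) u integrable_mult_right nonlinear_inner_integrable v)
      fix x :: "real^'n"
      have "norm (u x) powr q + q * norm (u x) powr (q - 2) * (u x \<bullet> (u x + complex_of_real s * v x - u x)) \<le> norm (u x + complex_of_real s * v x) powr q"
        using q by (intro norm_powr_convex) simp
      moreover have "u x \<bullet> (u x + complex_of_real s * v x - u x) = s * (u x \<bullet> v x)" by (simp flip: scaleR_conv_of_real)
      ultimately have "norm (u x) powr q + q * norm (u x) powr (q - 2) * (s * (u x \<bullet> v x)) \<le> norm (u x + complex_of_real s * v x) powr q" by simp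
      then have "norm x powr (- b) * (norm (u x) powr q + q * norm (u x) powr (q - 2) * (s * (u x \<bullet> v x))) \<le> norm x powr (- b) * norm (u x + complex_of_real s * v x) powr q"
        by (rule mult_left_mono) simp
      then show "norm x powr (- b) * norm (u x) powr q + s * q * (norm x powr (- b) * (norm (u x) powr (q - 2) * (u x \<bullet> v x))) \<le> norm x powr (- b) * norm (u x + complex_of_real s * v x) powr q"
        by (simp add: algebra_simps)
    qed
    finally show "P (\<lambda>x. u x + complex_of_real s * v x) \<ge> \<mu> + s * q * ?L" .
  qed
  define B L where "B = ?B" and "L = ?L"
  \<comment> \<open>Its derivative at \<open>0\<close> is \<open>2 q \<mu> powr (q - 1)\<close>
    times \<open>B - L\<close>, and it has a local minimum there.\<close>
  define \<phi> where "\<phi> s = (\<mu> + 2 * s * B + s^2 * C) powr q - \<mu> powr (q - 2) * (\<mu> + s * q * L)^2" for s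
  have "(\<phi> has_real_derivative (q * \<mu> powr (q - 1) * (2 * B) - \<mu> powr (q - 2) * (2 * \<mu> * (q * L)))) (at 0)"
    unfolding \<phi>_def[abs_def] by (rule derivative_eq_intros refl | use \<mu>_pos in simp)+
  moreover have "\<mu> powr (q - 2) * \<mu> = \<mu> powr (q - 1)"
  proof -
    have "\<mu> powr (q - 2) * \<mu> powr 1 = \<mu> powr (q - 1)" unfolding powr_add[symmetric] by simp
    then show ?thesis using \<mu>_pos by simp
  qed
  then have "q * \<mu> powr (q - 1) * (2 * B) - \<mu> powr (q - 2) * (2 * \<mu> * (q * L)) = 2 * q * \<mu> powr (q - 1) * (B - L)"
    by (simp add: algebra_simps)
  ultimately have der: "(\<phi> has_real_derivative (2 * q * \<mu> powr (q - 1) * (B - L))) (at 0)" by simp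
  \<comment> \<open>The tangent has to be positive for its square to be a lower bound of the square
    of \<open>P\<close>, and for \<open>u + s v\<close> to be nonzero.\<close>
  have "\<forall>\<^sub>F s in at 0. \<mu> + s * q * L > 0"
  proof -
    have "((\<lambda>s. \<mu> + s * q * L) \<longlongrightarrow> \<mu> + 0 * q * L) (at 0)" by (intro tendsto_intros)
    then show ?thesis using \<mu>_pos by (intro order_tendstoD(1)) auto
  qed
  then obtain d where d: "d > 0" "\<And>s. s \<noteq> 0 \<Longrightarrow> \<bar>s\<bar> < d \<Longrightarrow> \<mu> + s * q * L > 0" by (auto simp: eventually_at dist_real_def)
  have "\<phi> 0 \<le> \<phi> s" if s: "\<bar>0 - s\<bar> < d" for s
  proof -
    have pos: "\<mu> + s * q * L > 0" using d(2)[of s] s \<mu>_pos by (cases "s = 0") auto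
    have "P (\<lambda>x. u x + complex_of_real s * v x) > 0" using par(3)[of s] pos by (simp add: L_def)
    then have m: "mass (\<lambda>x. u x + complex_of_real s * v x) > 0" by (rule mass_pos_of_P_pos[OF par(1)])
    have "\<mu> powr (q - 2) * (\<mu> + s * q * L)^2 \<le> \<mu> powr (q - 2) * (P (\<lambda>x. u x + complex_of_real s * v x))^2"
      using pos par(3)[of s] by (intro mult_left_mono power_mono) (auto simp: L_def)
    also have "\<dots> \<le> (\<mu> + 2 * s * B + s^2 * C) powr q" using nehari_quotient[OF par(1) m] unfolding par(2) B_def .
    finally have "\<phi> s \<ge> 0" by (simp add: \<phi>_def)
    moreover have "\<phi> 0 = 0"
    proof -
      have "\<mu> powr (q - 2) * \<mu> powr 2 = \<mu> powr q" unfolding powr_add[symmetric] by simp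
      moreover have "\<mu>^2 = \<mu> powr 2" using \<mu>_pos by simp
      ultimately show ?thesis unfolding \<phi>_def by simp
    qed
    ultimately show ?thesis by simp
  qed
  then have "2 * q * \<mu> powr (q - 1) * (B - L) = 0" by (intro DERIV_local_min[OF der d(1)]) auto
  then show ?thesis using q \<mu>_pos by (simp add: B_def L_def)
qed

lemma weight_locally_integrable:
  assumes "compact (K :: (real^'n) set)"
  shows "set_integrable lborel K (\<lambda>x. norm x powr (- b))"
proof -
  have [measurable]: "K \<in> sets borel" using assms by (auto intro: borel_compact)
  have i1: "integrable lborel (\<lambda>x::real^'n. indicator (ball 0 1) x * norm x powr (- b))"
  proof (subst integrable_iff_bounded, intro conjI)
    have "(LBINT+ x. ennreal (norm (indicator (ball 0 1) x * norm (x::real^'n) powr (- b))))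
        = (LBINT+ x. indicator (ball 0 1) x * ennreal (norm (x::real^'n) powr (- b)))" by (intro nn_integral_cong) (auto simp: indicator_def)
    then show "(LBINT+ x. ennreal (norm (indicator (ball 0 1) x * norm (x::real^'n) powr (- b)))) < \<infinity>"
      using singular_weight_integrable[OF b] by simp
  qed measurable
  have i2: "integrable lborel (\<lambda>x::real^'n. indicator K x :: real)"
    using emeasure_compact_finite[OF assms] by (intro integrable_real_indicator) auto
  show ?thesis unfolding set_integrable_def
  proof (rule Bochner_Integration.integrable_bound[OF Bochner_Integration.integrable_add[OF i1 i2]])
    show "AE x in lborel. norm (indicator K x *\<^sub>R norm x powr (- b)) \<le> norm (indicator (ball 0 1) x * norm x powr (- b) + indicator K (x::real^'n))"
    proof (rule AE_I2)
      fix x :: "real^'n"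
      show "norm (indicator K x *\<^sub>R norm x powr (- b)) \<le> norm (indicator (ball 0 1) x * norm x powr (- b) + indicator K x)"
        using powr_mono2'[of "- b" 1 "norm x"] b by (cases "norm x < 1") (auto simp: indicator_def)
    qed
  qed measurable
qed

text \<open>The Euler-Lagrange identity with \<open>v = c * \<psi>\<close> for an arbitrary complex
  constant \<open>c\<close> is the inner product of the wanted integral with \<open>c\<close>; one
  more use of the weak gradient moves the second derivative onto \<open>\<psi>\<close>.\<close>

lemma minimizer_weak_equation:
  fixes u :: "real^'n \<Rightarrow> complex"
  assumes un: "u \<in> nehari" and uE: "E u = \<mu>" and \<psi>: "test_function \<psi>"
  defines "k \<equiv> (\<lambda>x. norm x powr (- b) * norm (u x) powr (q - 2))"
  shows "borel_fun (laplacian \<psi>)"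
    "integrable lborel (\<lambda>x. (- laplacian \<psi> x) *\<^sub>R u x + \<psi> x *\<^sub>R (\<omega> *\<^sub>R u x + (\<gamma>^2 * nsq x) *\<^sub>R u x - k x *\<^sub>R u x))"
    "(LBINT x. (- laplacian \<psi> x) *\<^sub>R u x + \<psi> x *\<^sub>R (\<omega> *\<^sub>R u x + (\<gamma>^2 * nsq x) *\<^sub>R u x - k x *\<^sub>R u x)) = 0"
    (is "?I = 0")
proof -
  have u: "u \<in> bsigma" "mass u > 0" using un by (auto simp: nehari_def)
  have um[measurable]: "borel_fun u" by (rule bsigmaD[OF u(1)])
  note us = bsigmaD(2)[OF u(1)] and xus = bsigmaD(3)[OF u(1)]
  obtain G where G: "wgrad u G" using bsigmaE[OF u(1)] by blast
  note Gs = wgrad_measurable(4)[OF G]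
  have km[measurable]: "borel_fun k" unfolding k_def by measurable
  have kn: "norm (k x *\<^sub>R u x) = norm x powr (- b) * norm (u x) powr (q - 1)" for x by (simp add: k_def abs_mult mult.assoc powr_mult_self)
  have d1: "test_function (partial_deriv i \<psi>)" and d2: "test_function (partial_deriv i (partial_deriv i \<psi>))" for i
    using test_function_partial_deriv \<psi> by blast+
  have \<psi>m[measurable]: "borel_fun \<psi>" by (rule test_functionD[OF \<psi>])
  have d2m: "partial_deriv i (partial_deriv i \<psi>) \<in> borel_measurable borel" for i by (rule test_functionD[OF d2])
  show "borel_fun (laplacian \<psi>)" unfolding laplacian_def[abs_def] using d2m by (intro borel_measurable_sum) auto
  note \<psi>s = test_function_square_integrable[OF \<psi>]
  note \<psi>b = test_in_bsigma[OF \<psi>]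
  have x\<psi>: "square_integrable lborel (\<lambda>x. norm x * \<psi> x)" using bsigmaD(3)[OF \<psi>b] by (simp add: square_integrable_def abs_mult)
  have j: "integrable lborel (\<lambda>x. partial_deriv i (partial_deriv i \<psi>) x *\<^sub>R u x)" for i
    by (rule integrable_scaleR_square[OF test_function_square_integrable[OF d2] us])
  have i1: "integrable lborel (\<lambda>x. (- laplacian \<psi> x) *\<^sub>R u x)" unfolding laplacian_def using j by (simp add: scaleR_sum_left)
  have i2: "integrable lborel (\<lambda>x. \<psi> x *\<^sub>R u x)" by (rule integrable_scaleR_square[OF \<psi>s us])
  have i3: "integrable lborel (\<lambda>x. (norm x * \<psi> x) *\<^sub>R (norm x *\<^sub>R u x))" by (rule integrable_scaleR_square[OF x\<psi> xus])
  have i4: "integrable lborel (\<lambda>x. \<psi> x *\<^sub>R (k x *\<^sub>R u x))"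
  proof (rule Bochner_Integration.integrable_bound[OF nonlinear_integrable[OF u(1) \<psi>b]])
    have "norm (\<psi> x *\<^sub>R (k x *\<^sub>R u x)) = norm x powr (- b) * (norm (u x) powr (q - 1) * norm (complex_of_real (\<psi> x)))" for x
      unfolding norm_scaleR[of "\<psi> x"] kn by simp
    then show "AE x in lborel. norm (\<psi> x *\<^sub>R (k x *\<^sub>R u x)) \<le> norm (norm x powr (- b) * (norm (u x) powr (q - 1) * norm (complex_of_real (\<psi> x))))"
      by (intro AE_I2) (simp only:, simp)
  qed measurable
  have F: "(\<lambda>x. (- laplacian \<psi> x) *\<^sub>R u x + \<psi> x *\<^sub>R (\<omega> *\<^sub>R u x + (\<gamma>^2 * nsq x) *\<^sub>R u x - k x *\<^sub>R u x))
    = (\<lambda>x. (- laplacian \<psi> x) *\<^sub>R u x + (\<omega> *\<^sub>R (\<psi> x *\<^sub>R u x) + (\<gamma>^2 *\<^sub>R ((norm x * \<psi> x) *\<^sub>R (norm x *\<^sub>R u x)) - \<psi> x *\<^sub>R (k x *\<^sub>R u x))))"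
    by (intro ext) (simp add: scaleR_add_right scaleR_diff_right power2_eq_square mult_ac)
  have int: "integrable lborel (\<lambda>x. (- laplacian \<psi> x) *\<^sub>R u x + (\<omega> *\<^sub>R (\<psi> x *\<^sub>R u x) + (\<gamma>^2 *\<^sub>R ((norm x * \<psi> x) *\<^sub>R (norm x *\<^sub>R u x)) - \<psi> x *\<^sub>R (k x *\<^sub>R u x))))"
    using i1 i2 i3 i4 by (intro Bochner_Integration.integrable_add Bochner_Integration.integrable_diff integrable_scaleR_right) auto
  show "integrable lborel (\<lambda>x. (- laplacian \<psi> x) *\<^sub>R u x + \<psi> x *\<^sub>R (\<omega> *\<^sub>R u x + (\<gamma>^2 * nsq x) *\<^sub>R u x - k x *\<^sub>R u x))"
    unfolding F by (rule int)
  have "?I = (LBINT x. (- laplacian \<psi> x) *\<^sub>R u x + (\<omega> *\<^sub>R (\<psi> x *\<^sub>R u x) + (\<gamma>^2 *\<^sub>R ((norm x * \<psi> x) *\<^sub>R (norm x *\<^sub>R u x)) - \<psi> x *\<^sub>R (k x *\<^sub>R u x))))"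
    unfolding F ..
  also have "\<dots> = (LBINT x. (- laplacian \<psi> x) *\<^sub>R u x) + (\<omega> *\<^sub>R (LBINT x. \<psi> x *\<^sub>R u x)
      + (\<gamma>^2 *\<^sub>R (LBINT x. (norm x * \<psi> x) *\<^sub>R (norm x *\<^sub>R u x)) - (LBINT x. \<psi> x *\<^sub>R (k x *\<^sub>R u x))))"
  proof -
    have add: "(LBINT x. f1 x + (a *\<^sub>R f2 x + (c *\<^sub>R f3 x - f4 x))) = (LBINT x. f1 x) + (a *\<^sub>R (LBINT x. f2 x) + (c *\<^sub>R (LBINT x. f3 x) - (LBINT x. f4 x)))"
      if "integrable lborel f1" "integrable lborel f2" "integrable lborel f3" "integrable lborel f4"
      for f1 f2 f3 f4 :: "real^'n \<Rightarrow> complex" and a c :: real using that by simp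
    show ?thesis by (rule add[OF i1 i2 i3 i4])
  qed
  finally have I: "?I = (LBINT x. (- laplacian \<psi> x) *\<^sub>R u x) + (\<omega> *\<^sub>R (LBINT x. \<psi> x *\<^sub>R u x)
      + (\<gamma>^2 *\<^sub>R (LBINT x. (norm x * \<psi> x) *\<^sub>R (norm x *\<^sub>R u x)) - (LBINT x. \<psi> x *\<^sub>R (k x *\<^sub>R u x))))" .
  have "?I \<bullet> c = 0" for c
  proof -
    define v where "v = (\<lambda>x. c * complex_of_real (\<psi> x))"
    have vb: "v \<in> bsigma" unfolding v_def by (rule bsigma_cmult(1)[OF \<psi>b])
    have vH: "wgrad v (\<lambda>x. \<chi> i. c * (\<chi> i. complex_of_real (partial_deriv i \<psi> x)) $ i)"
      unfolding v_def by (rule wgrad_cmult(1)[OF wgrad_test[OF \<psi>]])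
    have uv: "z \<bullet> v x = \<psi> x * (z \<bullet> c)" for z x unfolding v_def by (simp add: inner_complex_def algebra_simps)
    have g1: "(LBINT x. G x \<bullet> (\<chi> i. c * (\<chi> i. complex_of_real (partial_deriv i \<psi> x)) $ i)) = (LBINT x. (- laplacian \<psi> x) *\<^sub>R u x) \<bullet> c"
    proof -
      have Gi: "integrable lborel (\<lambda>x. partial_deriv i \<psi> x *\<^sub>R (G x $ i))" for i
        by (rule integrable_scaleR_square[OF test_function_square_integrable[OF d1] square_integrable_vec_nth[OF Gs]])
      have "(LBINT x. G x \<bullet> (\<chi> i. c * (\<chi> i. complex_of_real (partial_deriv i \<psi> x)) $ i)) = (LBINT x. (\<Sum>i\<in>UNIV. (partial_deriv i \<psi> x *\<^sub>R (G x $ i)) \<bullet> c))"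
        by (intro Bochner_Integration.integral_cong) (simp_all add: inner_vec_def inner_complex_def algebra_simps)
      also have "\<dots> = (\<Sum>i\<in>UNIV. (LBINT x. (partial_deriv i \<psi> x *\<^sub>R (G x $ i)) \<bullet> c))"
        by (intro Bochner_Integration.integral_sum integrable_inner_left Gi)
      also have "\<dots> = (\<Sum>i\<in>UNIV. (LBINT x. partial_deriv i \<psi> x *\<^sub>R (G x $ i)) \<bullet> c)"
        using Gi by (intro sum.cong integral_inner_left) auto
      also have "\<dots> = (\<Sum>i\<in>UNIV. - (LBINT x. partial_deriv i (partial_deriv i \<psi>) x *\<^sub>R u x)) \<bullet> c"
      proof -
        have "(LBINT x. partial_deriv i \<psi> x *\<^sub>R (G x $ i)) = - (LBINT x. partial_deriv i (partial_deriv i \<psi>) x *\<^sub>R u x)" for i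
          using G d1[of i] by (simp add: wgrad_def)
        then show ?thesis by (simp only: inner_sum_left)
      qed
      also have "(\<Sum>i\<in>UNIV. - (LBINT x. partial_deriv i (partial_deriv i \<psi>) x *\<^sub>R u x)) = (LBINT x. (- laplacian \<psi> x) *\<^sub>R u x)"
        unfolding laplacian_def using j by (simp add: scaleR_sum_left sum_negf)
      finally show ?thesis .
    qed
    have "(LBINT x. nsq x * (u x \<bullet> v x)) = (LBINT x. (norm x * \<psi> x) *\<^sub>R (norm x *\<^sub>R u x)) \<bullet> c"
      unfolding uv by (subst integral_inner_left[OF i3, symmetric]) (simp add: power2_eq_square mult_ac)
    moreover have "(LBINT x. u x \<bullet> v x) = (LBINT x. \<psi> x *\<^sub>R u x) \<bullet> c"
      unfolding uv by (subst integral_inner_left[OF i2, symmetric]) simp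
    moreover have "(LBINT x. norm x powr (- b) * (norm (u x) powr (q - 2) * (u x \<bullet> v x))) = (LBINT x. \<psi> x *\<^sub>R (k x *\<^sub>R u x)) \<bullet> c"
      unfolding uv by (subst integral_inner_left[OF i4, symmetric]) (simp add: k_def mult_ac)
    ultimately show ?thesis unfolding I using euler_lagrange[OF un uE G vb vH] unfolding g1 by (simp add: inner_add_left inner_diff_left)
  qed
  \<comment> \<open>The choice \<open>c = ?I\<close>.\<close>
  then have "?I \<bullet> ?I = 0" .
  then show "?I = 0" by simp
qed

lemma minimizer_is_solution:
  fixes u :: "real^'n \<Rightarrow> complex"
  assumes un: "u \<in> nehari" and uE: "E u = \<mu>"
  shows "is_solution \<gamma> b p \<omega> u"
proof -
  have u: "u \<in> bsigma" "mass u > 0" using un by (auto simp: nehari_def)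
  have um[measurable]: "borel_fun u" by (rule bsigmaD[OF u(1)])
  have pq: "p - 1 = q - 2" by (simp add: q_def)
  define k where "k = (\<lambda>x. norm x powr (- b) * norm (u x) powr (q - 2))"
  have km[measurable]: "borel_fun k" unfolding k_def by measurable
  have kn: "norm (k x *\<^sub>R u x) = norm x powr (- b) * norm (u x) powr (q - 1)" for x by (simp add: k_def abs_mult mult.assoc powr_mult_self)
  have loc: "locally_integrable (\<lambda>x. k x *\<^sub>R u x)" unfolding locally_integrable_def
  proof (intro allI impI)
    fix K :: "(real^'n) set" assume K: "compact K"
    have Km[measurable]: "K \<in> sets borel" using K by (auto intro: borel_compact)
    have "integrable lborel (\<lambda>x. indicator K x *\<^sub>R (k x *\<^sub>R u x))"
    proof (rule Bochner_Integration.integrable_bound)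
      show "integrable lborel (\<lambda>x. indicator K x *\<^sub>R norm x powr (- b) + norm x powr (- b) * norm (u x) powr q)"
        using weight_locally_integrable[OF K] P_fun_eq(2)[OF u(1)] by (auto simp: set_integrable_def)
      have "norm (indicator K x *\<^sub>R (k x *\<^sub>R u x)) \<le> norm (indicator K x *\<^sub>R norm x powr (- b) + norm x powr (- b) * norm (u x) powr q)" for x
      proof -
        \<comment> \<open>Splits the nonlinear term between the locally integrable weight and the
          integrand of \<open>P\<close>.\<close>
        have "norm (u x) powr (q - 1) \<le> 1 + norm (u x) powr q"
        proof (cases "norm (u x) \<le> 1")
          case True
          then have "norm (u x) powr (q - 1) \<le> 1" using q by (intro powr_le1) auto
          then show ?thesis by (simp add: add_increasing2)
        next
          case False
          then have "norm (u x) powr (q - 1) \<le> norm (u x) powr q" by (intro powr_mono) auto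
          then show ?thesis by simp
        qed
        then have "norm x powr (- b) * norm (u x) powr (q - 1) \<le> norm x powr (- b) * (1 + norm (u x) powr q)" by (intro mult_left_mono) auto
        then show ?thesis using kn[of x] by (auto simp: indicator_def distrib_left)
      qed
      then show "AE x in lborel. norm (indicator K x *\<^sub>R (k x *\<^sub>R u x)) \<le> norm (indicator K x *\<^sub>R norm x powr (- b) + norm x powr (- b) * norm (u x) powr q)" by simp
    qed measurable
    then show "set_integrable lebesgue K (\<lambda>x. k x *\<^sub>R u x)" by (subst set_integrable_lebesgue_iff) (auto simp: set_integrable_def)
  qed
  have "(\<integral>x. (- laplacian \<psi> x) *\<^sub>R u x + \<psi> x *\<^sub>R (\<omega> *\<^sub>R u x + (\<gamma>^2 * nsq x) *\<^sub>R u x - k x *\<^sub>R u x) \<partial>lebesgue) = 0"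
    if \<psi>: "test_function \<psi>" for \<psi>
  proof -
    have [measurable]: "borel_fun \<psi>" "borel_fun (laplacian \<psi>)" using test_functionD(3)[OF \<psi>] minimizer_weak_equation(1)[OF un uE \<psi>] by auto
    show ?thesis by (subst integral_lebesgue_eq) (measurable, unfold k_def, rule minimizer_weak_equation(3)[OF un uE \<psi>])
  qed
  then show ?thesis using loc u sigma_nonzero_iff[OF um] unfolding is_solution_def k_def pq by blast
qed

end

subsection \<open>Reflections\<close>

text \<open>For a unit vector \<open>e\<close> this is the reflection in the hyperplane of all
  points whose inner product with \<open>e\<close> is \<open>s\<close>.\<close>

definition refl_at :: "'a::euclidean_space \<Rightarrow> real \<Rightarrow> 'a \<Rightarrow> 'a" where
  "refl_at e s x = x + (2 * (s - x \<bullet> e)) *\<^sub>R e"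

context
  fixes e :: "'a::euclidean_space" and s :: real
  assumes e: "norm e = 1"
begin

lemma ee: "e \<bullet> e = 1" using e by (simp add: norm_eq_1)

lemma refl_inner: "refl_at e s x \<bullet> e = 2 * s - x \<bullet> e" by (simp add: refl_at_def inner_add_left ee)

lemma refl_refl: "refl_at e s (refl_at e s x) = x" unfolding refl_at_def[of e s "refl_at e s x"] refl_inner by (simp add: refl_at_def algebra_simps)

lemma refl_boundary: "x \<bullet> e = s \<Longrightarrow> refl_at e s x = x" by (simp add: refl_at_def)

text \<open>For \<open>s > 0\<close> the origin lies in \<open>x \<bullet> e < s\<close>, and
  reflecting a point out of this half-space increases its norm by an explicit amount.\<close>

lemma refl_norm_sq: "nsq (refl_at e s x) = nsq x + 4 * s * (s - x \<bullet> e)" unfolding power2_norm_eq_inner refl_at_def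
  by (simp add: inner_add_left inner_add_right ee inner_commute[of e x]) (simp add: algebra_simps power2_eq_square)

lemma refl_diff: "refl_at e s x - refl_at e s y = (x - y) - (2 * ((x - y) \<bullet> e)) *\<^sub>R e" by (simp add: refl_at_def algebra_simps)

lemma norm_reflect0: "norm (z - (2 * (z \<bullet> e)) *\<^sub>R e) = norm z"
proof -
  have "nsq (z - (2 * (z \<bullet> e)) *\<^sub>R e) = nsq z" unfolding power2_norm_eq_inner
    by (simp add: inner_diff_left inner_diff_right ee inner_commute[of e z])
  then show ?thesis by (simp only: power2_eq_iff_nonneg norm_ge_zero)
qed

lemma refl_dist: "dist (refl_at e s x) (refl_at e s y) = dist x y" unfolding dist_norm refl_diff norm_reflect0 ..

lemma refl_dist_swap: "dist (refl_at e s x) y = dist x (refl_at e s y)" using refl_dist[of x "refl_at e s y"] by (simp add: refl_refl)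

text \<open>Points on the same side are no farther apart than one of them is from the mirror image
  of the other; a kernel that decreases with the distance therefore favours equal sides.\<close>

lemma refl_dist_ge:
  assumes "x \<bullet> e \<le> s" "y \<bullet> e \<le> s"
  shows "dist x y \<le> dist x (refl_at e s y)"
proof -
  have "(dist x (refl_at e s y))^2 = (dist x y)^2 + 4 * (s - x \<bullet> e) * (s - y \<bullet> e)"
    unfolding dist_norm power2_norm_eq_inner refl_at_def
    by (simp add: inner_add_left inner_add_right inner_diff_left inner_diff_right ee inner_commute[of e x] inner_commute[of e y])
      (simp add: algebra_simps)
  moreover have "4 * (s - x \<bullet> e) * (s - y \<bullet> e) \<ge> 0" using assms by simp
  ultimately have "(dist x y)^2 \<le> (dist x (refl_at e s y))^2" by linarith
  then show ?thesis by (rule power2_le_imp_le) simp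
qed

lemma refl_measurable [measurable]: "borel_fun (refl_at e s)" unfolding refl_at_def[abs_def] by measurable

lemma distr_lborel_refl: "distr lborel borel (refl_at e s) = lborel"
proof (rule measure_eqI)
  show "sets (distr lborel borel (refl_at e s)) = sets lborel" by simp
  fix A assume "A \<in> sets (distr lborel borel (refl_at e s))"
  then have A[measurable]: "A \<in> sets borel" by simp
  define R where "R = (\<lambda>z. z - (2 * (z \<bullet> e)) *\<^sub>R e)"
  have "linear R" unfolding R_def by (intro linearI) (simp_all add: algebra_simps inner_add_left)
  then have R: "orthogonal_transformation R" unfolding orthogonal_transformation using norm_reflect0 by (simp add: R_def)
  have "emeasure (distr lborel borel (refl_at e s)) A = (LBINT+ x. indicator A (refl_at e s x))"
    using nn_integral_distr[of "refl_at e s" lborel borel "indicator A"] refl_measurable by simp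
  also have "\<dots> = (LBINT+ x. indicator A (R x + (2 * s) *\<^sub>R e))" by (simp add: refl_at_def R_def algebra_simps)
  also have "\<dots> = (LBINT+ x. indicator A (x + (2 * s) *\<^sub>R e))"
    by (rule nn_integral_lborel_orthogonal[OF R, of "\<lambda>x. indicator A (x + (2 * s) *\<^sub>R e)"]) measurable
  also have "\<dots> = (LBINT+ x. indicator A x)" by (rule nn_integral_lborel_translate) measurable
  also have "\<dots> = emeasure lborel A" by simp
  finally show "emeasure (distr lborel borel (refl_at e s)) A = emeasure lborel A" .
qed

lemma nn_integral_refl:
  assumes "borel_fun f"
  shows "(LBINT+ x. f (refl_at e s x)) = (LBINT+ x. f x)"
  using nn_integral_distr[of "refl_at e s" lborel borel f] assms refl_measurable by (simp add: distr_lborel_refl)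

lemma integral_refl:
  fixes f :: "'a \<Rightarrow> real"
  assumes "borel_fun f"
  shows "(LBINT x. f (refl_at e s x)) = (LBINT x. f x)"
  using integral_distr[of "refl_at e s" lborel borel f] assms refl_measurable by (simp add: distr_lborel_refl)

lemma integrable_refl:
  fixes f :: "'a \<Rightarrow> real"
  assumes f: "integrable lborel f"
  shows "integrable lborel (\<lambda>x. f (refl_at e s x))"
  using integrable_distr[of "refl_at e s" lborel borel f] f refl_measurable by (simp add: distr_lborel_refl)

lemma AE_refl:
  assumes "AE x in lborel. Q x" and Q: "Measurable.pred borel Q"
  shows "AE x in lborel. Q (refl_at e s x)"
proof -
  have "AE x in distr lborel borel (refl_at e s). Q x" unfolding distr_lborel_refl by (rule assms(1))
  then show ?thesis by (rule AE_distrD[rotated]) (use refl_measurable in simp)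
qed

text \<open>The form in which inequalities for a pair of mirror points are integrated: both
  integrals are doubled by adding the reflected integrand, and then the pair occurs at every
  point.\<close>

lemma nn_integral_mono_refl:
  assumes [measurable]: "borel_fun F" "borel_fun G"
    and le: "\<And>x. x \<bullet> e \<le> s \<Longrightarrow> F x + F (refl_at e s x) \<le> G x + G (refl_at e s x)"
  shows "(LBINT+ x. F x) \<le> (LBINT+ x. (G x :: ennreal))"
proof -
  note [measurable] = refl_measurable
  have "F x + F (refl_at e s x) \<le> G x + G (refl_at e s x)" for x
  proof (cases "x \<bullet> e \<le> s")
    case False
    then show ?thesis using le[of "refl_at e s x"] by (simp add: refl_inner refl_refl add.commute)
  qed (rule le)
  then have "(LBINT+ x. F x + F (refl_at e s x)) \<le> (LBINT+ x. G x + G (refl_at e s x))" by (intro nn_integral_mono) simp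
  then have "2 * (LBINT+ x. F x) \<le> 2 * (LBINT+ x. G x)" by (simp add: nn_integral_add nn_integral_refl mult_2)
  then show ?thesis by (simp add: ennreal_mult_le_mult_iff)
qed

end

subsection \<open>Two-point rearrangement\<close>

text \<open>Maximum and minimum are taken in each component, so that the real and imaginary parts
  are rearranged independently.\<close>

definition cmax :: "complex \<Rightarrow> complex \<Rightarrow> complex" where
  "cmax z w = Complex (max (Re z) (Re w)) (max (Im z) (Im w))"

definition cmin :: "complex \<Rightarrow> complex \<Rightarrow> complex" where
  "cmin z w = Complex (min (Re z) (Re w)) (min (Im z) (Im w))"

definition nonneg_parts :: "complex \<Rightarrow> bool" where
  "nonneg_parts z \<longleftrightarrow> Re z \<ge> 0 \<and> Im z \<ge> 0"

lemma cmax_cmin_sq: "nsq (cmax z w) + nsq (cmin z w) = nsq z + nsq w" by (simp add: cmod_power2 cmax_def cmin_def max_def min_def)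

lemma cmin_norm_le:
  assumes "nonneg_parts z" "nonneg_parts w"
  shows "norm (cmin z w) \<le> norm z" "norm (cmin z w) \<le> norm w"
proof -
  have "nsq (cmin z w) \<le> nsq z" "nsq (cmin z w) \<le> nsq w"
    unfolding cmod_power2 using assms by (auto simp: cmin_def nonneg_parts_def intro!: add_mono power_mono)
  then show "norm (cmin z w) \<le> norm z" "norm (cmin z w) \<le> norm w" by (blast intro: power2_le_imp_le norm_ge_zero)+
qed

lemma cmax_norm_ge:
  assumes "nonneg_parts z" "nonneg_parts w"
  shows "norm z \<le> norm (cmax z w)" "norm w \<le> norm (cmax z w)"
proof -
  have "nsq z \<le> nsq (cmax z w)" "nsq w \<le> nsq (cmax z w)"
    unfolding cmod_power2 using assms by (auto simp: cmax_def nonneg_parts_def intro!: add_mono power_mono)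
  then show "norm z \<le> norm (cmax z w)" "norm w \<le> norm (cmax z w)" by (blast intro: power2_le_imp_le norm_ge_zero)+
qed

text \<open>The modulus of \<open>w\<close> can only be kept if no component of \<open>w\<close> is
  lowered.\<close>

lemma cmin_eq_iff:
  assumes "nonneg_parts z" "nonneg_parts w" "nsq (cmin z w) = nsq w"
  shows "Re w \<le> Re z"
proof (rule ccontr)
  assume n: "\<not> Re w \<le> Re z"
  then have "(Re z)^2 < (Re w)^2" using assms by (intro power_strict_mono) (auto simp: nonneg_parts_def)
  moreover have "(min (Im z) (Im w))^2 \<le> (Im w)^2" using assms by (intro power_mono) (auto simp: nonneg_parts_def)
  ultimately show False using assms(3) n by (simp add: cmod_power2 cmin_def)
qed

text \<open>Tangent lines of the convex power at \<open>z\<close> and \<open>w\<close>: the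
  distances \<open>x - z\<close> and \<open>w - y\<close> agree, and the slope is larger at the
  larger of the two points.\<close>

lemma powr_majorization:
  fixes x y z w r :: real
  assumes r: "r \<ge> 1" and pos: "y \<ge> 0" "y \<le> z" "y \<le> w" "z \<le> x" "w \<le> x" and sum: "x + y = z + w"
  shows "z powr r + w powr r \<le> x powr r + y powr r"
proof -
  have wlog: "z powr r + w powr r \<le> x powr r + y powr r"
    if "y \<ge> 0" "y \<le> w" "w \<le> z" "z \<le> x" "x + y = z + w" for x y z w :: real
  proof -
    have t: "a powr r + r * (a powr (r - 1) * (c - a)) \<le> c powr r" if "a \<ge> 0" "c \<ge> 0" for a c :: real
    proof -
      have "a powr (r - 2) * a = a powr (r - 1)"
      proof (cases "a = 0")
        case False
        then have "a powr (r - 2) * a powr 1 = a powr (r - 1)" unfolding powr_add[symmetric] by simp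
        then show ?thesis using False that by simp
      qed simp
      then have "r * (a powr (r - 1) * (c - a)) = r * a powr (r - 2) * (a * (c - a))" by (metis mult.assoc)
      moreover have "a powr r + r * a powr (r - 2) * (a * (c - a)) \<le> c powr r" using norm_powr_convex[OF r, of a c] that by simp
      ultimately show ?thesis by linarith
    qed
    have "z powr r + r * (z powr (r - 1) * (x - z)) \<le> x powr r" using that by (intro t) auto
    moreover have "w powr r - r * (w powr (r - 1) * (x - z)) \<le> y powr r"
    proof -
      have "w powr r + r * (w powr (r - 1) * (y - w)) \<le> y powr r" using that by (intro t) auto
      moreover have "y - w = - (x - z)" using that by simp
      ultimately show ?thesis by (simp only: mult_minus_right)
    qed
    moreover have "r * (w powr (r - 1) * (x - z)) \<le> r * (z powr (r - 1) * (x - z))"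
      using that r by (intro mult_left_mono mult_right_mono powr_mono2) auto
    ultimately show ?thesis by linarith
  qed
  show ?thesis
  proof (cases "w \<le> z")
    case True
    then show ?thesis using assms wlog by simp
  next
    case False
    then show ?thesis using assms wlog[of y z w x] by simp
  qed
qed

text \<open>The squared moduli of maximum and minimum have the same sum as those of \<open>z\<close>
  and \<open>w\<close> and enclose them, so convexity of the power \<open>q/2\<close>
  applies.\<close>

lemma cmax_cmin_powr:
  assumes q: "q \<ge> 2" and z: "nonneg_parts z" "nonneg_parts w"
  shows "norm z powr q + norm w powr q \<le> norm (cmax z w) powr q + norm (cmin z w) powr q" unfolding powr_eq_square_powr[OF norm_ge_zero]
  by (rule powr_majorization) (use q cmax_cmin_sq[of z w] cmin_norm_le[OF z] cmax_norm_ge[OF z] in \<open>auto intro!: power_mono\<close>)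

text \<open>The larger weight is written as \<open>r' + (r - r')\<close>: the common part uses
  convexity, the excess uses that the maximum has the larger modulus.\<close>

lemma weighted_cmax_cmin_powr:
  assumes q: "q \<ge> 2" and z: "nonneg_parts z" "nonneg_parts w" and r: "r' \<le> r" "0 \<le> r'"
  shows "r * norm z powr q + r' * norm w powr q \<le> r * norm (cmax z w) powr q + r' * norm (cmin z w) powr q"
proof -
  have "(r - r') * norm z powr q + r' * (norm z powr q + norm w powr q)
    \<le> (r - r') * norm (cmax z w) powr q + r' * (norm (cmax z w) powr q + norm (cmin z w) powr q)"
    using r q cmax_norm_ge[OF z] by (intro add_mono mult_left_mono cmax_cmin_powr z powr_mono2) auto
  then show ?thesis by (simp add: algebra_simps)
qed

text \<open>The second claim gives the exact deficit. For \<open>r < r'\<close> it vanishes only if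
  the minimum has the modulus of \<open>w\<close>, which is where strictness in the moment comes
  from.\<close>

lemma weighted_cmax_cmin_sq:
  assumes z: "nonneg_parts z" "nonneg_parts w" and r: "r \<le> r'"
  shows "r * nsq (cmax z w) + r' * nsq (cmin z w) \<le> r * nsq z + r' * nsq w"
    "r * nsq z + r' * nsq w - (r * nsq (cmax z w) + r' * nsq (cmin z w))
      = (r' - r) * (nsq w - nsq (cmin z w))"
proof -
  have e: "nsq (cmax z w) = nsq z + nsq w - nsq (cmin z w)" using cmax_cmin_sq[of z w] by simp
  show eq: "r * nsq z + r' * nsq w - (r * nsq (cmax z w) + r' * nsq (cmin z w))
      = (r' - r) * (nsq w - nsq (cmin z w))" unfolding e by (simp add: algebra_simps)
  have "nsq (cmin z w) \<le> nsq w" using cmin_norm_le[OF z] by (intro power_mono) auto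
  then have "0 \<le> (r' - r) * (nsq w - nsq (cmin z w))" using r by simp
  then show "r * nsq (cmax z w) + r' * nsq (cmin z w) \<le> r * nsq z + r' * nsq w" using eq by linarith
qed

text \<open>The rearrangement changes something only if \<open>a\<close>, \<open>a'\<close> and
  \<open>c\<close>, \<open>c'\<close> are ordered oppositely; then the two brackets are exchanged,
  and the gain is \<open>2 (K1 - K2) (a - a') (c' - c) >= 0\<close>.\<close>

lemma two_point_real:
  fixes a a' c c' K1 K2 :: real
  assumes K: "K2 \<le> K1"
  shows "K1 * ((max a a' - max c c')^2 + (min a a' - min c c')^2) + K2 * ((max a a' - min c c')^2 + (min a a' - max c c')^2)
    \<le> K1 * ((a - c)^2 + (a' - c')^2) + K2 * ((a - c')^2 + (a' - c)^2)"
proof -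
  have key: "K1 * ((a - c')^2 + (a' - c)^2) + K2 * ((a - c)^2 + (a' - c')^2) \<le> K1 * ((a - c)^2 + (a' - c')^2) + K2 * ((a - c')^2 + (a' - c)^2)"
    if "(a - a') * (c' - c) \<ge> 0" for a a' c c'
  proof -
    have "0 \<le> (K1 - K2) * ((a - a') * (c' - c))" using K that by simp
    then show ?thesis by (simp add: power2_eq_square algebra_simps)
  qed
  consider "a' \<le> a" "c' \<le> c" | "a \<le> a'" "c \<le> c'" | "a' \<le> a" "c \<le> c'" | "a \<le> a'" "c' \<le> c" by linarith
  then show ?thesis
  proof cases
    case 3
    then have "(a - a') * (c' - c) \<ge> 0" by simp
    from key[OF this] show ?thesis using 3 by (simp add: max_absorb1 max_absorb2 min_absorb1 min_absorb2 add.commute)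
  next
    case 4
    then have "(a - a') * (c' - c) \<ge> 0" by (simp add: mult_nonpos_nonpos)
    from key[OF this] show ?thesis using 4 by (simp add: max_absorb1 max_absorb2 min_absorb1 min_absorb2 add.commute)
  qed (simp_all add: max_absorb1 max_absorb2 min_absorb1 min_absorb2 add.commute)
qed

lemma two_point_complex:
  fixes K1 K2 :: real
  assumes K: "K2 \<le> K1"
  shows "K1 * (nsq (cmax z z' - cmax w w') + nsq (cmin z z' - cmin w w')) + K2 * (nsq (cmax z z' - cmin w w') + nsq (cmin z z' - cmax w w'))
    \<le> K1 * (nsq (z - w) + nsq (z' - w')) + K2 * (nsq (z - w') + nsq (z' - w))"
  using add_mono[OF two_point_real[OF K, of "Re z" "Re z'" "Re w" "Re w'"] two_point_real[OF K, of "Im z" "Im z'" "Im w" "Im w'"]]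
  by (simp add: cmod_power2 cmax_def cmin_def) (simp add: algebra_simps)

subsection \<open>Polarization\<close>

text \<open>The larger values are moved to the side \<open>x \<bullet> e <= s\<close>, which
  contains the origin when \<open>s > 0\<close>.\<close>

definition polarize :: "'a::euclidean_space \<Rightarrow> real \<Rightarrow> ('a \<Rightarrow> complex) \<Rightarrow> 'a \<Rightarrow> complex" where
  "polarize e s u x = (if x \<bullet> e \<le> s then cmax (u x) (u (refl_at e s x)) else cmin (u x) (u (refl_at e s x)))"

lemma cmin_commute: "cmin z w = cmin w z" by (simp add: cmin_def min.commute)

lemma cmax_self: "cmax z z = z" and cmin_self: "cmin z z = z" by (simp_all add: cmax_def cmin_def complex_eq_iff)

lemma polarize_measurable:
  assumes [measurable]: "borel_fun u"
  shows "borel_fun (polarize e s u)"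
proof -
  have [measurable]: "borel_fun (refl_at e s)" unfolding refl_at_def[abs_def] by measurable
  have Complex_eq': "Complex a c = complex_of_real a + \<i> * complex_of_real c" for a c by (simp add: Complex_eq)
  show ?thesis unfolding polarize_def[abs_def] cmax_def cmin_def Complex_eq' by measurable
qed

text \<open>In terms of two points the averaged difference has a kernel that depends on the distance
  only, so that each point can be reflected separately.\<close>

lemma ball_transl_sq_double:
  fixes u :: "'a::euclidean_space \<Rightarrow> complex"
  assumes [measurable]: "borel_fun u"
  shows "(LBINT+ h. indicator (ball 0 t) h * transl_sq h u)
    = (LBINT+ x. LBINT+ y. ennreal (if dist x y < t then nsq (u x - u y) else 0))"
proof -
  have "(LBINT+ h. indicator (ball 0 t) h * transl_sq h u)
    = (LBINT+ h. LBINT+ x. indicator (ball 0 t) h * ennreal (nsq (u (x + h) - u x)))"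
    unfolding transl_sq_def by (intro nn_integral_cong nn_integral_cmult[symmetric]) measurable
  also have "\<dots> = (LBINT+ x. LBINT+ h. indicator (ball 0 t) h * ennreal (nsq (u (x + h) - u x)))" by (rule lborel_pair.Fubini') measurable
  also have "\<dots> = (LBINT+ x. LBINT+ y. ennreal (if dist x y < t then nsq (u x - u y) else 0))"
  proof (rule nn_integral_cong)
    fix x :: 'a
    have "(LBINT+ h. indicator (ball 0 t) h * ennreal (nsq (u (x + h) - u x)))
        = (LBINT+ h. ennreal (if dist x (h + x) < t then nsq (u x - u (h + x)) else 0))"
      by (intro nn_integral_cong) (auto simp: indicator_def dist_norm norm_minus_commute add.commute)
    also have "\<dots> = (LBINT+ y. ennreal (if dist x y < t then nsq (u x - u y) else 0))" by (rule nn_integral_lborel_translate) measurable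
    finally show "(LBINT+ h. indicator (ball 0 t) h * ennreal (nsq (u (x + h) - u x)))
        = (LBINT+ y. ennreal (if dist x y < t then nsq (u x - u y) else 0))" .
  qed
  finally show ?thesis .
qed

context
  fixes e :: "'a::euclidean_space" and s :: real
  assumes e: "norm e = 1"
begin

lemma polarize_le: "x \<bullet> e \<le> s \<Longrightarrow> polarize e s u x = cmax (u x) (u (refl_at e s x))" by (simp add: polarize_def)

lemma polarize_refl: "x \<bullet> e \<le> s \<Longrightarrow> polarize e s u (refl_at e s x) = cmin (u x) (u (refl_at e s x))"
  using refl_boundary[OF e, of x s] refl_inner[OF e, of s x] refl_refl[OF e, of s x]
  by (cases "x \<bullet> e = s") (auto simp: polarize_def cmax_self cmin_self cmin_commute)

text \<open>Both double integrals are symmetrized over reflection of either variable; the four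
  values at two pairs of mirror points are then compared by
  \<open>two_point_complex\<close>.\<close>

lemma double_integral_polarize_le:
  fixes u :: "'a \<Rightarrow> complex"
  assumes um[measurable]: "borel_fun u"
  shows "(LBINT+ x. LBINT+ y. ennreal (if dist x y < t then nsq (polarize e s u x - polarize e s u y) else 0))
    \<le> (LBINT+ x. LBINT+ y. ennreal (if dist x y < t then nsq (u x - u y) else 0))"
proof -
  note pm[measurable] = polarize_measurable[OF um, of e s]
  note rm[measurable] = refl_measurable[OF e, of s]
  let ?r = "refl_at e s"
  define Q where "Q f x y = (if dist x y < t then nsq (f x - f y) else 0)" for f :: "'a \<Rightarrow> complex" and x y
  have Q0: "Q f x y \<ge> 0" for f x y by (simp add: Q_def)
  have Qm[measurable]: "(\<lambda>(x, y). Q f x y) \<in> borel_measurable (borel \<Otimes>\<^sub>M borel)" if [measurable]: "borel_fun f" for f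
    unfolding Q_def by measurable
  \<comment> \<open>Invariant under reflecting \<open>x\<close> or \<open>y\<close>, so both points
    may be taken on the side \<open>x \<bullet> e <= s\<close>.\<close>
  define S where "S f x y = Q f x y + Q f (?r x) (?r y) + (Q f x (?r y) + Q f (?r x) y)" for f x y
  have four: "4 * (LBINT+ x. LBINT+ y. ennreal (Q f x y)) = (LBINT+ x. LBINT+ y. ennreal (S f x y))"
    if fm[measurable]: "borel_fun f" for f
  proof -
    have Qy: "(LBINT+ y. ennreal (Q f x (?r y))) = (LBINT+ y. ennreal (Q f x y))" for x
      by (rule nn_integral_refl[OF e, of "\<lambda>y. ennreal (Q f x y)"]) (simp add: Q_def)
    have Qx: "(LBINT+ x. (LBINT+ y. ennreal (Q f (?r x) y))) = (LBINT+ x. (LBINT+ y. ennreal (Q f x y)))"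
      by (rule nn_integral_refl[OF e, of "\<lambda>x. LBINT+ y. ennreal (Q f x y)"]) (unfold Q_def, measurable)
    have "(LBINT+ x. LBINT+ y. ennreal (S f x y))
      = (LBINT+ x. (LBINT+ y. ennreal (Q f x y) + ennreal (Q f (?r x) (?r y)) + (ennreal (Q f x (?r y)) + ennreal (Q f (?r x) y))))"
      unfolding S_def using Q0 by simp
    also have "\<dots> = (LBINT+ x. (LBINT+ y. ennreal (Q f x y)) + (LBINT+ y. ennreal (Q f (?r x) y))
        + ((LBINT+ y. ennreal (Q f x y)) + (LBINT+ y. ennreal (Q f (?r x) y))))"
    proof (rule nn_integral_cong)
      fix x
      have m: "(\<lambda>y. ennreal (Q f x y)) \<in> borel_measurable lborel" "(\<lambda>y. ennreal (Q f x (?r y))) \<in> borel_measurable lborel" for x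
        unfolding Q_def by measurable
      show "(LBINT+ y. ennreal (Q f x y) + ennreal (Q f (?r x) (?r y)) + (ennreal (Q f x (?r y)) + ennreal (Q f (?r x) y)))
        = (LBINT+ y. ennreal (Q f x y)) + (LBINT+ y. ennreal (Q f (?r x) y))
        + ((LBINT+ y. ennreal (Q f x y)) + (LBINT+ y. ennreal (Q f (?r x) y)))" by (simp only: nn_integral_add m borel_measurable_add Qy)
    qed
    also have "\<dots> = 4 * (LBINT+ x. LBINT+ y. ennreal (Q f x y))"
    proof -
      have m1: "(\<lambda>x. LBINT+ y. ennreal (Q f x y)) \<in> borel_measurable lborel" unfolding Q_def by measurable
      have m2: "(\<lambda>x. LBINT+ y. ennreal (Q f (?r x) y)) \<in> borel_measurable lborel" unfolding Q_def by measurable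
      have four: "a + a + (a + a) = 4 * (a::ennreal)" for a by (metis add_2_eq_Suc' mult_2 numeral_Bit0 distrib_right mult_2_right)
      show ?thesis using m1 m2 by (simp add: nn_integral_add Qx four)
    qed
    finally show ?thesis ..
  qed
  have core: "S (polarize e s u) x y \<le> S u x y" if xy: "x \<bullet> e \<le> s" "y \<bullet> e \<le> s" for x y
  proof -
    define K1 K2 :: real where "K1 = (if dist x y < t then 1 else 0)" and "K2 = (if dist x (?r y) < t then 1 else 0)"
    have K: "K2 \<le> K1" using refl_dist_ge[OF e xy] by (auto simp: K1_def K2_def)
    have S: "S f x y = K1 * (nsq (f x - f y) + nsq (f (?r x) - f (?r y))) + K2 * (nsq (f x - f (?r y)) + nsq (f (?r x) - f y))" for f
      by (simp add: S_def Q_def K1_def K2_def refl_dist[OF e] refl_dist_swap[OF e] refl_refl[OF e])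
    show ?thesis unfolding S polarize_le[OF xy(1)] polarize_le[OF xy(2)] polarize_refl[OF xy(1)] polarize_refl[OF xy(2)]
      by (rule two_point_complex[OF K])
  qed
  have Sx: "S f (?r x) y = S f x y" and Sy: "S f x (?r y) = S f x y" for f x y by (simp_all add: S_def refl_refl[OF e])
  have S: "S (polarize e s u) x y \<le> S u x y" for x y
  proof -
    have c1: "S (polarize e s u) x y \<le> S u x y" if "y \<bullet> e \<le> s" for x y
      using core[of x y] core[of "?r x" y] that by (cases "x \<bullet> e \<le> s") (auto simp: Sx refl_inner[OF e])
    show ?thesis using c1[of y x] c1[of "?r y" x] by (cases "y \<bullet> e \<le> s") (auto simp: Sy refl_inner[OF e])
  qed
  have "4 * (LBINT+ x. LBINT+ y. ennreal (Q (polarize e s u) x y)) \<le> 4 * (LBINT+ x. LBINT+ y. ennreal (Q u x y))"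
    unfolding four[OF pm] four[OF um] by (rule nn_integral_mono, rule nn_integral_mono, rule ennreal_leI, rule S)
  then show ?thesis unfolding Q_def by (simp add: ennreal_mult_le_mult_iff)
qed

end

subsection \<open>Radial representatives\<close>

text \<open>The reflection that exchanges \<open>x\<close> and \<open>y\<close> maps one ball to the
  other, and \<open>x\<close> lies on the side where \<open>f\<close> is larger than at the mirror
  points.\<close>

lemma ball_average_nonincreasing:
  fixes f :: "'a::euclidean_space \<Rightarrow> real"
  assumes fm[measurable]: "borel_fun f"
    and fi: "\<And>x. integrable lborel (\<lambda>z. indicator (ball x \<rho>) z * f z)"
    and mono: "\<And>e s. norm e = 1 \<Longrightarrow> s > 0 \<Longrightarrow> AE x in lborel. x \<bullet> e < s \<longrightarrow> f (refl_at e s x) \<le> f x"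
    and xy: "norm x < norm y"
  shows "(LBINT z. indicator (ball y \<rho>) z * f z) \<le> (LBINT z. indicator (ball x \<rho>) z * f z)"
proof -
  define d where "d = norm (y - x)"
  have d: "d > 0" using xy by (auto simp: d_def)
  have dsq: "d^2 = nsq x - 2 * (x \<bullet> y) + nsq y"
    unfolding d_def power2_norm_eq_inner by (simp add: inner_diff_left inner_diff_right inner_commute[of y x])
  define e where "e = (1 / d) *\<^sub>R (y - x)"
  have e: "norm e = 1" using d by (simp add: e_def d_def)
  \<comment> \<open>The hyperplane that bisects the segment from \<open>x\<close> to
    \<open>y\<close>; \<open>s > 0\<close> is equivalent to \<open>norm x < norm y\<close>.\<close>
  define s where "s = (nsq y - nsq x) / (2 * d)"
  have "nsq x < nsq y" using xy by (intro power_strict_mono) auto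
  then have s: "s > 0" using d by (simp add: s_def)
  have "x \<bullet> e = (x \<bullet> y - nsq x) / d" by (simp add: e_def inner_diff_right power2_norm_eq_inner)
  then have "s - x \<bullet> e = d^2 / (2 * d)" unfolding s_def dsq using d by (simp add: field_simps)
  then have sx: "s - x \<bullet> e = d / 2" using d by (simp add: power2_eq_square)
  have rx: "refl_at e s x = y" unfolding refl_at_def sx using d by (simp add: e_def)
  have xs: "x \<bullet> e \<le> s" using sx d by simp
  note [measurable] = refl_measurable[OF e, of s]
  \<comment> \<open>Odd under the reflection and nonnegative on the side of \<open>x\<close>, so
    that its pairing with \<open>f\<close> reduces to differences of \<open>f\<close> at mirror
    points.\<close>
  define k where "k z = indicator (ball x \<rho>) z - (indicator (ball y \<rho>) z :: real)" for z
  have km[measurable]: "borel_fun k" unfolding k_def[abs_def] by measurable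
  have sw: "dist y (refl_at e s z) = dist x z" "dist x (refl_at e s z) = dist y z" for z
    using refl_dist[OF e, of s x z] refl_dist_swap[OF e, of s x z] by (simp_all add: rx)
  have kr: "k (refl_at e s z) = - k z" for z by (simp add: k_def indicator_def sw)
  have kp: "k z \<ge> 0" if "z \<bullet> e \<le> s" for z
  proof -
    have "dist x z \<le> dist y z" using refl_dist_ge[OF e xs that] by (simp add: sw)
    then show ?thesis by (auto simp: k_def indicator_def)
  qed
  have ki: "integrable lborel (\<lambda>z. k z * f z)" using fi by (simp add: k_def left_diff_distrib)
  have "AE z in lborel. z \<bullet> e < s \<longrightarrow> f (refl_at e s z) \<le> f z" by (rule mono[OF e s])
  moreover from AE_refl[OF e this, of s]
  have "AE z in lborel. refl_at e s z \<bullet> e < s \<longrightarrow> f (refl_at e s (refl_at e s z)) \<le> f (refl_at e s z)" by simp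
  ultimately have "AE z in lborel. 0 \<le> k z * (f z - f (refl_at e s z))"
  proof eventually_elim
    case (elim z)
    consider "z \<bullet> e < s" | "z \<bullet> e = s" | "z \<bullet> e > s" by linarith
    then show ?case
    proof cases
      case 1
      then show ?thesis using elim(1) kp[of z] by simp
    next
      case 2
      then show ?thesis using refl_boundary[OF e 2] by simp
    next
      case 3
      then have "refl_at e s z \<bullet> e < s" by (simp add: refl_inner[OF e])
      then have "f z \<le> f (refl_at e s z)" "k z \<le> 0" using elim(2) kp[of "refl_at e s z"] by (simp_all add: refl_refl[OF e] kr)
      then show ?thesis by (simp add: mult_nonpos_nonpos)
    qed
  qed
  then have "0 \<le> (LBINT z. k z * (f z - f (refl_at e s z)))" by (rule integral_nonneg_AE)
  also have "\<dots> = (LBINT z. k z * f z + k (refl_at e s z) * f (refl_at e s z))" by (simp add: kr algebra_simps)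
  also have "\<dots> = (LBINT z. k z * f z) + (LBINT z. k (refl_at e s z) * f (refl_at e s z))"
    by (rule Bochner_Integration.integral_add[OF ki integrable_refl[OF e ki]])
  also have "(LBINT z. k (refl_at e s z) * f (refl_at e s z)) = (LBINT z. k z * f z)"
    by (rule integral_refl[OF e, of "\<lambda>z. k z * f z"]) measurable
  finally have "0 \<le> (LBINT z. k z * f z)" by simp
  also have "(LBINT z. k z * f z) = (LBINT z. indicator (ball x \<rho>) z * f z) - (LBINT z. indicator (ball y \<rho>) z * f z)"
    using fi by (simp add: k_def left_diff_distrib)
  finally show ?thesis by simp
qed

text \<open>The hypothesis \<open>mono\<close> admits an exceptional null set for each hyperplane.
  Averages over balls are defined at every point and monotone without exception, and they recover
  \<open>f\<close> almost everywhere along radii \<open>(1/2)^n\<close>.\<close>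

lemma nonincreasing_averages:
  fixes f :: "'a::euclidean_space \<Rightarrow> real"
  assumes f: "square_integrable lborel f" and D: "D \<ge> 0"
    and tr: "\<And>h. transl_sq h f \<le> ennreal (nsq h * D)"
    and mono: "\<And>e s. norm e = 1 \<Longrightarrow> s > 0 \<Longrightarrow> AE x in lborel. x \<bullet> e < s \<longrightarrow> f (refl_at e s x) \<le> f x"
  obtains g :: "nat \<Rightarrow> 'a \<Rightarrow> real" where
    "\<And>n x y. norm x \<le> norm y \<Longrightarrow> g n y \<le> g n x" "AE x in lborel. (\<lambda>n. g n x) \<longlonglongrightarrow> f x"
proof -
  note fm[measurable] = square_integrableD(1)[OF f, simplified]
  define A where "A \<rho> x = (1 / measure lborel (ball (0::'a) \<rho>)) *\<^sub>R (LBINT h. indicator (ball 0 \<rho>) h *\<^sub>R f (x + h))" for \<rho> x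
  have ft: "square_integrable lborel (\<lambda>h. f (x + h))" for x using square_integrable_translate[OF f, of x] by (simp add: add.commute)
  have fin: "emeasure lborel (ball (0::'a) \<rho>) < \<infinity>" for \<rho> using emeasure_lborel_ball_finite by simp
  have mp: "measure lborel (ball (0::'a) \<rho>) > 0" if "\<rho> > 0" for \<rho>
    using content_ball_pos[OF that, of "0::'a"] by (simp add: measure_completion)
  have ind: "square_integrable lborel (\<lambda>h. indicator (ball 0 \<rho>) h *\<^sub>R F h)" if "square_integrable lborel F" for F :: "'a \<Rightarrow> real" and \<rho>
  proof (rule square_integrable_bound[OF that, where c = 1])
    have [measurable]: "borel_fun F" using that by (simp add: square_integrable_def)
    show "(\<lambda>h. indicator (ball 0 \<rho>) h *\<^sub>R F h) \<in> borel_measurable lborel" by measurable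
  qed (auto simp: indicator_def)
  have Am[measurable]: "borel_fun (A \<rho>)" for \<rho>
  proof -
    have "borel_fun (\<lambda>x. LBINT h. indicator (ball 0 \<rho>) h *\<^sub>R f (x + h))"
      by (rule lborel.borel_measurable_lebesgue_integral) measurable
    then show ?thesis unfolding A_def[abs_def] by simp
  qed
  have Ab: "A \<rho> x = (1 / measure lborel (ball (0::'a) \<rho>)) * (LBINT z. indicator (ball x \<rho>) z * f z)"
    and bi: "integrable lborel (\<lambda>z. indicator (ball x \<rho>) z * f z)" if "\<rho> > 0" for \<rho> x
  proof -
    have i: "indicator (ball x \<rho>) (h + x) = (indicator (ball 0 \<rho>) h :: real)" for h by (simp add: indicator_def dist_norm)
    have "(LBINT z. indicator (ball x \<rho>) z * f z) = (LBINT h. indicator (ball x \<rho>) (h + x) * f (h + x))"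
      by (rule integral_lborel_translate[symmetric]) measurable
    then show "A \<rho> x = (1 / measure lborel (ball (0::'a) \<rho>)) * (LBINT z. indicator (ball x \<rho>) z * f z)"
      by (simp add: A_def i add.commute)
    have "integrable lborel (\<lambda>h. indicator (ball 0 \<rho>) h *\<^sub>R f (x + h))"
      by (rule average_square_le(1)[OF _ fin mp[OF that] ind[OF ft]]) simp
    from integrable_lborel_translate[OF this, of "- x"] show "integrable lborel (\<lambda>z. indicator (ball x \<rho>) z * f z)"
    proof (rule back_subst[where P = "integrable lborel"])
      show "(\<lambda>z. indicator (ball 0 \<rho>) (z + - x) *\<^sub>R f (x + (z + - x))) = (\<lambda>z. indicator (ball x \<rho>) z * f z)"
        using i[of "_ - x"] by (intro ext) simp
    qed
  qed
  have lt: "A \<rho> y \<le> A \<rho> x" if "\<rho> > 0" "norm x < norm y" for \<rho> x y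
    unfolding Ab[OF that(1)] by (intro mult_left_mono ball_average_nonincreasing[OF fm bi[OF that(1)] mono that(2)]) auto
  \<comment> \<open>Continuity of the averages, by which monotonicity for
    \<open>norm x < norm y\<close> extends to points of equal norm; this is what makes the averages
    radial.\<close>
  have lip: "(A \<rho> (x + k) - A \<rho> x)^2 \<le> nsq k * D / measure lborel (ball (0::'a) \<rho>)" if \<rho>: "\<rho> > 0" for \<rho> x k
  proof -
    define F where "F h = f (x + k + h) - f (x + h)" for h
    have Fs: "square_integrable lborel F" unfolding F_def by (intro square_integrable_diff ft)
    have i: "integrable lborel (\<lambda>h. indicator (ball 0 \<rho>) h *\<^sub>R f (x + h))" for x
      by (rule average_square_le(1)[OF _ fin mp[OF \<rho>] ind[OF ft]]) simp
    have dA: "A \<rho> (x + k) - A \<rho> x = (1 / measure lborel (ball (0::'a) \<rho>)) *\<^sub>R (LBINT h. indicator (ball 0 \<rho>) h *\<^sub>R F h)"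
      unfolding A_def F_def using i[of x] i[of "x + k"] by (simp add: right_diff_distrib)
    have "measure lborel (ball (0::'a) \<rho>) * nsq (A \<rho> (x + k) - A \<rho> x - 0) \<le> (LBINT h. indicator (ball 0 \<rho>) h * nsq (F h - 0))"
      unfolding dA by (rule average_square_le(2)[OF _ fin mp[OF \<rho>] ind[OF Fs]]) simp
    also have "\<dots> \<le> (LBINT h. nsq (F h))" using square_integrableD(2)[OF Fs] average_square_le(3)[OF _ fin mp[OF \<rho>] ind[OF Fs], of 0]
      by (intro integral_mono) (auto simp: indicator_def)
    also have "ennreal (LBINT h. nsq (F h)) \<le> ennreal (nsq k * D)"
    proof -
      have "ennreal (LBINT h. nsq (F h)) = (LBINT+ h. ennreal (nsq (F h)))" by (rule nn_integral_square[OF Fs, symmetric])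
      also have "\<dots> = (LBINT+ h. ennreal (nsq (f ((h + x) + k) - f (h + x))))" by (simp add: F_def add_ac)
      also have "\<dots> = transl_sq k f" unfolding transl_sq_def
        by (rule nn_integral_lborel_translate[of "\<lambda>z. ennreal (nsq (f (z + k) - f z))"]) measurable
      finally show ?thesis using tr by simp
    qed
    then have "(LBINT h. nsq (F h)) \<le> nsq k * D" using D by (simp add: ennreal_le_iff)
    finally show ?thesis using mp[OF \<rho>] by (simp add: pos_le_divide_eq mult.commute)
  qed
  have le: "A \<rho> y \<le> A \<rho> x" if \<rho>: "\<rho> > 0" and xy: "norm x \<le> norm y" for \<rho> x y
  proof (cases "norm x < norm y \<or> x = 0")
    case True
    then show ?thesis using lt[OF \<rho>, of x y] xy by (cases "norm x < norm y") auto
  next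
    case False
    then have n: "norm x = norm y" "norm x > 0" using xy by auto
    define C where "C = sqrt (nsq x * D / measure lborel (ball (0::'a) \<rho>))"
    have C: "C \<ge> 0" "C^2 = nsq x * D / measure lborel (ball (0::'a) \<rho>)" using D by (simp_all add: C_def)
    show ?thesis
    proof (rule field_le_epsilon)
      fix \<epsilon> :: real assume \<epsilon>: "\<epsilon> > 0"
      \<comment> \<open>Shrinking \<open>x\<close> by the factor \<open>1 - \<delta>\<close> makes
        its norm strictly smaller at the cost of at most \<open>\<epsilon>\<close>.\<close>
      define \<delta> where "\<delta> = min 1 (\<epsilon> / (C + 1))"
      have \<delta>: "\<delta> > 0" "\<delta> \<le> 1" "\<delta> * C \<le> \<epsilon>" using \<epsilon> C(1) by (auto simp: \<delta>_def min_def field_simps)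
      have xd: "x + (- \<delta>) *\<^sub>R x = (1 - \<delta>) *\<^sub>R x" by (simp add: algebra_simps)
      have "(1 - \<delta>) * norm x < 1 * norm x" using n \<delta> by (intro mult_strict_right_mono) auto
      then have "norm ((1 - \<delta>) *\<^sub>R x) < norm y" using n \<delta> by simp
      from lt[OF \<rho> this] have "A \<rho> y \<le> A \<rho> (x + (- \<delta>) *\<^sub>R x)" unfolding xd .
      moreover have "(A \<rho> (x + (- \<delta>) *\<^sub>R x) - A \<rho> x)^2 \<le> (\<delta> * C)^2"
        using lip[OF \<rho>, of x "(- \<delta>) *\<^sub>R x"] by (simp add: power_mult_distrib C(2) mult.assoc)
      then have "\<bar>A \<rho> (x + (- \<delta>) *\<^sub>R x) - A \<rho> x\<bar> \<le> \<delta> * C" using \<delta> C by (simp add: abs_le_square_iff[symmetric])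
      ultimately show "A \<rho> y \<le> A \<rho> x + \<epsilon>" using \<delta>(3) by linarith
    qed
  qed
  \<comment> \<open>Jensen and Tonelli again, with translations of length at most the radius; along
    \<open>(1/2)^n\<close> the bounds are summable.\<close>
  have conv: "(LBINT+ x. ennreal ((A \<rho> x - f x)^2)) \<le> ennreal (\<rho>^2 * D)" if \<rho>: "\<rho> > 0" for \<rho>
  proof -
    let ?m = "measure lborel (ball (0::'a) \<rho>)"
    have "ennreal ?m * (LBINT+ x. ennreal ((A \<rho> x - f x)^2)) = (LBINT+ x. ennreal (?m * nsq (A \<rho> x - f x)))"
      by (subst nn_integral_cmult[symmetric]) (auto simp: ennreal_mult)
    also have "\<dots> \<le> (LBINT+ x. LBINT+ h. indicator (ball 0 \<rho>) h * ennreal (nsq (f (x + h) - f x)))"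
    proof (rule nn_integral_mono)
      fix x :: 'a
      note avg = average_square_le(2,3)[OF _ fin mp[OF \<rho>] ind[OF ft[of x]], of "f x"]
      have "ennreal (?m * nsq (A \<rho> x - f x)) \<le> ennreal (LBINT h. indicator (ball 0 \<rho>) h * nsq (f (x + h) - f x))"
        unfolding A_def using avg(1) by (intro ennreal_leI) simp
      also have "\<dots> = (LBINT+ h. ennreal (indicator (ball 0 \<rho>) h * nsq (f (x + h) - f x)))"
        by (rule nn_integral_eq_integral[symmetric]) (use avg(2) in auto)
      also have "\<dots> = (LBINT+ h. indicator (ball 0 \<rho>) h * ennreal (nsq (f (x + h) - f x)))"
        by (intro nn_integral_cong) (auto simp: indicator_def)
      finally show "ennreal (?m * nsq (A \<rho> x - f x)) \<le> (LBINT+ h. indicator (ball 0 \<rho>) h * ennreal (nsq (f (x + h) - f x)))" .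
    qed
    also have "\<dots> = (LBINT+ h. LBINT+ x. indicator (ball 0 \<rho>) h * ennreal (nsq (f (x + h) - f x)))" by (rule lborel_pair.Fubini') measurable
    also have "\<dots> = (LBINT+ h. indicator (ball 0 \<rho>) h * transl_sq h f)"
      unfolding transl_sq_def by (intro nn_integral_cong nn_integral_cmult) measurable
    also have "\<dots> \<le> (LBINT+ h. ennreal (\<rho>^2 * D) * indicator (ball 0 \<rho>) (h::'a))"
    proof (rule nn_integral_mono)
      fix h :: 'a
      show "indicator (ball 0 \<rho>) h * transl_sq h f \<le> ennreal (\<rho>^2 * D) * indicator (ball 0 \<rho>) h"
      proof (cases "norm h < \<rho>")
        case True
        then have "nsq h * D \<le> \<rho>^2 * D" using D by (intro mult_right_mono power_mono) auto
        then have "transl_sq h f \<le> ennreal (\<rho>^2 * D)" by (intro order_trans[OF tr] ennreal_leI)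
        then show ?thesis using True by simp
      qed simp
    qed
    also have "\<dots> = ennreal (\<rho>^2 * D) * emeasure lborel (ball (0::'a) \<rho>)" by (simp add: nn_integral_cmult)
    also have "\<dots> = ennreal ?m * ennreal (\<rho>^2 * D)"
      using emeasure_eq_ennreal_measure[of lborel "ball (0::'a) \<rho>"] fin[of \<rho>] by (simp add: mult.commute)
    finally show ?thesis using mp[OF \<rho>] by (subst (asm) ennreal_mult_le_mult_iff) auto
  qed
  define \<rho> where "\<rho> n = (1/2::real)^n" for n
  have \<rho>: "\<rho> n > 0" for n by (simp add: \<rho>_def)
  have "(LBINT+ x. (\<Sum>n. ennreal ((A (\<rho> n) x - f x)^2))) = (\<Sum>n. (LBINT+ x. ennreal ((A (\<rho> n) x - f x)^2)))"
    by (rule nn_integral_suminf) measurable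
  also have "\<dots> \<le> (\<Sum>n. ennreal ((1/4)^n * D))"
  proof (rule suminf_le)
    fix n
    have "(\<rho> n)^2 = (1/4)^n" by (simp add: \<rho>_def power_mult[symmetric] mult.commute[of n] power_mult power_divide)
    then show "(LBINT+ x. ennreal ((A (\<rho> n) x - f x)^2)) \<le> ennreal ((1/4)^n * D)" using conv[OF \<rho>, of n] by simp
  qed auto
  also have "\<dots> < \<infinity>"
  proof -
    have "summable (\<lambda>n. (1/4::real)^n * D)" by (intro summable_mult2 summable_geometric) simp
    then have "(\<Sum>n. ennreal ((1/4)^n * D)) = ennreal (\<Sum>n. (1/4)^n * D)" using D by (intro suminf_ennreal2) auto
    then show ?thesis by simp
  qed
  finally have fin_sum: "(LBINT+ x. (\<Sum>n. ennreal ((A (\<rho> n) x - f x)^2))) < \<infinity>" .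
  have "AE x in lborel. (\<Sum>n. ennreal ((A (\<rho> n) x - f x)^2)) \<noteq> \<infinity>" by (rule nn_integral_noteq_infinite) (use fin_sum in auto)
  then have "AE x in lborel. (\<lambda>n. A (\<rho> n) x) \<longlonglongrightarrow> f x"
  proof eventually_elim
    case (elim x)
    then have "summable (\<lambda>n. (A (\<rho> n) x - f x)^2)" by (intro summable_suminf_not_top) auto
    then have "(\<lambda>n. (A (\<rho> n) x - f x)^2) \<longlonglongrightarrow> 0" by (rule summable_LIMSEQ_zero)
    then have "(\<lambda>n. sqrt ((A (\<rho> n) x - f x)^2)) \<longlonglongrightarrow> sqrt 0" by (intro tendsto_intros)
    then have "(\<lambda>n. \<bar>A (\<rho> n) x - f x\<bar>) \<longlonglongrightarrow> 0" by simp
    then have "(\<lambda>n. A (\<rho> n) x - f x) \<longlonglongrightarrow> 0" by (simp add: tendsto_rabs_zero_iff)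
    then show ?case by (simp add: LIM_zero_iff)
  qed
  then show ?thesis using le[OF \<rho>] by (intro that[of "\<lambda>n. A (\<rho> n)"]) auto
qed

subsection \<open>Folding the target plane\<close>

text \<open>The first component is the quantity of interest. The second is the modulus of the rest
  of \<open>z\<close>, which restores the modulus of \<open>z\<close> with a nonnegative
  number.\<close>

definition fold_part :: "complex \<Rightarrow> complex" where
  "fold_part z = Complex (max 0 (Re z)) (norm (Complex (min 0 (Re z)) (Im z)))"

lemma norm_fold_part: "norm (fold_part z) = norm z"
proof -
  have "nsq (fold_part z) = nsq z" by (simp add: fold_part_def cmod_power2 max_def min_def)
  then show ?thesis by (simp only: power2_eq_iff_nonneg norm_ge_zero)
qed

lemma nonneg_parts_fold: "nonneg_parts (fold_part z)" by (simp add: fold_part_def nonneg_parts_def)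

text \<open>Splitting a real number into positive and negative part does not increase distances in
  the plane, and neither does replacing a vector by its length.\<close>

lemma fold_part_nonexpansive: "norm (fold_part z - fold_part w) \<le> norm (z - w)"
proof -
  define m where "m z = Complex (min 0 (Re z)) (Im z)" for z
  have "\<bar>norm (m z) - norm (m w)\<bar> \<le> norm (m z - m w)" by (rule norm_triangle_ineq3)
  then have "(norm (m z) - norm (m w))^2 \<le> nsq (m z - m w)" by (simp add: abs_le_square_iff[symmetric])
  also have "\<dots> = (min 0 (Re z) - min 0 (Re w))^2 + (Im z - Im w)^2" by (simp add: m_def cmod_power2)
  finally have "(norm (m z) - norm (m w))^2 \<le> (min 0 (Re z) - min 0 (Re w))^2 + (Im z - Im w)^2" .
  \<comment> \<open>For opposite signs the right side exceeds the left by
    \<open>- 2 a c >= 0\<close>; otherwise both sides agree.\<close>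
  moreover have "(max 0 a - max 0 c)^2 + (min 0 a - min 0 c)^2 \<le> (a - c)^2" for a c :: real
  proof -
    consider "a \<ge> 0" "c \<ge> 0" | "a \<le> 0" "c \<le> 0" | "a \<ge> 0" "c \<le> 0" | "a \<le> 0" "c \<ge> 0" by linarith
    then show ?thesis
    proof cases
      case 3
      then have "a * c \<le> 0" by (simp add: mult_nonneg_nonpos)
      then show ?thesis using 3 by (simp add: max_absorb1 max_absorb2 min_absorb1 min_absorb2 power2_diff)
    next
      case 4
      then have "a * c \<le> 0" by (simp add: mult_nonpos_nonneg)
      then show ?thesis using 4 by (simp add: max_absorb1 max_absorb2 min_absorb1 min_absorb2 power2_diff)
    qed (simp_all add: max_absorb1 max_absorb2 min_absorb1 min_absorb2)
  qed
  from this[of "Re z" "Re w"]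
  have "nsq (fold_part z - fold_part w) \<le> nsq (z - w)" using calculation by (simp add: fold_part_def cmod_power2 m_def[symmetric])
  then show ?thesis by (rule power2_le_imp_le) simp
qed

lemma fold_part_measurable [measurable]: "borel_fun fold_part"
proof -
  have "continuous_on UNIV fold_part"
  proof (rule continuous_onI)
    fix x :: complex and \<epsilon> :: real assume "\<epsilon> > 0"
    then show "\<exists>\<delta>>0. \<forall>x'\<in>UNIV. dist x' x < \<delta> \<longrightarrow> dist (fold_part x') (fold_part x) \<le> \<epsilon>"
      using order_trans[OF fold_part_nonexpansive less_imp_le] by (intro exI[of _ \<epsilon>]) (auto simp: dist_norm)
  qed
  then show ?thesis by (rule borel_measurable_continuous_onI)
qed

context ground_state
begin

subsection \<open>Symmetry of minimizers\<close>

text \<open>The hypotheses are in \<open>ennreal\<close> because \<open>U\<close> is not yet known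
  to lie in the energy space. Equality of the energies, with equal mass and two terms that cannot
  increase, forces equality of each, in particular of the moment.\<close>

lemma minimizer_comparison:
  assumes u: "u \<in> nehari" "E u = \<mu>" and Um[measurable]: "borel_fun U"
    and grad: "\<And>t. t > 0 \<Longrightarrow> (LBINT+ h. indicator (ball 0 t) h * transl_sq h U) \<le> (LBINT+ h. indicator (ball 0 t) h * transl_sq h u)"
    and ma: "(LBINT+ x. ennreal (nsq (U x))) = (LBINT+ x. ennreal (nsq (u x)))"
    and mo: "(LBINT+ x. ennreal (nsq x * nsq (U x))) \<le> (LBINT+ x. ennreal (nsq x * nsq (u x)))"
    and W: "W u \<le> W U"
  shows "U \<in> nehari" "E U = \<mu>" "moment U = moment u"
proof -
  have ub: "u \<in> bsigma" and uP: "P u = \<mu>" using u by (auto simp: nehari_def)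
  have um[measurable]: "borel_fun u" by (rule bsigmaD[OF ub])
  have xu: "(LBINT+ x. ennreal (nsq x * nsq (u x))) = ennreal (moment u)"
    using nn_integral_square[OF bsigmaD(3)[OF ub]] by (simp add: moment_def power_mult_distrib)
  have Us: "square_integrable lborel U" unfolding square_integrable_iff ma nn_integral_square[OF bsigmaD(2)[OF ub]] by simp
  have xUs: "square_integrable lborel (\<lambda>x. norm x *\<^sub>R U x)"
    using le_less_trans[OF mo[unfolded xu]] unfolding square_integrable_iff by (simp add: power_mult_distrib)
  have xU: "(LBINT+ x. ennreal (nsq x * nsq (U x))) = ennreal (moment U)"
    using nn_integral_square[OF xUs] by (simp add: moment_def power_mult_distrib)
  have mass: "mass U = mass u" using ma mass_nonneg[of U] mass_nonneg[of u]
    unfolding nn_integral_square[OF Us] nn_integral_square[OF bsigmaD(2)[OF ub]] by (simp add: mass_def)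
  have mom: "moment U \<le> moment u" using mo moment_nonneg[of u] unfolding xu xU by (simp add: ennreal_le_iff)
  have "grad_bound U (dirichlet u)" unfolding grad_bound_def using grad grad_bound_dirichlet[OF ub] by (auto simp: grad_bound_def intro: order_trans)
  from bsigma_of_grad_bound[OF Us xUs this dirichlet_nonneg]
  have Ub: "U \<in> bsigma" and D: "dirichlet U \<le> dirichlet u" by auto
  have g: "\<gamma>^2 * moment U \<le> \<gamma>^2 * moment u" using mom by (intro mult_left_mono) auto
  have "E U \<le> E u" using D g mass by (simp add: energy_def)
  moreover have "P u \<le> P U" using W W_finite[OF ub] W_finite[OF Ub] by (simp add: ennreal_le_iff)
  ultimately have "E U \<le> \<mu>" "\<mu> \<le> P U" using u uP by auto
  from quotient_rigidity[OF Ub this] show "U \<in> nehari" and EU: "E U = \<mu>" by auto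
  have "dirichlet U + \<gamma>^2 * moment U = dirichlet u + \<gamma>^2 * moment u" using EU u(2) mass by (simp add: energy_def)
  then have "\<gamma>^2 * moment U = \<gamma>^2 * moment u" using D g by linarith
  then show "moment U = moment u" using \<gamma> by simp
qed

text \<open>Folding keeps the modulus pointwise and does not increase differences, so all
  requirements of the comparison hold pointwise.\<close>

lemma minimizer_fold:
  assumes u: "u \<in> nehari" "E u = \<mu>" and c: "norm c = 1"
  defines "U \<equiv> \<lambda>x. fold_part (c * u x)"
  shows "U \<in> nehari" "E U = \<mu>"
proof -
  have [measurable]: "borel_fun u" using u by (auto simp: nehari_def dest: bsigmaD)
  have Um: "borel_fun U" unfolding U_def by measurable
  have n: "norm (U x) = norm (u x)" for x by (simp add: U_def norm_fold_part norm_mult c)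
  have d: "norm (U x - U y) \<le> norm (u x - u y)" for x y
    unfolding U_def by (rule order_trans[OF fold_part_nonexpansive]) (simp add: norm_mult c flip: right_diff_distrib)
  have tr: "transl_sq h U \<le> transl_sq h u" for h unfolding transl_sq_def by (intro nn_integral_mono ennreal_leI power_mono d) simp
  have grad: "(LBINT+ h. indicator (ball 0 t) h * transl_sq h U) \<le> (LBINT+ h. indicator (ball 0 t) h * transl_sq h u)" for t
    by (rule nn_integral_mono) (rule mult_left_mono[OF tr], simp)
  have W: "W u \<le> W U" unfolding weighted_power_def n by simp
  show "U \<in> nehari" "E U = \<mu>" by (rule minimizer_comparison[OF u Um grad _ _ W]; simp add: n)+
qed

text \<open>The conclusion says that the real part is already polarized. As polarization preserves
  the moment of a minimizer, the deficits of pairs of mirror points, which are nonnegative, vanish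
  almost everywhere.\<close>

lemma minimizer_polarize:
  assumes u: "u \<in> nehari" "E u = \<mu>" and nn: "\<And>x. nonneg_parts (u x)" and e: "norm e = 1" and s: "s > 0"
  shows "AE x in lborel. x \<bullet> e < s \<longrightarrow> Re (u (refl_at e s x)) \<le> Re (u x)"
proof -
  let ?r = "refl_at e s"
  have ub: "u \<in> bsigma" using u by (auto simp: nehari_def)
  have um[measurable]: "borel_fun u" by (rule bsigmaD[OF ub])
  define U where "U = polarize e s u"
  have Um[measurable]: "borel_fun U" unfolding U_def by (rule polarize_measurable[OF um])
  note rm[measurable] = refl_measurable[OF e, of s]
  note U = polarize_le[OF e, of _ s u, folded U_def] polarize_refl[OF e, of _ s u, folded U_def]
  have rn: "norm x \<le> norm (?r x)" "nsq x \<le> nsq (?r x)" if "x \<bullet> e \<le> s" for x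
  proof -
    show "nsq x \<le> nsq (?r x)" using refl_norm_sq[OF e, of s x] s that by simp
    then show "norm x \<le> norm (?r x)" by (rule power2_le_imp_le) simp
  qed
  have sq: "nsq (U x) + nsq (U (?r x)) = nsq (u x) + nsq (u (?r x))" if "x \<bullet> e \<le> s" for x by (simp add: U that cmax_cmin_sq)
  have mo_pt: "nsq x * nsq (U x) + nsq (?r x) * nsq (U (?r x))
      \<le> nsq x * nsq (u x) + nsq (?r x) * nsq (u (?r x))" if "x \<bullet> e \<le> s" for x
    unfolding U(1)[OF that] U(2)[OF that] by (rule weighted_cmax_cmin_sq(1)[OF nn nn rn(2)[OF that]])
  have grad: "(LBINT+ h. indicator (ball 0 t) h * transl_sq h U) \<le> (LBINT+ h. indicator (ball 0 t) h * transl_sq h u)" for t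
    unfolding ball_transl_sq_double[OF Um] ball_transl_sq_double[OF um] unfolding U_def by (rule double_integral_polarize_le[OF e um])
  have mass: "(LBINT+ x. ennreal (nsq (U x))) = (LBINT+ x. ennreal (nsq (u x)))"
  proof -
    have pt: "ennreal (nsq (U x)) + ennreal (nsq (U (?r x))) = ennreal (nsq (u x)) + ennreal (nsq (u (?r x)))" if "x \<bullet> e \<le> s" for x
      using sq[OF that] by (simp flip: ennreal_plus)
    show ?thesis by (rule antisym; rule nn_integral_mono_refl[OF e, of _ _ s]; (simp only: pt order_refl | measurable))
  qed
  have mom: "(LBINT+ x. ennreal (nsq x * nsq (U x))) \<le> (LBINT+ x. ennreal (nsq x * nsq (u x)))"
  proof (rule nn_integral_mono_refl[OF e, of _ _ s])
    fix x :: "real^'n" assume "x \<bullet> e \<le> s"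
    from mo_pt[OF this] show "ennreal (nsq x * nsq (U x)) + ennreal (nsq (?r x) * nsq (U (?r x)))
      \<le> ennreal (nsq x * nsq (u x)) + ennreal (nsq (?r x) * nsq (u (?r x)))" by (simp add: ennreal_leI flip: ennreal_plus)
  qed measurable
  have W: "W u \<le> W U"
  proof -
    \<comment> \<open>As \<open>0 powr (- b) = 0\<close>, the weight has to be corrected at the origin to decrease under reflection.\<close>
    define w where "w x = (if x = 0 then norm (?r 0) powr (- b) else norm x powr (- b))" for x :: "real^'n"
    have w0: "w x \<ge> 0" for x by (simp add: w_def)
    have Ww: "W f = (LBINT+ x. ennreal (w x * norm (f x) powr q))" for f :: "real^'n \<Rightarrow> complex" unfolding weighted_power_def
      by (rule nn_integral_cong_AE) (use AE_lborel_singleton[of 0] in eventually_elim, simp add: w_def)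
    have wr: "w (?r x) \<le> w x" if x: "x \<bullet> e \<le> s" for x
    proof -
      have "?r x \<noteq> 0"
      proof
        assume "?r x = 0"
        then have "x = 0" using rn(1)[OF x] by simp
        then show False using \<open>?r x = 0\<close> refl_norm_sq[OF e, of s 0] s by simp
      qed
      then show ?thesis using rn(1)[OF x] b by (auto simp: w_def intro: powr_mono2')
    qed
    show ?thesis unfolding Ww
    proof (rule nn_integral_mono_refl[OF e, of _ _ s])
      have [measurable]: "borel_fun w" unfolding w_def[abs_def] by measurable
      show "borel_fun (\<lambda>x. ennreal (w x * norm (u x) powr q))"
        "borel_fun (\<lambda>x. ennreal (w x * norm (U x) powr q))" by measurable
      fix x :: "real^'n" assume x: "x \<bullet> e \<le> s"
      have "w x * norm (u x) powr q + w (?r x) * norm (u (?r x)) powr q \<le> w x * norm (U x) powr q + w (?r x) * norm (U (?r x)) powr q"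
        unfolding U(1)[OF x] U(2)[OF x] using q by (intro weighted_cmax_cmin_powr nn wr[OF x] w0) auto
      then show "ennreal (w x * norm (u x) powr q) + ennreal (w (?r x) * norm (u (?r x)) powr q)
          \<le> ennreal (w x * norm (U x) powr q) + ennreal (w (?r x) * norm (U (?r x)) powr q)"
        using w0 by (simp add: ennreal_leI flip: ennreal_plus)
    qed
  qed
  note cmp = minimizer_comparison[OF u Um grad mass mom W]
  have Ub: "U \<in> bsigma" and moment: "moment U = moment u" using cmp by (auto simp: nehari_def)
  \<comment> \<open>\<open>D\<close> itself has no sign; only the sum over a pair of mirror points
    does.\<close>
  define D where "D x = nsq x * nsq (u x) - nsq x * nsq (U x)" for x
  have mi: "integrable lborel (\<lambda>x. nsq x * nsq (f x))" if "f \<in> bsigma" for f :: "real^'n \<Rightarrow> complex"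
    using square_integrableD(2)[OF bsigmaD(3)[OF that]] by (simp add: power_mult_distrib)
  have Di: "integrable lborel D" unfolding D_def by (intro Bochner_Integration.integrable_diff mi ub Ub)
  have Dm: "borel_fun D" unfolding D_def[abs_def] by measurable
  have "(LBINT x. D x) = moment u - moment U" unfolding D_def moment_def by (rule Bochner_Integration.integral_diff[OF mi[OF ub] mi[OF Ub]])
  then have D0: "(LBINT x. D x) = 0" using moment by simp
  have Dpos: "D x + D (?r x) \<ge> 0" for x
  proof -
    have *: "D x + D (?r x) \<ge> 0" if "x \<bullet> e \<le> s" for x using mo_pt[OF that] by (simp add: D_def)
    show ?thesis using *[of x] *[of "?r x"] by (cases "x \<bullet> e \<le> s") (simp_all add: refl_inner[OF e] refl_refl[OF e] add.commute)
  qed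
  have Dsum: "integrable lborel (\<lambda>x. D x + D (?r x))" by (intro Bochner_Integration.integrable_add Di integrable_refl[OF e])
  have "(LBINT x. D x + D (?r x)) = 0" unfolding Bochner_Integration.integral_add[OF Di integrable_refl[OF e Di]] integral_refl[OF e Dm] D0 by simp
  then have "AE x in lborel. D x + D (?r x) = 0" using integral_nonneg_eq_0_iff_AE[OF Dsum] Dpos by simp
  then show ?thesis
  proof eventually_elim
    case (elim x)
    show ?case
    proof
      assume xs: "x \<bullet> e < s"
      then have x: "x \<bullet> e \<le> s" by simp
      have "D x + D (?r x) = (nsq (?r x) - nsq x) * (nsq (u (?r x)) - nsq (cmin (u x) (u (?r x))))"
        using weighted_cmax_cmin_sq(2)[OF nn nn rn(2)[OF x], of x "?r x"] by (simp add: D_def U[OF x])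
      \<comment> \<open>The strict increase of the norm under reflection, where \<open>s > 0\<close>
        is used.\<close>
      moreover have "nsq (?r x) - nsq x \<noteq> 0" using refl_norm_sq[OF e, of s x] s xs by simp
      ultimately have "nsq (cmin (u x) (u (?r x))) = nsq (u (?r x))" using elim by simp
      then show "Re (u (?r x)) \<le> Re (u x)" by (rule cmin_eq_iff[OF nn nn])
    qed
  qed
qed

lemma nonneg_minimizer_compact_support:
  assumes u: "u \<in> nehari" "E u = \<mu>" and nn: "\<And>x. nonneg_parts (u x)" and R: "R \<ge> 0"
    and z: "AE x in lborel. norm x > R \<longrightarrow> Re (u x) = 0"
  shows "AE x in lborel. Re (u x) = 0"
proof -
  \<comment> \<open>Dominates the linear potential on the ball with \<open>1\<close> to spare; the
    nonlinear coefficient \<open>k\<close> has the favourable sign and is bounded by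
    \<open>0\<close>.\<close>
  define K where "K = \<bar>\<omega>\<bar> + \<gamma>^2 * R^2 + 1"
  obtain \<psi> :: "real^'n \<Rightarrow> real" where \<psi>: "test_function \<psi>" "\<And>x. \<psi> x \<ge> 0" "\<And>x. norm x \<le> R \<Longrightarrow> \<psi> x > 0 \<and> laplacian \<psi> x \<ge> K * \<psi> x"
    using laplacian_barrier[OF R, of K] by blast
  define k where "k = (\<lambda>x. norm x powr (- b) * norm (u x) powr (q - 2))"
  define F where "F = (\<lambda>x. (- laplacian \<psi> x) *\<^sub>R u x + \<psi> x *\<^sub>R (\<omega> *\<^sub>R u x + (\<gamma>^2 * nsq x) *\<^sub>R u x - k x *\<^sub>R u x))"
  have F: "integrable lborel F" "(LBINT x. F x) = 0" using minimizer_weak_equation(2,3)[OF u \<psi>(1)] unfolding F_def k_def by blast+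
  \<comment> \<open>All coefficients, including the one from the nonlinearity, are real once
    \<open>norm (u x)\<close> is regarded as given, so the real part satisfies its own linear
    equation.\<close>
  have ReF: "Re (F x) = Re (u x) * (- laplacian \<psi> x + \<psi> x * (\<omega> + \<gamma>^2 * nsq x - k x))" for x by (simp add: F_def algebra_simps)
  have le: "\<psi> x * Re (u x) \<le> - Re (F x)" if x: "norm x \<le> R" for x
  proof -
    have k0: "k x \<ge> 0" by (simp add: k_def)
    have "\<gamma>^2 * nsq x \<le> \<gamma>^2 * R^2" using x by (intro mult_left_mono power_mono) auto
    then have "\<omega> + \<gamma>^2 * nsq x - k x \<le> K - 1" using k0 by (simp add: K_def)
    then have "\<psi> x * (\<omega> + \<gamma>^2 * nsq x - k x) \<le> \<psi> x * (K - 1)" using \<psi>(2) by (rule mult_left_mono)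
    then have "- laplacian \<psi> x + \<psi> x * (\<omega> + \<gamma>^2 * nsq x - k x) \<le> - \<psi> x"
      using \<psi>(3)[OF x] by (simp add: algebra_simps)
    then have "Re (u x) * (- laplacian \<psi> x + \<psi> x * (\<omega> + \<gamma>^2 * nsq x - k x)) \<le> Re (u x) * (- \<psi> x)"
      using nn[of x] by (intro mult_left_mono) (auto simp: nonneg_parts_def)
    then show ?thesis unfolding ReF by (simp add: mult.commute)
  qed
  have nonneg: "AE x in lborel. 0 \<le> - Re (F x)" using z
  proof eventually_elim
    case (elim x)
    show ?case
    proof (cases "norm x \<le> R")
      case True
      have "0 \<le> \<psi> x * Re (u x)" using \<psi>(2)[of x] nn[of x] by (simp add: nonneg_parts_def)
      then show ?thesis using le[OF True] by linarith
    qed (use elim in \<open>simp add: ReF\<close>)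
  qed
  have i: "integrable lborel (\<lambda>x. - Re (F x))" using F(1) by simp
  have "(LBINT x. - Re (F x)) = 0" using F by simp
  then have "AE x in lborel. - Re (F x) = 0" using integral_nonneg_eq_0_iff_AE[OF i nonneg] by simp
  then show ?thesis using z
  proof eventually_elim
    case (elim x)
    show ?case
    proof (cases "norm x \<le> R")
      case True
      then have "\<psi> x * Re (u x) \<le> 0" "\<psi> x > 0" using le[OF True] elim(1) \<psi>(3)[OF True] by auto
      then have "Re (u x) \<le> 0" by (simp add: mult_le_0_iff)
      then show ?thesis using nn[of x] by (simp add: nonneg_parts_def)
    qed (use elim in simp)
  qed
qed

lemma nonneg_minimizer_dichotomy:
  assumes u: "u \<in> nehari" "E u = \<mu>" and nn: "\<And>x. nonneg_parts (u x)"
  shows "(AE x in lborel. Re (u x) = 0) \<or>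
    (\<exists>\<phi> :: real^'n \<Rightarrow> real. (\<forall>x. \<phi> x > 0) \<and> spherically_symmetric \<phi> \<and> (AE x in lborel. Re (u x) = \<phi> x))"
proof (cases "\<exists>R\<ge>0. AE x in lborel. norm x > R \<longrightarrow> Re (u x) = 0")
  case True
  then show ?thesis using nonneg_minimizer_compact_support[OF u nn] by blast
next
  case False
  have ub: "u \<in> bsigma" using u by (auto simp: nehari_def)
  have um[measurable]: "borel_fun u" by (rule bsigmaD[OF ub])
  have tr: "transl_sq h (\<lambda>x. Re (u x)) \<le> ennreal (nsq h * dirichlet u)" for h
  proof -
    have "nsq (Re (u (x + h)) - Re (u x)) \<le> nsq (u (x + h) - u x)" for x using abs_Re_le_cmod[of "u (x + h) - u x"] by (intro power_mono) auto
    then have "transl_sq h (\<lambda>x. Re (u x)) \<le> transl_sq h u" unfolding transl_sq_def by (intro nn_integral_mono ennreal_leI)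
    then show ?thesis using transl_sq_le_dirichlet[OF ub, of h] by (rule order_trans)
  qed
  obtain g :: "nat \<Rightarrow> real^'n \<Rightarrow> real" where g: "\<And>n x y. norm x \<le> norm y \<Longrightarrow> g n y \<le> g n x"
    and lim: "AE x in lborel. (\<lambda>n. g n x) \<longlonglongrightarrow> Re (u x)"
    by (rule nonincreasing_averages[OF square_integrable_Re_Im(1)[OF bsigmaD(2)[OF ub]] dirichlet_nonneg[of u] tr minimizer_polarize[OF u nn]]) blast+
  have pos: "AE x in lborel. Re (u x) > 0" using lim
  proof eventually_elim
    case (elim x)
    \<comment> \<open>Outside every ball there are points with positive value at which the averages
      converge, and monotonicity of the averages carries this positivity inwards to
      \<open>x\<close>.\<close>
    have "\<not> (AE y in lborel. norm y > norm x \<longrightarrow> Re (u y) = 0)" using False norm_ge_zero by blast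
    then have "\<exists>y. (\<lambda>n. g n y) \<longlonglongrightarrow> Re (u y) \<and> norm y > norm x \<and> Re (u y) \<noteq> 0"
      using lim by (metis (mono_tags, lifting) eventually_mono)
    then obtain y where y: "(\<lambda>n. g n y) \<longlonglongrightarrow> Re (u y)" "norm y > norm x" "Re (u y) \<noteq> 0" by blast
    have "Re (u y) \<le> Re (u x)" by (rule LIMSEQ_le[OF y(1) elim]) (use g y(2) in force)
    moreover have "Re (u y) > 0" using y(3) nn[of y] by (simp add: nonneg_parts_def)
    ultimately show ?case by simp
  qed
  \<comment> \<open>The default value \<open>1\<close> makes \<open>\<phi>\<close> positive
    everywhere. It also depends only on the sequence of averages at \<open>x\<close>, which are
    radial, so no exceptional set spoils symmetry.\<close>
  define \<phi> where "\<phi> x = (if \<exists>l>0. (\<lambda>n. g n x) \<longlonglongrightarrow> l then lim (\<lambda>n. g n x) else 1)" for x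
  have "\<phi> x > 0" for x by (auto simp: \<phi>_def limI)
  moreover have "spherically_symmetric \<phi>" unfolding spherically_symmetric_def
  proof (intro allI impI)
    fix x y :: "real^'n" assume "norm x = norm y"
    then have "(\<lambda>n. g n x) = (\<lambda>n. g n y)" using g by (intro ext antisym) auto
    then show "\<phi> x = \<phi> y" by (simp only: \<phi>_def)
  qed
  moreover have "AE x in lborel. Re (u x) = \<phi> x" using lim pos by eventually_elim (auto simp: \<phi>_def limI)
  ultimately show ?thesis by blast
qed

lemma minimizer_part_dichotomy:
  assumes u: "u \<in> nehari" "E u = \<mu>" and c: "norm c = 1"
  shows "(AE x in lborel. Re (c * u x) \<le> 0) \<or>
    (\<exists>\<phi> :: real^'n \<Rightarrow> real. (\<forall>x. \<phi> x > 0) \<and> spherically_symmetric \<phi> \<and> (AE x in lborel. Re (c * u x) = \<phi> x))"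
proof -
  have Re: "Re (fold_part z) = max 0 (Re z)" for z by (simp add: fold_part_def)
  consider "AE x in lborel. Re (fold_part (c * u x)) = 0"
    | \<phi> :: "real^'n \<Rightarrow> real" where "\<forall>x. \<phi> x > 0" "spherically_symmetric \<phi>" "AE x in lborel. Re (fold_part (c * u x)) = \<phi> x"
    using nonneg_minimizer_dichotomy[OF minimizer_fold[OF u c] nonneg_parts_fold] by blast
  then show ?thesis
  proof cases
    case 1
    then have "AE x in lborel. Re (c * u x) \<le> 0" unfolding Re by eventually_elim (auto simp: max_def split: if_splits)
    then show ?thesis by blast
  next
    case (2 \<phi>)
    from 2(3) have "AE x in lborel. Re (c * u x) = \<phi> x"
    proof eventually_elim
      case (elim x)
      then show ?case using 2(1)[rule_format, of x] unfolding Re by (auto simp: max_def split: if_splits)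
    qed
    then show ?thesis using 2 by blast
  qed
qed

lemma minimizer_symmetric:
  assumes u: "u \<in> nehari" "E u = \<mu>"
  obtains d and \<phi> :: "real^'n \<Rightarrow> real" where "norm d = 1" "\<And>x. \<phi> x > 0" "spherically_symmetric \<phi>"
    "AE x in lborel. u x = d * complex_of_real (\<phi> x)"
proof -
  have ub: "u \<in> bsigma" "mass u > 0" using u by (auto simp: nehari_def)
  have um[measurable]: "borel_fun u" by (rule bsigmaD[OF ub(1)])
  let ?B = "ball (0::real^'n) 1"
  have ui: "integrable lborel (\<lambda>x. indicator ?B x *\<^sub>R u x)"
    using square_integrable_set_integrable[OF bsigmaD(2)[OF ub(1)], of ?B] emeasure_lborel_ball_finite[of "0::real^'n" 1] by (simp add: set_integrable_def)
  define z where "z = (LBINT x. indicator ?B x *\<^sub>R u x)"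
  obtain c where c: "norm c = 1" "Re (c * z) = 0"
  proof (cases "z = 0")
    case True
    then show ?thesis by (intro that[of 1]) auto
  next
    case False
    \<comment> \<open>This rotation makes the mean over the unit ball purely imaginary.\<close>
    have "\<i> * cnj z / norm z * z = \<i> * norm z" using False complex_norm_square[of z] by (simp add: power2_eq_square field_simps)
    then show ?thesis using False by (intro that[of "\<i> * cnj z / norm z"]) (simp_all add: norm_mult norm_divide)
  qed
  \<comment> \<open>The positive alternative would give the rotated function a real part with
    strictly positive mean over the ball, contradicting the choice of the rotation.\<close>
  have no_pos: "AE x in lborel. Re (c' * u x) \<le> 0" if c': "norm c' = 1" "Re (c' * z) = 0" for c'
  proof (rule ccontr)
    assume n: "\<not> (AE x in lborel. Re (c' * u x) \<le> 0)"
    then obtain \<phi> :: "real^'n \<Rightarrow> real" where \<phi>: "\<forall>x. \<phi> x > 0" "AE x in lborel. Re (c' * u x) = \<phi> x"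
      using minimizer_part_dichotomy[OF u c'(1)] by blast
    have i: "integrable lborel (\<lambda>x. c' * (indicator ?B x *\<^sub>R u x))" by (intro integrable_mult_right ui)
    have cz: "(LBINT x. c' * (indicator ?B x *\<^sub>R u x)) = c' * z" unfolding z_def by (rule integral_mult_right_zero)
    have "(LBINT x. Re (c' * (indicator ?B x *\<^sub>R u x))) = Re (LBINT x. c' * (indicator ?B x *\<^sub>R u x))" by (rule integral_Re[OF i])
    also have "\<dots> = 0" unfolding cz by (rule c'(2))
    finally have 0: "(LBINT x. Re (c' * (indicator ?B x *\<^sub>R u x))) = 0" .
    have Req: "Re (c' * (indicator ?B x *\<^sub>R u x)) = indicator ?B x * Re (c' * u x)" for x by (simp add: indicator_def)
    have "AE x in lborel. 0 \<le> Re (c' * (indicator ?B x *\<^sub>R u x))" using \<phi>(2)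
      unfolding Req by eventually_elim (use \<phi>(1) in \<open>auto simp: indicator_def intro: less_imp_le\<close>)
    from integral_nonneg_eq_0_iff_AE[OF integrable_Re[OF i] this] 0
    have "AE x in lborel. indicator ?B x * Re (c' * u x) = 0" unfolding Req by simp
    then have "AE x in lborel. x \<notin> ?B" using \<phi>(2)
    proof eventually_elim
      case (elim x)
      then show ?case using \<phi>(1)[rule_format, of x] by (auto simp: indicator_def)
    qed
    moreover have "{x :: real^'n. \<not> (x \<notin> ball 0 1)} = ball 0 1" by auto
    ultimately have "emeasure lborel ?B = 0" using AE_iff_measurable[of ?B lborel "\<lambda>x. x \<notin> ?B"] by simp
    then show False using content_ball_pos[of 1 "0::real^'n"] by (simp add: measure_def measure_completion)
  qed
  have "AE x in lborel. Re (c * u x) \<le> 0" by (rule no_pos[OF c])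
  moreover have "AE x in lborel. Re (- c * u x) \<le> 0" by (rule no_pos) (use c in auto)
  ultimately have Re0: "AE x in lborel. Re (c * u x) = 0" by eventually_elim simp
  note conclusion = that
  have fin: thesis if e: "norm e = 1" "e = - \<i> * c \<or> e = \<i> * c"
    and \<phi>: "\<forall>x. \<phi> x > 0" "spherically_symmetric \<phi>" "AE x in lborel. Re (e * u x) = \<phi> x" for e and \<phi> :: "real^'n \<Rightarrow> real"
  proof (rule conclusion[of "cnj e" \<phi>])
    have ee: "cnj e * e = 1" using complex_norm_square[of e] e(1) by (simp add: mult.commute)
    show "AE x in lborel. u x = cnj e * complex_of_real (\<phi> x)" using \<phi>(3) Re0
    proof eventually_elim
      case (elim x)
      \<comment> \<open>\<open>e\<close> is \<open>c\<close> times plus or minus the imaginary unit,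
        so this imaginary part is \<open>Re (c * u x)\<close> up to sign.\<close>
      have "Im (e * u x) = 0" using e(2) elim(2) by auto
      then have "e * u x = complex_of_real (\<phi> x)" using elim(1) by (simp add: complex_eq_iff)
      then have "cnj e * (e * u x) = cnj e * complex_of_real (\<phi> x)" by simp
      then show ?case by (simp only: mult.assoc[symmetric] ee mult_1)
    qed
  qed (use e \<phi> in auto)
  have n: "norm (- \<i> * c) = 1" "norm (\<i> * c) = 1" using c by (simp_all add: norm_mult)
  \<comment> \<open>The remaining component of \<open>c * u\<close> is examined with both signs. If
    neither sign gives the positive alternative, it vanishes as well, and so does
    \<open>u\<close>.\<close>
  consider "AE x in lborel. Re (- \<i> * c * u x) \<le> 0" "AE x in lborel. Re (\<i> * c * u x) \<le> 0"
    | \<phi> e where "e = - \<i> * c \<or> e = \<i> * c" "\<forall>x. \<phi> x > 0" "spherically_symmetric \<phi>" "AE x in lborel. Re (e * u x) = \<phi> x"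
    using minimizer_part_dichotomy[OF u n(1)] minimizer_part_dichotomy[OF u n(2)] by blast
  then show thesis
  proof cases
    case 1
    then have "AE x in lborel. u x = 0" using Re0
    proof eventually_elim
      case (elim x)
      then have "c * u x = 0" by (simp add: complex_eq_iff)
      then show ?case using c(1) by auto
    qed
    then have "AE x in lebesgue. u x = 0" by (rule AE_completion)
    then show thesis using mass_pos_iff[OF ub(1)] ub(2) by simp
  next
    case (2 \<phi> e)
    then show thesis using n by (intro fin[of e \<phi>]) auto
  qed
qed

end

theorem theorem1p5:
  fixes \<gamma> b p \<omega> :: real
  assumes "\<gamma> > 0"
    and "0 < b" and "b < min 2 (real CARD('n::finite))"
    and "1 < p" and "ereal p < two_circ CARD('n) b"
    and "\<omega> > - \<gamma> * real CARD('n)"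
  shows "d_level TYPE('n) \<gamma> b p \<omega> > 0
    \<and> (\<exists>\<phi> :: real^'n \<Rightarrow> complex. is_minimizer \<gamma> b p \<omega> \<phi> \<and> is_solution \<gamma> b p \<omega> \<phi>)
    \<and> (\<forall>u :: real^'n \<Rightarrow> complex. is_minimizer \<gamma> b p \<omega> u \<longrightarrow>
         (\<exists>(\<theta>::real) (\<phi> :: real^'n \<Rightarrow> real).
            (\<forall>x. \<phi> x > 0) \<and> spherically_symmetric \<phi> \<and>
            (AE x in lebesgue. u x = exp (\<i> * complex_of_real \<theta>) * complex_of_real (\<phi> x))))"
proof (intro conjI allI impI)
  interpret ground_state \<gamma> b p \<omega> "TYPE('n)" by unfold_locales (use assms in auto)
  show "d_level TYPE('n) \<gamma> b p \<omega> > 0" unfolding level_eq using s0 \<mu>_pos by simp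
  obtain v where v: "v \<in> nehari" "E v = \<mu>" using minimizer_exists by blast
  then have "borel_fun v" by (auto simp: nehari_def dest: bsigmaD)
  then show "\<exists>\<phi> :: real^'n \<Rightarrow> complex. is_minimizer \<gamma> b p \<omega> \<phi> \<and> is_solution \<gamma> b p \<omega> \<phi>"
    using v minimizer_borel_iff minimizer_is_solution by blast
  fix u :: "real^'n \<Rightarrow> complex" assume u: "is_minimizer \<gamma> b p \<omega> u"
  then have "u \<in> Sigma_space" by (simp add: is_minimizer_def Sigma_nonzero_def)
  then obtain v where v: "v \<in> bsigma" "AE x in lebesgue. u x = v x" "borel_fun v"
    "H_norm_sq \<gamma> \<omega> u = energy \<gamma> \<omega> v" "P_fun b p u = P_fun b p v" "u \<in> Sigma_nonzero \<longleftrightarrow> mass v > 0"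
    by (rule sigma_representative[where \<gamma> = \<gamma> and \<omega> = \<omega> and b = b and p = p]) blast
  \<comment> \<open>Being a minimizer depends only on the class modulo null sets, so it passes to
    the Borel representative.\<close>
  have "is_minimizer \<gamma> b p \<omega> v"
    using u v sigma_nonzero_iff[OF v(3)] by (simp add: is_minimizer_def K_fun_def S_fun_def H_norm_sq_eq_energy[OF v(3)])
  then have "v \<in> nehari" "E v = \<mu>" using minimizer_borel_iff[OF v(3)] by auto
  then obtain d and \<phi> :: "real^'n \<Rightarrow> real" where d: "norm d = 1" "\<And>x. \<phi> x > 0" "spherically_symmetric \<phi>"
    "AE x in lborel. v x = d * complex_of_real (\<phi> x)" by (rule minimizer_symmetric) blast
  have "d \<noteq> 0" using d(1) by auto
  from Arg_eq[OF this] have d\<theta>: "exp (\<i> * complex_of_real (Arg d)) = d" unfolding d(1) by simp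
  have "AE x in lebesgue. v x = d * complex_of_real (\<phi> x)" using d(4) by (rule AE_completion)
  with v(2) have ae: "AE x in lebesgue. u x = d * complex_of_real (\<phi> x)" by eventually_elim simp
  show "\<exists>(\<theta>::real) (\<phi> :: real^'n \<Rightarrow> real). (\<forall>x. \<phi> x > 0) \<and> spherically_symmetric \<phi> \<and>
      (AE x in lebesgue. u x = exp (\<i> * complex_of_real \<theta>) * complex_of_real (\<phi> x))"
  proof (intro exI conjI)
    show "\<forall>x. \<phi> x > 0" "spherically_symmetric \<phi>" using d by auto
    show "AE x in lebesgue. u x = exp (\<i> * complex_of_real (Arg d)) * complex_of_real (\<phi> x)" unfolding d\<theta> by (rule ae)
  qed
qed

end
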